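(* Let $n\ge2$ and let $\mathcal{L}=\{L_1,\dots,L_n\}$ be an elliptic system of linearly independent complex vector fields on $\mathbb{R}^N$ with constant complex coefficients, and let $1<p<\infty$, $\frac1p+\frac1{p'}=1$. Then there is a constant $C>0$ such that, whenever $V\in L^p(\mathbb{R}^N,\mathbb{C}^n)$ and $\operatorname{div}_{\mathcal{L}^*}V\in L^p(\mathbb{R}^N)$, the inequality $$\|V\cdot\nabla_{\mathcal{L}}\phi\|_{h^1}\le C\left(\|V\|_{L^p}+\|\operatorname{div}_{\mathcal{L}^*}V\|_{L^p}\right)\|\nabla_{\mathcal{L}}\phi\|_{L^{p'}}$$ holds for every function $\phi$ such that $\nabla_{\mathcal{L}}\phi\in L^{p'}(\mathbb{R}^N,\mathbb{C}^n)$; the constant $C$ does not depend on $V$ or $\phi$.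
   Context: Let $N\ge2$. A complex vector field with constant coefficients on $\mathbb{R}^N$ is $L_j=\sum_{k=1}^N c_{jk}\,\partial_{x_k}$ with $c_{jk}\in\mathbb{C}$; its formal adjoint is $L_j^*=-\sum_k\overline{c_{jk}}\,\partial_{x_k}$. The system is elliptic if for real $\xi\in\mathbb{R}^N$, $\sum_k c_{jk}\xi_k=0$ for all $j$ implies $\xi=0$ (equivalently, $\sum_jL_j^*L_j$ is elliptic). In the sense of distributions: $\nabla_{\mathcal{L}}\phi=(L_1\phi,\dots,L_n\phi)$ and $\operatorname{div}_{\mathcal{L}^*}V=\sum_jL_j^*V_j$. The product is Hermitian: $V\cdot W=\sum_jV_j\overline{W_j}$. Functions are complex-valued and locally integrable. Local Hardy space norm: fix $\varphi\in\mathcal{S}(\mathbb{R}^N)$ with $\int\varphi\ne0$, $\varphi_t(x)=t^{-N}\varphi(x/t)$; then $\|f\|_{h^1}=\|m_\varphi f\|_{L^1}$ with $m_\varphi f(x)=\sup_{0<t<1}|\langle f,\varphi_t(x-\cdot)\rangle|$. Different $\varphi$ give equivalent norms. *)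

theory Defs
  imports "HOL-Analysis.Analysis"
begin

section \<open>Smooth functions, test functions, Schwartz functions\<close>

definition partial :: "'N::finite \<Rightarrow> (real^'N \<Rightarrow> complex) \<Rightarrow> real^'N \<Rightarrow> complex" where
  "partial k f x = frechet_derivative f (at x) (axis k 1)"

text \<open>A list of directions encodes an iterated partial derivative. Requiring every iterated
  partial derivative (including \<open>f\<close> itself) to be Frechet differentiable everywhere
  is the same as \<open>f\<close> being \<open>C\<close>-infinity.\<close>

abbreviation partials :: "'N::finite list \<Rightarrow> (real^'N \<Rightarrow> complex) \<Rightarrow> real^'N \<Rightarrow> complex" where
  "partials ks f \<equiv> foldr partial ks f"

definition smooth :: "(real^'N::finite \<Rightarrow> complex) \<Rightarrow> bool" where
  "smooth f \<longleftrightarrow> (\<forall>ks x. partials ks f differentiable (at x))"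

definition test_function :: "(real^'N::finite \<Rightarrow> complex) \<Rightarrow> bool" where
  "test_function \<psi> \<longleftrightarrow> smooth \<psi> \<and> compact (closure {x. \<psi> x \<noteq> 0})"

definition schwartz :: "(real^'N::finite \<Rightarrow> complex) \<Rightarrow> bool" where
  "schwartz f \<longleftrightarrow> smooth f \<and>
     (\<forall>m::nat. \<forall>ks. bounded (range (\<lambda>x. norm x ^ m *\<^sub>R partials ks f x)))"

section \<open>Lebesgue spaces\<close>

definition locally_integrable :: "(real^'N::finite \<Rightarrow> complex) \<Rightarrow> bool" where
  "locally_integrable f \<longleftrightarrow> (\<forall>K. compact K \<longrightarrow> f absolutely_integrable_on K)"

definition in_Lp :: "real \<Rightarrow> (real^'N::finite \<Rightarrow> 'b::euclidean_space) \<Rightarrow> bool" where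
  "in_Lp p f \<longleftrightarrow> f \<in> borel_measurable lebesgue \<and> integrable lebesgue (\<lambda>x. norm (f x) powr p)"

definition Lp_norm :: "real \<Rightarrow> (real^'N::finite \<Rightarrow> 'b::euclidean_space) \<Rightarrow> real" where
  "Lp_norm p f = (\<integral>x. norm (f x) powr p \<partial>lebesgue) powr (1 / p)"

section \<open>Constant-coefficient complex vector fields\<close>

text \<open>The vector field \<open>\<Sum>k. a $ k * \<partial>\<^sub>k\<close> is represented by its coefficient vector \<open>a\<close>,
  and the system \<open>L\<^sub>j\<close> by the matrix \<open>c\<close> whose \<open>j\<close>-th row \<open>c $ j\<close> is the coefficient
  vector of \<open>L\<^sub>j\<close>.\<close>

definition vfield :: "complex^'N \<Rightarrow> (real^'N::finite \<Rightarrow> complex) \<Rightarrow> real^'N \<Rightarrow> complex" where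
  "vfield a f x = (\<Sum>k\<in>UNIV. a $ k * partial k f x)"

definition adjoint_vfield :: "complex^'N::finite \<Rightarrow> complex^'N" where
  "adjoint_vfield a = (\<chi> k. - cnj (a $ k))"

definition elliptic_system :: "complex^'N::finite^'n::finite \<Rightarrow> bool" where
  "elliptic_system c \<longleftrightarrow>
     (\<forall>\<xi>::real^'N. (\<forall>j. (\<Sum>k\<in>UNIV. c $ j $ k * complex_of_real (\<xi> $ k)) = 0) \<longrightarrow> \<xi> = 0)"

text \<open>Linear independence, over the complex numbers, of the family \<open>j \<mapsto> c $ j\<close>;
  injectivity excludes repeated rows, which the set of rows does not see.\<close>

definition independent_system :: "complex^'N::finite^'n::finite \<Rightarrow> bool" where
  "independent_system c \<longleftrightarrow> inj (\<lambda>j. c $ j) \<and> vec.independent (range (\<lambda>j. c $ j))"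

text \<open>The pairing of the distributional derivative \<open>\<Sum>k. a $ k * \<partial>\<^sub>k u\<close> of a locally integrable
  \<open>u\<close> with a test function \<open>\<psi>\<close>. Distributions are complex bilinear in this pairing, so no
  conjugate appears.\<close>

definition distr_vfield ::
  "complex^'N \<Rightarrow> (real^'N::finite \<Rightarrow> complex) \<Rightarrow> (real^'N \<Rightarrow> complex) \<Rightarrow> complex" where
  "distr_vfield a u \<psi> = - (\<integral>x. u x * vfield a \<psi> x \<partial>lebesgue)"

definition has_distr_gradient ::
  "complex^'N^'n::finite \<Rightarrow> (real^'N::finite \<Rightarrow> complex) \<Rightarrow> (real^'N \<Rightarrow> complex^'n) \<Rightarrow> bool" where
  "has_distr_gradient c u G \<longleftrightarrow>
     (\<forall>j \<psi>. test_function \<psi> \<longrightarrow>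
        distr_vfield (c $ j) u \<psi> = (\<integral>x. G x $ j * \<psi> x \<partial>lebesgue))"

definition has_distr_adjoint_div ::
  "complex^'N^'n::finite \<Rightarrow> (real^'N::finite \<Rightarrow> complex^'n) \<Rightarrow> (real^'N \<Rightarrow> complex) \<Rightarrow> bool" where
  "has_distr_adjoint_div c V g \<longleftrightarrow>
     (\<forall>\<psi>. test_function \<psi> \<longrightarrow>
        (\<Sum>j\<in>UNIV. distr_vfield (adjoint_vfield (c $ j)) (\<lambda>x. V x $ j) \<psi>)
          = (\<integral>x. g x * \<psi> x \<partial>lebesgue))"

definition hermitian_prod :: "complex^'n::finite \<Rightarrow> complex^'n \<Rightarrow> complex" where
  "hermitian_prod v w = (\<Sum>j\<in>UNIV. v $ j * cnj (w $ j))"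

section \<open>The local Hardy space norm\<close>

definition dilate :: "(real^'N::finite \<Rightarrow> complex) \<Rightarrow> real \<Rightarrow> real^'N \<Rightarrow> complex" where
  "dilate \<eta> t x = (1 / t ^ CARD('N)) *\<^sub>R \<eta> ((1 / t) *\<^sub>R x)"

text \<open>Maximal function and norm are extended nonnegative, so that the norm is finite exactly
  when \<open>f\<close> belongs to the local Hardy space.\<close>

definition local_maximal ::
  "(real^'N::finite \<Rightarrow> complex) \<Rightarrow> (real^'N \<Rightarrow> complex) \<Rightarrow> real^'N \<Rightarrow> ennreal" where
  "local_maximal \<eta> f x =
     (SUP t\<in>{0<..<1}. ennreal (norm (\<integral>y. f y * dilate \<eta> t (x - y) \<partial>lebesgue)))"

definition local_hardy_norm ::
  "(real^'N::finite \<Rightarrow> complex) \<Rightarrow> (real^'N \<Rightarrow> complex) \<Rightarrow> ennreal" where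
  "local_hardy_norm \<eta> f = (\<integral>\<^sup>+x. local_maximal \<eta> f x \<partial>lebesgue)"

end

theory Submission
  imports Defs
begin

text \<open>
  Average the product against a bump \<open>\<psi>\<close> of radius \<open>R\<close>. Testing the equation for \<open>div V\<close> with \<open>\<psi>\<close> times the conjugate of a
  smooth function \<open>E\<close> bounds the average of \<open>V \<cdot> \<nabla>E\<close> by averages of \<open>(|V| + |div V|) |E|\<close>; this is used for functions \<open>E\<close>
  whose gradients along the system tend to that of \<open>\<phi>\<close>.

  Such \<open>E\<close> of size \<open>R\<close> times a mean of \<open>|G|\<close>, where \<open>G = \<nabla>\<phi>\<close>, are obtained without singular integrals. The symbol of
  \<open>\<Sum>L\<^sub>j\<^sup>*L\<^sub>j\<close> is a positive definite real quadratic form, so for a bump \<open>\<rho>\<close> that is radial for the dual form the difference of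
  its dilates at scales \<open>s\<close> and \<open>2s\<close> is, up to sign, \<open>\<Sum>L\<^sub>j\<^sup>*L\<^sub>j\<Psi>\<close> with \<open>\<Psi>\<close> a test function at scale \<open>s\<close>. Hence the
  difference of the mollifications of \<open>\<phi>\<close> at these scales is a convolution of \<open>G\<close> with a test function at scale \<open>s\<close>. Sum over
  dyadic \<open>s\<close>. Scales below \<open>R\<close> are estimated by Young's inequality. Scales above \<open>R\<close> agree up to an admissible error with
  their first order Taylor polynomial at the centre; the derivative of this polynomial along the system is a mean of \<open>G\<close>, so by
  linear independence of the fields it differs by an admissible error from an affine function annihilated by all \<open>L\<^sub>j\<close>, which may
  be subtracted from \<open>E\<close>.

  This bounds the averages at \<open>x\<close> by a product \<open>(M(|V| + |div V|)\<^sup>\<alpha>)\<^sup>1\<^sup>/\<^sup>\<alpha> (M|G|\<^sup>\<beta>)\<^sup>1\<^sup>/\<^sup>\<beta>\<close> of maximal functions at \<open>x\<close>,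
  with some \<open>\<alpha> < p\<close> and \<open>\<beta> < p'\<close>, and the maximal theorem and Hoelder's inequality conclude. A Schwartz function is a rapidly
  convergent sum of bumps of radius \<open>2\<^sup>k\<close>.
\<close>

section \<open>Calculus of smooth functions\<close>

text \<open>A Poincare inequality cannot bound a function by its derivatives along the system: the
  common null space of the fields may be infinite dimensional, as for the Cauchy-Riemann operators
  in several variables. Hence \<open>E\<close> is assembled from convolutions of \<open>G\<close>,
  and \<phi> enters through the compatibility conditions \<open>L_i G_j = L_j G_i\<close>. Removing
  affine null solutions is enough, since the first order Taylor remainder of a piece at scale
  \<open>s\<close> carries the factor \<open>(R/s)^2\<close> against the size \<open>s\<close> of
  the piece, which is summable over dyadic \<open>s > R\<close>. The maximal theorem in both factors
  forces \<alpha> < p and \<beta> < p', so that \<open>1/\<alpha> + 1/\<beta> > 1\<close> and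
  Hoelder's inequality alone no longer pairs the two factors on a ball. Young's inequality does, at
  the price of \<open>s\<close> to the power \<open>-N(1/\<alpha> + 1/\<beta> - 1)\<close>; the
  factor \<open>s\<close> of the kernel outweighs it when \<alpha> and \<beta> are close enough to p
  and p'. Differentiating a bump of radius \<open>R\<close> costs \<open>1/R\<close>, so the term
  with div V is larger by the factor \<open>R\<close>. The restriction to \<open>t < 1\<close> in
  the local norm keeps this factor under control.\<close>

lemma has_derivative_partial:
  assumes "f differentiable (at x)"
  shows "(f has_derivative (\<lambda>h. \<Sum>k\<in>UNIV. h $ k *\<^sub>R partial k f x)) (at x)"
proof -
  let ?D = "frechet_derivative f (at x)"
  have D: "(f has_derivative ?D) (at x)"
    using assms frechet_derivative_works by blast
  then interpret linear ?D by (rule has_derivative_linear)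
  have "?D h = (\<Sum>k\<in>UNIV. h $ k *\<^sub>R partial k f x)" for h
  proof -
    have "h = (\<Sum>k\<in>UNIV. h $ k *\<^sub>R axis k 1)"
      using basis_expansion[of h] by (simp add: scalar_mult_eq_scaleR)
    then have "?D h = ?D (\<Sum>k\<in>UNIV. h $ k *\<^sub>R axis k 1)" by simp
    then show ?thesis by (simp add: sum scale partial_def)
  qed
  then have "?D = (\<lambda>h. \<Sum>k\<in>UNIV. h $ k *\<^sub>R partial k f x)" by blast
  then show ?thesis using D by simp
qed

lemma partial_eqI:
  "(f has_derivative D) (at x) \<Longrightarrow> partial k f x = D (axis k 1)"
  unfolding partial_def using frechet_derivative_at by metis

lemma smooth_differentiable: "smooth f \<Longrightarrow> f differentiable (at x)"
  unfolding smooth_def by (metis foldr_Nil id_apply)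

lemma smooth_partial: "smooth f \<Longrightarrow> smooth (partial k f)"
  unfolding smooth_def
proof (intro allI)
  fix ks x assume "\<forall>ks x. partials ks f differentiable at x"
  then have "partials (ks @ [k]) f differentiable at x" by blast
  then show "partials ks (partial k f) differentiable at x" by simp
qed

text \<open>Smooth functions form the largest class of everywhere differentiable functions that is
  closed under partial derivatives, so an invariant suffices. The second disjunct stops the
  recursion at functions already known to be smooth.\<close>

lemma smooth_coinduct:
  assumes "R f"
    and step: "\<And>f. R f \<Longrightarrow> (\<forall>x. f differentiable (at x)) \<and> (\<forall>k. R (partial k f) \<or> smooth (partial k f))"
  shows "smooth f"
proof -
  have "R f \<or> smooth f \<Longrightarrow> partials ks f differentiable (at x)" for ks x f
  \<comment> \<open>\<open>foldr\<close> applies the last direction of the list first, so the list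
    is peeled from its right end.\<close>
  proof (induction ks arbitrary: f rule: rev_induct)
    case Nil
    then show ?case using step smooth_differentiable by auto
  next
    case (snoc k ks)
    have "R (partial k f) \<or> smooth (partial k f)"
      using snoc.prems step smooth_partial by blast
    then show ?case using snoc.IH by simp
  qed
  then show ?thesis using assms(1) unfolding smooth_def by blast
qed

lemma smooth_has_derivative:
  "smooth f \<Longrightarrow> (f has_derivative (\<lambda>h. \<Sum>k\<in>UNIV. h $ k *\<^sub>R partial k f x)) (at x)"
  by (simp add: has_derivative_partial smooth_differentiable)

lemma sum_axis_scaleR: "(\<Sum>i\<in>UNIV. axis k (1::real) $ i *\<^sub>R g i) = (g k :: 'a :: real_vector)"
proof -
  have "(\<Sum>i\<in>UNIV. axis k (1::real) $ i *\<^sub>R g i) = (\<Sum>i\<in>UNIV. if i = k then g i else 0)"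
    by (intro sum.cong) (auto simp: axis_def)
  then show ?thesis by simp
qed

lemma smooth_continuous_on: "smooth f \<Longrightarrow> continuous_on A f"
  by (meson continuous_at_imp_continuous_on differentiable_imp_continuous_within smooth_differentiable)

lemma smooth_const: "smooth (\<lambda>_. c)"
proof (rule smooth_coinduct[where R="\<lambda>f. \<exists>c. f = (\<lambda>_. c)"])
  fix f :: "real^'a \<Rightarrow> complex" assume "\<exists>c. f = (\<lambda>_. c)"
  then obtain c where f: "f = (\<lambda>_. c)" by blast
  have "partial k f = (\<lambda>_. 0)" for k
    using partial_eqI[of f "\<lambda>_. 0"] by (auto simp: f fun_eq_iff)
  then show "(\<forall>x. f differentiable at x) \<and> (\<forall>k. (\<exists>c. partial k f = (\<lambda>_. c)) \<or> smooth (partial k f))"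
    by (auto simp: f)
qed auto

lemma partial_add:
  "f differentiable (at x) \<Longrightarrow> g differentiable (at x) \<Longrightarrow>
    partial k (\<lambda>x. f x + g x) x = partial k f x + partial k g x"
  by (subst partial_eqI[OF has_derivative_add[OF has_derivative_partial has_derivative_partial]])
    (auto simp: sum_axis_scaleR)

lemma partial_mult:
  "f differentiable (at x) \<Longrightarrow> g differentiable (at x) \<Longrightarrow>
    partial k (\<lambda>x. f x * g x) x = partial k f x * g x + f x * partial k g x"
  by (subst partial_eqI[OF has_derivative_mult[OF has_derivative_partial has_derivative_partial]])
    (auto simp: sum_axis_scaleR)

lemma has_derivative_cnj_comp:
  assumes "(f has_derivative D) (at x)"
  shows "((\<lambda>x. cnj (f x)) has_derivative (\<lambda>h. cnj (D h))) (at x)"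
  using bounded_linear.has_derivative[OF bounded_linear_cnj assms] .

lemma partial_cnj:
  "f differentiable (at x) \<Longrightarrow> partial k (\<lambda>x. cnj (f x)) x = cnj (partial k f x)"
  by (subst partial_eqI[OF has_derivative_cnj_comp[OF has_derivative_partial]])
    (auto simp: sum_axis_scaleR)

lemma has_derivative_affine_comp:
  assumes "f differentiable (at (a *\<^sub>R x + b))"
  shows "((\<lambda>x. f (a *\<^sub>R x + b)) has_derivative
     (\<lambda>h. \<Sum>k\<in>UNIV. (a * h $ k) *\<^sub>R partial k f (a *\<^sub>R x + b))) (at x)"
proof -
  have "((\<lambda>x. a *\<^sub>R x + b) has_derivative (\<lambda>h. a *\<^sub>R h)) (at x)"
    by (auto intro!: derivative_eq_intros)
  from has_derivative_compose[OF this has_derivative_partial[OF assms]]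
  show ?thesis by simp
qed

lemma partial_affine:
  assumes "f differentiable (at (a *\<^sub>R x + b))"
  shows "partial k (\<lambda>x. f (a *\<^sub>R x + b)) x = a *\<^sub>R partial k f (a *\<^sub>R x + b)"
proof -
  have eq: "(\<Sum>i\<in>UNIV. (a * axis k 1 $ i) *\<^sub>R partial i f (a *\<^sub>R x + b)) =
      (\<Sum>i\<in>UNIV. axis k 1 $ i *\<^sub>R (a *\<^sub>R partial i f (a *\<^sub>R x + b)))"
    by (intro sum.cong) auto
  show ?thesis
    unfolding partial_eqI[OF has_derivative_affine_comp[OF assms]] eq by (rule sum_axis_scaleR)
qed

lemma smooth_add: assumes "smooth f" "smooth g" shows "smooth (\<lambda>x. f x + g x)"
proof (rule smooth_coinduct[where R="\<lambda>h. \<exists>f g. smooth f \<and> smooth g \<and> h = (\<lambda>x. f x + g x)"])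
  fix h :: "real^'a \<Rightarrow> complex" assume "\<exists>f g. smooth f \<and> smooth g \<and> h = (\<lambda>x. f x + g x)"
  then obtain f g where h: "h = (\<lambda>x. f x + g x)" and s: "smooth f" "smooth g" by blast
  have "partial k h = (\<lambda>x. partial k f x + partial k g x)" for k
    by (auto simp: h partial_add s smooth_differentiable)
  moreover have "h differentiable at x" for x
    unfolding h by (intro differentiable_add) (auto simp: s smooth_differentiable)
  ultimately show "(\<forall>x. h differentiable at x) \<and>
      (\<forall>k. (\<exists>f g. smooth f \<and> smooth g \<and> partial k h = (\<lambda>x. f x + g x)) \<or> smooth (partial k h))"
    using s smooth_partial by blast
qed (use assms in auto)

text \<open>A partial derivative of a product is no longer a product, so the coinduction for products runs over their span.\<close>

inductive product_span :: "(real^'N::finite \<Rightarrow> complex) \<Rightarrow> bool" where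
  "smooth f \<Longrightarrow> smooth g \<Longrightarrow> product_span (\<lambda>x. f x * g x)"
| "product_span f \<Longrightarrow> product_span g \<Longrightarrow> product_span (\<lambda>x. f x + g x)"

lemma smooth_mult: assumes "smooth f" "smooth g" shows "smooth (\<lambda>x. f x * g x)"
proof (rule smooth_coinduct[where R=product_span])
  fix h :: "real^'a \<Rightarrow> complex" assume "product_span h"
  then show "(\<forall>x. h differentiable at x) \<and> (\<forall>k. product_span (partial k h) \<or> smooth (partial k h))"
  proof (induction)
    case (1 f g)
    then have "(\<lambda>x. f x * g x) differentiable at x" for x
      by (intro differentiable_mult) (auto simp: smooth_differentiable)
    moreover have "partial k (\<lambda>x. f x * g x) = (\<lambda>x. partial k f x * g x + f x * partial k g x)" for k
      using 1 by (auto simp: partial_mult smooth_differentiable)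
    moreover have "product_span (\<lambda>x. partial k f x * g x + f x * partial k g x)" for k
      using 1 by (intro product_span.intros smooth_partial)
    ultimately show ?case by simp
  next
    case (2 f g)
    have eq: "partial k (\<lambda>x. f x + g x) = (\<lambda>x. partial k f x + partial k g x)" for k
      using 2 by (auto simp: partial_add)
    have "product_span (partial k (\<lambda>x. f x + g x)) \<or> smooth (partial k (\<lambda>x. f x + g x))" for k
    proof -
      \<comment> \<open>A smooth function belongs to the span as its product with 1.\<close>
      have p: "product_span (partial k f)" if "product_span (partial k f) \<or> smooth (partial k f)" for f
        using that product_span.intros(1)[OF _ smooth_const[of 1], of "partial k f"] by auto
      show ?thesis unfolding eq using 2 product_span.intros(2)[OF p p, of f g] by blast
    qed
    then show ?case using 2 by (auto intro: differentiable_add)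
  qed
qed (use assms product_span.intros(1) in blast)

lemma smooth_cnj: assumes "smooth f" shows "smooth (\<lambda>x. cnj (f x))"
proof (rule smooth_coinduct[where R="\<lambda>h. \<exists>f. smooth f \<and> h = (\<lambda>x. cnj (f x))"])
  fix h :: "real^'a \<Rightarrow> complex" assume "\<exists>f. smooth f \<and> h = (\<lambda>x. cnj (f x))"
  then obtain f where h: "h = (\<lambda>x. cnj (f x))" and s: "smooth f" by blast
  have "partial k h = (\<lambda>x. cnj (partial k f x))" for k
    by (auto simp: h partial_cnj s smooth_differentiable)
  moreover have "h differentiable at x" for x
    unfolding h using has_derivative_cnj_comp[OF smooth_has_derivative[OF s]] differentiable_def by blast
  ultimately show "(\<forall>x. h differentiable at x) \<and>
      (\<forall>k. (\<exists>f. smooth f \<and> partial k h = (\<lambda>x. cnj (f x))) \<or> smooth (partial k h))"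
    using s smooth_partial by blast
qed (use assms in auto)

lemma smooth_scaleR: "smooth f \<Longrightarrow> smooth (\<lambda>x. c *\<^sub>R f x)"
  using smooth_mult[OF smooth_const[of "of_real c"], of f] by (simp add: scaleR_conv_of_real)

lemma smooth_cmult: "smooth f \<Longrightarrow> smooth (\<lambda>x. c * f x)"
  by (rule smooth_mult[OF smooth_const])

lemma smooth_affine: assumes "smooth f" shows "smooth (\<lambda>x. f (a *\<^sub>R x + b))"
proof -
  have "smooth (\<lambda>x. 1 *\<^sub>R f (a *\<^sub>R x + b))"
  \<comment> \<open>Every differentiation brings out a factor \<open>a\<close>, which the free
    scalar of the invariant absorbs.\<close>
  proof (rule smooth_coinduct[where R="\<lambda>h. \<exists>f c. smooth f \<and> h = (\<lambda>x. c *\<^sub>R f (a *\<^sub>R x + b))"])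
    fix h :: "real^'a \<Rightarrow> complex" assume "\<exists>f c. smooth f \<and> h = (\<lambda>x. c *\<^sub>R f (a *\<^sub>R x + b))"
    then obtain f c where h: "h = (\<lambda>x. c *\<^sub>R f (a *\<^sub>R x + b))" and s: "smooth f" by blast
    have s': "smooth (\<lambda>x. c *\<^sub>R f x)" by (rule smooth_scaleR[OF s])
    have "partial k (\<lambda>x. c *\<^sub>R f x) y = c *\<^sub>R partial k f y" for k y
      using partial_mult[of "\<lambda>_. of_real c" y f k] smooth_differentiable[OF s]
        partial_eqI[of "\<lambda>_. of_real c" "\<lambda>_. 0" y k]
      by (auto simp: scaleR_conv_of_real)
    then have "partial k h = (\<lambda>x. (a * c) *\<^sub>R partial k f (a *\<^sub>R x + b))" for k
      using partial_affine[OF smooth_differentiable[OF s']] by (auto simp: h)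
    moreover have "h differentiable at x" for x
      unfolding h using has_derivative_affine_comp[OF smooth_differentiable[OF s']] differentiable_def by blast
    ultimately show "(\<forall>x. h differentiable at x) \<and>
        (\<forall>k. (\<exists>f c. smooth f \<and> partial k h = (\<lambda>x. c *\<^sub>R f (a *\<^sub>R x + b))) \<or> smooth (partial k h))"
      using s smooth_partial by blast
  qed (use assms in blast)
  then show ?thesis by simp
qed

lemma smooth_sum: "(\<And>i. i \<in> I \<Longrightarrow> smooth (f i)) \<Longrightarrow> smooth (\<lambda>x. \<Sum>i\<in>I. f i x)"
  by (induction I rule: infinite_finite_induct) (auto intro: smooth_const smooth_add)

lemma smooth_diff: assumes "smooth f" "smooth g" shows "smooth (\<lambda>x. f x - g x)"
  using smooth_add[OF assms(1) smooth_cmult[OF assms(2), of "-1"]] by simp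

lemma smooth_vfield: "smooth f \<Longrightarrow> smooth (vfield a f)"
  unfolding vfield_def[abs_def] by (intro smooth_sum smooth_cmult smooth_partial)

lemma partial_coord: "partial k (\<lambda>x. complex_of_real (x $ i)) = (\<lambda>_. of_real (axis k 1 $ i))"
proof
  fix x :: "real^'a"
  have "((\<lambda>x. complex_of_real (x $ i)) has_derivative (\<lambda>h. of_real (h $ i))) (at x)"
    by (auto intro!: derivative_eq_intros bounded_linear_imp_has_derivative bounded_linear_compose[OF bounded_linear_of_real bounded_linear_vec_nth])
  from partial_eqI[OF this] show "partial k (\<lambda>x. complex_of_real (x $ i)) x = of_real (axis k 1 $ i)" .
qed

lemma coord_differentiable: "(\<lambda>x. complex_of_real (x $ i)) differentiable (at x)"
  by (intro bounded_linear_imp_differentiable bounded_linear_compose[OF bounded_linear_of_real bounded_linear_vec_nth])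

lemma smooth_coord: "smooth (\<lambda>x. complex_of_real (x $ i))"
  by (rule smooth_coinduct[where R="\<lambda>f. f = (\<lambda>x. complex_of_real (x $ i))"])
    (auto simp: partial_coord smooth_const coord_differentiable)

section \<open>Functions flat at the origin, for building bumps\<close>

lemma tendsto_poly_mult_exp: "((\<lambda>x::real. poly P x * exp (-x)) \<longlongrightarrow> 0) at_top"
proof -
  have "((\<lambda>x. \<Sum>i\<le>degree P. coeff P i * (x ^ i / exp x)) \<longlongrightarrow> (\<Sum>i\<le>degree P. coeff P i * 0)) at_top"
    by (intro tendsto_sum tendsto_mult tendsto_const tendsto_power_div_exp_0)
  then show ?thesis by (simp add: poly_altdef sum_distrib_right exp_minus divide_inverse mult.assoc)
qed

text \<open>The classical \<open>exp (-1/u)\<close> extended by zero. The polynomial factors in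
  \<open>1/u\<close> close the family under differentiation.\<close>

definition flat :: "real poly \<Rightarrow> real \<Rightarrow> real" where
  "flat P u = (if u > 0 then poly P (1 / u) * exp (- 1 / u) else 0)"

text \<open>With \<open>x = 1/u\<close>, differentiation in \<open>u\<close> is \<open>-x^2\<close>
  times differentiation in \<open>x\<close>, and it turns \<open>P(x) exp(-x)\<close> into
  \<open>x^2 (P - P')(x) exp(-x)\<close>.\<close>

definition flat_deriv :: "real poly \<Rightarrow> real poly" where
  "flat_deriv P = [:0, 0, 1:] * (P - pderiv P)"

lemma flat_has_derivative: "(flat P has_real_derivative flat (flat_deriv P) u) (at u)"
proof -
  consider "u > 0" | "u < 0" | "u = 0" by linarith
  then show ?thesis
  proof cases
    case 1
    have "((\<lambda>u. poly P (1 / u) * exp (- 1 / u)) has_real_derivative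
        (poly (pderiv P) (1/u) * (- (1 / u^2)) * exp (-1/u) + poly P (1/u) * (exp (-1/u) * (1 / u^2)))) (at u)"
      using 1 by (auto intro!: derivative_eq_intros DERIV_chain2[OF poly_DERIV] simp: power2_eq_square field_simps)
    moreover have "poly (pderiv P) (1/u) * (- (1 / u^2)) * exp (-1/u) + poly P (1/u) * (exp (-1/u) * (1 / u^2)) = flat (flat_deriv P) u"
      using 1 by (simp add: flat_def flat_deriv_def power2_eq_square field_simps)
    ultimately have "((\<lambda>u. poly P (1 / u) * exp (- 1 / u)) has_real_derivative flat (flat_deriv P) u) (at u)" by simp
    then show ?thesis
      by (rule has_field_derivative_transform_within_open[of _ _ _ "{0<..}"]) (use 1 in \<open>auto simp: flat_def\<close>)
  next
    case 2
    have "((\<lambda>u. 0) has_real_derivative flat (flat_deriv P) u) (at u)" using 2 by (auto simp: flat_def)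
    then show ?thesis
      by (rule has_field_derivative_transform_within_open[of _ _ _ "{..<0}"]) (use 2 in \<open>auto simp: flat_def\<close>)
  next
    case 3
    \<comment> \<open>In the variable \<open>x = 1/h\<close> the right difference quotient is
      \<open>x P(x) exp(-x)\<close>, again a polynomial times a decaying exponential.\<close>
    have "((\<lambda>h. flat P h / h) \<longlongrightarrow> 0) (at_right 0)"
    proof -
      have "((\<lambda>x::real. poly ([:0,1:] * P) x * exp (-x)) \<longlongrightarrow> 0) at_top" by (rule tendsto_poly_mult_exp)
      then have "((\<lambda>h::real. poly ([:0,1:] * P) (inverse h) * exp (- (inverse h))) \<longlongrightarrow> 0) (at_right 0)"
        using filterlim_inverse_at_top_right filterlim_compose by blast
      then show ?thesis
        by (rule Lim_transform_eventually) (auto simp: eventually_at_right_less flat_def field_simps intro!: eventually_at_rightI[of 0 1])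
    qed
    moreover have "((\<lambda>h. flat P h / h) \<longlongrightarrow> 0) (at_left 0)"
      by (rule Lim_transform_eventually[of "\<lambda>_. 0"]) (auto simp: flat_def intro!: eventually_at_leftI[of "-1" 0])
    ultimately have "((\<lambda>h. flat P h / h) \<longlongrightarrow> 0) (at 0)" by (simp add: filterlim_at_split)
    then show ?thesis using 3 by (simp add: DERIV_def flat_def)
  qed
qed

text \<open>Sums are needed for the same reason as in \<open>product_span\<close>: differentiating a
  coefficient times \<open>flat P\<close> of \<open>w\<close> gives two such terms, the second one
  with \<open>flat_deriv P\<close>.\<close>

inductive flat_span :: "(real^'N::finite \<Rightarrow> real) \<Rightarrow> (real^'N \<Rightarrow> complex) \<Rightarrow> bool" for w where
  "smooth f \<Longrightarrow> flat_span w (\<lambda>x. f x * of_real (flat P (w x)))"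
| "flat_span w f \<Longrightarrow> flat_span w g \<Longrightarrow> flat_span w (\<lambda>x. f x + g x)"

lemma has_derivative_flat_comp:
  assumes "(\<lambda>x. complex_of_real (w x)) differentiable (at x)"
  shows "((\<lambda>x. complex_of_real (flat P (w x))) has_derivative
     (\<lambda>h. of_real (flat (flat_deriv P) (w x)) * (\<Sum>k\<in>UNIV. h $ k *\<^sub>R partial k (\<lambda>x. complex_of_real (w x)) x))) (at x)"
proof -
  let ?D = "\<lambda>h. \<Sum>k\<in>UNIV. h $ k *\<^sub>R partial k (\<lambda>x. complex_of_real (w x)) x"
  have 1: "((\<lambda>x. complex_of_real (w x)) has_derivative ?D) (at x)"
    by (rule has_derivative_partial[OF assms])
  have w: "(w has_derivative (\<lambda>h. Re (?D h))) (at x)"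
    using bounded_linear.has_derivative[OF bounded_linear_Re 1] by simp
  have im: "((\<lambda>x. 0) has_derivative (\<lambda>h. Im (?D h))) (at x)"
    using bounded_linear.has_derivative[OF bounded_linear_Im 1] by simp
  \<comment> \<open>The function is real valued, so its derivative has no imaginary part and the
    real chain rule for \<open>flat\<close> applies.\<close>
  have "Im (?D h) = 0" for h
    using has_derivative_unique[OF im has_derivative_const] by metis
  then have r: "of_real (Re (?D h)) = ?D h" for h
    by (simp add: complex_eq_iff)
  have "((\<lambda>x. flat P (w x)) has_derivative (\<lambda>h. flat (flat_deriv P) (w x) * Re (?D h))) (at x)"
    using has_derivative_compose[OF w flat_has_derivative[unfolded has_field_derivative_def]] by simp
  from bounded_linear.has_derivative[OF bounded_linear_of_real this]
  have "((\<lambda>x. complex_of_real (flat P (w x))) has_derivative (\<lambda>h. of_real (flat (flat_deriv P) (w x) * Re (?D h)))) (at x)" .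
  then show ?thesis unfolding of_real_mult r .
qed

lemma partial_flat_comp:
  assumes "(\<lambda>x. complex_of_real (w x)) differentiable (at x)"
  shows "partial k (\<lambda>x. complex_of_real (flat P (w x))) x =
    of_real (flat (flat_deriv P) (w x)) * partial k (\<lambda>x. complex_of_real (w x)) x"
  using partial_eqI[OF has_derivative_flat_comp[OF assms]] by (simp add: sum_axis_scaleR)

lemma smooth_flat_comp:
  assumes w: "smooth (\<lambda>x. complex_of_real (w x))"
  shows "smooth (\<lambda>x. complex_of_real (flat P (w x)))"
proof -
  have "smooth (\<lambda>x. 1 * complex_of_real (flat P (w x)))"
  proof (rule smooth_coinduct[where R="flat_span w"])
    show "flat_span w (\<lambda>x. 1 * complex_of_real (flat P (w x)))"
      using flat_span.intros(1)[OF smooth_const[of 1]] by auto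
    fix h :: "real^'a \<Rightarrow> complex" assume "flat_span w h"
    then have "(\<forall>x. h differentiable at x) \<and> (\<forall>k. flat_span w (partial k h))"
    proof (induction)
      case (1 f P)
      have d: "(\<lambda>x. complex_of_real (flat P (w x))) differentiable at x" for x
        using has_derivative_flat_comp[OF smooth_differentiable[OF w]] differentiable_def by blast
      have "(\<lambda>x. f x * complex_of_real (flat P (w x))) differentiable at x" for x
        using 1 d by (intro differentiable_mult) (auto simp: smooth_differentiable)
      moreover have "partial k (\<lambda>x. f x * complex_of_real (flat P (w x))) = (\<lambda>x. partial k f x * of_real (flat P (w x))
         + (f x * partial k (\<lambda>x. complex_of_real (w x)) x) * of_real (flat (flat_deriv P) (w x)))" for k
        using 1 d smooth_differentiable[OF w] by (auto simp: partial_mult smooth_differentiable partial_flat_comp algebra_simps)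
      moreover have "flat_span w (\<lambda>x. partial k f x * of_real (flat P (w x))
         + (f x * partial k (\<lambda>x. complex_of_real (w x)) x) * of_real (flat (flat_deriv P) (w x)))" for k
        using 1 w by (intro flat_span.intros(2) flat_span.intros(1) smooth_mult smooth_partial)
      ultimately show ?case by simp
    next
      case (2 f g)
      have eq: "partial k (\<lambda>x. f x + g x) = (\<lambda>x. partial k f x + partial k g x)" for k
        using 2 by (auto simp: partial_add)
      show ?case unfolding eq using 2 flat_span.intros(2)[of w "partial _ f" "partial _ g"]
        by (auto intro: differentiable_add)
    qed
    then show "(\<forall>x. h differentiable at x) \<and> (\<forall>k. flat_span w (partial k h) \<or> smooth (partial k h))" by blast
  qed
  then show ?thesis by simp
qed

text \<open>As a function of the step along \<open>j\<close>, the second difference has for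
  derivative the difference of \<open>partial j f\<close> at two points displaced along
  \<open>i\<close>. Differentiability of \<open>partial j f\<close> at the single point
  \<open>x\<close> evaluates this up to \<open>e * t\<close>, and the mean value inequality
  integrates the error to \<open>e * t^2\<close>.\<close>

lemma mixed_difference_estimate:
  assumes s: "smooth f" and e: "e > 0"
  shows "\<exists>d>0. \<forall>t. 0 < t \<and> t < d \<longrightarrow>
    norm (f (x + t *\<^sub>R axis i 1 + t *\<^sub>R axis j 1) - f (x + t *\<^sub>R axis j 1) - f (x + t *\<^sub>R axis i 1) + f x
      - (t^2) *\<^sub>R partial i (partial j f) x) \<le> e * t^2"
proof -
  let ?u = "axis i 1 :: real^'a" and ?v = "axis j 1 :: real^'a"
  let ?g = "partial j f"
  define D where "D = (\<lambda>h. \<Sum>k\<in>UNIV. h $ k *\<^sub>R partial k ?g x)"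
  have "(?g has_derivative D) (at x)" unfolding D_def by (intro smooth_has_derivative smooth_partial s)
  then interpret D: bounded_linear D by (rule has_derivative_bounded_linear)
  \<comment> \<open>The share \<open>e/3\<close> is used once at distance at most
    \<open>2 * t\<close> and once at distance at most \<open>t\<close>, which adds up to
    \<open>e * t\<close>.\<close>
  have "\<exists>d>0. \<forall>y. norm (y - x) < d \<longrightarrow> norm (?g y - ?g x - D (y - x)) \<le> (e/3) * norm (y - x)"
    using \<open>(?g has_derivative D) (at x)\<close> e unfolding has_derivative_at_alt by (meson divide_pos_pos zero_less_numeral)
  then obtain d where d: "d > 0" "\<And>y. norm (y - x) < d \<Longrightarrow> norm (?g y - ?g x - D (y - x)) \<le> (e/3) * norm (y - x)"
    by blast
  show ?thesis
  proof (intro exI[of _ "d/2"] conjI allI impI)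
    show "d/2 > 0" using d by simp
    fix t assume t: "0 < t \<and> t < d/2"
    define F where "F s = f (s *\<^sub>R ?v + (x + t *\<^sub>R ?u)) - f (s *\<^sub>R ?v + x) - (s * t) *\<^sub>R partial i ?g x" for s
    have dF: "(F has_vector_derivative (?g (s *\<^sub>R ?v + (x + t *\<^sub>R ?u)) - ?g (s *\<^sub>R ?v + x) - t *\<^sub>R partial i ?g x)) (at s within {0..t})" for s
    proof -
      have *: "((\<lambda>s. f (s *\<^sub>R ?v + b)) has_vector_derivative ?g (s *\<^sub>R ?v + b)) (at s within {0..t})" for b
      proof -
        have "((\<lambda>s. s *\<^sub>R ?v + b) has_derivative (\<lambda>h. h *\<^sub>R ?v)) (at s within {0..t})"
          by (auto intro!: derivative_eq_intros)
        from has_derivative_compose[OF this smooth_has_derivative[OF s]]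
        have "((\<lambda>s. f (s *\<^sub>R ?v + b)) has_derivative (\<lambda>h. \<Sum>k\<in>UNIV. (h *\<^sub>R ?v) $ k *\<^sub>R partial k f (s *\<^sub>R ?v + b))) (at s within {0..t})" .
        moreover have "(\<Sum>k\<in>UNIV. (h *\<^sub>R ?v) $ k *\<^sub>R partial k f (s *\<^sub>R ?v + b)) = h *\<^sub>R ?g (s *\<^sub>R ?v + b)" for h
          using sum_axis_scaleR[of j "\<lambda>k. partial k f (s *\<^sub>R ?v + b)"]
          by (simp flip: scaleR_scaleR scaleR_sum_right)
        ultimately show ?thesis unfolding has_vector_derivative_def by simp
      qed
      have **: "((\<lambda>s. (s * t) *\<^sub>R partial i ?g x) has_vector_derivative t *\<^sub>R partial i ?g x) (at s within {0..t})"
        unfolding has_vector_derivative_def by (auto intro!: derivative_eq_intros)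
      show ?thesis unfolding F_def
        by (intro has_vector_derivative_diff * **)
    qed
    have bd: "norm (?g (s *\<^sub>R ?v + (x + t *\<^sub>R ?u)) - ?g (s *\<^sub>R ?v + x) - t *\<^sub>R partial i ?g x) \<le> e * t" if "s \<in> {0..t}" for s
    proof -
      let ?y1 = "s *\<^sub>R ?v + (x + t *\<^sub>R ?u)" and ?y2 = "s *\<^sub>R ?v + x"
      have n1: "norm (?y1 - x) \<le> s + t" using norm_triangle_ineq[of "s *\<^sub>R ?v" "t *\<^sub>R ?u"] that t by (simp add: algebra_simps)
      have n2: "norm (?y2 - x) \<le> s" using that by simp
      have a1: "norm (?g ?y1 - ?g x - D (?y1 - x)) \<le> (e/3) * norm (?y1 - x)"
        by (rule d) (use n1 t that in auto)
      have a1: "norm (?g ?y1 - ?g x - D (?y1 - x)) \<le> (e/3) * (2 * t)"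
        by (rule order_trans[OF a1], rule mult_left_mono) (use n1 that e in auto)
      have a2: "norm (?g ?y2 - ?g x - D (?y2 - x)) \<le> (e/3) * norm (?y2 - x)"
        by (rule d) (use n2 t that in auto)
      have a2: "norm (?g ?y2 - ?g x - D (?y2 - x)) \<le> (e/3) * t"
        by (rule order_trans[OF a2], rule mult_left_mono) (use n2 that e in auto)
      have "D (?y1 - x) - D (?y2 - x) = D (t *\<^sub>R ?u)" by (subst D.diff[symmetric]) simp
      also have "\<dots> = t *\<^sub>R partial i ?g x" using D.scaleR[of t ?u] by (simp add: D_def sum_axis_scaleR)
      finally have "?g ?y1 - ?g ?y2 - t *\<^sub>R partial i ?g x = (?g ?y1 - ?g x - D (?y1 - x)) - (?g ?y2 - ?g x - D (?y2 - x))"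
        by (simp add: algebra_simps)
      also have "norm \<dots> \<le> (e/3) * (2 * t) + (e/3) * t" using norm_triangle_ineq4 a1 a2 by (meson add_mono order_trans)
      finally show ?thesis by (simp add: field_simps)
    qed
    have "norm (F t - F 0) \<le> (e * t) * norm (t - 0)"
    proof (rule differentiable_bound[of "{0..t}" F "\<lambda>s h. h *\<^sub>R (?g (s *\<^sub>R ?v + (x + t *\<^sub>R ?u)) - ?g (s *\<^sub>R ?v + x) - t *\<^sub>R partial i ?g x)"])
      show "(F has_derivative (\<lambda>h. h *\<^sub>R (?g (s *\<^sub>R ?v + (x + t *\<^sub>R ?u)) - ?g (s *\<^sub>R ?v + x) - t *\<^sub>R partial i ?g x))) (at s within {0..t})" for s
        using dF unfolding has_vector_derivative_def .
      show "onorm (\<lambda>h. h *\<^sub>R (?g (s *\<^sub>R ?v + (x + t *\<^sub>R ?u)) - ?g (s *\<^sub>R ?v + x) - t *\<^sub>R partial i ?g x)) \<le> e * t" if "s \<in> {0..t}" for s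
        using bd[OF that] e t by (intro onorm_bound) (auto simp: mult.commute intro!: mult_left_mono)
    qed (use t in auto)
    then show "norm (f (x + t *\<^sub>R ?u + t *\<^sub>R ?v) - f (x + t *\<^sub>R ?v) - f (x + t *\<^sub>R ?u) + f x
      - (t^2) *\<^sub>R partial i (partial j f) x) \<le> e * t^2"
      using t by (simp add: F_def power2_eq_square algebra_simps)
  qed
qed

text \<open>The second difference is symmetric in \<open>i\<close> and \<open>j\<close>; divided by
  \<open>t^2\<close> it is close to both mixed derivatives.\<close>

lemma partial_commute:
  assumes "smooth f"
  shows "partial i (partial j f) = partial j (partial i f)"
proof
  fix x
  let ?a = "partial i (partial j f) x" and ?b = "partial j (partial i f) x"
  have "norm (?a - ?b) \<le> 2 * e" if "e > 0" for e
  proof -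
    obtain d1 where d1: "d1 > 0" "\<forall>t. 0 < t \<and> t < d1 \<longrightarrow>
    norm (f (x + t *\<^sub>R axis i 1 + t *\<^sub>R axis j 1) - f (x + t *\<^sub>R axis j 1) - f (x + t *\<^sub>R axis i 1) + f x
      - (t^2) *\<^sub>R ?a) \<le> e * t^2"
      using mixed_difference_estimate[OF assms \<open>e > 0\<close>] by blast
    obtain d2 where d2: "d2 > 0" "\<forall>t. 0 < t \<and> t < d2 \<longrightarrow>
    norm (f (x + t *\<^sub>R axis j 1 + t *\<^sub>R axis i 1) - f (x + t *\<^sub>R axis i 1) - f (x + t *\<^sub>R axis j 1) + f x
      - (t^2) *\<^sub>R ?b) \<le> e * t^2"
      using mixed_difference_estimate[OF assms \<open>e > 0\<close>] by blast
    define t where "t = min d1 d2 / 2"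
    have t: "0 < t" "t < d1" "t < d2" using d1 d2 by (auto simp: t_def)
    let ?E = "f (x + t *\<^sub>R axis i 1 + t *\<^sub>R axis j 1) - f (x + t *\<^sub>R axis j 1) - f (x + t *\<^sub>R axis i 1) + f x"
    have 1: "norm (?E - t^2 *\<^sub>R ?a) \<le> e * t^2" using d1 t by blast
    have 2: "norm (?E - t^2 *\<^sub>R ?b) \<le> e * t^2"
    proof -
      have "norm (f (x + t *\<^sub>R axis j 1 + t *\<^sub>R axis i 1) - f (x + t *\<^sub>R axis i 1) - f (x + t *\<^sub>R axis j 1) + f x
      - (t^2) *\<^sub>R ?b) \<le> e * t^2" using d2 t by blast
      moreover have "x + t *\<^sub>R axis j 1 + t *\<^sub>R axis i 1 = x + t *\<^sub>R axis i 1 + t *\<^sub>R axis j (1::real)" by simp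
      ultimately show ?thesis by (simp add: algebra_simps)
    qed
    have "t^2 * norm (?a - ?b) = norm ((?E - t^2 *\<^sub>R ?b) - (?E - t^2 *\<^sub>R ?a))"
      using t by (simp flip: scaleR_diff_right)
    also have "\<dots> \<le> e * t^2 + e * t^2" using norm_triangle_ineq4 1 2 by (meson add_mono order_trans)
    finally have "t^2 * norm (?a - ?b) \<le> t^2 * (2 * e)" by (simp add: algebra_simps)
    then show ?thesis using t by simp
  qed
  note bound = this
  have "norm (?a - ?b) \<le> 0"
  proof (rule field_le_epsilon)
    fix e :: real assume "0 < e"
    then show "norm (?a - ?b) \<le> 0 + e" using bound[of "e/2"] by simp
  qed
  then show "?a = ?b" by simp
qed

section \<open>Test functions and convolution\<close>

lemma test_functionI:
  assumes "smooth f" "\<And>x. norm x > r \<Longrightarrow> f x = 0"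
  shows "test_function f"
proof -
  have "{x. f x \<noteq> 0} \<subseteq> cball 0 r" using assms(2) by (force simp: not_le)
  then have "closure {x. f x \<noteq> 0} \<subseteq> cball 0 r" by (simp add: closure_minimal)
  then have "compact (closure {x. f x \<noteq> 0})"
    using bounded_subset[OF bounded_cball] compact_eq_bounded_closed by blast
  then show ?thesis using assms(1) by (simp add: test_function_def)
qed

lemma test_function_smooth: "test_function f \<Longrightarrow> smooth f"
  by (simp add: test_function_def)

lemma test_function_support:
  assumes "test_function f"
  obtains r where "r > 0" "\<And>x. norm x \<ge> r \<Longrightarrow> f x = 0"
proof -
  have "bounded {x. f x \<noteq> 0}"
    using assms compact_imp_bounded bounded_subset closure_subset unfolding test_function_def by blast
  then obtain b where b: "\<And>x. f x \<noteq> 0 \<Longrightarrow> norm x \<le> b" unfolding bounded_iff by auto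
  have "f x = 0" if "norm x \<ge> max b 0 + 1" for x using b[of x] that by (cases "f x = 0") auto
  then show ?thesis using that[of "max b 0 + 1"] by auto
qed

lemma test_function_differentiable: "test_function f \<Longrightarrow> f differentiable (at x)"
  by (simp add: smooth_differentiable test_function_smooth)

lemma test_function_partial: assumes "test_function f" shows "test_function (partial k f)"
proof -
  obtain r where r: "r > 0" "\<And>x. norm x \<ge> r \<Longrightarrow> f x = 0" using test_function_support[OF assms] by metis
  show ?thesis
  proof (rule test_functionI[of _ r])
    show "smooth (partial k f)" by (rule smooth_partial[OF test_function_smooth[OF assms]])
    fix x :: "real^'a" assume "norm x > r"
    then have "x \<in> - cball 0 r" by simp
    moreover have "((\<lambda>x. 0) has_derivative (\<lambda>_. 0)) (at x)" by simp
    ultimately have "(f has_derivative (\<lambda>_. 0)) (at x)"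
      by (elim has_derivative_transform_within_open[where s="- cball 0 r", rotated 2]) (use r in auto)
    then show "partial k f x = 0" by (rule partial_eqI)
  qed
qed

lemma test_function_mult_smooth:
  assumes "test_function f" "smooth g" shows "test_function (\<lambda>x. f x * g x)"
proof -
  obtain r where r: "\<And>x. norm x \<ge> r \<Longrightarrow> f x = 0" using test_function_support[OF assms(1)] by metis
  show ?thesis
    by (rule test_functionI[of _ r]) (use assms r in \<open>auto intro: smooth_mult test_function_smooth\<close>)
qed

lemma test_function_add:
  assumes "test_function f" "test_function g" shows "test_function (\<lambda>x. f x + g x)"
proof -
  obtain r where r: "\<And>x. norm x \<ge> r \<Longrightarrow> f x = 0" using test_function_support[OF assms(1)] by metis
  obtain s where s: "\<And>x. norm x \<ge> s \<Longrightarrow> g x = 0" using test_function_support[OF assms(2)] by metis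
  show ?thesis
    by (rule test_functionI[of _ "max r s"]) (use assms r s in \<open>auto intro: smooth_add test_function_smooth\<close>)
qed

lemma test_function_cmult: "test_function f \<Longrightarrow> test_function (\<lambda>x. c * f x)"
  using test_function_mult_smooth[OF _ smooth_const, of f c] by (simp add: mult.commute)

lemma test_function_scaleR: "test_function f \<Longrightarrow> test_function (\<lambda>x. c *\<^sub>R f x)"
  using test_function_cmult[of f "of_real c"] by (simp add: scaleR_conv_of_real)

lemma test_function_zero: "test_function (\<lambda>_. 0)"
  by (rule test_functionI[of _ 0]) (auto intro: smooth_const)

lemma test_function_sum: "(\<And>i. i \<in> I \<Longrightarrow> test_function (f i)) \<Longrightarrow> test_function (\<lambda>x. \<Sum>i\<in>I. f i x)"
  by (induction I rule: infinite_finite_induct) (auto intro: test_function_zero test_function_add)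

lemma test_function_diff:
  assumes "test_function f" "test_function g" shows "test_function (\<lambda>x. f x - g x)"
  using test_function_add[OF assms(1) test_function_cmult[OF assms(2), of "-1"]] by simp

lemma test_function_affine:
  assumes "test_function f" "a \<noteq> 0" shows "test_function (\<lambda>x. f (a *\<^sub>R x + b))"
proof -
  obtain r where r: "\<And>x. norm x \<ge> r \<Longrightarrow> f x = 0" using test_function_support[OF assms(1)] by metis
  show ?thesis
  proof (rule test_functionI[of _ "(r + norm b) / \<bar>a\<bar>"])
    fix x :: "real^'a" assume "norm x > (r + norm b) / \<bar>a\<bar>"
    then have "norm (a *\<^sub>R x) > r + norm b" using assms(2) by (simp add: field_simps)
    then have "norm (a *\<^sub>R x + b) \<ge> r" using norm_diff_ineq[of "a *\<^sub>R x" b] by simp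
    then show "f (a *\<^sub>R x + b) = 0" using r by simp
  qed (use assms in \<open>auto intro: smooth_affine test_function_smooth\<close>)
qed

lemma test_function_vfield: "test_function f \<Longrightarrow> test_function (vfield a f)"
  unfolding vfield_def[abs_def] by (intro test_function_sum test_function_cmult test_function_partial)

lemma test_function_dilate: "test_function f \<Longrightarrow> t > 0 \<Longrightarrow> test_function (dilate f t)"
  using test_function_scaleR[OF test_function_affine[of f "1/t" 0], of "1 / t ^ CARD('a)"]
  unfolding dilate_def[abs_def] by simp

lemma test_function_bounded:
  assumes "test_function f" obtains M where "M > 0" "\<And>x. norm (f x) \<le> M"
proof -
  obtain r where r: "\<And>x. norm x \<ge> r \<Longrightarrow> f x = 0" using test_function_support[OF assms] by metis
  have "compact (f ` cball 0 r)"
    by (intro compact_continuous_image smooth_continuous_on test_function_smooth assms compact_cball)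
  then obtain M where M: "M > 0" "\<And>y. y \<in> f ` cball 0 r \<Longrightarrow> norm y \<le> M"
    using compact_imp_bounded bounded_pos by metis
  have "norm (f x) \<le> M" for x using M r[of x] by (cases "norm x \<le> r") auto
  then show ?thesis using that M by blast
qed

lemma test_function_lipschitz:
  assumes "test_function f" obtains L where "L > 0" "\<And>x y. norm (f x - f y) \<le> L * norm (x - y)"
proof -
  have "\<exists>M>0. \<forall>x. norm (partial k f x) \<le> M" for k
    using test_function_bounded[OF test_function_partial[OF assms]] by metis
  then obtain M where M: "\<And>k. M k > 0" "\<And>k x. norm (partial k f x) \<le> M k" by metis
  have *: "onorm (\<lambda>h. \<Sum>k\<in>UNIV. h $ k *\<^sub>R partial k f x) \<le> (\<Sum>k\<in>UNIV. M k)" for x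
  proof (rule onorm_bound)
    show "0 \<le> (\<Sum>k\<in>UNIV. M k)" using M(1) by (intro sum_nonneg) (auto intro: less_imp_le)
    fix h :: "real^'a"
    have "norm (\<Sum>k\<in>UNIV. h $ k *\<^sub>R partial k f x) \<le> (\<Sum>k\<in>UNIV. norm h * M k)"
      by (rule sum_norm_le) (use M component_le_norm_cart in \<open>auto intro!: mult_mono\<close>)
    then show "norm (\<Sum>k\<in>UNIV. h $ k *\<^sub>R partial k f x) \<le> (\<Sum>k\<in>UNIV. M k) * norm h"
      by (simp add: sum_distrib_left mult.commute)
  qed
  have "norm (f x - f y) \<le> (\<Sum>k\<in>UNIV. M k) * norm (x - y)" for x y
    by (rule differentiable_bound[of UNIV f "\<lambda>x h. \<Sum>k\<in>UNIV. h $ k *\<^sub>R partial k f x"])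
      (use * in \<open>auto intro: smooth_has_derivative[OF test_function_smooth[OF assms]]\<close>)
  moreover have "(\<Sum>k\<in>UNIV. M k) > 0" using M(1) by (intro sum_pos) auto
  ultimately show ?thesis using that by blast
qed

text \<open>Uniformity of the quadratic remainder in the base point is what lets derivatives pass
  under integrals, and it later produces the decay of the large scales.\<close>

lemma test_function_taylor:
  assumes "test_function f"
  obtains C where "C > 0" "\<And>x h. norm (f (x + h) - f x - (\<Sum>k\<in>UNIV. h $ k *\<^sub>R partial k f x)) \<le> C * norm h ^ 2"
proof -
  have "\<exists>L>0. \<forall>x y. norm (partial k f x - partial k f y) \<le> L * norm (x - y)" for k
    using test_function_lipschitz[OF test_function_partial[OF assms]] by metis
  then obtain L where L: "\<And>k. L k > 0" "\<And>k x y. norm (partial k f x - partial k f y) \<le> L k * norm (x - y)"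
    by metis
  define C where "C = (\<Sum>k\<in>UNIV. L k)"
  have "C > 0" unfolding C_def using L(1) by (intro sum_pos) auto
  moreover have "norm (f (x + h) - f x - (\<Sum>k\<in>UNIV. h $ k *\<^sub>R partial k f x)) \<le> C * norm h ^ 2" for x h
  proof -
    define g where "g y = f y - (\<Sum>k\<in>UNIV. (y - x) $ k *\<^sub>R partial k f x)" for y
    have bl: "bounded_linear (\<lambda>h. \<Sum>k\<in>UNIV. h $ k *\<^sub>R partial k f x)"
      by (rule has_derivative_bounded_linear[OF smooth_has_derivative[OF test_function_smooth[OF assms]]])
    have dg: "(g has_derivative (\<lambda>h. (\<Sum>k\<in>UNIV. h $ k *\<^sub>R partial k f y) - (\<Sum>k\<in>UNIV. h $ k *\<^sub>R partial k f x))) (at y within S)" for y S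
    proof -
      have "((\<lambda>y. y - x) has_derivative (\<lambda>h. h)) (at y within S)" by (auto intro!: derivative_eq_intros)
      from bounded_linear.has_derivative[OF bl this]
      show ?thesis unfolding g_def[abs_def]
        by (intro has_derivative_diff has_derivative_at_withinI[OF smooth_has_derivative[OF test_function_smooth[OF assms]]])
    qed
    have "norm (g (x + h) - g x) \<le> (C * norm h) * norm (x + h - x)"
    proof (rule differentiable_bound[of "closed_segment x (x + h)" g, OF _ dg])
      fix y assume y: "y \<in> closed_segment x (x + h)"
      then have nb: "norm (y - x) \<le> norm h" using segment_bound(1)[OF y] by simp
      show "onorm (\<lambda>h. (\<Sum>k\<in>UNIV. h $ k *\<^sub>R partial k f y) - (\<Sum>k\<in>UNIV. h $ k *\<^sub>R partial k f x)) \<le> C * norm h"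
      proof (rule onorm_bound)
        show "0 \<le> C * norm h" using \<open>C > 0\<close> by simp
        fix v :: "real^'a"
        have "norm ((\<Sum>k\<in>UNIV. v $ k *\<^sub>R partial k f y) - (\<Sum>k\<in>UNIV. v $ k *\<^sub>R partial k f x))
            = norm (\<Sum>k\<in>UNIV. v $ k *\<^sub>R (partial k f y - partial k f x))"
          by (simp add: sum_subtractf scaleR_diff_right)
        also have "\<dots> \<le> (\<Sum>k\<in>UNIV. norm v * (L k * norm h))"
        proof (rule sum_norm_le)
          fix k
          have "norm (partial k f y - partial k f x) \<le> L k * norm h"
            using L(2)[of k y x] mult_left_mono[OF nb, of "L k"] L(1)[of k] by linarith
          then show "norm (v $ k *\<^sub>R (partial k f y - partial k f x)) \<le> norm v * (L k * norm h)"
            using component_le_norm_cart[of v k] by (auto intro!: mult_mono)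
        qed
        also have "\<dots> = C * norm h * norm v" by (simp add: C_def sum_distrib_left sum_distrib_right mult_ac)
        finally show "norm ((\<Sum>k\<in>UNIV. v $ k *\<^sub>R partial k f y) - (\<Sum>k\<in>UNIV. v $ k *\<^sub>R partial k f x)) \<le> C * norm h * norm v" .
      qed
    qed auto
    then show ?thesis by (simp add: g_def power2_eq_square algebra_simps)
  qed
  ultimately show ?thesis using that by blast
qed

lemma test_function_borel [measurable]: "test_function f \<Longrightarrow> f \<in> borel_measurable borel"
  by (simp add: borel_measurable_continuous_onI smooth_continuous_on test_function_smooth)

section \<open>Differentiation under the integral sign\<close>

lemma has_derivative_quadraticI:
  fixes f :: "'a::real_normed_vector \<Rightarrow> 'b::real_normed_vector"
  assumes "bounded_linear D" "\<And>h. norm (f (x + h) - f x - D h) \<le> C * norm h ^ 2"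
  shows "(f has_derivative D) (at x)"
  unfolding has_derivative_at_alt
proof (intro conjI allI impI)
  fix e :: real assume e: "0 < e"
  show "\<exists>d>0. \<forall>y. norm (y - x) < d \<longrightarrow> norm (f y - f x - D (y - x)) \<le> e * norm (y - x)"
  proof (intro exI[of _ "e / (\<bar>C\<bar> + 1)"] conjI allI impI)
    show "0 < e / (\<bar>C\<bar> + 1)" using e by (simp add: add_nonneg_pos)
    fix y assume "norm (y - x) < e / (\<bar>C\<bar> + 1)"
    then have "(\<bar>C\<bar> + 1) * norm (y - x) \<le> e" by (simp add: field_simps add_nonneg_pos)
    then have 1: "\<bar>C\<bar> * norm (y - x) \<le> e" by (smt (verit) mult_right_mono norm_ge_zero)
    have "norm (f y - f x - D (y - x)) \<le> C * norm (y - x) ^ 2" using assms(2)[of "y - x"] by simp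
    also have "\<dots> \<le> (\<bar>C\<bar> * norm (y - x)) * norm (y - x)"
      by (simp add: power2_eq_square mult.assoc mult_right_mono)
    also have "\<dots> \<le> e * norm (y - x)" using 1 by (intro mult_right_mono) auto
    finally show "norm (f y - f x - D (y - x)) \<le> e * norm (y - x)" .
  qed
qed (use assms in auto)

lemma integrable_bounded_mult:
  fixes w :: "'a \<Rightarrow> complex"
  assumes "integrable M w" "P \<in> borel_measurable M" "\<And>t. norm (P t) \<le> B"
  shows "integrable M (\<lambda>t. w t * P t)"
proof (rule Bochner_Integration.integrable_bound[of M "\<lambda>t. B *\<^sub>R w t"])
  show "integrable M (\<lambda>t. B *\<^sub>R w t)" using assms by simp
  show "(\<lambda>t. w t * P t) \<in> borel_measurable M" using assms by measurable
  have "norm (w t * P t) \<le> norm (B *\<^sub>R w t)" for t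
    using mult_left_mono[OF assms(3)[of t], of "norm (w t)"] assms(3)[of t]
    by (simp add: norm_mult mult.commute) (smt (verit) mult_right_mono norm_ge_zero)
  then show "AE t in M. norm (w t * P t) \<le> norm (B *\<^sub>R w t)" by simp
qed

lemma test_function_compose_measurable [measurable]:
  "test_function P \<Longrightarrow> b \<in> borel_measurable M \<Longrightarrow> (\<lambda>t. P (b t)) \<in> borel_measurable M"
  using measurable_compose[OF _ test_function_borel] by blast

text \<open>A Taylor remainder uniform in the parameter takes the place of dominated convergence.
  The arguments \<open>a t *\<^sub>R x + b t\<close> cover convolutions (\<open>a = 1\<close>,
  \<open>b\<close> a reflection) as well as averages of dilates (\<open>b = 0\<close>); the bound on
  \<open>a\<close> keeps the remainder uniform.\<close>

lemma has_derivative_param_integral: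
  fixes w :: "'a \<Rightarrow> complex" and b :: "'a \<Rightarrow> real^'N::finite"
  assumes P: "test_function P" and w: "integrable M w"
    and [measurable]: "a \<in> borel_measurable M" "b \<in> borel_measurable M" and a: "\<And>t. \<bar>a t\<bar> \<le> 1"
  shows "((\<lambda>x. \<integral>t. w t * P (a t *\<^sub>R x + b t) \<partial>M) has_derivative
    (\<lambda>h. \<Sum>k\<in>UNIV. h $ k *\<^sub>R (\<integral>t. (w t * of_real (a t)) * partial k P (a t *\<^sub>R x + b t) \<partial>M))) (at x)"
proof -
  obtain C where C: "C > 0" "\<And>x h. norm (P (x + h) - P x - (\<Sum>k\<in>UNIV. h $ k *\<^sub>R partial k P x)) \<le> C * norm h ^ 2"
    using test_function_taylor[OF P] by metis
  have wa: "integrable M (\<lambda>t. w t * of_real (a t))"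
    by (rule integrable_bounded_mult[OF w, where B=1]) (use a in auto)
  have int1: "integrable M (\<lambda>t. w t * P (a t *\<^sub>R x + b t))" for x
  proof -
    obtain B where "\<And>x. norm (P x) \<le> B" using test_function_bounded[OF P] by metis
    then show ?thesis using P by (intro integrable_bounded_mult[OF w, where B=B]) auto
  qed
  have int2: "integrable M (\<lambda>t. (w t * of_real (a t)) * partial k P (a t *\<^sub>R x + b t))" for x k
  proof -
    obtain B where "\<And>x. norm (partial k P x) \<le> B" using test_function_bounded[OF test_function_partial[OF P]] by metis
    then show ?thesis using test_function_partial[OF P] by (intro integrable_bounded_mult[OF wa, where B=B]) auto
  qed
  let ?U = "\<lambda>x. \<integral>t. w t * P (a t *\<^sub>R x + b t) \<partial>M"
  let ?D = "\<lambda>h. \<Sum>k\<in>UNIV. h $ k *\<^sub>R (\<integral>t. (w t * of_real (a t)) * partial k P (a t *\<^sub>R x + b t) \<partial>M)"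
  show ?thesis
  proof (rule has_derivative_quadraticI)
    show "bounded_linear ?D"
      by (intro bounded_linear_sum bounded_linear_compose[OF bounded_linear_scaleR_left bounded_linear_vec_nth])
    fix h :: "real^'N"
    let ?R = "\<lambda>t. P (a t *\<^sub>R (x + h) + b t) - P (a t *\<^sub>R x + b t) - (\<Sum>k\<in>UNIV. (a t *\<^sub>R h) $ k *\<^sub>R partial k P (a t *\<^sub>R x + b t))"
    have R: "norm (?R t) \<le> C * norm h ^ 2" for t
    proof -
      have "norm (?R t) \<le> C * norm (a t *\<^sub>R h) ^ 2"
        using C(2)[of "a t *\<^sub>R x + b t" "a t *\<^sub>R h"] by (simp add: algebra_simps)
      also have "\<dots> \<le> C * norm h ^ 2"
        using C(1) a[of t] by (intro mult_left_mono power_mono) (auto simp: mult_left_le_one_le)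
      finally show ?thesis .
    qed
    have eq: "w t * ?R t = w t * P (a t *\<^sub>R (x + h) + b t) - w t * P (a t *\<^sub>R x + b t)
        - (\<Sum>k\<in>UNIV. h $ k *\<^sub>R ((w t * of_real (a t)) * partial k P (a t *\<^sub>R x + b t)))" for t
    proof -
      have "(w t * of_real (a t)) * p = a t *\<^sub>R (w t * p)" for p
        by (simp add: scaleR_conv_of_real)
      then show ?thesis by (simp add: right_diff_distrib sum_distrib_left mult.commute[of "a t"])
    qed
    have "?U (x + h) - ?U x - ?D h = (\<integral>t. w t * ?R t \<partial>M)"
      unfolding eq using int1 int2
      by (subst Bochner_Integration.integral_diff Bochner_Integration.integral_sum; (intro Bochner_Integration.integrable_diff Bochner_Integration.integrable_sum integrable_scaleR_right)?; auto)+
    also have "norm \<dots> \<le> (\<integral>t. norm (w t) * (C * norm h ^ 2) \<partial>M)"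
    proof (rule order_trans[OF integral_norm_bound integral_mono])
      have "integrable M (\<lambda>t. w t * ?R t)" unfolding eq using int1 int2
        by (intro Bochner_Integration.integrable_diff Bochner_Integration.integrable_sum integrable_scaleR_right) auto
      then show "integrable M (\<lambda>t. norm (w t * ?R t))" by (rule integrable_norm)
      show "integrable M (\<lambda>t. norm (w t) * (C * norm h ^ 2))" using w by simp
      show "norm (w t * ?R t) \<le> norm (w t) * (C * norm h ^ 2)" for t
        unfolding norm_mult by (intro mult_left_mono R) auto
    qed
    also have "\<dots> = ((\<integral>t. norm (w t) \<partial>M) * C) * norm h ^ 2" by simp
    finally show "norm (?U (x + h) - ?U x - ?D h) \<le> ((\<integral>t. norm (w t) \<partial>M) * C) * norm h ^ 2" .
  qed
qed

lemma partial_param_integral: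
  fixes w :: "'a \<Rightarrow> complex" and b :: "'a \<Rightarrow> real^'N::finite"
  assumes "test_function P" "integrable M w" "a \<in> borel_measurable M" "b \<in> borel_measurable M" "\<And>t. \<bar>a t\<bar> \<le> 1"
  shows "partial k (\<lambda>x. \<integral>t. w t * P (a t *\<^sub>R x + b t) \<partial>M) x =
     (\<integral>t. (w t * of_real (a t)) * partial k P (a t *\<^sub>R x + b t) \<partial>M)"
  unfolding partial_eqI[OF has_derivative_param_integral[OF assms]] by (rule sum_axis_scaleR)

lemma smooth_param_integral:
  fixes w :: "'a \<Rightarrow> complex" and b :: "'a \<Rightarrow> real^'N::finite"
  assumes P: "test_function P" and w: "integrable M w"
    and [measurable]: "a \<in> borel_measurable M" "b \<in> borel_measurable M" and a: "\<And>t. \<bar>a t\<bar> \<le> 1"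
  shows "smooth (\<lambda>x. \<integral>t. w t * P (a t *\<^sub>R x + b t) \<partial>M)"
proof (rule smooth_coinduct[where R="\<lambda>U. \<exists>w P. integrable M w \<and> test_function P \<and> U = (\<lambda>x. \<integral>t. w t * P (a t *\<^sub>R x + b t) \<partial>M)"])
  fix U assume "\<exists>w P. integrable M w \<and> test_function P \<and> U = (\<lambda>x. \<integral>t. w t * P (a t *\<^sub>R x + b t) \<partial>M)"
  then obtain w P where w: "integrable M w" and P: "test_function P" and U: "U = (\<lambda>x. \<integral>t. w t * P (a t *\<^sub>R x + b t) \<partial>M)"
    by blast
  have "integrable M (\<lambda>t. w t * of_real (a t))"
    by (rule integrable_bounded_mult[OF w, where B=1]) (use a in auto)
  moreover have "partial k U = (\<lambda>x. \<integral>t. (w t * of_real (a t)) * partial k P (a t *\<^sub>R x + b t) \<partial>M)" for k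
    unfolding U using partial_param_integral[OF P w \<open>a \<in> borel_measurable M\<close> \<open>b \<in> borel_measurable M\<close> a] by blast
  moreover have "U differentiable at x" for x
    unfolding U differentiable_def
    using has_derivative_param_integral[OF P w \<open>a \<in> borel_measurable M\<close> \<open>b \<in> borel_measurable M\<close> a] by blast
  ultimately show "(\<forall>x. U differentiable at x) \<and> (\<forall>k. (\<exists>w P. integrable M w \<and> test_function P \<and>
      partial k U = (\<lambda>x. \<integral>t. w t * P (a t *\<^sub>R x + b t) \<partial>M)) \<or> smooth (partial k U))"
    using test_function_partial[OF P] by blast
qed (use assms in blast)

section \<open>Convolution of locally integrable functions with test functions\<close>

definition conv :: "(real^'N::finite \<Rightarrow> complex) \<Rightarrow> (real^'N \<Rightarrow> complex) \<Rightarrow> real^'N \<Rightarrow> complex" where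
  "conv f K y = (\<integral>z. f z * K (y - z) \<partial>lebesgue)"

lemma ident_measurable_lebesgue: "(\<lambda>x. x) \<in> borel_measurable lebesgue"
  using id_borel_measurable_lebesgue by (simp add: id_def)

lemma locally_integrable_cball:
  assumes "locally_integrable f"
  shows "integrable lebesgue (\<lambda>x. indicator (cball y r) x *\<^sub>R f x)"
proof -
  have "f absolutely_integrable_on cball y r"
    using assms by (simp add: locally_integrable_def)
  then show ?thesis by (simp add: set_integrable_def)
qed

text \<open>For \<open>y\<close> near a fixed \<open>x\<close> only the values of \<open>f\<close>
  on one ball matter, so a locally integrable \<open>f\<close> may be replaced by an integrable
  weight.\<close>

lemma conv_localize:
  assumes "\<And>x. norm x \<ge> r \<Longrightarrow> K x = 0" "norm (y - x) \<le> 1"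
  shows "conv f K y = (\<integral>z. (indicator (cball x (r + 1)) z *\<^sub>R f z) * K (y - z) \<partial>lebesgue)"
  unfolding conv_def
proof (rule Bochner_Integration.integral_cong[OF refl])
  fix z
  show "f z * K (y - z) = (indicator (cball x (r + 1)) z *\<^sub>R f z) * K (y - z)"
  proof (cases "z \<in> cball x (r + 1)")
    case False
    then have "norm (y - z) \<ge> r" using assms(2) norm_triangle_ineq[of "x - y" "y - z"]
      by (simp add: dist_norm norm_minus_commute)
    then show ?thesis using assms(1) by simp
  qed simp
qed

lemma conv_integrable:
  assumes f: "locally_integrable f" and K: "test_function K"
  shows "integrable lebesgue (\<lambda>z. f z * K (y - z))"
proof -
  obtain r where r: "\<And>x. norm x \<ge> r \<Longrightarrow> K x = 0" using test_function_support[OF K] by metis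
  obtain B where B: "\<And>x. norm (K x) \<le> B" using test_function_bounded[OF K] by metis
  have "integrable lebesgue (\<lambda>z. (indicator (cball y r) z *\<^sub>R f z) * K (y - z))"
    by (rule integrable_bounded_mult[OF locally_integrable_cball[OF f] _ B])
      (use K in \<open>auto intro!: test_function_compose_measurable borel_measurable_diff ident_measurable_lebesgue\<close>)
  moreover have "(indicator (cball y r) z *\<^sub>R f z) * K (y - z) = f z * K (y - z)" for z
    using r[of "y - z"] by (auto simp: indicator_def dist_norm split: if_splits)
  ultimately show ?thesis by simp
qed

lemma conv_deriv:
  assumes f: "locally_integrable f" and K: "test_function K"
  shows "conv f K differentiable (at x)" "partial k (conv f K) x = conv f (partial k K) x"
proof -
  obtain r where r: "r > 0" "\<And>x. norm x \<ge> r \<Longrightarrow> K x = 0" using test_function_support[OF K] by metis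
  \<comment> \<open>From radius \<open>r + 1\<close> on there is an open neighbourhood in which
    \<open>K\<close> vanishes. With the further margin 1 for the location of \<open>y\<close> this
    explains the radius \<open>r + 2\<close> of the weight.\<close>
  have r': "partial k K x = 0" if "norm x \<ge> r + 1" for x k
  proof -
    have "((\<lambda>x. 0) has_derivative (\<lambda>_. 0)) (at x)" by simp
    then have "(K has_derivative (\<lambda>_. 0)) (at x)"
      by (rule has_derivative_transform_within_open[where s="- cball 0 r"]) (use r that in auto)
    then show ?thesis by (rule partial_eqI)
  qed
  define w where "w z = indicator (cball x (r + 2)) z *\<^sub>R f z" for z
  have w: "integrable lebesgue w" unfolding w_def by (rule locally_integrable_cball[OF f])
  have m: "uminus \<in> borel_measurable lebesgue" using borel_measurable_uminus[OF ident_measurable_lebesgue] by simp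
  note d = has_derivative_param_integral[OF K w _ m, of "\<lambda>_. 1" x, simplified]
  have eq: "conv f K' y = (\<integral>z. w z * K' (y - z) \<partial>lebesgue)"
    if "\<And>x. norm x \<ge> r + 1 \<Longrightarrow> K' x = 0" "y \<in> ball x 1" for y K'
    unfolding w_def using conv_localize[of "r + 1" K' y x f] that by (simp add: dist_norm norm_minus_commute add.commute)
  have D: "(conv f K has_derivative (\<lambda>h. \<Sum>k\<in>UNIV. h $ k *\<^sub>R (\<integral>t. w t * partial k K (x - t) \<partial>lebesgue))) (at x)"
    by (rule has_derivative_transform_within_open[OF d, of "ball x 1"]) (use eq[of K] r in auto)
  then show "conv f K differentiable (at x)" unfolding differentiable_def by blast
  show "partial k (conv f K) x = conv f (partial k K) x"
    unfolding partial_eqI[OF D] sum_axis_scaleR by (subst eq) (use r' in auto)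
qed

lemma smooth_conv:
  assumes f: "locally_integrable f" and K: "test_function K"
  shows "smooth (conv f K)"
proof (rule smooth_coinduct[where R="\<lambda>U. \<exists>K. test_function K \<and> U = conv f K"])
  fix U assume "\<exists>K. test_function K \<and> U = conv f K"
  then obtain K where K: "test_function K" and U: "U = conv f K" by blast
  have "partial k U = conv f (partial k K)" for k unfolding U using conv_deriv(2)[OF f K] by auto
  then show "(\<forall>x. U differentiable at x) \<and> (\<forall>k. (\<exists>K. test_function K \<and> partial k U = conv f K) \<or> smooth (partial k U))"
    using test_function_partial[OF K] conv_deriv(1)[OF f K] U by blast
qed (use K in blast)

lemma conv_sum_right:
  assumes f: "locally_integrable f" and K: "\<And>i. i \<in> I \<Longrightarrow> test_function (K i)"
  shows "conv f (\<lambda>x. \<Sum>i\<in>I. K i x) y = (\<Sum>i\<in>I. conv f (K i) y)"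
  unfolding conv_def using conv_integrable[OF f K] by (simp add: sum_distrib_left Bochner_Integration.integral_sum)

lemma conv_cmult_right: "conv f (\<lambda>x. c * K x) y = c * conv f K y"
proof -
  have "conv f (\<lambda>x. c * K x) y = (\<integral>z. c * (f z * K (y - z)) \<partial>lebesgue)"
    unfolding conv_def by (simp add: mult_ac)
  then show ?thesis unfolding conv_def by simp
qed

lemma conv_diff_right:
  assumes "locally_integrable f" "test_function K" "test_function K'"
  shows "conv f (\<lambda>x. K x - K' x) y = conv f K y - conv f K' y"
  unfolding conv_def using conv_integrable[OF assms(1,2)] conv_integrable[OF assms(1,3)]
  by (simp add: right_diff_distrib)

lemma vfield_conv:
  assumes f: "locally_integrable f" and K: "test_function K"
  shows "vfield a (conv f K) y = conv f (vfield a K) y"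
  unfolding vfield_def[abs_def]
  by (subst conv_sum_right[OF f]) (auto simp: conv_cmult_right conv_deriv[OF f K] intro!: test_function_cmult test_function_partial K)

lemma partial_sum:
  "(\<And>i. i \<in> I \<Longrightarrow> smooth (f i)) \<Longrightarrow> partial k (\<lambda>x. \<Sum>i\<in>I. f i x) x = (\<Sum>i\<in>I. partial k (f i) x)"
proof (induction I rule: infinite_finite_induct)
  case (insert i I)
  then show ?case by (simp add: partial_add smooth_differentiable smooth_sum)
qed (auto intro: partial_eqI[of _ "\<lambda>_. 0"])

lemma partial_cmult: "f differentiable (at x) \<Longrightarrow> partial k (\<lambda>x. c * f x) x = c * partial k f x"
  using partial_mult[of "\<lambda>_. c" x f k] partial_eqI[of "\<lambda>_. c" "\<lambda>_. 0" x k] by simp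

lemma partial_vfield:
  assumes "smooth f" shows "partial k (vfield a f) x = vfield a (partial k f) x"
  unfolding vfield_def[abs_def]
  by (subst partial_sum)
    (auto simp: assms smooth_cmult smooth_partial partial_cmult smooth_differentiable partial_commute[OF assms, of k])

lemma vfield_commute:
  assumes "smooth f" shows "vfield a (vfield b f) x = vfield b (vfield a f) x"
proof -
  have "vfield a (vfield b f) x = (\<Sum>k\<in>UNIV. \<Sum>l\<in>UNIV. a $ k * (b $ l * partial l (partial k f) x))"
    unfolding vfield_def[of a "vfield b f"] partial_vfield[OF assms] by (simp add: vfield_def sum_distrib_left)
  also have "\<dots> = (\<Sum>l\<in>UNIV. \<Sum>k\<in>UNIV. a $ k * (b $ l * partial l (partial k f) x))" by (rule sum.swap)
  also have "\<dots> = (\<Sum>l\<in>UNIV. b $ l * partial l (vfield a f) x)"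
    unfolding partial_vfield[OF assms] by (simp add: vfield_def sum_distrib_left partial_commute[OF assms] mult_ac)
  finally show ?thesis by (simp add: vfield_def)
qed

text \<open>The test function is the reflected translate \<open>f (y - z)\<close>. The reflection
  changes the sign of the derivative, which cancels the minus sign in
  \<open>distr_vfield\<close>.\<close>

lemma distr_gradient_conv:
  assumes G: "has_distr_gradient c \<phi> G" and f: "test_function f"
  shows "conv \<phi> (vfield (c $ j) f) y = conv (\<lambda>x. G x $ j) f y"
proof -
  let ?\<psi> = "\<lambda>z. f ((-1) *\<^sub>R z + y)"
  have "test_function ?\<psi>" by (rule test_function_affine[OF f]) simp
  then have "distr_vfield (c $ j) \<phi> ?\<psi> = (\<integral>x. G x $ j * ?\<psi> x \<partial>lebesgue)"
    using G unfolding has_distr_gradient_def by blast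
  moreover have "vfield (c $ j) ?\<psi> z = - vfield (c $ j) f (y - z)" for z
    unfolding vfield_def by (subst partial_affine) (auto simp: sum_negf test_function_differentiable[OF f])
  ultimately show ?thesis unfolding distr_vfield_def conv_def by simp
qed

text \<open>The compatibility condition \<open>L_i G_j = L_j G_i\<close> in mollified form, valid
  because fields with constant coefficients commute. It is in this form that \<phi> enters the
  construction of the approximating functions.\<close>

lemma curl_identity:
  assumes G: "has_distr_gradient c \<phi> G" and f: "test_function f"
  shows "conv (\<lambda>x. G x $ j) (vfield (c $ i) f) y = conv (\<lambda>x. G x $ i) (vfield (c $ j) f) y"
proof -
  have "vfield (c $ j) (vfield (c $ i) f) = vfield (c $ i) (vfield (c $ j) f)"
    using vfield_commute[OF test_function_smooth[OF f]] by blast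
  then show ?thesis
    using distr_gradient_conv[OF G test_function_vfield[OF f]] by metis
qed

section \<open>The kernel of the system\<close>

text \<open>The coefficients of minus the formal adjoint. With this sign the sum of the
  \<open>L_j\<close> composed with the conjugate fields has a positive definite coefficient
  matrix.\<close>

definition cnj_row :: "complex^'N::finite \<Rightarrow> complex^'N" where
  "cnj_row a = (\<chi> k. cnj (a $ k))"

text \<open>The form of \<open>A\<close> at a real vector is the sum of the squared moduli of the
  symbols of the fields, which by ellipticity vanishes only at 0. The inverse \<open>B\<close>
  represents the dual form; its positivity follows by writing \<open>x\<close> as \<open>A\<close>
  applied to \<open>B x\<close>.\<close>

lemma elliptic_real_inverse:
  fixes c :: "complex^'N::finite^'n::finite"
  assumes "elliptic_system c"
  defines "A \<equiv> (\<chi> k l. Re (\<Sum>j\<in>UNIV. c $ j $ k * cnj (c $ j $ l))) :: real^'N^'N"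
  obtains B :: "real^'N^'N" where "A ** B = mat 1" "\<And>k l. B $ k $ l = B $ l $ k"
    "\<And>x. x \<noteq> 0 \<Longrightarrow> (B *v x) \<bullet> x > 0"
proof -
  have A_sym: "A $ k $ l = A $ l $ k" for k l
    by (simp add: A_def mult.commute)
  have quad: "(A *v x) \<bullet> x = (\<Sum>j\<in>UNIV. (cmod (\<Sum>k\<in>UNIV. c $ j $ k * of_real (x $ k)))\<^sup>2)" for x
  proof -
    have "complex_of_real ((A *v x) \<bullet> x) = complex_of_real (Re (\<Sum>k\<in>UNIV. \<Sum>l\<in>UNIV. \<Sum>j\<in>UNIV. (c $ j $ k * of_real (x $ k)) * cnj (c $ j $ l * of_real (x $ l))))"
      by (simp add: A_def inner_vec_def matrix_vector_mult_def sum_distrib_right sum_distrib_left algebra_simps)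
    also have "(\<Sum>k\<in>UNIV. \<Sum>l\<in>UNIV. \<Sum>j\<in>UNIV. (c $ j $ k * of_real (x $ k)) * cnj (c $ j $ l * of_real (x $ l)))
      = (\<Sum>k\<in>UNIV. \<Sum>j\<in>UNIV. \<Sum>l\<in>UNIV. (c $ j $ k * of_real (x $ k)) * cnj (c $ j $ l * of_real (x $ l)))"
      by (intro sum.cong refl sum.swap)
    also have "\<dots> = (\<Sum>j\<in>UNIV. \<Sum>k\<in>UNIV. \<Sum>l\<in>UNIV. (c $ j $ k * of_real (x $ k)) * cnj (c $ j $ l * of_real (x $ l)))"
      by (rule sum.swap)
    also have "\<dots> = (\<Sum>j\<in>UNIV. (\<Sum>k\<in>UNIV. c $ j $ k * of_real (x $ k)) * cnj (\<Sum>k\<in>UNIV. c $ j $ k * of_real (x $ k)))"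
      unfolding cnj_sum sum_product by simp
    also have "\<dots> = (\<Sum>j\<in>UNIV. of_real ((cmod (\<Sum>k\<in>UNIV. c $ j $ k * of_real (x $ k)))\<^sup>2))"
      by (simp only: complex_norm_square)
    finally show ?thesis by (simp flip: of_real_sum)
  qed
  have ker: "x = 0" if "(A *v x) \<bullet> x = 0" for x
  proof -
    have "(\<Sum>k\<in>UNIV. c $ j $ k * of_real (x $ k)) = 0" for j
      using that unfolding quad by (subst (asm) sum_nonneg_eq_0_iff) auto
    then show ?thesis using assms(1) unfolding elliptic_system_def by blast
  qed
  then have "\<forall>x. A *v x = 0 \<longrightarrow> x = 0" by auto
  then obtain B where B: "B ** A = mat 1" using matrix_left_invertible_ker by blast
  then have AB: "A ** B = mat 1" by (simp add: matrix_left_right_inverse)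
  have tA: "transpose A = A" using A_sym by (simp add: transpose_def vec_eq_iff)
  have "transpose B ** A = mat 1"
    using arg_cong[OF AB, of transpose] by (simp add: matrix_transpose_mul tA)
  then have "transpose B = B"
    by (metis AB matrix_mul_assoc matrix_mul_lid matrix_mul_rid)
  then have "B $ k $ l = B $ l $ k" for k l by (metis transpose_def vec_lambda_beta)
  moreover have "(B *v x) \<bullet> x > 0" if "x \<noteq> 0" for x
  proof -
    let ?y = "B *v x"
    have x: "x = A *v ?y" by (simp add: matrix_vector_mul_assoc AB)
    have "?y \<noteq> 0" using that x by auto
    have "(B *v x) \<bullet> x = (A *v ?y) \<bullet> ?y" using x by (metis inner_commute)
    moreover have "(A *v ?y) \<bullet> ?y \<ge> 0" unfolding quad by (intro sum_nonneg) auto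
    ultimately show ?thesis using ker[of ?y] \<open>?y \<noteq> 0\<close> by force
  qed
  ultimately show ?thesis using AB that by blast
qed

text \<open>A Hermitian matrix is contracted with the symmetric matrix of second derivatives, so its
  antisymmetric imaginary part cancels. This is why one real quadratic form governs a system with
  complex coefficients.\<close>

lemma vfield_laplacian:
  fixes c :: "complex^'N::finite^'n::finite"
  assumes f: "smooth f"
  shows "(\<Sum>j\<in>UNIV. vfield (c $ j) (vfield (cnj_row (c $ j)) f) x) =
    (\<Sum>k\<in>UNIV. \<Sum>l\<in>UNIV. of_real (Re (\<Sum>j\<in>UNIV. c $ j $ k * cnj (c $ j $ l))) * partial k (partial l f) x)"
    (is "_ = (\<Sum>k\<in>UNIV. \<Sum>l\<in>UNIV. of_real (Re (?H k l)) * ?P k l)")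
proof -
  have "(\<Sum>j\<in>UNIV. vfield (c $ j) (vfield (cnj_row (c $ j)) f) x) =
      (\<Sum>j\<in>UNIV. \<Sum>k\<in>UNIV. \<Sum>l\<in>UNIV. c $ j $ k * cnj (c $ j $ l) * ?P k l)"
    unfolding vfield_def[of "c $ _"] partial_vfield[OF f]
    by (simp add: vfield_def cnj_row_def sum_distrib_left mult.assoc partial_commute[OF f])
  also have "\<dots> = (\<Sum>k\<in>UNIV. \<Sum>j\<in>UNIV. \<Sum>l\<in>UNIV. c $ j $ k * cnj (c $ j $ l) * ?P k l)"
    by (rule sum.swap)
  also have "\<dots> = (\<Sum>k\<in>UNIV. \<Sum>l\<in>UNIV. \<Sum>j\<in>UNIV. c $ j $ k * cnj (c $ j $ l) * ?P k l)"
    by (intro sum.cong refl sum.swap)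
  also have "\<dots> = (\<Sum>k\<in>UNIV. \<Sum>l\<in>UNIV. ?H k l * ?P k l)" (is "_ = ?S")
    by (simp add: sum_distrib_right)
  finally have 1: "(\<Sum>j\<in>UNIV. vfield (c $ j) (vfield (cnj_row (c $ j)) f) x) = ?S" .
  have "?S = (\<Sum>l\<in>UNIV. \<Sum>k\<in>UNIV. ?H k l * ?P k l)" by (rule sum.swap)
  also have "\<dots> = (\<Sum>k\<in>UNIV. \<Sum>l\<in>UNIV. ?H l k * ?P k l)" by (simp add: partial_commute[OF f])
  finally have "2 * ?S = (\<Sum>k\<in>UNIV. \<Sum>l\<in>UNIV. (?H k l + ?H l k) * ?P k l)"
    by (simp add: sum.distrib distrib_right)
  moreover have "?H k l + ?H l k = 2 * of_real (Re (?H k l))" for k l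
  proof -
    have "?H l k = cnj (?H k l)" by (simp add: mult.commute)
    then show ?thesis using complex_add_cnj[of "?H k l"] by simp
  qed
  ultimately have "2 * ?S = 2 * (\<Sum>k\<in>UNIV. \<Sum>l\<in>UNIV. of_real (Re (?H k l)) * ?P k l)"
    by (simp only: sum_distrib_left mult.assoc)
  then show ?thesis using 1 by simp
qed

section \<open>The bump that is radial for the dual form, and its potential\<close>

lemma test_function_integrable:
  assumes "test_function f" shows "integrable lebesgue f"
proof -
  obtain r where r: "\<And>x. norm x \<ge> r \<Longrightarrow> f x = 0" using test_function_support[OF assms] by metis
  obtain B where B: "\<And>x. norm (f x) \<le> B" using test_function_bounded[OF assms] by metis
  have "integrable lebesgue (\<lambda>x. complex_of_real (indicator (cball 0 r) x) * f x)"
    by (rule integrable_bounded_mult[OF _ _ B])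
      (use assms lmeasurable_cball[of 0 r] in \<open>auto simp: fmeasurable_def intro!: integrable_of_real integrable_real_indicator
        test_function_compose_measurable[of _ "\<lambda>x. x"] ident_measurable_lebesgue\<close>)
  moreover have "complex_of_real (indicator (cball 0 r) x) * f x = f x" for x
    using r[of x] by (auto simp: indicator_def)
  ultimately show ?thesis by simp
qed

lemma partial_dilate:
  "f differentiable (at ((1/t) *\<^sub>R x)) \<Longrightarrow> partial k (\<lambda>x. f ((1/t) *\<^sub>R x)) x = (1/t) *\<^sub>R partial k f ((1/t) *\<^sub>R x)"
  using partial_affine[of f "1/t" x 0 k] by simp

text \<open>The right side is minus the divergence of \<open>x\<close> times \<rho>, which is also
  the derivative, at scale 1, of the dilates of \<rho> with respect to the scale. Let
  \<open>w = 1 - q\<close> with \<open>q\<close> the dual form, and \<Theta> the bump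
  \<open>exp (-1/w)\<close>. The gradient of \<open>w\<close> is \<open>-2 B x\<close>, so
  \<open>A\<close> maps the gradient of \<Theta> to \<open>-x\<close> times \<rho>, where \<rho> is
  twice the derivative of \<open>flat 1\<close> taken at \<open>w\<close>.\<close>

lemma radial_kernel_exists:
  fixes c :: "complex^'N::finite^'n::finite"
  assumes ell: "elliptic_system c"
  obtains \<rho> \<Theta> :: "real^'N \<Rightarrow> complex" where "test_function \<rho>" "test_function \<Theta>"
    "(\<integral>x. \<rho> x \<partial>lebesgue) \<noteq> 0"
    "\<And>x. (\<Sum>k\<in>UNIV. \<Sum>l\<in>UNIV. of_real (Re (\<Sum>j\<in>UNIV. c $ j $ k * cnj (c $ j $ l))) * partial k (partial l \<Theta>) x)
       = - (of_nat CARD('N) * \<rho> x + (\<Sum>k\<in>UNIV. of_real (x $ k) * partial k \<rho> x))"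
proof -
  define A where "A = ((\<chi> k l. Re (\<Sum>j\<in>UNIV. c $ j $ k * cnj (c $ j $ l))) :: real^'N^'N)"
  obtain B :: "real^'N^'N" where B: "A ** B = mat 1" "\<And>k l. B $ k $ l = B $ l $ k"
    "\<And>x. x \<noteq> 0 \<Longrightarrow> (B *v x) \<bullet> x > 0"
    using elliptic_real_inverse[OF ell, folded A_def] by blast
  define q where "q x = (B *v x) \<bullet> x" for x
  define w where "w x = 1 - q x" for x
  have q_complex: "complex_of_real (w x) = 1 - (\<Sum>k\<in>UNIV. (\<Sum>l\<in>UNIV. of_real (B $ k $ l) * of_real (x $ l)) * of_real (x $ k))" for x
    by (simp add: w_def q_def inner_vec_def matrix_vector_mult_def)
  have w_smooth: "smooth (\<lambda>x. complex_of_real (w x))"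
    unfolding q_complex by (intro smooth_diff smooth_const smooth_sum smooth_mult smooth_coord)
  have partial_w: "partial k (\<lambda>x. complex_of_real (w x)) x = of_real (- 2 * (B *v x) $ k)" for k x
  proof -
    have blB: "bounded_linear ((*v) B)" by (rule matrix_vector_mul_bounded_linear)
    have "(w has_derivative (\<lambda>h. - ((B *v x) \<bullet> h + (B *v h) \<bullet> x))) (at x)"
      unfolding w_def[abs_def] q_def
      by (auto intro!: derivative_eq_intros bounded_linear.has_derivative[OF blB])
    from bounded_linear.has_derivative[OF bounded_linear_of_real this]
    have "((\<lambda>x. complex_of_real (w x)) has_derivative (\<lambda>h. of_real (- ((B *v x) \<bullet> h + (B *v h) \<bullet> x)))) (at x)" .
    moreover have "(B *v x) \<bullet> axis k 1 = (B *v x) $ k" by (simp add: inner_axis)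
    moreover have "(B *v axis k 1) \<bullet> x = (B *v x) $ k"
      unfolding matrix_vector_mult_basis by (simp add: inner_vec_def column_def matrix_vector_mult_def B(2)[of k])
    ultimately show ?thesis using partial_eqI by fastforce
  qed
  \<comment> \<open>The minimum of \<open>q\<close> on the unit sphere is positive by compactness;
    it confines the ellipsoid \<open>q < 1\<close>, which carries both bumps, to a ball.\<close>
  obtain m where m: "m > 0" "\<And>x. q x \<ge> m * norm x ^ 2"
  proof -
    have cont: "continuous_on (sphere 0 1) q" unfolding q_def
      by (intro continuous_intros)
    have ne: "sphere (0 :: real^'N) 1 \<noteq> {}" by simp
    obtain x0 where x0: "x0 \<in> sphere 0 1" "\<And>y. y \<in> sphere 0 1 \<Longrightarrow> q x0 \<le> q y"
      using continuous_attains_inf[OF compact_sphere ne cont] by blast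
    have pos: "q x0 > 0" using x0(1) B(3)[of x0] unfolding q_def by force
    have "q x \<ge> q x0 * norm x ^ 2" for x
    proof (cases "x = 0")
      case False
      let ?y = "(1 / norm x) *\<^sub>R x"
      have "q x0 \<le> q ?y" using x0(2)[of ?y] False by simp
      also have "q ?y = q x / norm x ^ 2"
        by (simp add: q_def matrix_vector_mult_scaleR power2_eq_square)
      finally show ?thesis using False by (simp add: field_simps)
    qed (simp add: q_def)
    then show ?thesis using that pos by blast
  qed
  define R where "R = sqrt (1 / m)"
  have w_neg: "w x \<le> 0" if "norm x > R" for x
  proof -
    have "norm x ^ 2 \<ge> R ^ 2" using that m by (intro power_mono) (auto simp: R_def)
    then have "m * norm x ^ 2 \<ge> m * (1 / m)" using m by (intro mult_left_mono) (auto simp: R_def)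
    then show ?thesis using m(2)[of x] m(1) by (simp add: w_def)
  qed
  define e' where "e' = flat (flat_deriv 1)"
  define \<Theta> where "\<Theta> x = complex_of_real (flat 1 (w x))" for x
  define \<rho> where "\<rho> x = complex_of_real (2 * e' (w x))" for x
  have \<Theta>: "test_function \<Theta>"
  proof (rule test_functionI[of _ R])
    show "smooth \<Theta>" unfolding \<Theta>_def[abs_def] by (rule smooth_flat_comp[OF w_smooth])
    show "\<Theta> x = 0" if "norm x > R" for x using w_neg[OF that] by (simp add: \<Theta>_def flat_def)
  qed
  have s': "smooth (\<lambda>x. complex_of_real (e' (w x)))" unfolding e'_def by (rule smooth_flat_comp[OF w_smooth])
  have \<rho>: "test_function \<rho>"
  proof (rule test_functionI[of _ R])
    show "smooth \<rho>" using smooth_cmult[OF s', of 2] by (simp add: \<rho>_def[abs_def])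
    show "\<rho> x = 0" if "norm x > R" for x using w_neg[OF that] by (simp add: \<rho>_def e'_def flat_def)
  qed
  have e'_nonneg: "e' u \<ge> 0" and e'_pos: "u > 0 \<Longrightarrow> e' u > 0" for u
    by (auto simp: e'_def flat_def flat_deriv_def)
  have grad: "(\<Sum>l\<in>UNIV. of_real (A $ k $ l) * partial l \<Theta> x) = - of_real (x $ k) * \<rho> x" for k x
  proof -
    have "partial l \<Theta> x = of_real (- 2 * e' (w x) * (B *v x) $ l)" for l
      unfolding \<Theta>_def[abs_def] partial_flat_comp[OF smooth_differentiable[OF w_smooth]] partial_w e'_def by simp
    then have "(\<Sum>l\<in>UNIV. of_real (A $ k $ l) * partial l \<Theta> x) = of_real (- 2 * e' (w x) * (\<Sum>l\<in>UNIV. A $ k $ l * (B *v x) $ l))"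
      by (simp add: sum_distrib_left mult_ac)
    also have "(\<Sum>l\<in>UNIV. A $ k $ l * (B *v x) $ l) = (A *v (B *v x)) $ k" by (simp add: matrix_vector_mult_def)
    also have "\<dots> = x $ k" by (simp add: matrix_vector_mul_assoc B(1))
    finally show ?thesis by (simp add: \<rho>_def)
  qed
  have lap: "(\<Sum>k\<in>UNIV. \<Sum>l\<in>UNIV. of_real (A $ k $ l) * partial k (partial l \<Theta>) x)
       = - (of_nat CARD('N) * \<rho> x + (\<Sum>k\<in>UNIV. of_real (x $ k) * partial k \<rho> x))" for x
  proof -
    have "(\<Sum>l\<in>UNIV. of_real (A $ k $ l) * partial k (partial l \<Theta>) x) = - (\<rho> x + of_real (x $ k) * partial k \<rho> x)" for k
    proof -
      have "(\<Sum>l\<in>UNIV. of_real (A $ k $ l) * partial k (partial l \<Theta>) x) = partial k (\<lambda>x. \<Sum>l\<in>UNIV. of_real (A $ k $ l) * partial l \<Theta> x) x"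
        by (subst partial_sum) (auto intro: smooth_cmult
            simp: partial_cmult smooth_differentiable smooth_partial test_function_smooth[OF \<Theta>])
      also have "\<dots> = partial k (\<lambda>x. (-1) * (of_real (x $ k) * \<rho> x)) x" unfolding grad by simp
      also have "\<dots> = (-1) * (1 * \<rho> x + of_real (x $ k) * partial k \<rho> x)"
        by (subst partial_cmult, intro differentiable_mult coord_differentiable test_function_differentiable[OF \<rho>],
            subst partial_mult) (auto simp: coord_differentiable test_function_differentiable[OF \<rho>] partial_coord)
      finally show ?thesis by simp
    qed
    then show ?thesis by (simp add: sum.distrib sum_negf sum_subtractf)
  qed
  \<comment> \<open>\<rho> is continuous, nonnegative and positive at the origin. If its integral
    were 0, the open set where it is nonzero would be a null set containing the origin.\<close>
  have "(\<integral>x. \<rho> x \<partial>lebesgue) \<noteq> 0"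
  proof
    assume "(\<integral>x. \<rho> x \<partial>lebesgue) = 0"
    moreover have "(\<integral>x. \<rho> x \<partial>lebesgue) = of_real (\<integral>x. 2 * e' (w x) \<partial>lebesgue)"
      unfolding \<rho>_def by (rule integral_complex_of_real)
    ultimately have 0: "(\<integral>x. 2 * e' (w x) \<partial>lebesgue) = 0" by simp
    have int: "integrable lebesgue (\<lambda>x. 2 * e' (w x))"
      using integrable_Re[OF test_function_integrable[OF \<rho>]] by (simp add: \<rho>_def)
    have "AE x in lebesgue. 2 * e' (w x) = 0"
      using integral_nonneg_eq_0_iff_AE[OF int] 0 e'_nonneg by simp
    then have "AE x in lebesgue. \<rho> x = 0" by (simp add: \<rho>_def)
    moreover have op: "open {x. \<rho> x \<noteq> 0}"
      by (intro open_Collect_neq continuous_intros smooth_continuous_on test_function_smooth \<rho>)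
    then have "{x. \<rho> x \<noteq> 0} \<in> sets lebesgue" by (simp add: sets_completionI_sets)
    ultimately have "negligible {x. \<rho> x \<noteq> 0}"
      by (simp add: negligible_iff_null_sets AE_iff_null_sets)
    moreover note op
    moreover have "0 \<in> {x. \<rho> x \<noteq> 0}" using e'_pos[of "w 0"] by (auto simp: \<rho>_def w_def q_def)
    ultimately show False using open_not_negligible by blast
  qed
  then show ?thesis using that \<rho> \<Theta> lap unfolding A_def by simp
qed

text \<open>Integrating the scale derivative of the dilates of \<rho> from scale 1 to scale 2 gives
  the right side. Accordingly \<Psi> is minus the integral of \<open>t^(1-N)\<close> times
  \<open>\<Theta> (x/t)\<close> over \<open>1 <= t <= 2\<close>: two derivatives in \<open>x\<close>
  bring out \<open>t^(-2)\<close> and leave the weight \<open>t^(-N-1)\<close> of the scale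
  derivative.\<close>

lemma kernel_exists:
  fixes c :: "complex^'N::finite^'n::finite"
  assumes ell: "elliptic_system c"
  obtains \<rho> \<Psi> :: "real^'N \<Rightarrow> complex" where "test_function \<rho>" "test_function \<Psi>"
    "(\<integral>x. \<rho> x \<partial>lebesgue) \<noteq> 0"
    "\<And>x. (\<Sum>j\<in>UNIV. vfield (c $ j) (vfield (cnj_row (c $ j)) \<Psi>) x) = \<rho> x - dilate \<rho> 2 x"
proof -
  let ?N = "CARD('N)"
  let ?A = "\<lambda>k l. Re (\<Sum>j\<in>UNIV. c $ j $ k * cnj (c $ j $ l))"
  obtain \<rho> \<Theta> :: "real^'N \<Rightarrow> complex" where \<rho>: "test_function \<rho>" and \<Theta>: "test_function \<Theta>"
    and int: "(\<integral>x. \<rho> x \<partial>lebesgue) \<noteq> 0"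
    and lap: "\<And>x. (\<Sum>k\<in>UNIV. \<Sum>l\<in>UNIV. of_real (?A k l) * partial k (partial l \<Theta>) x)
       = - (of_nat ?N * \<rho> x + (\<Sum>k\<in>UNIV. of_real (x $ k) * partial k \<rho> x))"
    by (rule radial_kernel_exists[OF ell]) blast
  \<comment> \<open>\<open>a\<close> is \<open>1/t\<close>, cut off outside the interval to meet the
    bound 1. The index of \<open>v\<close> counts derivatives, each of which contributes one factor
    \<open>a\<close>.\<close>
  define a where "a t = (if t \<in> {1..2} then 1 / t else 0)" for t :: real
  define v where "v j t = - complex_of_real (indicator {1..2} t *\<^sub>R (t / t ^ ?N * a t ^ j))" for j t
  have a: "\<bar>a t\<bar> \<le> 1" for t by (auto simp: a_def)
  have [measurable]: "a \<in> borel_measurable lborel" unfolding a_def[abs_def] by measurable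
  have v: "integrable lborel (v j)" for j
  proof -
    have "continuous_on {1..2} (\<lambda>t. t / t ^ ?N * (1 / t) ^ j :: real)" by (intro continuous_intros) auto
    then have "integrable lborel (\<lambda>t. indicator {1..2} t *\<^sub>R (t / t ^ ?N * (1 / t) ^ j :: real))"
      by (intro borel_integrable_compact) auto
    then have "integrable lborel (\<lambda>t. - complex_of_real (indicator {1..2} t *\<^sub>R (t / t ^ ?N * (1 / t) ^ j)))"
      by (intro Bochner_Integration.integrable_minus integrable_of_real)
    moreover have "v j = (\<lambda>t. - complex_of_real (indicator {1..2} t *\<^sub>R (t / t ^ ?N * (1 / t) ^ j)))"
      by (auto simp: v_def fun_eq_iff a_def indicator_def)
    ultimately show ?thesis by simp
  qed
  have va: "v j t * of_real (a t) = v (Suc j) t" for j t by (simp add: v_def mult_ac)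
  define \<Psi> where "\<Psi> x = (\<integral>t. v 0 t * \<Theta> (a t *\<^sub>R x + 0) \<partial>lborel)" for x
  obtain r where r: "r > 0" "\<And>x. norm x \<ge> r \<Longrightarrow> \<Theta> x = 0" using test_function_support[OF \<Theta>] by metis
  have \<Psi>: "test_function \<Psi>"
  proof (rule test_functionI[of _ "2 * r"])
    show "smooth \<Psi>" unfolding \<Psi>_def[abs_def] by (rule smooth_param_integral[OF \<Theta> v _ _ a]) auto
    fix x :: "real^'N" assume x: "norm x > 2 * r"
    have "v 0 t * \<Theta> (a t *\<^sub>R x + 0) = 0" for t
    proof (cases "t \<in> {1..2}")
      case True
      have "r * t \<le> r * 2" using True r by (intro mult_left_mono) auto
      then have "norm ((1/t) *\<^sub>R x) \<ge> r" using True x by (simp add: field_simps)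
      then show ?thesis using r(2) True by (simp add: a_def)
    qed (simp add: v_def)
    then show "\<Psi> x = 0" unfolding \<Psi>_def by (simp only: Bochner_Integration.integral_zero)
  qed
  have p1: "partial l \<Psi> = (\<lambda>x. \<integral>t. v 1 t * partial l \<Theta> (a t *\<^sub>R x + 0) \<partial>lborel)" for l
  proof
    fix x
    have "partial l \<Psi> x = (\<integral>t. (v 0 t * of_real (a t)) * partial l \<Theta> (a t *\<^sub>R x + 0) \<partial>lborel)"
      unfolding \<Psi>_def[abs_def] by (rule partial_param_integral[OF \<Theta> v _ _ a]) auto
    then show "partial l \<Psi> x = (\<integral>t. v 1 t * partial l \<Theta> (a t *\<^sub>R x + 0) \<partial>lborel)"
      by (simp only: va One_nat_def)
  qed
  have p2: "partial k (partial l \<Psi>) x = (\<integral>t. v 2 t * partial k (partial l \<Theta>) (a t *\<^sub>R x + 0) \<partial>lborel)" for k l x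
  proof -
    have "partial k (partial l \<Psi>) x = (\<integral>t. (v 1 t * of_real (a t)) * partial k (partial l \<Theta>) (a t *\<^sub>R x + 0) \<partial>lborel)"
      unfolding p1 by (rule partial_param_integral[OF test_function_partial[OF \<Theta>] v _ _ a]) auto
    then show ?thesis by (simp only: va numeral_2_eq_2 One_nat_def)
  qed
  have i2: "integrable lborel (\<lambda>t. v 2 t * partial k (partial l \<Theta>) (a t *\<^sub>R x + 0))" for k l x
  proof -
    have T: "test_function (partial k (partial l \<Theta>))" by (intro test_function_partial \<Theta>)
    obtain B where "\<And>x. norm (partial k (partial l \<Theta>) x) \<le> B" using test_function_bounded[OF T] by metis
    then show ?thesis using T by (intro integrable_bounded_mult[OF v, where B=B]) auto
  qed
  have "(\<Sum>j\<in>UNIV. vfield (c $ j) (vfield (cnj_row (c $ j)) \<Psi>) x) = \<rho> x - dilate \<rho> 2 x" for x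
  proof -
    have "(\<Sum>j\<in>UNIV. vfield (c $ j) (vfield (cnj_row (c $ j)) \<Psi>) x)
        = (\<Sum>k\<in>UNIV. \<Sum>l\<in>UNIV. of_real (?A k l) * partial k (partial l \<Psi>) x)"
      by (rule vfield_laplacian[OF test_function_smooth[OF \<Psi>]])
    also have "\<dots> = (\<integral>t. (\<Sum>k\<in>UNIV. \<Sum>l\<in>UNIV. of_real (?A k l) * (v 2 t * partial k (partial l \<Theta>) (a t *\<^sub>R x + 0))) \<partial>lborel)"
      unfolding p2 using i2 by (simp only: Bochner_Integration.integral_sum integral_mult_right_zero
          Bochner_Integration.integrable_sum integrable_mult_right)
    also have "\<dots> = (\<integral>t. indicator {1..2} t *\<^sub>R ((1 / t ^ (?N + 1)) *\<^sub>R (of_nat ?N * \<rho> ((1/t) *\<^sub>R x) + (\<Sum>k\<in>UNIV. of_real (((1/t) *\<^sub>R x) $ k) * partial k \<rho> ((1/t) *\<^sub>R x)))) \<partial>lborel)"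
    proof (rule Bochner_Integration.integral_cong[OF refl])
      fix t :: real
      have "(\<Sum>k\<in>UNIV. \<Sum>l\<in>UNIV. of_real (?A k l) * (v 2 t * partial k (partial l \<Theta>) (a t *\<^sub>R x + 0)))
          = v 2 t * (\<Sum>k\<in>UNIV. \<Sum>l\<in>UNIV. of_real (?A k l) * partial k (partial l \<Theta>) (a t *\<^sub>R x))"
        by (simp add: sum_distrib_left mult_ac)
      also have "\<dots> = v 2 t * (- (of_nat ?N * \<rho> (a t *\<^sub>R x) + (\<Sum>k\<in>UNIV. of_real ((a t *\<^sub>R x) $ k) * partial k \<rho> (a t *\<^sub>R x))))"
        unfolding lap ..
      also have "\<dots> = indicator {1..2} t *\<^sub>R ((1 / t ^ (?N + 1)) *\<^sub>R (of_nat ?N * \<rho> ((1/t) *\<^sub>R x) + (\<Sum>k\<in>UNIV. of_real (((1/t) *\<^sub>R x) $ k) * partial k \<rho> ((1/t) *\<^sub>R x))))"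
      proof (cases "t \<in> {1..2}")
        case True
        then have "a t = 1 / t" "v 2 t = - complex_of_real (1 / t ^ (?N + 1))"
          by (auto simp: a_def v_def power2_eq_square field_simps)
        then show ?thesis using True
          by (simp only: minus_mult_minus indicator_simps scaleR_one scaleR_conv_of_real[where 'a=complex] of_real_1 mult_1)
      qed (simp add: v_def)
      finally show "(\<Sum>k\<in>UNIV. \<Sum>l\<in>UNIV. of_real (?A k l) * (v 2 t * partial k (partial l \<Theta>) (a t *\<^sub>R x + 0))) = \<dots>" .
    qed
    \<comment> \<open>The fundamental theorem of calculus in the scale; minus the dilate of \<rho>
      at scale \<open>t\<close> is the antiderivative.\<close>
    also have "\<dots> = - ((1 / 2 ^ ?N) *\<^sub>R \<rho> ((1/2) *\<^sub>R x)) - - ((1 / 1 ^ ?N) *\<^sub>R \<rho> ((1/1) *\<^sub>R x))"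
    proof (rule integral_FTC_Icc)
      fix t :: real assume t: "1 \<le> t" "t \<le> 2"
      have d1: "((\<lambda>t. (1/t) *\<^sub>R x) has_derivative (\<lambda>h. (- h / t^2) *\<^sub>R x)) (at t within {1..2})"
        using t by (auto intro!: derivative_eq_intros simp: power2_eq_square)
      have d2: "((\<lambda>t. \<rho> ((1/t) *\<^sub>R x)) has_derivative (\<lambda>h. \<Sum>k\<in>UNIV. ((- h / t^2) *\<^sub>R x) $ k *\<^sub>R partial k \<rho> ((1/t) *\<^sub>R x))) (at t within {1..2})"
        using has_derivative_compose[OF d1 smooth_has_derivative[OF test_function_smooth[OF \<rho>]]] .
      have d2': "((\<lambda>t. \<rho> ((1/t) *\<^sub>R x)) has_vector_derivative (- 1 / t) *\<^sub>R (\<Sum>k\<in>UNIV. of_real (((1/t) *\<^sub>R x) $ k) * partial k \<rho> ((1/t) *\<^sub>R x))) (at t within {1..2})"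
        unfolding has_vector_derivative_def
      proof (rule has_derivative_eq_rhs[OF d2], rule ext)
        fix h :: real
        have "((- h / t^2) *\<^sub>R x) $ k *\<^sub>R z = h *\<^sub>R ((- 1 / t) *\<^sub>R (of_real (((1/t) *\<^sub>R x) $ k) * z))" for k and z :: complex
          unfolding scaleR_conv_of_real[symmetric, where 'a=complex] scaleR_scaleR vector_scaleR_component
          by (simp add: power2_eq_square)
        then show "(\<Sum>k\<in>UNIV. ((- h / t^2) *\<^sub>R x) $ k *\<^sub>R partial k \<rho> ((1/t) *\<^sub>R x)) =
            h *\<^sub>R ((- 1 / t) *\<^sub>R (\<Sum>k\<in>UNIV. of_real (((1/t) *\<^sub>R x) $ k) * partial k \<rho> ((1/t) *\<^sub>R x)))"
          by (simp only: scaleR_sum_right)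
      qed
      have d3: "((\<lambda>t. 1 / t ^ ?N) has_real_derivative (- of_nat ?N / t ^ (?N + 1))) (at t within {1..2})"
      proof -
        have "((\<lambda>t. inverse t ^ ?N) has_real_derivative of_nat ?N * inverse t ^ (?N - Suc 0) * - (inverse t * inverse t)) (at t within {1..2})"
          using t by (auto intro!: derivative_eq_intros)
        moreover have "inverse t ^ (?N - Suc 0) * (inverse t * inverse t) = inverse t ^ (?N + 1)"
          by (subst mult.assoc[symmetric], subst power_Suc2[symmetric]) (simp add: card_gt_0_iff)
        then have "of_nat ?N * inverse t ^ (?N - Suc 0) * - (inverse t * inverse t) = - of_nat ?N * inverse t ^ (?N + 1)"
          by (simp only: mult_minus_right mult_minus_left mult.assoc)
        then have "of_nat ?N * inverse t ^ (?N - Suc 0) * - (inverse t * inverse t) = - of_nat ?N / t ^ (?N + 1)"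
          by (simp only: power_inverse divide_inverse)
        moreover have "(\<lambda>t::real. inverse t ^ ?N) = (\<lambda>t. 1 / t ^ ?N)"
          by (simp add: inverse_eq_divide power_divide)
        ultimately show ?thesis by simp
      qed
      have "((\<lambda>t. - ((1 / t ^ ?N) *\<^sub>R \<rho> ((1/t) *\<^sub>R x))) has_vector_derivative
          - ((1 / t ^ ?N) *\<^sub>R ((- 1 / t) *\<^sub>R (\<Sum>k\<in>UNIV. of_real (((1/t) *\<^sub>R x) $ k) * partial k \<rho> ((1/t) *\<^sub>R x)))
             + (- of_nat ?N / t ^ (?N + 1)) *\<^sub>R \<rho> ((1/t) *\<^sub>R x))) (at t within {1..2})"
        by (intro has_vector_derivative_minus has_vector_derivative_scaleR d2' d3)
      moreover have "- ((1 / t ^ ?N) *\<^sub>R ((- 1 / t) *\<^sub>R S) + (- of_nat ?N / t ^ (?N + 1)) *\<^sub>R z)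
         = (1 / t ^ (?N + 1)) *\<^sub>R (of_nat ?N * z + S)" for S z :: complex
        by (simp add: scaleR_conv_of_real algebra_simps add_divide_distrib)
      ultimately show "((\<lambda>t. - ((1 / t ^ ?N) *\<^sub>R \<rho> ((1/t) *\<^sub>R x))) has_vector_derivative
          (1 / t ^ (?N + 1)) *\<^sub>R (of_nat ?N * \<rho> ((1/t) *\<^sub>R x) + (\<Sum>k\<in>UNIV. of_real (((1/t) *\<^sub>R x) $ k) * partial k \<rho> ((1/t) *\<^sub>R x)))) (at t within {1..2})"
        by simp
    next
      show "continuous_on {1..2} (\<lambda>t. (1 / t ^ (?N + 1)) *\<^sub>R (of_nat ?N * \<rho> ((1/t) *\<^sub>R x) + (\<Sum>k\<in>UNIV. of_real (((1/t) *\<^sub>R x) $ k) * partial k \<rho> ((1/t) *\<^sub>R x))))"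
        by (intro continuous_intros continuous_on_compose2[OF smooth_continuous_on[of _ UNIV]]
            test_function_smooth test_function_partial \<rho>) auto
    qed auto
    finally show ?thesis by (simp add: dilate_def)
  qed
  then show ?thesis using that \<rho> \<Psi> int by blast
qed

text \<open>This is the conjugate field applied to \<open>s^2\<close> times the dilate of \<Psi>:
  the differentiation uses up one power of \<open>s\<close>. Applying one more field leaves a plain
  dilate at scale \<open>s\<close>.\<close>

definition scaled_kernel :: "complex^'N::finite \<Rightarrow> (real^'N \<Rightarrow> complex) \<Rightarrow> real \<Rightarrow> real^'N \<Rightarrow> complex" where
  "scaled_kernel a \<Psi> s x = s *\<^sub>R dilate (vfield (cnj_row a) \<Psi>) s x"

lemma test_function_scaled_kernel:
  "test_function \<Psi> \<Longrightarrow> s > 0 \<Longrightarrow> test_function (scaled_kernel a \<Psi> s)"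
  unfolding scaled_kernel_def[abs_def]
  by (intro test_function_scaleR test_function_dilate test_function_vfield)

lemma vfield_scaled_kernel:
  assumes "test_function (\<Psi> :: real^'N::finite \<Rightarrow> complex)" "s > 0"
  shows "vfield b (scaled_kernel a \<Psi> s) x = (1 / s ^ CARD('N)) *\<^sub>R vfield b (vfield (cnj_row a) \<Psi>) ((1/s) *\<^sub>R x)"
proof -
  let ?K = "vfield (cnj_row a) \<Psi>"
  have K: "test_function ?K" by (intro test_function_vfield assms)
  have "partial k (scaled_kernel a \<Psi> s) x = (1 / s ^ CARD('N)) *\<^sub>R partial k ?K ((1/s) *\<^sub>R x)" for k
  proof -
    have "partial k (\<lambda>x. complex_of_real (s / s ^ CARD('N)) * ?K ((1/s) *\<^sub>R x)) x
       = complex_of_real (s / s ^ CARD('N)) * ((1/s) *\<^sub>R partial k ?K ((1/s) *\<^sub>R x))"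
      using test_function_differentiable[OF test_function_affine[OF K, of "1/s" 0]] assms(2)
      by (subst partial_cmult) (auto simp: partial_dilate[OF test_function_differentiable[OF K]])
    then show ?thesis using assms(2)
      by (simp add: scaled_kernel_def[abs_def] dilate_def scaleR_conv_of_real)
  qed
  then show ?thesis unfolding vfield_def[of b] by (simp add: scaleR_sum_right)
qed

text \<open>\<open>L_i\<close> is moved onto the kernel, the curl identity exchanges
  \<open>G_j\<close> and \<open>L_i\<close> for \<open>G_i\<close> and \<open>L_j\<close>, and the
  sum over \<open>j\<close> becomes the rescaled kernel equation. So this sum of convolutions has
  the same derivatives along the system as the difference of the mollifications of \<phi> at the
  scales \<open>s\<close> and \<open>2 * s\<close>.\<close>

lemma vfield_telescope:
  fixes c :: "complex^'N::finite^'n::finite"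
  assumes G: "has_distr_gradient c \<phi> G" and loc: "\<And>j. locally_integrable (\<lambda>x. G x $ j)"
    and \<Psi>: "test_function \<Psi>" and \<rho>: "test_function \<rho>"
    and eq: "\<And>x. (\<Sum>j\<in>UNIV. vfield (c $ j) (vfield (cnj_row (c $ j)) \<Psi>) x) = \<rho> x - dilate \<rho> 2 x"
    and s: "s > 0"
  shows "vfield (c $ i) (\<lambda>y. \<Sum>j\<in>UNIV. conv (\<lambda>x. G x $ j) (scaled_kernel (c $ j) \<Psi> s) y) y =
    conv (\<lambda>x. G x $ i) (dilate \<rho> s) y - conv (\<lambda>x. G x $ i) (dilate \<rho> (2 * s)) y"
proof -
  let ?K = "\<lambda>j. scaled_kernel (c $ j) \<Psi> s"
  have K: "test_function (?K j)" for j by (rule test_function_scaled_kernel[OF \<Psi> s])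
  have "vfield (c $ i) (\<lambda>y. \<Sum>j\<in>UNIV. conv (\<lambda>x. G x $ j) (?K j) y) y
      = (\<Sum>j\<in>UNIV. vfield (c $ i) (conv (\<lambda>x. G x $ j) (?K j)) y)"
  proof -
    have "partial k (\<lambda>y. \<Sum>j\<in>UNIV. conv (\<lambda>x. G x $ j) (?K j) y) y = (\<Sum>j\<in>UNIV. partial k (conv (\<lambda>x. G x $ j) (?K j)) y)" for k
      by (rule partial_sum) (rule smooth_conv[OF loc K])
    then show ?thesis unfolding vfield_def sum_distrib_left by (simp only: sum_distrib_left) (rule sum.swap)
  qed
  also have "\<dots> = (\<Sum>j\<in>UNIV. conv (\<lambda>x. G x $ i) (vfield (c $ j) (?K j)) y)"
    unfolding vfield_conv[OF loc K] curl_identity[OF G K] ..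
  also have "\<dots> = conv (\<lambda>x. G x $ i) (\<lambda>x. \<Sum>j\<in>UNIV. vfield (c $ j) (?K j) x) y"
    by (rule conv_sum_right[symmetric]) (auto intro: loc test_function_vfield K)
  also have "(\<lambda>x. \<Sum>j\<in>UNIV. vfield (c $ j) (?K j) x) = (\<lambda>x. dilate \<rho> s x - dilate \<rho> (2 * s) x)"
  proof
    fix x
    have "(\<Sum>j\<in>UNIV. vfield (c $ j) (?K j) x) = (1 / s ^ CARD('N)) *\<^sub>R (\<rho> ((1/s) *\<^sub>R x) - dilate \<rho> 2 ((1/s) *\<^sub>R x))"
      unfolding vfield_scaled_kernel[OF \<Psi> s] by (simp flip: scaleR_sum_right eq)
    then show "(\<Sum>j\<in>UNIV. vfield (c $ j) (?K j) x) = dilate \<rho> s x - dilate \<rho> (2 * s) x"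
      by (simp add: dilate_def scaleR_diff_right power_mult_distrib mult.commute)
  qed
  also have "conv (\<lambda>x. G x $ i) (\<lambda>x. dilate \<rho> s x - dilate \<rho> (2 * s) x) y
     = conv (\<lambda>x. G x $ i) (dilate \<rho> s) y - conv (\<lambda>x. G x $ i) (dilate \<rho> (2 * s)) y"
    using s by (intro conv_diff_right loc test_function_dilate \<rho>) auto
  finally show ?thesis .
qed

section \<open>The Hardy--Littlewood maximal function\<close>

text \<open>Tonelli's theorem is applied below directly to the completed measure.\<close>

lemma sigma_finite_lebesgue: "sigma_finite_measure (lebesgue :: 'a::euclidean_space measure)"
proof
  obtain A :: "'a set set" where A: "countable A" "A \<subseteq> sets lborel" "\<Union>A = space lborel" "\<forall>a\<in>A. emeasure lborel a \<noteq> \<infinity>"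
    using lborel.sigma_finite_countable by metis
  then have "emeasure lebesgue a \<noteq> \<infinity>" if "a \<in> A" for a
    using that by (auto simp: emeasure_completion main_part_sets)
  then show "\<exists>A::'a set set. countable A \<and> A \<subseteq> sets lebesgue \<and> \<Union>A = space lebesgue \<and> (\<forall>a\<in>A. emeasure lebesgue a \<noteq> \<infinity>)"
    using A by (intro exI[of _ A]) (auto intro: sets_completionI_sets)
qed

interpretation lebesgue: sigma_finite_measure "lebesgue :: 'a::euclidean_space measure"
  by (rule sigma_finite_lebesgue)

text \<open>The centred Hardy-Littlewood maximal function, with means normalised by
  \<open>r^N\<close>; the volume of the unit ball is left to the constants.\<close>

definition maximal :: "(real^'N::finite \<Rightarrow> ennreal) \<Rightarrow> real^'N \<Rightarrow> ennreal" where
  "maximal f x = (SUP r\<in>{0<..}. (\<integral>\<^sup>+z. f z * indicator (ball x r) z \<partial>lebesgue) / ennreal (r ^ CARD('N)))"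

lemma ball_sets_lebesgue [simp, measurable]: "ball x r \<in> sets lebesgue"
  using borel_open[OF open_ball] by (auto intro: sets_completionI_sets)

lemma emeasure_lebesgue_ball:
  "r \<ge> 0 \<Longrightarrow> emeasure lebesgue (ball (x::real^'N::finite) r) = ennreal (unit_ball_vol (real CARD('N)) * r ^ CARD('N))"
  using emeasure_ball[of r x] by simp

lemma maximal_upper:
  fixes x :: "real^'N::finite"
  assumes "r > 0"
  shows "(\<integral>\<^sup>+z. f z * indicator (ball x r) z \<partial>lebesgue) \<le> ennreal (r ^ CARD('N)) * maximal f x"
proof -
  have "(\<integral>\<^sup>+z. f z * indicator (ball x r) z \<partial>lebesgue) / ennreal (r ^ CARD('N)) \<le> maximal f x"
    unfolding maximal_def using assms by (intro SUP_upper) auto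
  then have "ennreal (r ^ CARD('N)) * ((\<integral>\<^sup>+z. f z * indicator (ball x r) z \<partial>lebesgue) / ennreal (r ^ CARD('N)))
      \<le> ennreal (r ^ CARD('N)) * maximal f x" by (rule mult_left_mono) simp
  moreover have "ennreal (r ^ CARD('N)) * (I / ennreal (r ^ CARD('N))) = I" for I
    using assms by (subst ennreal_times_divide) (auto simp: ennreal_mult_divide_eq mult.commute[of _ I])
  ultimately show ?thesis by simp
qed

lemma maximal_greaterE:
  fixes x :: "real^'N::finite"
  assumes "ennreal l < maximal f x" "l \<ge> 0"
  obtains r where "r > 0" "ennreal (l * r ^ CARD('N)) < (\<integral>\<^sup>+z. f z * indicator (ball x r) z \<partial>lebesgue)"
proof -
  obtain r where r: "r > 0" "ennreal l < (\<integral>\<^sup>+z. f z * indicator (ball x r) z \<partial>lebesgue) / ennreal (r ^ CARD('N))"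
    (is "_ < ?I / _")
    using assms(1) unfolding maximal_def less_SUP_iff by auto
  have "ennreal (l * r ^ CARD('N)) < ?I"
  proof (rule ccontr)
    assume "\<not> ennreal (l * r ^ CARD('N)) < ?I"
    then have "?I / ennreal (r ^ CARD('N)) \<le> ennreal (l * r ^ CARD('N)) / ennreal (r ^ CARD('N))"
      by (intro divide_right_mono_ennreal) simp
    also have "\<dots> = ennreal l" using r(1) assms(2) by (simp add: divide_ennreal)
    finally show False using r(2) by simp
  qed
  then show ?thesis using that r(1) by blast
qed

lemma maximal_greaterI:
  fixes x :: "real^'N::finite"
  assumes "r > 0" "l \<ge> 0" "ennreal (l * r ^ CARD('N)) < (\<integral>\<^sup>+z. f z * indicator (ball x r) z \<partial>lebesgue)"
  shows "ennreal l < maximal f x"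
proof (rule ccontr)
  assume "\<not> ennreal l < maximal f x"
  then have "ennreal (r ^ CARD('N)) * maximal f x \<le> ennreal (r ^ CARD('N)) * ennreal l"
    by (intro mult_left_mono) auto
  also have "\<dots> = ennreal (l * r ^ CARD('N))" using assms by (simp add: ennreal_mult mult.commute)
  finally show False using maximal_upper[OF assms(1), of f x] assms(3) by (meson leD order_trans)
qed

text \<open>A strict inequality for the ball of radius \<open>r\<close> about \<open>x\<close>
  survives a slight increase of the radius to \<open>r + d\<close>, and the ball of that radius
  about any \<open>y\<close> within \<open>d\<close> of \<open>x\<close> contains the original one.
  Borel measurability of the maximal function follows.\<close>

lemma open_maximal_superlevel:
  fixes f :: "real^'N::finite \<Rightarrow> ennreal"
  assumes "l \<ge> 0"
  shows "open {x. ennreal l < maximal f x}"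
  unfolding open_contains_ball
proof
  fix x assume "x \<in> {x. ennreal l < maximal f x}"
  then obtain r where r: "r > 0" "ennreal (l * r ^ CARD('N)) < (\<integral>\<^sup>+z. f z * indicator (ball x r) z \<partial>lebesgue)"
    (is "_ < ?I") using maximal_greaterE assms by blast
  have "((\<lambda>d. ennreal (l * (r + d) ^ CARD('N))) \<longlongrightarrow> ennreal (l * (r + 0) ^ CARD('N))) (at_right 0)"
    by (intro tendsto_intros)
  then have "eventually (\<lambda>d. ennreal (l * (r + d) ^ CARD('N)) < ?I) (at_right 0)"
    using r(2) by (intro order_tendstoD) auto
  then obtain b where b: "b > 0" "\<And>d. 0 < d \<Longrightarrow> d < b \<Longrightarrow> ennreal (l * (r + d) ^ CARD('N)) < ?I"
    unfolding eventually_at_right_field by auto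
  define d where "d = b / 2"
  have d: "d > 0" "ennreal (l * (r + d) ^ CARD('N)) < ?I" using b by (auto simp: d_def)
  have "ball x d \<subseteq> {x. ennreal l < maximal f x}"
  proof
    fix y assume "y \<in> ball x d"
    then have sub: "ball x r \<subseteq> ball y (r + d)"
      by (auto simp: dist_commute) (metis add.commute add_strict_mono dist_commute dist_triangle_lt)
    have "?I \<le> (\<integral>\<^sup>+z. f z * indicator (ball y (r + d)) z \<partial>lebesgue)"
      by (intro nn_integral_mono mult_left_mono) (use sub in \<open>auto split: split_indicator\<close>)
    then have "ennreal (l * (r + d) ^ CARD('N)) < (\<integral>\<^sup>+z. f z * indicator (ball y (r + d)) z \<partial>lebesgue)"
      using d(2) by simp
    then show "y \<in> {x. ennreal l < maximal f x}"
      using maximal_greaterI[of "r + d" l f y] r(1) d(1) assms by simp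
  qed
  then show "\<exists>e>0. ball x e \<subseteq> {x. ennreal l < maximal f x}" using d(1) by blast
qed

lemma borel_measurable_maximal: "maximal f \<in> borel_measurable borel"
proof (rule borel_measurableI_greater)
  fix y :: ennreal
  show "{x \<in> space borel. y < maximal f x} \<in> sets borel"
    by (cases y) (auto intro!: borel_open open_maximal_superlevel)
qed

lemma measurable_maximal_lebesgue: "maximal f \<in> borel_measurable lebesgue"
  by (rule measurable_completion) (simp add: borel_measurable_maximal)

text \<open>Vitali's covering lemma selects disjoint balls whose fivefold enlargements cover the
  superlevel set, and over each of them the integral of \<open>f\<close> exceeds \<open>l\<close>
  times the \<open>N\<close>-th power of the radius.\<close>

lemma maximal_weak_type:
  fixes f :: "real^'N::finite \<Rightarrow> ennreal"
  assumes f [measurable]: "f \<in> borel_measurable lebesgue" and l: "l > 0"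
  shows "emeasure lebesgue {x. ennreal l < maximal f x} \<le>
     ennreal (5 ^ CARD('N) * unit_ball_vol (real CARD('N)) / l) * (\<integral>\<^sup>+z. f z \<partial>lebesgue)"
proof (cases "(\<integral>\<^sup>+z. f z \<partial>lebesgue) = \<infinity>")
  case True
  have "5 ^ CARD('N) * unit_ball_vol (real CARD('N)) / l > 0"
    using l by (intro divide_pos_pos mult_pos_pos) auto
  then have "ennreal (5 ^ CARD('N) * unit_ball_vol (real CARD('N)) / l) \<noteq> 0" by (simp add: ennreal_eq_0_iff)
  then show ?thesis using True by (simp add: ennreal_mult_top)
next
  case False
  let ?N = "CARD('N)" and ?w = "unit_ball_vol (real CARD('N))"
  have w: "?w > 0" by simp
  define F where "F = enn2real (\<integral>\<^sup>+z. f z \<partial>lebesgue)"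
  have F: "(\<integral>\<^sup>+z. f z \<partial>lebesgue) = ennreal F" using False by (simp add: F_def top.not_eq_extremum)
  let ?S = "{x. ennreal l < maximal f x}"
  have "\<forall>x\<in>?S. \<exists>r>0. ennreal (l * r ^ ?N) < (\<integral>\<^sup>+z. f z * indicator (ball x r) z \<partial>lebesgue)"
    using maximal_greaterE[of l f] l by (metis less_eq_real_def mem_Collect_eq)
  then obtain r where r: "\<And>x. x \<in> ?S \<Longrightarrow> r x > 0"
    "\<And>x. x \<in> ?S \<Longrightarrow> ennreal (l * r x ^ ?N) < (\<integral>\<^sup>+z. f z * indicator (ball x (r x)) z \<partial>lebesgue)"
    by metis
  \<comment> \<open>The covering lemma asks for bounded radii: \<open>l * r^N\<close> is at most
    \<open>F\<close>, and \<open>r\<close> is at most \<open>r^N\<close> once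
    \<open>r > 1\<close>.\<close>
  have bound: "r x \<le> max 1 (F / l)" if "x \<in> ?S" for x
  proof (cases "r x \<le> 1")
    case False
    have "ennreal (l * r x ^ ?N) \<le> (\<integral>\<^sup>+z. f z * indicator (ball x (r x)) z \<partial>lebesgue)" using r(2)[OF that] by simp
    also have "\<dots> \<le> (\<integral>\<^sup>+z. f z \<partial>lebesgue)" by (intro nn_integral_mono) (auto split: split_indicator)
    finally have "l * r x ^ ?N \<le> F" unfolding F by (simp add: F_def)
    moreover have "r x ^ 1 \<le> r x ^ ?N" using False by (intro power_increasing) (auto simp: Suc_le_eq)
    then have "l * r x \<le> l * r x ^ ?N" using l by simp
    ultimately have "l * r x \<le> F" by linarith
    then have "r x \<le> F / l" using l by (simp add: field_simps)
    then show ?thesis by simp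
  qed auto
  obtain C where C: "countable C" "C \<subseteq> ?S" "pairwise (\<lambda>i j. disjnt (ball i (r i)) (ball j (r j))) C"
    "?S \<subseteq> (\<Union>i\<in>C. ball i (5 * r i))"
    by (rule Vitali_covering_lemma_balls[of ?S "\<lambda>x. x" r ?S "max 1 (F / l)"]) (use r(1) bound in auto)
  \<comment> \<open>Sums over the countably many selected centres are written as integrals over
    \<open>count_space C\<close>, so that they can be interchanged with the Lebesgue
    integral.\<close>
  have "emeasure lebesgue ?S \<le> (\<integral>\<^sup>+x. (\<integral>\<^sup>+i. indicator (ball i (5 * r i)) x \<partial>count_space C) \<partial>lebesgue)"
  proof -
    have S: "?S \<in> sets lebesgue" using open_maximal_superlevel[of l f] l by (simp add: sets_completionI_sets)
    have "emeasure lebesgue ?S = (\<integral>\<^sup>+x. indicator ?S x \<partial>lebesgue)" using S by simp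
    also have "\<dots> \<le> (\<integral>\<^sup>+x. (\<integral>\<^sup>+i. indicator (ball i (5 * r i)) x \<partial>count_space C) \<partial>lebesgue)"
    proof (rule nn_integral_mono)
      fix x
      show "indicator ?S x \<le> (\<integral>\<^sup>+i. indicator (ball i (5 * r i)) x \<partial>count_space C :: ennreal)"
      proof (cases "x \<in> ?S")
        case True
        then obtain i where i: "i \<in> C" "x \<in> ball i (5 * r i)" using C(4) by blast
        have "indicator ?S x = (indicator (ball i (5 * r i)) x :: ennreal)" using True i by simp
        also have "\<dots> \<le> (\<integral>\<^sup>+i. indicator (ball i (5 * r i)) x \<partial>count_space C)"
          by (rule nn_integral_ge_point[OF i(1)])
        finally show ?thesis .
      qed auto
    qed
    finally show ?thesis .
  qed
  also have "\<dots> = (\<integral>\<^sup>+i. (\<integral>\<^sup>+x. indicator (ball i (5 * r i)) x \<partial>lebesgue) \<partial>count_space C)"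
    by (rule nn_integral_count_space_nn_integral[OF C(1)]) simp
  also have "\<dots> \<le> (\<integral>\<^sup>+i. ennreal (5 ^ ?N * ?w / l) * (\<integral>\<^sup>+z. f z * indicator (ball i (r i)) z \<partial>lebesgue) \<partial>count_space C)"
  proof (rule nn_integral_mono)
    fix i assume "i \<in> space (count_space C)"
    then have i: "i \<in> ?S" using C(2) by auto
    have "(\<integral>\<^sup>+x. indicator (ball i (5 * r i)) x \<partial>lebesgue) = emeasure lebesgue (ball i (5 * r i))"
      by simp
    also have "\<dots> = ennreal (?w * (5 * r i) ^ ?N)" using r(1)[OF i] by (subst emeasure_lebesgue_ball) auto
    also have "\<dots> = ennreal (5 ^ ?N * ?w / l * (l * r i ^ ?N))" using l by (simp add: power_mult_distrib mult_ac)
    also have "\<dots> = ennreal (5 ^ ?N * ?w / l) * ennreal (l * r i ^ ?N)"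
      using l w r(1)[OF i] by (intro ennreal_mult) auto
    also have "\<dots> \<le> ennreal (5 ^ ?N * ?w / l) * (\<integral>\<^sup>+z. f z * indicator (ball i (r i)) z \<partial>lebesgue)"
      using r(2)[OF i] by (intro mult_left_mono) auto
    finally show "(\<integral>\<^sup>+x. indicator (ball i (5 * r i)) x \<partial>lebesgue) \<le> \<dots>" .
  qed
  also have "\<dots> = ennreal (5 ^ ?N * ?w / l) * (\<integral>\<^sup>+i. (\<integral>\<^sup>+z. f z * indicator (ball i (r i)) z \<partial>lebesgue) \<partial>count_space C)"
    by (rule nn_integral_cmult) simp
  also have "(\<integral>\<^sup>+i. (\<integral>\<^sup>+z. f z * indicator (ball i (r i)) z \<partial>lebesgue) \<partial>count_space C)
      = (\<integral>\<^sup>+i. emeasure (density lebesgue f) (ball i (r i)) \<partial>count_space C)"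
    by (simp add: emeasure_density)
  also have "\<dots> = emeasure (density lebesgue f) (\<Union>i\<in>C. ball i (r i))"
  proof (rule emeasure_UN_countable[symmetric])
    show "disjoint_family_on (\<lambda>i. ball i (r i)) C"
      using C(3) unfolding disjoint_family_on_def pairwise_def disjnt_def by blast
  qed (use C(1) in auto)
  also have "\<dots> \<le> emeasure (density lebesgue f) (space (density lebesgue f))"
    by (rule emeasure_space)
  also have "\<dots> = (\<integral>\<^sup>+z. f z \<partial>lebesgue)" by (simp add: emeasure_density)
  finally show ?thesis by (simp add: mult_left_mono)
qed

section \<open>Marcinkiewicz interpolation for the maximal function\<close>

lemma layer_cake_powr:
  assumes "q > 0" "a \<ge> 0"
  shows "(\<integral>\<^sup>+l. ennreal (q * l powr (q - 1)) * indicator {0<..<a} l \<partial>lborel) = ennreal (a powr q)"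
proof -
  have "((\<lambda>l. l powr (q - 1)) has_integral (a powr (q - 1 + 1) / (q - 1 + 1))) {0..a}"
    using assms by (intro has_integral_powr_from_0) auto
  then have "((\<lambda>l. q * l powr (q - 1)) has_integral (q * (a powr q / q))) {0..a}"
    by (intro has_integral_mult_right) simp
  then have "((\<lambda>l. q * l powr (q - 1)) has_integral a powr q) {0..a}" using assms by simp
  then have "(\<integral>\<^sup>+l. ennreal (indicator {0..a} l * (q * l powr (q - 1))) \<partial>lborel) = ennreal (a powr q)"
    using assms by (intro nn_integral_has_integral_lebesgue) auto
  moreover have "(\<integral>\<^sup>+l. ennreal (indicator {0..a} l * (q * l powr (q - 1))) \<partial>lborel)
     = (\<integral>\<^sup>+l. ennreal (q * l powr (q - 1)) * indicator {0<..<a} l \<partial>lborel)"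
  proof (rule nn_integral_cong_AE)
    have "AE l in lborel. l \<noteq> 0 \<and> l \<noteq> a" using AE_lborel_singleton[of 0] AE_lborel_singleton[of a] by auto
    then show "AE l in lborel. ennreal (indicator {0..a} l * (q * l powr (q - 1))) = ennreal (q * l powr (q - 1)) * indicator {0<..<a} l"
      by eventually_elim (auto split: split_indicator)
  qed
  ultimately show ?thesis by simp
qed

text \<open>Where \<open>f\<close> is at most \<open>l\<close> divided by twice the volume of the
  unit ball, it contributes at most \<open>l / 2\<close> to any mean, so the weak bound at height
  \<open>l / 2\<close> is needed only for the rest of \<open>f\<close>. The truncation is written as
  a condition on \<open>l\<close>, ready for integration in \<open>l\<close>.\<close>

lemma maximal_truncation:
  fixes f :: "real^'N::finite \<Rightarrow> real"
  assumes f [measurable]: "f \<in> borel_measurable lebesgue" and f0: "\<And>x. f x \<ge> 0" and l: "l > 0"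
  shows "emeasure lebesgue {x. ennreal l < maximal (\<lambda>x. ennreal (f x)) x} \<le>
     ennreal (2 * 5 ^ CARD('N) * unit_ball_vol (real CARD('N)) / l) *
       (\<integral>\<^sup>+z. ennreal (f z) * indicator {0<..<2 * unit_ball_vol (real CARD('N)) * f z} l \<partial>lebesgue)"
proof -
  let ?N = "CARD('N)" and ?w = "unit_ball_vol (real CARD('N))"
  have w: "?w > 0" by simp
  define h where "h z = ennreal (f z) * indicator {0<..<2 * ?w * f z} l" for z
  have [measurable]: "h \<in> borel_measurable lebesgue"
  proof -
    have "h = (\<lambda>z. ennreal (f z) * (if l < 2 * ?w * f z then 1 else 0))"
      using l by (auto simp: h_def fun_eq_iff indicator_def)
    then show ?thesis by simp
  qed
  have hle: "ennreal (f z) \<le> h z + ennreal (l / (2 * ?w))" for z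
  proof (cases "l < 2 * ?w * f z")
    case True then show ?thesis using l by (simp add: h_def)
  next
    case False
    then have "f z \<le> l / (2 * ?w)" using w by (simp add: field_simps)
    then have "ennreal (f z) \<le> ennreal (l / (2 * ?w))" by (rule ennreal_leI)
    then show ?thesis by (meson add_increasing zero_le order_trans)
  qed
  have "{x. ennreal l < maximal (\<lambda>x. ennreal (f x)) x} \<subseteq> {x. ennreal (l / 2) < maximal h x}"
  proof
    fix x assume "x \<in> {x. ennreal l < maximal (\<lambda>x. ennreal (f x)) x}"
    then obtain r where r: "r > 0" "ennreal (l * r ^ ?N) < (\<integral>\<^sup>+z. ennreal (f z) * indicator (ball x r) z \<partial>lebesgue)"
      using maximal_greaterE[of l "\<lambda>x. ennreal (f x)" x] l by auto
    have "(\<integral>\<^sup>+z. ennreal (f z) * indicator (ball x r) z \<partial>lebesgue)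
       \<le> (\<integral>\<^sup>+z. h z * indicator (ball x r) z + ennreal (l / (2 * ?w)) * indicator (ball x r) z \<partial>lebesgue)"
      by (intro nn_integral_mono) (use hle in \<open>auto split: split_indicator\<close>)
    also have "\<dots> = (\<integral>\<^sup>+z. h z * indicator (ball x r) z \<partial>lebesgue) + ennreal (l / (2 * ?w)) * emeasure lebesgue (ball x r)"
      by (subst nn_integral_add) (auto simp: nn_integral_cmult)
    also have "ennreal (l / (2 * ?w)) * emeasure lebesgue (ball x r) = ennreal (l / 2 * r ^ ?N)"
      using r(1) l less_imp_neq[OF w] emeasure_ball[of r x] by (simp flip: ennreal_mult)
    finally have "ennreal (l * r ^ ?N) < (\<integral>\<^sup>+z. h z * indicator (ball x r) z \<partial>lebesgue) + ennreal (l / 2 * r ^ ?N)"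
      using r(2) by simp
    moreover have split: "ennreal (l * r ^ ?N) = ennreal (l / 2 * r ^ ?N) + ennreal (l / 2 * r ^ ?N)"
      using l r(1) by (simp flip: ennreal_plus)
    ultimately have less: "ennreal (l / 2 * r ^ ?N) + ennreal (l / 2 * r ^ ?N)
        < (\<integral>\<^sup>+z. h z * indicator (ball x r) z \<partial>lebesgue) + ennreal (l / 2 * r ^ ?N)" by simp
    have "ennreal (l / 2 * r ^ ?N) < (\<integral>\<^sup>+z. h z * indicator (ball x r) z \<partial>lebesgue)"
    proof (rule ccontr)
      assume "\<not> ?thesis"
      then have "(\<integral>\<^sup>+z. h z * indicator (ball x r) z \<partial>lebesgue) + ennreal (l / 2 * r ^ ?N)
         \<le> ennreal (l / 2 * r ^ ?N) + ennreal (l / 2 * r ^ ?N)"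
        by (intro add_right_mono) simp
      then show False using less by simp
    qed
    then show "x \<in> {x. ennreal (l / 2) < maximal h x}" using maximal_greaterI[of r "l / 2" h x] r(1) l by simp
  qed
  then have "emeasure lebesgue {x. ennreal l < maximal (\<lambda>x. ennreal (f x)) x} \<le> emeasure lebesgue {x. ennreal (l / 2) < maximal h x}"
    using open_maximal_superlevel[of "l/2" h] l by (intro emeasure_mono) (auto simp: sets_completionI_sets)
  also have "\<dots> \<le> ennreal (5 ^ ?N * ?w / (l / 2)) * (\<integral>\<^sup>+z. h z \<partial>lebesgue)"
    using l by (intro maximal_weak_type) auto
  also have "5 ^ ?N * ?w / (l / 2) = 2 * 5 ^ ?N * ?w / l" by simp
  finally show ?thesis by (simp add: h_def)
qed

text \<open>The factors come from the truncated weak bound, from the change of exponent in the layer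
  cake formula, and from the height of the truncation raised to the power
  \<open>q - 1\<close>.\<close>

definition maximal_const :: "nat \<Rightarrow> real \<Rightarrow> real" where
  "maximal_const N q = 2 * 5 ^ N * unit_ball_vol (real N) * (q / (q - 1)) * (2 * unit_ball_vol (real N)) powr (q - 1)"

lemma maximal_const_pos: "q > 1 \<Longrightarrow> maximal_const N q > 0"
  unfolding maximal_const_def by (intro mult_pos_pos divide_pos_pos) (auto simp: less_imp_neq[THEN not_sym])

text \<open>Stated for a real minorant \<open>m\<close> because \<open>powr\<close> lives on the
  reals. Finiteness almost everywhere is then a special case of the bound and not a prerequisite for
  it.\<close>

lemma maximal_strong_type:
  fixes f :: "real^'N::finite \<Rightarrow> real"
  assumes f [measurable]: "f \<in> borel_measurable lebesgue" and f0: "\<And>x. f x \<ge> 0" and q: "q > 1"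
    and m [measurable]: "m \<in> borel_measurable lebesgue" and m0: "\<And>x. m x \<ge> 0"
    and mle: "\<And>x. ennreal (m x) \<le> maximal (\<lambda>x. ennreal (f x)) x"
  shows "(\<integral>\<^sup>+x. ennreal (m x powr q) \<partial>lebesgue) \<le> ennreal (maximal_const CARD('N) q) * (\<integral>\<^sup>+x. ennreal (f x powr q) \<partial>lebesgue)"
proof -
  let ?N = "CARD('N)" and ?w = "unit_ball_vol (real CARD('N))"
  let ?C = "2 * 5 ^ ?N * ?w"
  have w: "?w > 0" by simp
  interpret pair_sigma_finite "lebesgue :: (real^'N) measure" "lborel :: real measure" ..
  have meas_ind: "(\<lambda>(x, l). indicator {0<..<a x} l :: ennreal) \<in> borel_measurable (lebesgue \<Otimes>\<^sub>M lborel)"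
    if [measurable]: "a \<in> borel_measurable lebesgue" for a :: "real^'N \<Rightarrow> real"
  proof -
    have "(\<lambda>(x, l). indicator {0<..<a x} l :: ennreal) = (\<lambda>(x, l). if 0 < l \<and> l < a x then 1 else 0)"
      by (auto simp: fun_eq_iff indicator_def)
    then show ?thesis by simp
  qed
  have [measurable]: "(\<lambda>l. ennreal (c * l powr e)) \<in> borel_measurable lborel" for c e :: real by measurable
  have "(\<integral>\<^sup>+x. ennreal (m x powr q) \<partial>lebesgue) = (\<integral>\<^sup>+x. (\<integral>\<^sup>+l. ennreal (q * l powr (q - 1)) * indicator {0<..<m x} l \<partial>lborel) \<partial>lebesgue)"
    using layer_cake_powr[of q] q m0 by simp
  also have "\<dots> = (\<integral>\<^sup>+l. (\<integral>\<^sup>+x. ennreal (q * l powr (q - 1)) * indicator {0<..<m x} l \<partial>lebesgue) \<partial>lborel)"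
    by (rule Fubini'[symmetric]) (use meas_ind[OF m] in \<open>auto simp: case_prod_beta'\<close>)
  also have "\<dots> \<le> (\<integral>\<^sup>+l. (\<integral>\<^sup>+x. ennreal (?C * (q / (q - 1))) * (ennreal (f x) * (ennreal ((q - 1) * l powr (q - 1 - 1)) * indicator {0<..<2 * ?w * f x} l)) \<partial>lebesgue) \<partial>lborel)"
  proof (rule nn_integral_mono)
    fix l :: real
    show "(\<integral>\<^sup>+x. ennreal (q * l powr (q - 1)) * indicator {0<..<m x} l \<partial>lebesgue)
      \<le> (\<integral>\<^sup>+x. ennreal (?C * (q / (q - 1))) * (ennreal (f x) * (ennreal ((q - 1) * l powr (q - 1 - 1)) * indicator {0<..<2 * ?w * f x} l)) \<partial>lebesgue)"
    proof (cases "l > 0")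
      case True
      have [measurable]: "(\<lambda>x. indicator {0<..<2 * ?w * f x} l :: ennreal) \<in> borel_measurable lebesgue"
      proof -
        have "(\<lambda>x. indicator {0<..<2 * ?w * f x} l :: ennreal) = (\<lambda>x. if l < 2 * ?w * f x then 1 else 0)"
          using True by (auto simp: fun_eq_iff indicator_def)
        then show ?thesis by simp
      qed
      have S: "{x. ennreal l < maximal (\<lambda>x. ennreal (f x)) x} \<in> sets lebesgue"
        using open_maximal_superlevel[of l "\<lambda>x. ennreal (f x)"] True by (simp add: sets_completionI_sets)
      have "(\<integral>\<^sup>+x. ennreal (q * l powr (q - 1)) * indicator {0<..<m x} l \<partial>lebesgue)
          \<le> (\<integral>\<^sup>+x. ennreal (q * l powr (q - 1)) * indicator {x. ennreal l < maximal (\<lambda>x. ennreal (f x)) x} x \<partial>lebesgue)"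
      proof (intro nn_integral_mono mult_left_mono)
        fix x
        show "indicator {0<..<m x} l \<le> (indicator {x. ennreal l < maximal (\<lambda>x. ennreal (f x)) x} x :: ennreal)"
          using mle[of x] True ennreal_less_iff[of l "m x"] by (auto simp: indicator_def dest: less_le_trans)
      qed auto
      also have "\<dots> = ennreal (q * l powr (q - 1)) * emeasure lebesgue {x. ennreal l < maximal (\<lambda>x. ennreal (f x)) x}"
        using S by (simp add: nn_integral_cmult)
      also have "\<dots> \<le> ennreal (q * l powr (q - 1)) * (ennreal (?C / l) * (\<integral>\<^sup>+z. ennreal (f z) * indicator {0<..<2 * ?w * f z} l \<partial>lebesgue))"
        using maximal_truncation[OF f f0 True] by (intro mult_left_mono) (auto simp: mult_ac)
      also have "\<dots> = (ennreal (q * l powr (q - 1)) * ennreal (?C / l)) * (\<integral>\<^sup>+z. ennreal (f z) * indicator {0<..<2 * ?w * f z} l \<partial>lebesgue)"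
        by (simp add: mult.assoc)
      \<comment> \<open>The weak bound lowers the power of \<open>l\<close> by one. The constants
        are regrouped so that the integral in \<open>l\<close> is the layer cake formula for the
        exponent \<open>q - 1\<close>.\<close>
      also have "ennreal (q * l powr (q - 1)) * ennreal (?C / l) = ennreal (?C * (q / (q - 1))) * ennreal ((q - 1) * l powr (q - 1 - 1))"
      proof -
        have "l powr (q - 1 - 1) = l powr (q - 1) / l" using True by (simp add: powr_diff power2_eq_square)
        then have "(q * l powr (q - 1)) * (?C / l) = (?C * (q / (q - 1))) * ((q - 1) * l powr (q - 1 - 1))"
          using q by (simp add: power2_eq_square)
        then show ?thesis using q True w by (simp flip: ennreal_mult)
      qed
      also have "ennreal (?C * (q / (q - 1))) * ennreal ((q - 1) * l powr (q - 1 - 1)) * (\<integral>\<^sup>+z. ennreal (f z) * indicator {0<..<2 * ?w * f z} l \<partial>lebesgue)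
         = (\<integral>\<^sup>+x. (ennreal (?C * (q / (q - 1))) * ennreal ((q - 1) * l powr (q - 1 - 1))) * (ennreal (f x) * indicator {0<..<2 * ?w * f x} l) \<partial>lebesgue)"
        by (rule nn_integral_cmult[symmetric]) simp
      also have "\<dots> = (\<integral>\<^sup>+x. ennreal (?C * (q / (q - 1))) * (ennreal (f x) * (ennreal ((q - 1) * l powr (q - 1 - 1)) * indicator {0<..<2 * ?w * f x} l)) \<partial>lebesgue)"
        by (intro nn_integral_cong) (simp add: mult_ac)
      finally show ?thesis .
    qed auto
  qed
  also have "\<dots> = (\<integral>\<^sup>+x. (\<integral>\<^sup>+l. ennreal (?C * (q / (q - 1))) * (ennreal (f x) * (ennreal ((q - 1) * l powr (q - 1 - 1)) * indicator {0<..<2 * ?w * f x} l)) \<partial>lborel) \<partial>lebesgue)"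
    by (rule Fubini') (use meas_ind[of "\<lambda>x. 2 * ?w * f x"] in \<open>auto simp: case_prod_beta'\<close>)
  also have "\<dots> = (\<integral>\<^sup>+x. ennreal (maximal_const ?N q) * ennreal (f x powr q) \<partial>lebesgue)"
  proof (rule nn_integral_cong)
    fix x :: "real^'N"
    have "(\<integral>\<^sup>+l. ennreal (?C * (q / (q - 1))) * (ennreal (f x) * (ennreal ((q - 1) * l powr (q - 1 - 1)) * indicator {0<..<2 * ?w * f x} l)) \<partial>lborel)
       = ennreal (?C * (q / (q - 1))) * (ennreal (f x) * (\<integral>\<^sup>+l. ennreal ((q - 1) * l powr (q - 1 - 1)) * indicator {0<..<2 * ?w * f x} l \<partial>lborel))"
      by (simp add: nn_integral_cmult)
    also have "\<dots> = ennreal (?C * (q / (q - 1))) * (ennreal (f x) * ennreal ((2 * ?w * f x) powr (q - 1)))"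
      using layer_cake_powr[of "q - 1" "2 * ?w * f x"] q f0[of x] w by simp
    also have "\<dots> = ennreal (?C * (q / (q - 1)) * (f x * (2 * ?w * f x) powr (q - 1)))"
      using q f0[of x] w by (simp flip: ennreal_mult)
    also have "?C * (q / (q - 1)) * (f x * (2 * ?w * f x) powr (q - 1)) = maximal_const ?N q * f x powr q"
    proof (cases "f x = 0")
      case False
      then have "f x > 0" using f0[of x] by simp
      then have "f x powr q = f x * f x powr (q - 1)" by (simp add: powr_diff)
      then show ?thesis using w f0[of x] by (simp add: maximal_const_def powr_mult)
    qed (use q in simp)
    also have "ennreal (maximal_const ?N q * f x powr q) = ennreal (maximal_const ?N q) * ennreal (f x powr q)"
      using maximal_const_pos[OF q, of ?N] by (intro ennreal_mult) auto
    finally show "(\<integral>\<^sup>+l. ennreal (?C * (q / (q - 1))) * (ennreal (f x) * (ennreal ((q - 1) * l powr (q - 1 - 1)) * indicator {0<..<2 * ?w * f x} l)) \<partial>lborel) = \<dots>" .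
  qed
  also have "\<dots> = ennreal (maximal_const ?N q) * (\<integral>\<^sup>+x. ennreal (f x powr q) \<partial>lebesgue)"
    by (rule nn_integral_cmult) simp
  finally show ?thesis .
qed

text \<open>With the minorant equal to \<open>n powr (1 / q)\<close> on the set where the maximal
  function is infinite, the strong bound says that \<open>n\<close> times the measure of this set is
  at most \<open>K\<close>, for every \<open>n\<close>.\<close>

lemma maximal_AE_finite:
  fixes f :: "real^'N::finite \<Rightarrow> real"
  assumes f [measurable]: "f \<in> borel_measurable lebesgue" and f0: "\<And>x. f x \<ge> 0" and q: "q > 1"
    and fin: "(\<integral>\<^sup>+x. ennreal (f x powr q) \<partial>lebesgue) < \<infinity>"
  shows "AE x in lebesgue. maximal (\<lambda>x. ennreal (f x)) x < \<infinity>"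
proof -
  let ?M = "maximal (\<lambda>x. ennreal (f x))"
  have [measurable]: "?M \<in> borel_measurable lebesgue" by (rule measurable_maximal_lebesgue)
  define S where "S = {x. ?M x = \<infinity>}"
  have S [measurable]: "S \<in> sets lebesgue"
    using measurable_sets[OF measurable_maximal_lebesgue, of "{\<infinity>}" "\<lambda>x. ennreal (f x)"] by (simp add: S_def vimage_def)
  define K where "K = enn2real (ennreal (maximal_const CARD('N) q) * (\<integral>\<^sup>+x. ennreal (f x powr q) \<partial>lebesgue))"
  have K: "ennreal (maximal_const CARD('N) q) * (\<integral>\<^sup>+x. ennreal (f x powr q) \<partial>lebesgue) = ennreal K"
    unfolding K_def by (rule ennreal_enn2real[symmetric]) (use fin in \<open>simp add: ennreal_mult_less_top\<close>)
  have bound: "ennreal (real n) * emeasure lebesgue S \<le> ennreal K" if "n > 0" for n :: nat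
  proof -
    let ?T = "real n powr (1 / q)"
    have "(\<integral>\<^sup>+x. ennreal ((?T * indicator S x) powr q) \<partial>lebesgue) \<le> ennreal K"
      unfolding K[symmetric]
      by (rule maximal_strong_type[OF f f0 q]) (auto simp: S_def split: split_indicator)
    also have "(\<integral>\<^sup>+x. ennreal ((?T * indicator S x) powr q) \<partial>lebesgue) = (\<integral>\<^sup>+x. ennreal (real n) * indicator S x \<partial>lebesgue)"
      using q by (intro nn_integral_cong) (auto simp: powr_powr split: split_indicator)
    also have "\<dots> = ennreal (real n) * emeasure lebesgue S" by (rule nn_integral_cmult_indicator[OF S])
    finally show ?thesis .
  qed
  have "emeasure lebesgue S = 0"
  proof -
    have "emeasure lebesgue S \<le> ennreal K" using bound[of 1] by simp
    then obtain e where e: "emeasure lebesgue S = ennreal e" "e \<ge> 0"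
      by (cases "emeasure lebesgue S") (auto simp: top_unique)
    have "e \<le> 0"
    proof (rule ccontr)
      assume "\<not> e \<le> 0"
      then obtain n :: nat where n: "real n * e > max K 0" using ex_less_of_nat_mult[of e "max K 0"] by auto
      then have "n > 0" using e(2) by (cases n) auto
      from bound[OF this] e have "ennreal (real n * e) \<le> ennreal K" by (simp add: ennreal_mult)
      then show False using n by (auto simp: ennreal_le_iff2)
    qed
    then show ?thesis using e by simp
  qed
  then have "S \<in> null_sets lebesgue" using S by auto
  then have "AE x in lebesgue. x \<notin> S" by (rule AE_not_in)
  then show ?thesis by eventually_elim (auto simp: S_def less_top)
qed

section \<open>Hoelder and Young inequalities on balls\<close>

text \<open>Young's inequality for the two factors after normalising them by their bounds; a
  vanishing bound is treated apart because the normalisation divides by it.\<close>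

lemma nn_integral_Holder:
  fixes f g :: "'a \<Rightarrow> real"
  assumes [measurable]: "f \<in> borel_measurable M" "g \<in> borel_measurable M"
    and f0: "\<And>x. f x \<ge> 0" and g0: "\<And>x. g x \<ge> 0"
    and pq: "p > 1" "q > 1" "1 / p + 1 / q = 1" and AB: "A \<ge> 0" "B \<ge> 0"
    and fA: "(\<integral>\<^sup>+x. ennreal (f x powr p) \<partial>M) \<le> ennreal A"
    and gB: "(\<integral>\<^sup>+x. ennreal (g x powr q) \<partial>M) \<le> ennreal B"
  shows "(\<integral>\<^sup>+x. ennreal (f x * g x) \<partial>M) \<le> ennreal (A powr (1 / p) * B powr (1 / q))"
proof (cases "A = 0 \<or> B = 0")
  case True
  have "AE x in M. f x * g x = 0"
  proof (cases "A = 0")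
    case True
    then have "(\<integral>\<^sup>+x. ennreal (f x powr p) \<partial>M) = 0" using fA by simp
    then have "AE x in M. ennreal (f x powr p) = 0" by (subst (asm) nn_integral_0_iff_AE) auto
    then show ?thesis by eventually_elim (auto simp: ennreal_eq_0_iff)
  next
    case False
    then have "(\<integral>\<^sup>+x. ennreal (g x powr q) \<partial>M) = 0" using gB True by simp
    then have "AE x in M. ennreal (g x powr q) = 0" by (subst (asm) nn_integral_0_iff_AE) auto
    then show ?thesis by eventually_elim (auto simp: ennreal_eq_0_iff)
  qed
  then have "(\<integral>\<^sup>+x. ennreal (f x * g x) \<partial>M) = (\<integral>\<^sup>+x. 0 \<partial>M)"
    by (intro nn_integral_cong_AE) (auto elim: eventually_mono)
  then show ?thesis by simp
next
  case False
  then have pos: "A > 0" "B > 0" using AB by auto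
  define s where "s = A powr (1 / p)"
  define t where "t = B powr (1 / q)"
  have st: "s > 0" "t > 0" using pos by (auto simp: s_def t_def)
  have sp: "s powr p = A" "t powr q = B" using pos pq by (auto simp: s_def t_def powr_powr)
  have bound: "f x * g x \<le> s * t / (A * p) * f x powr p + s * t / (B * q) * g x powr q" for x
  proof -
    have "(f x / s) * (g x / t) \<le> (f x / s) powr p / p + (g x / t) powr q / q"
      using st f0 g0 by (intro Youngs_inequality pq) auto
    then have "(s * t) * ((f x / s) * (g x / t)) \<le> (s * t) * ((f x / s) powr p / p + (g x / t) powr q / q)"
      using st by (intro mult_left_mono) auto
    moreover have "(s * t) * ((f x / s) * (g x / t)) = f x * g x" using st by simp
    moreover have "(s * t) * ((f x / s) powr p / p + (g x / t) powr q / q) = s * t / (A * p) * f x powr p + s * t / (B * q) * g x powr q"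
      using st f0[of x] g0[of x] by (simp add: powr_divide sp ring_distribs)
    ultimately show ?thesis by simp
  qed
  have "(\<integral>\<^sup>+x. ennreal (f x * g x) \<partial>M) \<le> (\<integral>\<^sup>+x. ennreal (s * t / (A * p)) * ennreal (f x powr p) + ennreal (s * t / (B * q)) * ennreal (g x powr q) \<partial>M)"
  proof (rule nn_integral_mono)
    fix x
    have "ennreal (f x * g x) \<le> ennreal (s * t / (A * p) * f x powr p + s * t / (B * q) * g x powr q)"
      by (rule ennreal_leI[OF bound])
    also have "\<dots> = ennreal (s * t / (A * p) * f x powr p) + ennreal (s * t / (B * q) * g x powr q)"
      by (rule ennreal_plus) (use st pos pq in auto)
    also have "\<dots> = ennreal (s * t / (A * p)) * ennreal (f x powr p) + ennreal (s * t / (B * q)) * ennreal (g x powr q)"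
      by (subst (1 2) ennreal_mult) (use st pos pq in auto)
    finally show "ennreal (f x * g x) \<le> \<dots>" .
  qed
  also have "\<dots> = ennreal (s * t / (A * p)) * (\<integral>\<^sup>+x. ennreal (f x powr p) \<partial>M) + ennreal (s * t / (B * q)) * (\<integral>\<^sup>+x. ennreal (g x powr q) \<partial>M)"
    by (subst nn_integral_add) (auto simp: nn_integral_cmult)
  also have "\<dots> \<le> ennreal (s * t / (A * p)) * ennreal A + ennreal (s * t / (B * q)) * ennreal B"
    by (intro add_mono mult_left_mono fA gB) auto
  also have "\<dots> = ennreal (s * t / (A * p) * A + s * t / (B * q) * B)"
  proof -
    have "ennreal (s * t / (A * p)) * ennreal A = ennreal (s * t / (A * p) * A)"
      "ennreal (s * t / (B * q)) * ennreal B = ennreal (s * t / (B * q) * B)"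
      by (rule ennreal_mult[symmetric]; use st pos pq in simp)+
    then show ?thesis using st pos pq by (simp only:) (rule ennreal_plus[symmetric]; simp)
  qed
  also have "s * t / (A * p) * A + s * t / (B * q) * B = s * t * (1 / p + 1 / q)"
    using pos by (simp add: ring_distribs)
  finally show ?thesis using pq by (simp add: s_def t_def)
qed

lemma nn_integral_Holder_ball:
  fixes f :: "real^'N::finite \<Rightarrow> real"
  assumes [measurable]: "f \<in> borel_measurable lebesgue" and f0: "\<And>x. f x \<ge> 0" and p: "p > 1" and A: "A \<ge> 0" and r: "r \<ge> 0"
    and fA: "(\<integral>\<^sup>+z. ennreal (f z powr p) * indicator (ball x r) z \<partial>lebesgue) \<le> ennreal A"
  shows "(\<integral>\<^sup>+z. ennreal (f z) * indicator (ball x r) z \<partial>lebesgue)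
    \<le> ennreal (A powr (1 / p) * (unit_ball_vol (real CARD('N)) * r ^ CARD('N)) powr (1 - 1 / p))"
proof -
  define q where "q = p / (p - 1)"
  have q: "q > 1" "1 / p + 1 / q = 1" "1 / q = 1 - 1 / p" using p by (auto simp: q_def field_simps)
  have "(\<integral>\<^sup>+z. ennreal (f z) * indicator (ball x r) z \<partial>lebesgue) = (\<integral>\<^sup>+z. ennreal ((f z * indicator (ball x r) z) * indicator (ball x r) z) \<partial>lebesgue)"
    by (intro nn_integral_cong) (auto split: split_indicator)
  also have "\<dots> \<le> ennreal (A powr (1 / p) * (unit_ball_vol (real CARD('N)) * r ^ CARD('N)) powr (1 / q))"
  proof (rule nn_integral_Holder[OF _ _ _ _ p q(1,2) A])
    have "(\<integral>\<^sup>+z. ennreal ((f z * indicator (ball x r) z) powr p) \<partial>lebesgue) = (\<integral>\<^sup>+z. ennreal (f z powr p) * indicator (ball x r) z \<partial>lebesgue)"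
      using p by (intro nn_integral_cong) (auto split: split_indicator)
    then show "(\<integral>\<^sup>+z. ennreal ((f z * indicator (ball x r) z) powr p) \<partial>lebesgue) \<le> ennreal A" using fA by simp
    have "(\<integral>\<^sup>+z. ennreal ((indicator (ball x r) z) powr q) \<partial>lebesgue) = (\<integral>\<^sup>+z. indicator (ball x r) z \<partial>lebesgue)"
      using q by (intro nn_integral_cong) (auto split: split_indicator)
    also have "\<dots> = emeasure lebesgue (ball x r)" by simp
    also have "\<dots> = ennreal (unit_ball_vol (real CARD('N)) * r ^ CARD('N))" by (rule emeasure_lebesgue_ball[OF r])
    finally show "(\<integral>\<^sup>+z. ennreal ((indicator (ball x r) z) powr q) \<partial>lebesgue) \<le> ennreal (unit_ball_vol (real CARD('N)) * r ^ CARD('N))" by simp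
  qed (use f0 r in auto)
  finally show ?thesis by (simp add: q(3))
qed

section \<open>Young's inequality for averages over balls\<close>

lemma measurable_dist_lebesgue_pair:
  "(\<lambda>p. dist (fst p) (snd p)) \<in> borel_measurable (lebesgue \<Otimes>\<^sub>M (lebesgue :: 'a::euclidean_space measure))"
  by (intro borel_measurable_dist measurable_compose[OF measurable_fst ident_measurable_lebesgue]
      measurable_compose[OF measurable_snd ident_measurable_lebesgue])

lemma measurable_ball_indicator_pair [measurable]:
  "(\<lambda>p. indicator (ball (fst p) s) (snd p) :: ennreal) \<in> borel_measurable (lebesgue \<Otimes>\<^sub>M (lebesgue :: 'a::euclidean_space measure))"
proof -
  note measurable_dist_lebesgue_pair[measurable]
  have "(\<lambda>p. indicator (ball (fst p) s) (snd p) :: ennreal) = (\<lambda>p::'a\<times>'a. if dist (fst p) (snd p) < s then 1 else 0)"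
    by (auto simp: fun_eq_iff indicator_def)
  then show ?thesis by simp
qed

lemma measurable_ball_average:
  fixes f :: "'a::euclidean_space \<Rightarrow> ennreal"
  assumes [measurable]: "f \<in> borel_measurable lebesgue"
  shows "(\<lambda>y. \<integral>\<^sup>+z. f z * indicator (ball y s) z \<partial>lebesgue) \<in> borel_measurable lebesgue"
proof -
  have "(\<lambda>(y, z). f z * indicator (ball y s) z) \<in> borel_measurable (lebesgue \<Otimes>\<^sub>M lebesgue)"
    unfolding case_prod_beta' by measurable
  then show ?thesis by (rule lebesgue.borel_measurable_nn_integral)
qed

lemma nn_integral_ball_average:
  fixes f :: "real^'N::finite \<Rightarrow> ennreal"
  assumes [measurable]: "f \<in> borel_measurable lebesgue" and s: "s \<ge> 0"
  shows "(\<integral>\<^sup>+y. (\<integral>\<^sup>+z. f z * indicator (ball y s) z \<partial>lebesgue) * indicator (ball x R) y \<partial>lebesgue)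
    \<le> ennreal (unit_ball_vol (real CARD('N)) * s ^ CARD('N)) * (\<integral>\<^sup>+z. f z * indicator (ball x (R + s)) z \<partial>lebesgue)"
proof -
  interpret pair_sigma_finite "lebesgue :: (real^'N) measure" "lebesgue :: (real^'N) measure" ..
  have "(\<integral>\<^sup>+y. (\<integral>\<^sup>+z. f z * indicator (ball y s) z \<partial>lebesgue) * indicator (ball x R) y \<partial>lebesgue)
      = (\<integral>\<^sup>+y. (\<integral>\<^sup>+z. f z * indicator (ball y s) z * indicator (ball x R) y \<partial>lebesgue) \<partial>lebesgue)"
    by (intro nn_integral_cong nn_integral_multc[symmetric]) simp
  also have "\<dots> = (\<integral>\<^sup>+z. (\<integral>\<^sup>+y. f z * indicator (ball y s) z * indicator (ball x R) y \<partial>lebesgue) \<partial>lebesgue)"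
    by (rule Fubini'[symmetric]) (unfold case_prod_beta', measurable)
  also have "\<dots> \<le> (\<integral>\<^sup>+z. ennreal (unit_ball_vol (real CARD('N)) * s ^ CARD('N)) * (f z * indicator (ball x (R + s)) z) \<partial>lebesgue)"
  proof (rule nn_integral_mono)
    fix z
    have "(\<integral>\<^sup>+y. f z * indicator (ball y s) z * indicator (ball x R) y \<partial>lebesgue)
      \<le> (\<integral>\<^sup>+y. (f z * indicator (ball x (R + s)) z) * indicator (ball z s) y \<partial>lebesgue)"
    proof (rule nn_integral_mono)
      fix y
      have "dist x z < R + s" if "dist y z < s" "dist x y < R"
        using dist_triangle[of x z y] that by linarith
      then show "f z * indicator (ball y s) z * indicator (ball x R) y \<le> (f z * indicator (ball x (R + s)) z) * indicator (ball z s) y"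
        by (auto split: split_indicator simp: dist_commute)
    qed
    also have "\<dots> = (f z * indicator (ball x (R + s)) z) * emeasure lebesgue (ball z s)"
      by (rule nn_integral_cmult_indicator) simp
    also have "\<dots> = ennreal (unit_ball_vol (real CARD('N)) * s ^ CARD('N)) * (f z * indicator (ball x (R + s)) z)"
      by (subst emeasure_lebesgue_ball[OF s]) (simp add: mult.commute)
    finally show "(\<integral>\<^sup>+y. f z * indicator (ball y s) z * indicator (ball x R) y \<partial>lebesgue) \<le> \<dots>" .
  qed
  also have "\<dots> = ennreal (unit_ball_vol (real CARD('N)) * s ^ CARD('N)) * (\<integral>\<^sup>+z. f z * indicator (ball x (R + s)) z \<partial>lebesgue)"
    by (rule nn_integral_cmult) simp
  finally show ?thesis .
qed

text \<open>Convolution of \<open>w\<close> with the indicator of the ball of radius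
  \<open>s\<close>, paired with \<open>u\<close>: the exponent of the volume is the reciprocal of
  the third exponent in Young's inequality. Hoelder on the small balls yields
  \<open>I^(1/\<beta>)\<close>; interpolating between the bound \<open>J\<close> for
  \<open>I\<close> and the bound \<open>v * J\<close> for its integral places this power in the
  space dual to that of \<open>u\<close>.\<close>

lemma nn_integral_Young_ball:
  fixes u w :: "real^'N::finite \<Rightarrow> real"
  assumes u [measurable]: "u \<in> borel_measurable lebesgue" and w [measurable]: "w \<in> borel_measurable lebesgue"
    and u0: "\<And>x. u x \<ge> 0" and w0: "\<And>x. w x \<ge> 0"
    and ab: "\<alpha> > 1" "\<beta> > 1" "1 / \<alpha> + 1 / \<beta> \<ge> 1" and AJ: "A \<ge> 0" "J \<ge> 0" and s: "s > 0"
    and uA: "(\<integral>\<^sup>+z. ennreal (u z powr \<alpha>) * indicator (ball x R) z \<partial>lebesgue) \<le> ennreal A"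
    and wJ: "(\<integral>\<^sup>+z. ennreal (w z powr \<beta>) * indicator (ball x (R + s)) z \<partial>lebesgue) \<le> ennreal J"
  shows "(\<integral>\<^sup>+y. ennreal (u y) * (\<integral>\<^sup>+z. ennreal (w z) * indicator (ball y s) z \<partial>lebesgue) * indicator (ball x R) y \<partial>lebesgue)
    \<le> ennreal (A powr (1 / \<alpha>) * J powr (1 / \<beta>) * (unit_ball_vol (real CARD('N)) * s ^ CARD('N)) powr (2 - 1 / \<alpha> - 1 / \<beta>))"
proof -
  define v where "v = unit_ball_vol (real CARD('N)) * s ^ CARD('N)"
  have v: "v > 0" using s by (simp add: v_def)
  define \<alpha>' where "\<alpha>' = \<alpha> / (\<alpha> - 1)"
  have \<alpha>': "\<alpha>' > 1" "1 / \<alpha> + 1 / \<alpha>' = 1" "1 / \<alpha>' = 1 - 1 / \<alpha>" using ab by (auto simp: \<alpha>'_def field_simps)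
  define I where "I y = (\<integral>\<^sup>+z. ennreal (w z powr \<beta>) * indicator (ball y s) z \<partial>lebesgue)" for y
  have [measurable]: "I \<in> borel_measurable lebesgue"
    unfolding I_def[abs_def] by (rule measurable_ball_average) simp
  have IJ: "I y \<le> ennreal J" if "y \<in> ball x R" for y
  proof -
    have "I y \<le> (\<integral>\<^sup>+z. ennreal (w z powr \<beta>) * indicator (ball x (R + s)) z \<partial>lebesgue)"
      unfolding I_def
    proof (rule nn_integral_mono)
      fix z
      have "dist x z < R + s" if "dist y z < s"
        using dist_triangle[of x z y] that \<open>y \<in> ball x R\<close> by simp
      then show "ennreal (w z powr \<beta>) * indicator (ball y s) z \<le> ennreal (w z powr \<beta>) * indicator (ball x (R + s)) z"
        by (auto split: split_indicator)
    qed
    then show ?thesis using wJ by simp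
  qed
  \<comment> \<open>A real valued copy of \<open>I\<close>, set to zero outside the ball of radius
    \<open>R\<close>, where no bound on \<open>I\<close> is at hand.\<close>
  define i where "i y = enn2real (I y) * indicator (ball x R) y" for y
  have [measurable]: "i \<in> borel_measurable lebesgue" unfolding i_def[abs_def] by simp
  have i0: "i y \<ge> 0" for y by (simp add: i_def)
  have iI: "ennreal (i y) = I y * indicator (ball x R) y" for y
  proof (cases "y \<in> ball x R")
    case True
    then have "I y < top" using IJ[OF True] by (meson ennreal_less_top order_le_less_trans)
    then show ?thesis using True by (simp add: i_def)
  qed (simp add: i_def)
  have iJ: "i y \<le> J" for y
  proof (cases "y \<in> ball x R")
    case True
    then have "ennreal (i y) \<le> ennreal J" using IJ[of y] iI[of y] by simp
    then show ?thesis using AJ(2) by (simp add: ennreal_le_iff)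
  qed (use AJ(2) in \<open>simp add: i_def\<close>)
  have W: "(\<integral>\<^sup>+z. ennreal (w z) * indicator (ball y s) z \<partial>lebesgue) \<le> ennreal (i y powr (1 / \<beta>) * v powr (1 - 1 / \<beta>))"
    if "y \<in> ball x R" for y
    unfolding v_def
    by (rule nn_integral_Holder_ball[OF w w0 ab(2) i0]) (use s iI[of y] that in \<open>auto simp: I_def\<close>)
  have "(\<integral>\<^sup>+y. ennreal (u y) * (\<integral>\<^sup>+z. ennreal (w z) * indicator (ball y s) z \<partial>lebesgue) * indicator (ball x R) y \<partial>lebesgue)
     \<le> (\<integral>\<^sup>+y. ennreal (v powr (1 - 1 / \<beta>)) * ennreal ((u y * indicator (ball x R) y) * i y powr (1 / \<beta>)) \<partial>lebesgue)"
  proof (rule nn_integral_mono)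
    fix y
    show "ennreal (u y) * (\<integral>\<^sup>+z. ennreal (w z) * indicator (ball y s) z \<partial>lebesgue) * indicator (ball x R) y
      \<le> ennreal (v powr (1 - 1 / \<beta>)) * ennreal ((u y * indicator (ball x R) y) * i y powr (1 / \<beta>))"
    proof (cases "y \<in> ball x R")
      case True
      have "ennreal (u y) * (\<integral>\<^sup>+z. ennreal (w z) * indicator (ball y s) z \<partial>lebesgue) \<le> ennreal (u y) * ennreal (i y powr (1 / \<beta>) * v powr (1 - 1 / \<beta>))"
        by (rule mult_left_mono[OF W[OF True]]) simp
      also have "\<dots> = ennreal (v powr (1 - 1 / \<beta>)) * ennreal ((u y * indicator (ball x R) y) * i y powr (1 / \<beta>))"
        using True u0[of y] by (simp add: mult_ac flip: ennreal_mult)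
      finally show ?thesis using True by simp
    qed simp
  qed
  also have "\<dots> = ennreal (v powr (1 - 1 / \<beta>)) * (\<integral>\<^sup>+y. ennreal ((u y * indicator (ball x R) y) * i y powr (1 / \<beta>)) \<partial>lebesgue)"
    by (rule nn_integral_cmult) simp
  also have "\<dots> \<le> ennreal (v powr (1 - 1 / \<beta>)) * ennreal (A powr (1 / \<alpha>) * (J powr (\<alpha>' / \<beta>) * v) powr (1 / \<alpha>'))"
  proof (intro mult_left_mono nn_integral_Holder[OF _ _ _ _ ab(1) \<alpha>'(1,2) AJ(1)])
    have "(\<integral>\<^sup>+z. ennreal ((u z * indicator (ball x R) z) powr \<alpha>) \<partial>lebesgue) = (\<integral>\<^sup>+z. ennreal (u z powr \<alpha>) * indicator (ball x R) z \<partial>lebesgue)"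
      using ab by (intro nn_integral_cong) (auto split: split_indicator)
    then show "(\<integral>\<^sup>+z. ennreal ((u z * indicator (ball x R) z) powr \<alpha>) \<partial>lebesgue) \<le> ennreal A" using uA by simp
    \<comment> \<open>This restates \<open>1/\<alpha> + 1/\<beta> >= 1\<close>. It makes the surplus
      power of \<open>i\<close> nonnegative, so that it can be bounded by the same power of
      \<open>J\<close>.\<close>
    have e: "\<alpha>' / \<beta> \<ge> 1"
    proof -
      have "1 / \<alpha>' \<le> 1 / \<beta>" using \<alpha>' ab by simp
      then show ?thesis using \<alpha>'(1) ab(2) by (simp add: field_simps)
    qed
    have "(\<integral>\<^sup>+y. ennreal ((i y powr (1 / \<beta>)) powr \<alpha>') \<partial>lebesgue) \<le> (\<integral>\<^sup>+y. ennreal (J powr (\<alpha>' / \<beta> - 1)) * (I y * indicator (ball x R) y) \<partial>lebesgue)"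
    proof (rule nn_integral_mono)
      fix y
      have "(i y powr (1 / \<beta>)) powr \<alpha>' \<le> J powr (\<alpha>' / \<beta> - 1) * i y"
      proof (cases "i y = 0")
        case False
        then have iy: "i y > 0" using i0[of y] by simp
        have "(i y powr (1 / \<beta>)) powr \<alpha>' = i y powr (\<alpha>' / \<beta> - 1) * i y"
          using iy by (simp add: powr_powr powr_diff)
        also have "\<dots> \<le> J powr (\<alpha>' / \<beta> - 1) * i y"
          using e iJ[of y] iy by (intro mult_right_mono powr_mono2) auto
        finally show ?thesis .
      qed simp
      then have "ennreal ((i y powr (1 / \<beta>)) powr \<alpha>') \<le> ennreal (J powr (\<alpha>' / \<beta> - 1) * i y)" by (rule ennreal_leI)
      also have "\<dots> = ennreal (J powr (\<alpha>' / \<beta> - 1)) * (I y * indicator (ball x R) y)"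
        using i0[of y] by (simp add: ennreal_mult iI)
      finally show "ennreal ((i y powr (1 / \<beta>)) powr \<alpha>') \<le> \<dots>" .
    qed
    also have "\<dots> = ennreal (J powr (\<alpha>' / \<beta> - 1)) * (\<integral>\<^sup>+y. I y * indicator (ball x R) y \<partial>lebesgue)"
      by (rule nn_integral_cmult) simp
    also have "\<dots> \<le> ennreal (J powr (\<alpha>' / \<beta> - 1)) * (ennreal v * ennreal J)"
    proof (intro mult_left_mono)
      have "(\<integral>\<^sup>+y. I y * indicator (ball x R) y \<partial>lebesgue) \<le> ennreal v * (\<integral>\<^sup>+z. ennreal (w z powr \<beta>) * indicator (ball x (R + s)) z \<partial>lebesgue)"
        unfolding I_def v_def by (rule nn_integral_ball_average) (use s in auto)
      also have "\<dots> \<le> ennreal v * ennreal J" by (intro mult_left_mono wJ) simp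
      finally show "(\<integral>\<^sup>+y. I y * indicator (ball x R) y \<partial>lebesgue) \<le> ennreal v * ennreal J" .
    qed simp
    also have "\<dots> = ennreal (J powr (\<alpha>' / \<beta>) * v)"
    proof (cases "J = 0")
      case False
      then have "J powr (\<alpha>' / \<beta>) = J powr (\<alpha>' / \<beta> - 1) * J" using AJ by (simp add: powr_diff)
      then show ?thesis using AJ v by (simp add: mult_ac flip: ennreal_mult)
    qed simp
    finally show "(\<integral>\<^sup>+y. ennreal ((i y powr (1 / \<beta>)) powr \<alpha>') \<partial>lebesgue) \<le> ennreal (J powr (\<alpha>' / \<beta>) * v)" .
  qed (use u0 v AJ in auto)
  also have "\<dots> = ennreal (A powr (1 / \<alpha>) * J powr (1 / \<beta>) * v powr (2 - 1 / \<alpha> - 1 / \<beta>))"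
  proof -
    have "(J powr (\<alpha>' / \<beta>) * v) powr (1 / \<alpha>') = J powr (1 / \<beta>) * v powr (1 - 1 / \<alpha>)"
    proof -
      have "(J powr (\<alpha>' / \<beta>) * v) powr (1 / \<alpha>') = (J powr (\<alpha>' / \<beta>)) powr (1 / \<alpha>') * v powr (1 / \<alpha>')"
        using v by (simp add: powr_mult)
      moreover have "\<alpha>' / \<beta> * (1 / \<alpha>') = 1 / \<beta>" using \<alpha>'(1) by simp
      ultimately show ?thesis by (simp only: powr_powr \<alpha>'(3))
    qed
    moreover have "v powr (2 - 1 / \<alpha> - 1 / \<beta>) = v powr (1 - 1 / \<beta>) * v powr (1 - 1 / \<alpha>)"
      unfolding powr_add[symmetric] by (rule arg_cong[of _ _ "\<lambda>e. v powr e"]) simp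
    ultimately show ?thesis by (simp add: mult_ac flip: ennreal_mult)
  qed
  finally show ?thesis by (simp add: v_def)
qed

lemma norm_conv_le:
  fixes f :: "real^'N::finite \<Rightarrow> complex"
  assumes [measurable]: "w \<in> borel_measurable lebesgue"
    and f: "\<And>z. norm (f z) \<le> w z" and K: "\<And>z. norm (K z) \<le> M" "\<And>z. norm z \<ge> s \<Longrightarrow> K z = 0"
    and M: "M \<ge> 0"
  shows "ennreal (norm (conv f K y)) \<le> ennreal M * (\<integral>\<^sup>+z. ennreal (w z) * indicator (ball y s) z \<partial>lebesgue)"
proof (cases "integrable lebesgue (\<lambda>z. f z * K (y - z))")
  case i: True
  have "ennreal (norm (conv f K y)) \<le> (\<integral>\<^sup>+z. ennreal (norm (f z * K (y - z))) \<partial>lebesgue)"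
    unfolding conv_def by (rule integral_norm_bound_ennreal[OF i])
  also have "\<dots> \<le> (\<integral>\<^sup>+z. ennreal M * (ennreal (w z) * indicator (ball y s) z) \<partial>lebesgue)"
  proof (rule nn_integral_mono)
    fix z
    show "ennreal (norm (f z * K (y - z))) \<le> ennreal M * (ennreal (w z) * indicator (ball y s) z)"
    proof (cases "z \<in> ball y s")
      case True
      have w0: "0 \<le> w z" using f[of z] norm_ge_zero order_trans by blast
      have "norm (f z * K (y - z)) \<le> w z * M"
        unfolding norm_mult by (intro mult_mono f K) (use w0 in auto)
      then show ?thesis using True M w0 by (simp add: mult.commute flip: ennreal_mult)
    next
      case False
      then have "K (y - z) = 0" using K(2)[of "y - z"] by (simp add: dist_norm)
      then show ?thesis by simp
    qed
  qed
  also have "\<dots> = ennreal M * (\<integral>\<^sup>+z. ennreal (w z) * indicator (ball y s) z \<partial>lebesgue)"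
    by (rule nn_integral_cmult) simp
  finally show ?thesis .
next
  case False
  \<comment> \<open>A Bochner integral that does not exist is 0 by convention, which makes the bound
    trivial.\<close>
  then show ?thesis by (simp add: conv_def not_integrable_integral_eq)
qed

section \<open>Oscillation of a gradient modulo the kernel of the system\<close>

lemma smooth_measurable: "smooth f \<Longrightarrow> f \<in> borel_measurable lebesgue"
  by (rule measurable_completion) (simp add: borel_measurable_continuous_onI smooth_continuous_on)

lemma norm_le_of_ennreal:
  "ennreal x \<le> ennreal M * I \<Longrightarrow> I \<le> ennreal J \<Longrightarrow> M \<ge> 0 \<Longrightarrow> J \<ge> 0 \<Longrightarrow> x \<le> M * J"
proof -
  assume *: "ennreal x \<le> ennreal M * I" "I \<le> ennreal J" "M \<ge> 0" "J \<ge> 0"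
  have "ennreal x \<le> ennreal M * ennreal J" using *(1) mult_left_mono[OF *(2), of "ennreal M"] by simp
  then have "ennreal x \<le> ennreal (M * J)" using *(3,4) by (simp add: ennreal_mult)
  then show "x \<le> M * J" using *(3,4) by (simp add: ennreal_le_iff)
qed

lemma dilate_supp:
  assumes "\<And>x. norm x \<ge> L \<Longrightarrow> f x = 0" "t > 0" "norm x \<ge> L * t"
  shows "dilate f t x = 0"
proof -
  have "norm ((1/t) *\<^sub>R x) \<ge> L" using assms(2,3) by (simp add: field_simps)
  then show ?thesis using assms(1) by (simp add: dilate_def)
qed

lemma dilate_bound:
  fixes f :: "real^'N::finite \<Rightarrow> complex"
  assumes "\<And>x. norm (f x) \<le> M" "t > 0"
  shows "norm (dilate f t x) \<le> M / t ^ CARD('N)"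
  using assms by (simp add: dilate_def divide_right_mono)

lemma sum_half_powers_le: "(\<Sum>k<n. (1 / 2 :: real) ^ k) \<le> 2"
proof -
  have "(\<Sum>k<n. (1 / 2 :: real) ^ k) = 2 - 2 * (1/2) ^ n"
    by (induction n) auto
  then show ?thesis by simp
qed

lemma sum_geometric_le:
  fixes x :: real assumes "0 \<le> x" "x < 1" shows "(\<Sum>k=1..m. x ^ k) \<le> 1 / (1 - x)"
proof -
  have "(\<Sum>k=1..m. x ^ k) \<le> (\<Sum>k<Suc m. x ^ k)"
    by (rule sum_mono2) (use assms in auto)
  also have "\<dots> \<le> (\<Sum>k. x ^ k)"
    by (rule sum_le_suminf) (use assms in \<open>auto intro: summable_geometric\<close>)
  also have "\<dots> = 1 / (1 - x)" by (rule suminf_geometric) (use assms in auto)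
  finally show ?thesis .
qed

lemma nn_integral_sum_cmult:
  assumes [measurable]: "\<And>k. p k \<in> borel_measurable M" "v \<in> borel_measurable M"
  shows "(\<integral>\<^sup>+y. (\<Sum>k\<in>I. p k y) + C * v y \<partial>M) = (\<Sum>k\<in>I. \<integral>\<^sup>+y. p k y \<partial>M) + C * (\<integral>\<^sup>+y. v y \<partial>M)"
  by (subst nn_integral_add) (auto simp: nn_integral_sum nn_integral_cmult)

lemma sum_ennreal_plus_mult:
  assumes "\<And>k. f k \<ge> 0" "A \<ge> 0" "B \<ge> 0"
  shows "(\<Sum>k\<in>I. ennreal (f k)) + ennreal A * ennreal B = ennreal ((\<Sum>k\<in>I. f k) + A * B)"
  using assms by (simp add: sum_ennreal sum_nonneg flip: ennreal_mult ennreal_plus)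

text \<open>One radius \<Lambda> and one bound \<open>M\<close> serve all kernels of the system. The
  right inverse \<open>P\<close> expresses linear independence of the fields; it produces a gradient
  with prescribed derivatives along the system. The last condition on the exponents says that the
  small scales gain a positive power of \<open>s / R\<close>.\<close>

locale elliptic_kernel =
  fixes c :: "complex^'N::finite^'n::finite" and \<rho> \<Psi> :: "real^'N \<Rightarrow> complex"
    and P :: "complex^'n^'N" and \<Lambda> M \<alpha> \<beta> :: real
  assumes rho: "test_function \<rho>" and Psi: "test_function \<Psi>"
    and laplace: "\<And>x. (\<Sum>j\<in>UNIV. vfield (c $ j) (vfield (cnj_row (c $ j)) \<Psi>) x) = \<rho> x - dilate \<rho> 2 x"
    and right_inverse: "c ** P = mat 1"
    and L1: "\<Lambda> \<ge> 1" and M0: "M > 0"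
    and rho_bound: "\<And>x. norm (\<rho> x) \<le> M" and rho_supp: "\<And>x. norm x \<ge> \<Lambda> \<Longrightarrow> \<rho> x = 0"
    and kap_bound: "\<And>j x. norm (vfield (cnj_row (c $ j)) \<Psi> x) \<le> M"
    and kap_supp: "\<And>j x. norm x \<ge> \<Lambda> \<Longrightarrow> vfield (cnj_row (c $ j)) \<Psi> x = 0"
    and kap_deriv_supp: "\<And>j k x. norm x \<ge> \<Lambda> \<Longrightarrow> partial k (vfield (cnj_row (c $ j)) \<Psi>) x = 0"
    and kap_taylor: "\<And>j x h. norm (vfield (cnj_row (c $ j)) \<Psi> (x + h) - vfield (cnj_row (c $ j)) \<Psi> x
        - (\<Sum>k\<in>UNIV. h $ k *\<^sub>R partial k (vfield (cnj_row (c $ j)) \<Psi>) x)) \<le> M * norm h ^ 2"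
    and ab: "\<alpha> > 1" "\<beta> > 1" "1 / \<alpha> + 1 / \<beta> \<ge> 1" "real CARD('N) * (1 / \<alpha> + 1 / \<beta> - 1) < 1"
begin

section \<open>Size, support and Taylor expansion of the kernels and pieces at one scale\<close>

abbreviation "K j s \<equiv> scaled_kernel (c $ j) \<Psi> s"

lemma test_K: "s > 0 \<Longrightarrow> test_function (K j s)"
  by (rule test_function_scaled_kernel[OF Psi])

lemma K_eq: "K j s x = (s / s ^ CARD('N)) *\<^sub>R vfield (cnj_row (c $ j)) \<Psi> ((1/s) *\<^sub>R x)"
  by (simp add: scaled_kernel_def dilate_def)

lemma K_bound: assumes "s > 0" shows "norm (K j s x) \<le> s / s ^ CARD('N) * M"
proof -
  have "norm (K j s x) = s / s ^ CARD('N) * norm (vfield (cnj_row (c $ j)) \<Psi> ((1/s) *\<^sub>R x))"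
    unfolding K_eq using assms by simp
  also have "\<dots> \<le> s / s ^ CARD('N) * M" using assms by (intro mult_left_mono kap_bound) auto
  finally show ?thesis .
qed

lemma scale_norm: "s > 0 \<Longrightarrow> norm x \<ge> L * s \<Longrightarrow> norm ((1/s) *\<^sub>R x) \<ge> L" for x :: "real^'N"
  by (simp add: field_simps)

lemma K_supp: "s > 0 \<Longrightarrow> norm x \<ge> \<Lambda> * s \<Longrightarrow> K j s x = 0"
  unfolding K_eq using kap_supp[OF scale_norm] by simp

lemma partial_K:
  assumes "s > 0"
  shows "partial k (K j s) x = (s / s ^ CARD('N) * (1 / s)) *\<^sub>R partial k (vfield (cnj_row (c $ j)) \<Psi>) ((1/s) *\<^sub>R x)"
proof -
  let ?\<kappa> = "vfield (cnj_row (c $ j)) \<Psi>"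
  have T: "test_function ?\<kappa>" by (intro test_function_vfield Psi)
  have "K j s = (\<lambda>x. complex_of_real (s / s ^ CARD('N)) * ?\<kappa> ((1/s) *\<^sub>R x))"
    by (simp add: K_eq fun_eq_iff scaleR_conv_of_real[where 'a=complex] del: of_real_divide)
  moreover have "(\<lambda>x. ?\<kappa> ((1/s) *\<^sub>R x)) differentiable at x"
    using test_function_differentiable[OF test_function_affine[OF T, of "1/s" 0]] assms by simp
  ultimately have "partial k (K j s) x = complex_of_real (s / s ^ CARD('N)) * partial k (\<lambda>x. ?\<kappa> ((1/s) *\<^sub>R x)) x"
    by (simp only: partial_cmult)
  also have "\<dots> = complex_of_real (s / s ^ CARD('N)) * ((1/s) *\<^sub>R partial k ?\<kappa> ((1/s) *\<^sub>R x))"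
    by (subst partial_dilate) (auto intro: test_function_differentiable T)
  finally show ?thesis by (simp only: scaleR_conv_of_real[symmetric, where 'a=complex] scaleR_scaleR)
qed

text \<open>Taylor remainder of first order; its convolution with \<open>G\<close> is the Taylor remainder of the convolution.\<close>

definition K_rem :: "'n \<Rightarrow> real \<Rightarrow> real^'N \<Rightarrow> real^'N \<Rightarrow> complex" where
  "K_rem j s h v = K j s (v + h) - K j s v - (\<Sum>k\<in>UNIV. h $ k *\<^sub>R partial k (K j s) v)"

lemma K_rem_eq:
  assumes "s > 0"
  shows "K_rem j s h v = (s / s ^ CARD('N)) *\<^sub>R (vfield (cnj_row (c $ j)) \<Psi> ((1/s) *\<^sub>R v + (1/s) *\<^sub>R h) - vfield (cnj_row (c $ j)) \<Psi> ((1/s) *\<^sub>R v)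
        - (\<Sum>k\<in>UNIV. ((1/s) *\<^sub>R h) $ k *\<^sub>R partial k (vfield (cnj_row (c $ j)) \<Psi>) ((1/s) *\<^sub>R v)))"
  unfolding K_rem_def partial_K[OF assms] K_eq
  by (simp add: scaleR_diff_right scaleR_sum_right scaleR_add_right mult_ac)

lemma K_rem_bound:
  assumes "s > 0" shows "norm (K_rem j s h v) \<le> s / s ^ CARD('N) * M * (norm h / s) ^ 2"
proof -
  have "norm ((1/s) *\<^sub>R h) = norm h / s" using assms by simp
  then have t: "norm (vfield (cnj_row (c $ j)) \<Psi> ((1/s) *\<^sub>R v + (1/s) *\<^sub>R h) - vfield (cnj_row (c $ j)) \<Psi> ((1/s) *\<^sub>R v)
        - (\<Sum>k\<in>UNIV. ((1/s) *\<^sub>R h) $ k *\<^sub>R partial k (vfield (cnj_row (c $ j)) \<Psi>) ((1/s) *\<^sub>R v))) \<le> M * (norm h / s) ^ 2"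
    using kap_taylor[of j "(1/s) *\<^sub>R v" "(1/s) *\<^sub>R h"] by (simp only:)
  have "0 \<le> s / s ^ CARD('N)" using assms by simp
  with mult_left_mono[OF t this] show ?thesis
    unfolding K_rem_eq[OF assms] norm_scaleR by (simp only: abs_of_nonneg mult.assoc)
qed

lemma K_rem_supp:
  assumes s: "s > 0" and h: "norm h \<le> s" and v: "norm v \<ge> (\<Lambda> + 1) * s"
  shows "K_rem j s h v = 0"
proof -
  have 1: "norm v \<ge> \<Lambda> * s" using v s by (simp add: algebra_simps)
  have "norm v \<le> norm (v + h) + norm h" by (metis add_diff_cancel norm_triangle_ineq4)
  then have 2: "norm (v + h) \<ge> \<Lambda> * s" using v h by (simp add: algebra_simps)
  have "partial k (K j s) v = 0" for k
    unfolding partial_K[OF s] using kap_deriv_supp[OF scale_norm[OF s 1]] by simp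
  then show ?thesis using K_supp[OF s 1] K_supp[OF s 2] by (simp add: K_rem_def)
qed

text \<open>Made of \<open>G\<close> alone, this plays the part of the difference of the
  mollifications of \<phi> at the scales \<open>s\<close> and \<open>2 * s\<close>.\<close>

definition piece :: "(real^'N \<Rightarrow> complex^'n) \<Rightarrow> real \<Rightarrow> real^'N \<Rightarrow> complex" where
  "piece G s y = (\<Sum>j\<in>UNIV. conv (\<lambda>x. G x $ j) (K j s) y)"

lemma norm_piece_le:
  assumes [measurable]: "G \<in> borel_measurable lebesgue" and s: "s > 0"
  shows "ennreal (norm (piece G s y)) \<le> ennreal (real CARD('n) * (s / s ^ CARD('N) * M)) *
    (\<integral>\<^sup>+z. ennreal (norm (G z)) * indicator (ball y (\<Lambda> * s)) z \<partial>lebesgue)"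
proof -
  have "ennreal (norm (piece G s y)) \<le> ennreal (\<Sum>j\<in>UNIV. norm (conv (\<lambda>x. G x $ j) (K j s) y))"
    unfolding piece_def by (intro ennreal_leI norm_sum)
  also have "\<dots> = (\<Sum>j\<in>UNIV. ennreal (norm (conv (\<lambda>x. G x $ j) (K j s) y)))" by (simp add: sum_ennreal)
  also have "\<dots> \<le> (\<Sum>j\<in>(UNIV::'n set). ennreal (s / s ^ CARD('N) * M) * (\<integral>\<^sup>+z. ennreal (norm (G z)) * indicator (ball y (\<Lambda> * s)) z \<partial>lebesgue))"
    by (intro sum_mono norm_conv_le) (use s M0 K_bound K_supp in \<open>auto simp: component_le_norm_cart Finite_Cartesian_Product.norm_nth_le\<close>)
  also have "\<dots> = ennreal (real CARD('n) * (s / s ^ CARD('N) * M)) * (\<integral>\<^sup>+z. ennreal (norm (G z)) * indicator (ball y (\<Lambda> * s)) z \<partial>lebesgue)"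
    using s M0 by (subst ennreal_mult) (auto simp: ennreal_of_nat_eq_real_of_nat mult.assoc)
  finally show ?thesis .
qed

lemma smooth_piece:
  assumes "\<And>j. locally_integrable (\<lambda>x. G x $ j)" "s > 0" shows "smooth (piece G s)"
  unfolding piece_def[abs_def] by (intro smooth_sum smooth_conv assms test_K)

lemma partial_piece:
  assumes "\<And>j. locally_integrable (\<lambda>x. G x $ j)" "s > 0"
  shows "partial k (piece G s) x = (\<Sum>j\<in>UNIV. conv (\<lambda>x. G x $ j) (partial k (K j s)) x)"
  unfolding piece_def[abs_def]
  by (subst partial_sum) (auto intro!: smooth_conv assms test_K sum.cong conv_deriv(2))

text \<open>At \<open>s = 2^l * R\<close> and for \<open>h\<close> of size \<open>R\<close>, the
  kernel size \<open>s\<close> times the factor \<open>(norm h / s)^2\<close> is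
  \<open>R / 2^l\<close>, which is summable in \<open>l\<close>. An expansion of order zero would
  give \<open>R\<close> at every scale. The condition \<open>norm h <= s\<close> keeps the shifted
  kernel within radius \<open>(\<Lambda> + 1) * s\<close>.\<close>

lemma piece_taylor:
  assumes [measurable]: "G \<in> borel_measurable lebesgue" and loc: "\<And>j. locally_integrable (\<lambda>x. G x $ j)"
    and s: "s > 0" and h: "norm h \<le> s"
  shows "ennreal (norm (piece G s (x + h) - piece G s x - (\<Sum>k\<in>UNIV. h $ k *\<^sub>R partial k (piece G s) x)))
    \<le> ennreal (real CARD('n) * (s / s ^ CARD('N) * M * (norm h / s) ^ 2)) *
    (\<integral>\<^sup>+z. ennreal (norm (G z)) * indicator (ball x ((\<Lambda> + 1) * s)) z \<partial>lebesgue)"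
proof -
  have conv_scaleR: "conv f (\<lambda>v. r *\<^sub>R g v) x = r *\<^sub>R conv f g x" for f g :: "real^'N \<Rightarrow> complex" and r x
    using conv_cmult_right[of f "of_real r" g x] by (simp add: scaleR_conv_of_real)
  have "piece G s (x + h) - piece G s x - (\<Sum>k\<in>UNIV. h $ k *\<^sub>R partial k (piece G s) x)
     = (\<Sum>j\<in>UNIV. conv (\<lambda>x. G x $ j) (K_rem j s h) x)"
  proof -
    have "conv (\<lambda>x. G x $ j) (K_rem j s h) x = conv (\<lambda>x. G x $ j) (K j s) (x + h) - conv (\<lambda>x. G x $ j) (K j s) x
        - (\<Sum>k\<in>UNIV. h $ k *\<^sub>R conv (\<lambda>x. G x $ j) (partial k (K j s)) x)" for j
    proof -
      have t1: "test_function (\<lambda>v. K j s (v + h))" using test_function_affine[OF test_K[OF s], where a=1 and b=h] by simp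
      have t2: "test_function (\<lambda>v. h $ k *\<^sub>R partial k (K j s) v)" for k
        by (intro test_function_scaleR test_function_partial test_K s)
      have "conv (\<lambda>x. G x $ j) (K_rem j s h) x = conv (\<lambda>x. G x $ j) (\<lambda>v. K j s (v + h)) x - conv (\<lambda>x. G x $ j) (K j s) x
         - (\<Sum>k\<in>UNIV. conv (\<lambda>x. G x $ j) (\<lambda>v. h $ k *\<^sub>R partial k (K j s) v) x)"
        unfolding K_rem_def[abs_def] using t1 t2 test_K[OF s]
        by (subst conv_diff_right conv_sum_right; (intro loc test_function_diff test_function_sum)?; simp?)+
      moreover have "conv (\<lambda>x. G x $ j) (\<lambda>v. K j s (v + h)) x = conv (\<lambda>x. G x $ j) (K j s) (x + h)"
        by (simp add: conv_def algebra_simps)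
      ultimately show ?thesis by (simp add: conv_scaleR)
    qed
    moreover have "(\<Sum>k\<in>UNIV. h $ k *\<^sub>R partial k (piece G s) x) = (\<Sum>j\<in>UNIV. \<Sum>k\<in>UNIV. h $ k *\<^sub>R conv (\<lambda>x. G x $ j) (partial k (K j s)) x)"
      unfolding partial_piece[OF loc s] scaleR_sum_right by (rule sum.swap)
    ultimately show ?thesis by (simp add: piece_def sum_subtractf)
  qed
  then have "ennreal (norm (piece G s (x + h) - piece G s x - (\<Sum>k\<in>UNIV. h $ k *\<^sub>R partial k (piece G s) x)))
     \<le> ennreal (\<Sum>j\<in>UNIV. norm (conv (\<lambda>x. G x $ j) (K_rem j s h) x))"
    by (simp only:) (intro ennreal_leI norm_sum)
  also have "\<dots> = (\<Sum>j\<in>UNIV. ennreal (norm (conv (\<lambda>x. G x $ j) (K_rem j s h) x)))" by (simp add: sum_ennreal)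
  also have "\<dots> \<le> (\<Sum>j\<in>(UNIV::'n set). ennreal (s / s ^ CARD('N) * M * (norm h / s) ^ 2) * (\<integral>\<^sup>+z. ennreal (norm (G z)) * indicator (ball x ((\<Lambda> + 1) * s)) z \<partial>lebesgue))"
    by (intro sum_mono norm_conv_le) (use s h M0 K_rem_bound[OF s] K_rem_supp in \<open>auto simp: Finite_Cartesian_Product.norm_nth_le\<close>)
  also have "\<dots> = ennreal (real CARD('n) * (s / s ^ CARD('N) * M * (norm h / s) ^ 2)) * (\<integral>\<^sup>+z. ennreal (norm (G z)) * indicator (ball x ((\<Lambda> + 1) * s)) z \<partial>lebesgue)"
    using s M0 by (subst ennreal_mult) (auto simp: ennreal_of_nat_eq_real_of_nat mult.assoc)
  finally show ?thesis .
qed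

section \<open>Small and large scales on a ball of radius R\<close>

lemma ball_mean_le:
  fixes f :: "real^'N \<Rightarrow> real"
  assumes "f \<in> borel_measurable lebesgue" "\<And>x. f x \<ge> 0" and p: "p > 1" and b: "b \<ge> 0" and r: "r > 0"
    and "(\<integral>\<^sup>+z. ennreal (f z powr p) * indicator (ball x r) z \<partial>lebesgue) \<le> ennreal (b * r ^ CARD('N))"
  shows "(\<integral>\<^sup>+z. ennreal (f z) * indicator (ball x r) z \<partial>lebesgue) \<le> ennreal (b powr (1 / p) * unit_ball_vol (real CARD('N)) powr (1 - 1 / p) * r ^ CARD('N))"
proof -
  have "(b * r ^ CARD('N)) powr (1 / p) * (unit_ball_vol (real CARD('N)) * r ^ CARD('N)) powr (1 - 1 / p)
     = b powr (1 / p) * unit_ball_vol (real CARD('N)) powr (1 - 1 / p) * ((r ^ CARD('N)) powr (1 / p) * (r ^ CARD('N)) powr (1 - 1 / p))"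
    using b r by (simp add: powr_mult)
  also have "(r ^ CARD('N)) powr (1 / p) * (r ^ CARD('N)) powr (1 - 1 / p) = r ^ CARD('N)"
    using r by (simp flip: powr_add)
  finally show ?thesis
    using nn_integral_Holder_ball[OF assms(1,2) p _ _ assms(6)] b r by simp
qed

text \<open>Collects the number of kernels, their bound, the passage from radius \<open>R\<close> to
  \<open>(1 + \<Lambda>) * R\<close> in the mean of \<open>G\<close>, and the volume factor of
  Young's inequality.\<close>

definition small_const :: real where
  "small_const = real CARD('n) * M * ((1 + \<Lambda>) ^ CARD('N)) powr (1 / \<beta>) * (unit_ball_vol (real CARD('N)) * \<Lambda> ^ CARD('N)) powr (2 - 1 / \<alpha> - 1 / \<beta>)"

text \<open>The kernel has size \<open>s^(1-N)\<close> and Young's inequality contributes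
  \<open>s\<close> to the power \<open>N * (2 - 1/\<alpha> - 1/\<beta>)\<close>. Together they give
  the exponent of \<open>s / R\<close>, which is positive by the choice of \<alpha> and
  \<beta>.\<close>

lemma small_scale:
  assumes G [measurable]: "G \<in> borel_measurable lebesgue" and u [measurable]: "u \<in> borel_measurable lebesgue"
    and u0: "\<And>x. u x \<ge> 0" and s: "0 < s" "s \<le> R" and a: "a \<ge> 0" and b: "b \<ge> 0"
    and Ha: "\<And>r. r > 0 \<Longrightarrow> (\<integral>\<^sup>+z. ennreal (u z powr \<alpha>) * indicator (ball x r) z \<partial>lebesgue) \<le> ennreal (a * r ^ CARD('N))"
    and Hb: "\<And>r. r > 0 \<Longrightarrow> (\<integral>\<^sup>+z. ennreal (norm (G z) powr \<beta>) * indicator (ball x r) z \<partial>lebesgue) \<le> ennreal (b * r ^ CARD('N))"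
  shows "(\<integral>\<^sup>+y. ennreal (u y * norm (piece G s y)) * indicator (ball x R) y \<partial>lebesgue)
    \<le> ennreal (small_const * (s / R) powr (1 - real CARD('N) * (1 / \<alpha> + 1 / \<beta> - 1)) * R ^ (CARD('N) + 1) * a powr (1 / \<alpha>) * b powr (1 / \<beta>))"
proof -
  have R: "R > 0" using s by simp
  let ?C = "real CARD('n) * (s / s ^ CARD('N) * M)"
  have C0: "?C \<ge> 0" using s M0 by simp
  have "(\<integral>\<^sup>+y. ennreal (u y * norm (piece G s y)) * indicator (ball x R) y \<partial>lebesgue)
    \<le> (\<integral>\<^sup>+y. ennreal ?C * (ennreal (u y) * (\<integral>\<^sup>+z. ennreal (norm (G z)) * indicator (ball y (\<Lambda> * s)) z \<partial>lebesgue) * indicator (ball x R) y) \<partial>lebesgue)"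
  proof (rule nn_integral_mono)
    fix y
    have "ennreal (u y * norm (piece G s y)) * indicator (ball x R) y = ennreal (u y) * ennreal (norm (piece G s y)) * indicator (ball x R) y"
      using u0[of y] by (simp add: ennreal_mult)
    also have "\<dots> \<le> ennreal (u y) * (ennreal ?C * (\<integral>\<^sup>+z. ennreal (norm (G z)) * indicator (ball y (\<Lambda> * s)) z \<partial>lebesgue)) * indicator (ball x R) y"
      by (intro mult_right_mono mult_left_mono norm_piece_le G s) auto
    finally show "ennreal (u y * norm (piece G s y)) * indicator (ball x R) y
      \<le> ennreal ?C * (ennreal (u y) * (\<integral>\<^sup>+z. ennreal (norm (G z)) * indicator (ball y (\<Lambda> * s)) z \<partial>lebesgue) * indicator (ball x R) y)"
      by (simp add: mult_ac)
  qed
  also have "\<dots> = ennreal ?C * (\<integral>\<^sup>+y. ennreal (u y) * (\<integral>\<^sup>+z. ennreal (norm (G z)) * indicator (ball y (\<Lambda> * s)) z \<partial>lebesgue) * indicator (ball x R) y \<partial>lebesgue)"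
    by (rule nn_integral_cmult) (use measurable_ball_average[of "\<lambda>z. ennreal (norm (G z))" "\<Lambda> * s"] in measurable)
  also have "\<dots> \<le> ennreal ?C * ennreal ((a * R ^ CARD('N)) powr (1 / \<alpha>) * (b * ((1 + \<Lambda>) * R) ^ CARD('N)) powr (1 / \<beta>) * (unit_ball_vol (real CARD('N)) * (\<Lambda> * s) ^ CARD('N)) powr (2 - 1 / \<alpha> - 1 / \<beta>))"
  proof (intro mult_left_mono nn_integral_Young_ball ab)
    show "(\<integral>\<^sup>+z. ennreal (u z powr \<alpha>) * indicator (ball x R) z \<partial>lebesgue) \<le> ennreal (a * R ^ CARD('N))" by (rule Ha[OF R])
    have "(\<integral>\<^sup>+z. ennreal (norm (G z) powr \<beta>) * indicator (ball x (R + \<Lambda> * s)) z \<partial>lebesgue)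
      \<le> (\<integral>\<^sup>+z. ennreal (norm (G z) powr \<beta>) * indicator (ball x ((1 + \<Lambda>) * R)) z \<partial>lebesgue)"
    proof (intro nn_integral_mono mult_left_mono)
      fix z
      have "R + \<Lambda> * s \<le> (1 + \<Lambda>) * R" using s L1 by (simp add: algebra_simps mult_left_mono)
      then show "indicator (ball x (R + \<Lambda> * s)) z \<le> (indicator (ball x ((1 + \<Lambda>) * R)) z :: ennreal)"
        by (auto split: split_indicator)
    qed auto
    also have "\<dots> \<le> ennreal (b * ((1 + \<Lambda>) * R) ^ CARD('N))" using R L1 by (intro Hb) auto
    finally show "(\<integral>\<^sup>+z. ennreal (norm (G z) powr \<beta>) * indicator (ball x (R + \<Lambda> * s)) z \<partial>lebesgue) \<le> ennreal (b * ((1 + \<Lambda>) * R) ^ CARD('N))" .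
  qed (use u0 a b R L1 s in auto)
  also have "\<dots> = ennreal (small_const * (s / R) powr (1 - real CARD('N) * (1 / \<alpha> + 1 / \<beta> - 1)) * R ^ (CARD('N) + 1) * a powr (1 / \<alpha>) * b powr (1 / \<beta>))"
  proof -
    let ?e = "2 - 1 / \<alpha> - 1 / \<beta>"
    have 1: "(a * R ^ CARD('N)) powr (1 / \<alpha>) = a powr (1 / \<alpha>) * R powr (real CARD('N) / \<alpha>)"
      using a R by (simp add: powr_mult powr_powr flip: powr_realpow)
    have 2: "(b * ((1 + \<Lambda>) * R) ^ CARD('N)) powr (1 / \<beta>) = b powr (1 / \<beta>) * (((1 + \<Lambda>) ^ CARD('N)) powr (1 / \<beta>) * R powr (real CARD('N) / \<beta>))"
      using b R L1 by (simp add: powr_mult powr_powr power_mult_distrib flip: powr_realpow)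
    have 3: "(unit_ball_vol (real CARD('N)) * (\<Lambda> * s) ^ CARD('N)) powr ?e = (unit_ball_vol (real CARD('N)) * \<Lambda> ^ CARD('N)) powr ?e * s powr (real CARD('N) * ?e)"
    proof -
      have "unit_ball_vol (real CARD('N)) * (\<Lambda> * s) ^ CARD('N) = (unit_ball_vol (real CARD('N)) * \<Lambda> ^ CARD('N)) * s powr real CARD('N)"
        using s by (simp add: power_mult_distrib powr_realpow)
      then show ?thesis using s L1 by (simp only: powr_mult powr_powr)
    qed
    have 4: "s / s ^ CARD('N) = s powr (1 - real CARD('N))" using s by (simp add: powr_diff powr_realpow)
    have 5: "s powr (1 - real CARD('N)) * s powr (real CARD('N) * ?e) = s powr (1 - real CARD('N) * (1 / \<alpha> + 1 / \<beta> - 1))"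
      unfolding powr_add[symmetric] by (rule arg_cong[of _ _ "\<lambda>e. s powr e"]) (simp add: algebra_simps)
    have 6: "R powr (real CARD('N) / \<alpha>) * R powr (real CARD('N) / \<beta>) = R ^ (CARD('N) + 1) / R powr (1 - real CARD('N) * (1 / \<alpha> + 1 / \<beta> - 1))"
    proof -
      have "R ^ (CARD('N) + 1) = R powr real (CARD('N) + 1)" using R by (simp only: powr_realpow)
      moreover have "real CARD('N) / \<alpha> + real CARD('N) / \<beta> = real (CARD('N) + 1) - (1 - real CARD('N) * (1 / \<alpha> + 1 / \<beta> - 1))" by (simp add: algebra_simps)
      ultimately show ?thesis by (simp only: powr_add[symmetric] powr_diff[symmetric])
    qed
    have "?C * ((a * R ^ CARD('N)) powr (1 / \<alpha>) * (b * ((1 + \<Lambda>) * R) ^ CARD('N)) powr (1 / \<beta>) * (unit_ball_vol (real CARD('N)) * (\<Lambda> * s) ^ CARD('N)) powr ?e)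
      = small_const * ((s powr (1 - real CARD('N)) * s powr (real CARD('N) * ?e)) * (R powr (real CARD('N) / \<alpha>) * R powr (real CARD('N) / \<beta>))) * a powr (1 / \<alpha>) * b powr (1 / \<beta>)"
      unfolding 1 2 3 4 small_const_def by (simp only: mult_ac)
    also have "\<dots> = small_const * (s / R) powr (1 - real CARD('N) * (1 / \<alpha> + 1 / \<beta> - 1)) * R ^ (CARD('N) + 1) * a powr (1 / \<alpha>) * b powr (1 / \<beta>)"
      unfolding 5 6 using s R by (simp add: powr_divide)
    finally show ?thesis using C0 by (simp flip: ennreal_mult)
  qed
  finally show ?thesis .
qed

definition P_norm :: real where "P_norm = (\<Sum>k\<in>UNIV. \<Sum>i\<in>UNIV. norm (P $ k $ i))"

text \<open>The quotient sums the geometric series over the scales below \<open>R\<close>. In the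
  other term, 2 bounds the sum of \<open>2^(-l)\<close> over the Taylor remainders, and
  \<open>P_norm\<close> times the bound for two mollifications of \<open>G\<close> accounts for the
  correction of the affine part.\<close>

definition osc_const :: real where
  "osc_const = small_const / (1 - 2 powr (- (1 - real CARD('N) * (1 / \<alpha> + 1 / \<beta> - 1)))) +
     (2 * real CARD('n) * M * (\<Lambda> + 1) ^ CARD('N) + P_norm * (2 * M * \<Lambda> ^ CARD('N))) * unit_ball_vol (real CARD('N)) powr (1 - 1 / \<beta>) * unit_ball_vol (real CARD('N)) powr (1 - 1 / \<alpha>)"

lemma small_const_nonneg: "small_const \<ge> 0"
  unfolding small_const_def using M0 by (intro mult_nonneg_nonneg) auto

lemma powr_theta_less: "2 powr (- (1 - real CARD('N) * (1 / \<alpha> + 1 / \<beta> - 1))) < (1::real)"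
  using ab(4) powr_less_mono[of "-(1 - real CARD('N) * (1 / \<alpha> + 1 / \<beta> - 1))" 0 2] by simp

lemma norm_conv_rho_le:
  assumes [measurable]: "G \<in> borel_measurable lebesgue" and s: "s > 0" and b: "b \<ge> 0"
    and Hb: "\<And>r. r > 0 \<Longrightarrow> (\<integral>\<^sup>+z. ennreal (norm (G z) powr \<beta>) * indicator (ball x r) z \<partial>lebesgue) \<le> ennreal (b * r ^ CARD('N))"
  shows "norm (conv (\<lambda>x. G x $ i) (dilate \<rho> s) x) \<le> M * \<Lambda> ^ CARD('N) * (b powr (1 / \<beta>) * unit_ball_vol (real CARD('N)) powr (1 - 1 / \<beta>))"
proof -
  have "ennreal (norm (conv (\<lambda>x. G x $ i) (dilate \<rho> s) x)) \<le> ennreal (M / s ^ CARD('N)) * (\<integral>\<^sup>+z. ennreal (norm (G z)) * indicator (ball x (\<Lambda> * s)) z \<partial>lebesgue)"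
    by (rule norm_conv_le) (use s M0 dilate_bound[of \<rho> M s] dilate_supp[of \<Lambda> \<rho> s] rho_bound rho_supp in \<open>auto simp: Finite_Cartesian_Product.norm_nth_le\<close>)
  from norm_le_of_ennreal[OF this ball_mean_le[OF _ _ ab(2) b _ Hb]]
  have "norm (conv (\<lambda>x. G x $ i) (dilate \<rho> s) x) \<le> M / s ^ CARD('N) * (b powr (1 / \<beta>) * unit_ball_vol (real CARD('N)) powr (1 - 1 / \<beta>) * (\<Lambda> * s) ^ CARD('N))"
    using s M0 L1 by simp
  also have "\<dots> = M * \<Lambda> ^ CARD('N) * (b powr (1 / \<beta>) * unit_ball_vol (real CARD('N)) powr (1 - 1 / \<beta>))" using s by (simp add: power_mult_distrib)
  finally show ?thesis .
qed

lemma piece_taylor_ball: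
  assumes [measurable]: "G \<in> borel_measurable lebesgue" and loc: "\<And>j. locally_integrable (\<lambda>x. G x $ j)"
    and R: "R > 0" and h: "norm h \<le> R" and b: "b \<ge> 0"
    and Hb: "\<And>r. r > 0 \<Longrightarrow> (\<integral>\<^sup>+z. ennreal (norm (G z) powr \<beta>) * indicator (ball x r) z \<partial>lebesgue) \<le> ennreal (b * r ^ CARD('N))"
  shows "norm (piece G (2 ^ l * R) (x + h) - piece G (2 ^ l * R) x - (\<Sum>k\<in>UNIV. h $ k *\<^sub>R partial k (piece G (2 ^ l * R)) x))
    \<le> (1 / 2) ^ l * (R * (real CARD('n) * M * (\<Lambda> + 1) ^ CARD('N) * (b powr (1 / \<beta>) * unit_ball_vol (real CARD('N)) powr (1 - 1 / \<beta>))))"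
    (is "norm ?T \<le> _")
proof -
  let ?s = "2 ^ l * R" and ?B = "b powr (1 / \<beta>) * unit_ball_vol (real CARD('N)) powr (1 - 1 / \<beta>)"
  have s: "?s > 0" using R by simp
  have hs: "norm h \<le> ?s" 
  proof -
    have "1 * R \<le> 2 ^ l * R" by (rule mult_right_mono) (use R in auto)
    then show ?thesis using h by linarith
  qed
  have "norm ?T \<le> (real CARD('n) * (?s / ?s ^ CARD('N) * M * (norm h / ?s) ^ 2)) * (?B * ((\<Lambda> + 1) * ?s) ^ CARD('N))"
    by (rule norm_le_of_ennreal[OF piece_taylor[OF _ loc s hs] ball_mean_le[OF _ _ ab(2) b _ Hb]]) (use s M0 L1 in auto)
  also have "\<dots> = real CARD('n) * M * (\<Lambda> + 1) ^ CARD('N) * ?B * (?s * (norm h / ?s) ^ 2)"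
    using s by (simp add: power_mult_distrib)
  also have "\<dots> \<le> real CARD('n) * M * (\<Lambda> + 1) ^ CARD('N) * ?B * (?s * (R / ?s) ^ 2)"
    using s h M0 L1 by (intro mult_left_mono power_mono divide_right_mono) auto
  also have "?s * (R / ?s) ^ 2 = (1 / 2) ^ l * R" using R by (simp add: power2_eq_square power_divide)
  finally show ?thesis by (simp add: mult_ac)
qed

lemma vfield_sum: "(\<And>i. i \<in> I \<Longrightarrow> smooth (f i)) \<Longrightarrow> vfield a (\<lambda>x. \<Sum>i\<in>I. f i x) y = (\<Sum>i\<in>I. vfield a (f i) y)"
  unfolding vfield_def by (simp add: partial_sum sum_distrib_left sum.swap[of _ I])

lemma vfield_piece:
  assumes G: "has_distr_gradient c \<phi> G" and loc: "\<And>j. locally_integrable (\<lambda>x. G x $ j)" and s: "s > 0"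
  shows "vfield (c $ i) (piece G s) y = conv (\<lambda>x. G x $ i) (dilate \<rho> s) y - conv (\<lambda>x. G x $ i) (dilate \<rho> (2 * s)) y"
  unfolding piece_def[abs_def] by (rule vfield_telescope[OF G loc Psi rho laplace s])

text \<open>The substitute for a Poincare inequality modulo null solutions: the mean of
  \<open>u\<close> times \<open>norm (E y)\<close> is controlled by \<open>R\<close> times means of
  \<open>u\<close> and \<open>G\<close>. The bound does not depend on the numbers \<open>m\<close>
  and \<open>n\<close> of scales, thanks to the affine null solution that is subtracted.\<close>

lemma oscillation:
  assumes dG: "has_distr_gradient c \<phi> G" and loc: "\<And>j. locally_integrable (\<lambda>x. G x $ j)"
    and G [measurable]: "G \<in> borel_measurable lebesgue" and u [measurable]: "u \<in> borel_measurable lebesgue"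
    and u0: "\<And>x. u x \<ge> 0" and R: "0 < R" and a: "a \<ge> 0" and b: "b \<ge> 0"
    and Ha: "\<And>r. r > 0 \<Longrightarrow> (\<integral>\<^sup>+z. ennreal (u z powr \<alpha>) * indicator (ball x r) z \<partial>lebesgue) \<le> ennreal (a * r ^ CARD('N))"
    and Hb: "\<And>r. r > 0 \<Longrightarrow> (\<integral>\<^sup>+z. ennreal (norm (G z) powr \<beta>) * indicator (ball x r) z \<partial>lebesgue) \<le> ennreal (b * r ^ CARD('N))"
  obtains E where "smooth E"
    "\<And>i y. vfield (c $ i) E y = conv (\<lambda>x. G x $ i) (dilate \<rho> (R / 2 ^ m)) y - conv (\<lambda>x. G x $ i) (dilate \<rho> (2 ^ n * R)) y"
    "(\<integral>\<^sup>+y. ennreal (u y * norm (E y)) * indicator (ball x R) y \<partial>lebesgue)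
      \<le> ennreal (osc_const * R ^ (CARD('N) + 1) * a powr (1 / \<alpha>) * b powr (1 / \<beta>))"
proof -
  let ?g = "\<lambda>i s y. conv (\<lambda>x. G x $ i) (dilate \<rho> s) y"
  define B0 where "B0 = b powr (1 / \<beta>) * unit_ball_vol (real CARD('N)) powr (1 - 1 / \<beta>)"
  have B0: "B0 \<ge> 0" by (simp add: B0_def)
  define Es where "Es y = (\<Sum>k=1..m. piece G (R / 2 ^ k) y)" for y
  define Eb where "Eb y = (\<Sum>k<n. piece G (2 ^ k * R) y)" for y
  have sm_small: "smooth (piece G (R / 2 ^ k))" and sm_big: "smooth (piece G (2 ^ k * R))" for k
    using R by (auto intro!: smooth_piece loc)
  have sEs: "smooth Es" and sEb: "smooth Eb"
    unfolding Es_def[abs_def] Eb_def[abs_def] by (intro smooth_sum sm_small sm_big)+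
  have vEs: "vfield (c $ i) Es y = ?g i (R / 2 ^ m) y - ?g i R y" for i y
  proof -
    have "vfield (c $ i) Es y = (\<Sum>k=1..m. ?g i (R / 2 ^ k) y - ?g i (2 * (R / 2 ^ k)) y)"
      unfolding Es_def[abs_def] using R by (subst vfield_sum) (auto simp: vfield_piece[OF dG loc] sm_small)
    also have "\<dots> = ?g i (R / 2 ^ m) y - ?g i R y" by (induction m) auto
    finally show ?thesis .
  qed
  have vEb: "vfield (c $ i) Eb y = ?g i R y - ?g i (2 ^ n * R) y" for i y
  proof -
    have "vfield (c $ i) Eb y = (\<Sum>k<n. ?g i (2 ^ k * R) y - ?g i (2 * (2 ^ k * R)) y)"
      unfolding Eb_def[abs_def] using R by (subst vfield_sum) (auto simp: vfield_piece[OF dG loc] sm_big)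
    also have "\<dots> = ?g i R y - ?g i (2 ^ n * R) y" by (induction n) (auto simp: mult.assoc)
    finally show ?thesis .
  qed
  \<comment> \<open>\<open>D\<close> is the gradient of the large scales at the centre, for which no
    bound uniform in \<open>n\<close> is at hand. Its image under \<open>c\<close> is a difference
    of two mollifications of \<open>G\<close> and hence bounded. \<open>Q\<close> has the same image
    under \<open>c\<close> and inherits a bound through \<open>P\<close>.\<close>
  define D where "D = (\<chi> k. partial k Eb x)"
  define Q where "Q = P *v (c *v D)"
  have cD: "(c *v D) $ i = vfield (c $ i) Eb x" for i
    by (simp add: D_def matrix_vector_mult_def vfield_def)
  have cD_le: "norm ((c *v D) $ i) \<le> 2 * M * \<Lambda> ^ CARD('N) * B0" for i
  proof -
    have "norm (?g i R x) \<le> M * \<Lambda> ^ CARD('N) * B0" "norm (?g i (2 ^ n * R) x) \<le> M * \<Lambda> ^ CARD('N) * B0"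
      unfolding B0_def using R by (auto intro!: norm_conv_rho_le b Hb)
    then show ?thesis unfolding cD vEb using norm_triangle_ineq4[of "?g i R x" "?g i (2 ^ n * R) x"] by simp
  qed
  have Q_le: "(\<Sum>k\<in>UNIV. norm (Q $ k)) \<le> P_norm * (2 * M * \<Lambda> ^ CARD('N) * B0)"
  proof -
    have "norm (Q $ k) \<le> (\<Sum>i\<in>UNIV. norm (P $ k $ i) * (2 * M * \<Lambda> ^ CARD('N) * B0))" for k
      unfolding Q_def matrix_vector_mult_def[of P] by (auto intro!: sum_norm_le mult_left_mono cD_le simp: norm_mult)
    then have "(\<Sum>k\<in>UNIV. norm (Q $ k)) \<le> (\<Sum>k\<in>UNIV. \<Sum>i\<in>UNIV. norm (P $ k $ i) * (2 * M * \<Lambda> ^ CARD('N) * B0))"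
      by (rule sum_mono)
    then show ?thesis by (simp add: P_norm_def sum_distrib_right)
  qed
  have cDQ: "(\<Sum>k\<in>UNIV. c $ i $ k * (D - Q) $ k) = 0" for i
  proof -
    have "c *v (D - Q) = 0"
      by (simp add: Q_def matrix_vector_mult_diff_distrib matrix_vector_mul_assoc matrix_mul_assoc right_inverse)
    then have "(c *v (D - Q)) $ i = 0" by simp
    then show ?thesis by (simp add: matrix_vector_mult_def)
  qed
  \<comment> \<open>The affine function with value \<open>Eb x\<close> at \<open>x\<close> and
    gradient \<open>D - Q\<close>, a vector annihilated by \<open>c\<close>.\<close>
  define A where "A y = (\<Sum>k\<in>UNIV. (D - Q) $ k * of_real (y $ k)) + (Eb x - (\<Sum>k\<in>UNIV. (D - Q) $ k * of_real (x $ k)))" for y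
  have s_lin: "smooth (\<lambda>y. (D - Q) $ k * of_real (y $ k))" for k by (intro smooth_cmult smooth_coord)
  have sA: "smooth A" unfolding A_def[abs_def] by (intro smooth_add smooth_sum s_lin smooth_const)
  have vA: "vfield (c $ i) A y = 0" for i y
  proof -
    have "partial k A y = (D - Q) $ k" for k
    proof -
      have "partial k A y = partial k (\<lambda>y. \<Sum>k\<in>UNIV. (D - Q) $ k * of_real (y $ k)) y + partial k (\<lambda>_. Eb x - (\<Sum>k\<in>UNIV. (D - Q) $ k * of_real (x $ k))) y"
        unfolding A_def[abs_def] by (intro partial_add smooth_differentiable smooth_sum s_lin smooth_const)
      also have "partial k (\<lambda>_. Eb x - (\<Sum>k\<in>UNIV. (D - Q) $ k * of_real (x $ k))) y = 0"
        by (rule partial_eqI[of _ "\<lambda>_. 0"]) simp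
      also have "partial k (\<lambda>y. \<Sum>k\<in>UNIV. (D - Q) $ k * of_real (y $ k)) y = (\<Sum>l\<in>UNIV. (D - Q) $ l * of_real (axis k 1 $ l))"
        by (subst partial_sum[OF s_lin]) (simp add: partial_cmult coord_differentiable partial_coord)
      also have "\<dots> = (\<Sum>l\<in>UNIV. if l = k then (D - Q) $ l else 0)" by (intro sum.cong) (auto simp: axis_def)
      finally show ?thesis by simp
    qed
    then show ?thesis unfolding vfield_def using cDQ by simp
  qed
  define E where "E y = Es y + (Eb y - A y)" for y
  have sE: "smooth E" unfolding E_def[abs_def] by (intro smooth_add smooth_diff sEs sEb sA)
  have vE: "vfield (c $ i) E y = ?g i (R / 2 ^ m) y - ?g i (2 ^ n * R) y" for i y
  proof -
    have "partial k E y = partial k Es y + (partial k Eb y + (-1) * partial k A y)" for k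
    proof -
      have E_eq: "E = (\<lambda>y. Es y + (Eb y + (-1) * A y))" by (simp add: E_def fun_eq_iff)
      show ?thesis unfolding E_eq
        by (simp only: partial_add partial_cmult smooth_differentiable smooth_add smooth_cmult sEs sEb sA)
    qed
    then have "vfield (c $ i) E y = vfield (c $ i) Es y + (vfield (c $ i) Eb y - vfield (c $ i) A y)"
      by (simp add: vfield_def sum.distrib sum_subtractf right_diff_distrib distrib_left)
    then show ?thesis by (simp add: vEs vEb vA)
  qed
  let ?T = "2 * real CARD('n) * M * (\<Lambda> + 1) ^ CARD('N) + P_norm * (2 * M * \<Lambda> ^ CARD('N))"
  have P0: "P_norm \<ge> 0" unfolding P_norm_def by (intro sum_nonneg) auto
  have T0: "?T \<ge> 0" using M0 L1 P0 by simp
  have big: "norm (Eb y - A y) \<le> R * (?T * B0)" if y: "y \<in> ball x R" for y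
  proof -
    define h where "h = y - x"
    have h: "norm h \<le> R" "y = x + h" using y by (auto simp: h_def dist_norm norm_minus_commute)
    have "partial k Eb x = (\<Sum>l<n. partial k (piece G (2 ^ l * R)) x)" for k
      unfolding Eb_def[abs_def] by (rule partial_sum) (rule sm_big)
    then have sumD: "(\<Sum>k\<in>UNIV. h $ k *\<^sub>R D $ k) = (\<Sum>l<n. \<Sum>k\<in>UNIV. h $ k *\<^sub>R partial k (piece G (2 ^ l * R)) x)"
      by (simp add: D_def scaleR_sum_right) (rule sum.swap)
    have Ay: "A y = Eb x + (\<Sum>k\<in>UNIV. h $ k *\<^sub>R D $ k) - (\<Sum>k\<in>UNIV. h $ k *\<^sub>R Q $ k)"
      unfolding A_def h_def by (simp add: scaleR_conv_of_real[where 'a=complex] algebra_simps sum.distrib sum_subtractf)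
    \<comment> \<open>What remains after subtracting \<open>A\<close> are the Taylor remainders of
      the single pieces and the linear term with gradient \<open>Q\<close>.\<close>
    have eq: "Eb y - A y = (\<Sum>l<n. piece G (2 ^ l * R) (x + h) - piece G (2 ^ l * R) x - (\<Sum>k\<in>UNIV. h $ k *\<^sub>R partial k (piece G (2 ^ l * R)) x))
        + (\<Sum>k\<in>UNIV. h $ k *\<^sub>R Q $ k)"
      unfolding Ay sumD by (simp add: Eb_def h(2) sum_subtractf)
    have 1: "norm (\<Sum>l<n. piece G (2 ^ l * R) (x + h) - piece G (2 ^ l * R) x - (\<Sum>k\<in>UNIV. h $ k *\<^sub>R partial k (piece G (2 ^ l * R)) x))
        \<le> (\<Sum>l<n. (1 / 2) ^ l * (R * (real CARD('n) * M * (\<Lambda> + 1) ^ CARD('N) * B0)))"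
      unfolding B0_def by (rule sum_norm_le) (rule piece_taylor_ball[OF G loc R h(1) b Hb])
    have 2: "(\<Sum>l<n. (1 / 2) ^ l * (R * (real CARD('n) * M * (\<Lambda> + 1) ^ CARD('N) * B0))) \<le> 2 * (R * (real CARD('n) * M * (\<Lambda> + 1) ^ CARD('N) * B0))"
      unfolding sum_distrib_right[symmetric] using R M0 L1 B0 by (intro mult_right_mono sum_half_powers_le) auto
    have 3: "norm (\<Sum>k\<in>UNIV. h $ k *\<^sub>R Q $ k) \<le> (\<Sum>k\<in>UNIV. R * norm (Q $ k))"
    proof (rule sum_norm_le)
      fix k
      have "\<bar>h $ k\<bar> \<le> R" using component_le_norm_cart[of h k] h(1) by simp
      then show "norm (h $ k *\<^sub>R Q $ k) \<le> R * norm (Q $ k)" by (simp add: mult_right_mono)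
    qed
    have 4: "(\<Sum>k\<in>UNIV. R * norm (Q $ k)) \<le> R * (P_norm * (2 * M * \<Lambda> ^ CARD('N) * B0))"
      unfolding sum_distrib_left[symmetric] using R by (intro mult_left_mono Q_le) auto
    have "norm (Eb y - A y) \<le> 2 * (R * (real CARD('n) * M * (\<Lambda> + 1) ^ CARD('N) * B0)) + R * (P_norm * (2 * M * \<Lambda> ^ CARD('N) * B0))"
      unfolding eq by (rule order_trans[OF norm_triangle_ineq add_mono]) (use 1 2 3 4 in linarith)+
    also have "\<dots> = R * (?T * B0)" by (simp add: algebra_simps)
    finally show ?thesis .
  qed
  have meas_piece [measurable]: "piece G (R / 2 ^ k) \<in> borel_measurable lebesgue" for k
    by (rule smooth_measurable[OF sm_small])
  have "(\<integral>\<^sup>+y. ennreal (u y * norm (E y)) * indicator (ball x R) y \<partial>lebesgue)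
    \<le> (\<integral>\<^sup>+y. (\<Sum>k=1..m. ennreal (u y * norm (piece G (R / 2 ^ k) y)) * indicator (ball x R) y) + ennreal (R * (?T * B0)) * (ennreal (u y) * indicator (ball x R) y) \<partial>lebesgue)"
  proof (rule nn_integral_mono)
    fix y
    show "ennreal (u y * norm (E y)) * indicator (ball x R) y
      \<le> (\<Sum>k=1..m. ennreal (u y * norm (piece G (R / 2 ^ k) y)) * indicator (ball x R) y) + ennreal (R * (?T * B0)) * (ennreal (u y) * indicator (ball x R) y)"
    proof (cases "y \<in> ball x R")
      case True
      have "norm (E y) \<le> (\<Sum>k=1..m. norm (piece G (R / 2 ^ k) y)) + R * (?T * B0)"
        unfolding E_def Es_def by (rule order_trans[OF norm_triangle_ineq add_mono[OF norm_sum big[OF True]]])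
      then have "u y * norm (E y) \<le> u y * ((\<Sum>k=1..m. norm (piece G (R / 2 ^ k) y)) + R * (?T * B0))"
        by (intro mult_left_mono u0)
      also have "\<dots> = (\<Sum>k=1..m. u y * norm (piece G (R / 2 ^ k) y)) + R * (?T * B0) * u y"
        by (simp add: ring_distribs sum_distrib_left mult_ac)
      finally have "ennreal (u y * norm (E y)) \<le> ennreal ((\<Sum>k=1..m. u y * norm (piece G (R / 2 ^ k) y)) + R * (?T * B0) * u y)"
        by (rule ennreal_leI)
      also have "\<dots> = ennreal (\<Sum>k=1..m. u y * norm (piece G (R / 2 ^ k) y)) + ennreal (R * (?T * B0) * u y)"
        using u0 R T0 B0 by (intro ennreal_plus sum_nonneg mult_nonneg_nonneg) auto
      also have "ennreal (\<Sum>k=1..m. u y * norm (piece G (R / 2 ^ k) y)) = (\<Sum>k=1..m. ennreal (u y * norm (piece G (R / 2 ^ k) y)))"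
        using u0 by (intro sum_ennreal[symmetric]) auto
      also have "ennreal (R * (?T * B0) * u y) = ennreal (R * (?T * B0)) * ennreal (u y)"
        using u0 R T0 B0 by (intro ennreal_mult mult_nonneg_nonneg) auto
      finally show ?thesis using True by simp
    qed simp
  qed
  also have "\<dots> = (\<Sum>k=1..m. \<integral>\<^sup>+y. ennreal (u y * norm (piece G (R / 2 ^ k) y)) * indicator (ball x R) y \<partial>lebesgue)
      + ennreal (R * (?T * B0)) * (\<integral>\<^sup>+y. ennreal (u y) * indicator (ball x R) y \<partial>lebesgue)"
    by (rule nn_integral_sum_cmult) measurable
  also have "\<dots> \<le> (\<Sum>k=1..m. ennreal (small_const * (R / 2 ^ k / R) powr (1 - real CARD('N) * (1 / \<alpha> + 1 / \<beta> - 1)) * R ^ (CARD('N) + 1) * a powr (1 / \<alpha>) * b powr (1 / \<beta>)))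
      + ennreal (R * (?T * B0)) * ennreal (a powr (1 / \<alpha>) * unit_ball_vol (real CARD('N)) powr (1 - 1 / \<alpha>) * R ^ CARD('N))"
  proof (intro add_mono sum_mono mult_left_mono)
    fix k
    show "(\<integral>\<^sup>+y. ennreal (u y * norm (piece G (R / 2 ^ k) y)) * indicator (ball x R) y \<partial>lebesgue)
      \<le> ennreal (small_const * (R / 2 ^ k / R) powr (1 - real CARD('N) * (1 / \<alpha> + 1 / \<beta> - 1)) * R ^ (CARD('N) + 1) * a powr (1 / \<alpha>) * b powr (1 / \<beta>))"
      by (rule small_scale[OF G u u0 _ _ a b Ha Hb]) (use R in \<open>auto simp: field_simps\<close>)
    show "(\<integral>\<^sup>+y. ennreal (u y) * indicator (ball x R) y \<partial>lebesgue) \<le> ennreal (a powr (1 / \<alpha>) * unit_ball_vol (real CARD('N)) powr (1 - 1 / \<alpha>) * R ^ CARD('N))"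
      by (rule ball_mean_le[OF u u0 ab(1) a R Ha[OF R]])
  qed auto
  also have "\<dots> = ennreal ((\<Sum>k=1..m. small_const * (R / 2 ^ k / R) powr (1 - real CARD('N) * (1 / \<alpha> + 1 / \<beta> - 1)) * R ^ (CARD('N) + 1) * a powr (1 / \<alpha>) * b powr (1 / \<beta>))
      + R * (?T * B0) * (a powr (1 / \<alpha>) * unit_ball_vol (real CARD('N)) powr (1 - 1 / \<alpha>) * R ^ CARD('N)))"
    by (rule sum_ennreal_plus_mult; intro mult_nonneg_nonneg) (use R T0 B0 small_const_nonneg in auto)
  also have "\<dots> \<le> ennreal (osc_const * R ^ (CARD('N) + 1) * a powr (1 / \<alpha>) * b powr (1 / \<beta>))"
  proof (rule ennreal_leI)
    let ?X = "R ^ (CARD('N) + 1) * a powr (1 / \<alpha>) * b powr (1 / \<beta>)"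
    let ?q = "2 powr (- (1 - real CARD('N) * (1 / \<alpha> + 1 / \<beta> - 1))) :: real"
    have X: "?X \<ge> 0" using R by (intro mult_nonneg_nonneg) auto
    have "(R / 2 ^ k / R) powr (1 - real CARD('N) * (1 / \<alpha> + 1 / \<beta> - 1)) = ?q ^ k" for k
    proof -
      have "(R / 2 ^ k / R) powr (1 - real CARD('N) * (1 / \<alpha> + 1 / \<beta> - 1)) = (2 powr (- real k)) powr (1 - real CARD('N) * (1 / \<alpha> + 1 / \<beta> - 1))" using R by (simp add: powr_minus powr_realpow divide_simps)
      also have "\<dots> = ?q powr real k"
        unfolding powr_powr by (rule arg_cong[of _ _ "\<lambda>e. 2 powr e"]) (simp add: algebra_simps)
      finally show ?thesis by (simp add: powr_realpow)
    qed
    then have "(\<Sum>k=1..m. small_const * (R / 2 ^ k / R) powr (1 - real CARD('N) * (1 / \<alpha> + 1 / \<beta> - 1)) * R ^ (CARD('N) + 1) * a powr (1 / \<alpha>) * b powr (1 / \<beta>))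
       = small_const * (\<Sum>k=1..m. ?q ^ k) * ?X"
      by (simp add: sum_distrib_left sum_distrib_right mult_ac)
    also have "\<dots> \<le> small_const * (1 / (1 - ?q)) * ?X"
      using small_const_nonneg X powr_theta_less by (intro mult_right_mono mult_left_mono sum_geometric_le) auto
    finally have "(\<Sum>k=1..m. small_const * (R / 2 ^ k / R) powr (1 - real CARD('N) * (1 / \<alpha> + 1 / \<beta> - 1)) * R ^ (CARD('N) + 1) * a powr (1 / \<alpha>) * b powr (1 / \<beta>)) \<le> small_const / (1 - ?q) * ?X"
      by simp
    moreover have "R * (?T * B0) * (a powr (1 / \<alpha>) * unit_ball_vol (real CARD('N)) powr (1 - 1 / \<alpha>) * R ^ CARD('N)) = ?T * unit_ball_vol (real CARD('N)) powr (1 - 1 / \<beta>) * unit_ball_vol (real CARD('N)) powr (1 - 1 / \<alpha>) * ?X"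
      unfolding B0_def by (simp only: power_add power_one_right mult_ac)
    ultimately show "(\<Sum>k=1..m. small_const * (R / 2 ^ k / R) powr (1 - real CARD('N) * (1 / \<alpha> + 1 / \<beta> - 1)) * R ^ (CARD('N) + 1) * a powr (1 / \<alpha>) * b powr (1 / \<beta>))
      + R * (?T * B0) * (a powr (1 / \<alpha>) * unit_ball_vol (real CARD('N)) powr (1 - 1 / \<alpha>) * R ^ CARD('N)) \<le> osc_const * R ^ (CARD('N) + 1) * a powr (1 / \<alpha>) * b powr (1 / \<beta>)"
      by (simp add: osc_const_def distrib_right mult.assoc)
  qed
  finally show ?thesis using that[OF sE vE] by blast
qed

end

section \<open>Mollification in Lebesgue spaces\<close>

lemma in_Lp_measurable: "in_Lp p f \<Longrightarrow> f \<in> borel_measurable lebesgue"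
  by (simp add: in_Lp_def)

lemma in_Lp_nn_integral:
  assumes "in_Lp p f" "p > 0"
  shows "(\<integral>\<^sup>+x. ennreal (norm (f x) powr p) \<partial>lebesgue) = ennreal (Lp_norm p f powr p)"
proof -
  have "(\<integral>\<^sup>+x. ennreal (norm (f x) powr p) \<partial>lebesgue) = ennreal (\<integral>x. norm (f x) powr p \<partial>lebesgue)"
    using assms by (intro nn_integral_eq_integral) (auto simp: in_Lp_def)
  moreover have "Lp_norm p f powr p = (\<integral>x. norm (f x) powr p \<partial>lebesgue)"
    using assms(2) by (simp add: Lp_norm_def powr_powr integral_nonneg)
  ultimately show ?thesis by simp
qed

lemma in_LpI:
  assumes "f \<in> borel_measurable lebesgue" "(\<integral>\<^sup>+x. ennreal (norm (f x) powr p) \<partial>lebesgue) < \<infinity>"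
  shows "in_Lp p f"
  unfolding in_Lp_def using assms by (auto intro!: integrableI_bounded)

lemma in_Lp_mono:
  assumes "in_Lp p f" "g \<in> borel_measurable lebesgue" "\<And>x. norm (g x) \<le> norm (f x)" "p > 0"
  shows "in_Lp p g"
proof (rule in_LpI[OF assms(2)])
  have "(\<integral>\<^sup>+x. ennreal (norm (g x) powr p) \<partial>lebesgue) \<le> (\<integral>\<^sup>+x. ennreal (norm (f x) powr p) \<partial>lebesgue)"
    using assms by (intro nn_integral_mono ennreal_leI powr_mono2) auto
  then show "(\<integral>\<^sup>+x. ennreal (norm (g x) powr p) \<partial>lebesgue) < \<infinity>"
    using in_Lp_nn_integral[OF assms(1,4)] by (simp add: order_le_less_trans)
qed

lemma in_Lp_component:
  fixes f :: "real^'N::finite \<Rightarrow> complex^'n::finite"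
  assumes "in_Lp p f" "p > 0" shows "in_Lp p (\<lambda>x. f x $ j)"
proof (rule in_Lp_mono[OF assms(1)])
  have "(\<lambda>v::complex^'n. v $ j) \<in> borel_measurable borel"
    by (intro borel_measurable_continuous_onI continuous_intros)
  then show "(\<lambda>x. f x $ j) \<in> borel_measurable lebesgue"
    by (rule measurable_compose[OF in_Lp_measurable[OF assms(1)]])
qed (use assms in \<open>auto simp: Finite_Cartesian_Product.norm_nth_le\<close>)

lemma Lp_norm_nonneg: "Lp_norm p f \<ge> 0"
  by (simp add: Lp_norm_def)

lemma Holder_Lp:
  assumes f: "in_Lp p f" and g: "in_Lp q g" and pq: "p > 1" "q > 1" "1 / p + 1 / q = 1"
  shows "(\<integral>\<^sup>+x. ennreal (norm (f x) * norm (g x)) \<partial>lebesgue) \<le> ennreal (Lp_norm p f * Lp_norm q g)"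
proof -
  note [measurable] = in_Lp_measurable[OF f] in_Lp_measurable[OF g]
  have "(\<integral>\<^sup>+x. ennreal (norm (f x) * norm (g x)) \<partial>lebesgue) \<le> ennreal ((Lp_norm p f powr p) powr (1 / p) * (Lp_norm q g powr q) powr (1 / q))"
    by (rule nn_integral_Holder) (use pq in_Lp_nn_integral[OF f] in_Lp_nn_integral[OF g] in auto)
  then show ?thesis using pq Lp_norm_nonneg[of p f] Lp_norm_nonneg[of q g] by (simp add: powr_powr)
qed

lemma integrable_mult_Lp:
  fixes f g :: "real^'N::finite \<Rightarrow> complex"
  assumes "in_Lp p f" "in_Lp q g" "p > 1" "q > 1" "1 / p + 1 / q = 1"
  shows "integrable lebesgue (\<lambda>x. f x * g x)"
proof (rule integrableI_bounded)
  note [measurable] = in_Lp_measurable[OF assms(1)] in_Lp_measurable[OF assms(2)]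
  show "(\<lambda>x. f x * g x) \<in> borel_measurable lebesgue" by measurable
  show "(\<integral>\<^sup>+x. ennreal (norm (f x * g x)) \<partial>lebesgue) < \<infinity>"
    using Holder_Lp[OF assms] by (simp add: norm_mult order_le_less_trans)
qed

lemma le_one_plus_powr: "p \<ge> 1 \<Longrightarrow> x \<ge> 0 \<Longrightarrow> x \<le> 1 + x powr p" for x :: real
proof (cases "x \<le> 1")
  case False
  assume "p \<ge> 1" "x \<ge> 0"
  then have "x powr 1 \<le> x powr p" using False by (intro powr_mono) auto
  then show ?thesis using False by simp
qed (auto intro: add_increasing2)

lemma in_Lp_locally_integrable:
  assumes f: "in_Lp p f" and p: "p \<ge> 1" shows "locally_integrable f"
  unfolding locally_integrable_def set_integrable_def
proof (intro allI impI)
  fix K :: "(real^'a) set" assume K: "compact K"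
  have Ks: "K \<in> lmeasurable" by (rule lmeasurable_compact[OF K])
  have i1: "integrable lebesgue (indicator K :: _ \<Rightarrow> real)"
    using Ks by (auto simp: fmeasurable_def intro!: integrable_real_indicator)
  show "integrable lebesgue (\<lambda>x. indicator K x *\<^sub>R f x)"
  proof (rule Bochner_Integration.integrable_bound)
    show "integrable lebesgue (\<lambda>x. indicator K x + norm (f x) powr p)"
      using f i1 by (auto simp: in_Lp_def)
    show "(\<lambda>x. indicator K x *\<^sub>R f x) \<in> borel_measurable lebesgue"
      using in_Lp_measurable[OF f] Ks by (auto simp: fmeasurable_def)
    show "AE x in lebesgue. norm (indicator K x *\<^sub>R f x) \<le> norm (indicator K x + norm (f x) powr p)"
      using le_one_plus_powr[OF p norm_ge_zero] by (auto split: split_indicator)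
  qed
qed

section \<open>Approximation by continuous functions of compact support\<close>

lemma add_powr_le:
  fixes a b :: real assumes "a \<ge> 0" "b \<ge> 0" "p > 0" shows "(a + b) powr p \<le> 2 powr p * (a powr p + b powr p)"
proof -
  have "(a + b) powr p \<le> (2 * max a b) powr p" using assms by (intro powr_mono2) auto
  also have "\<dots> = 2 powr p * max a b powr p" using assms by (simp add: powr_mult)
  also have "\<dots> \<le> 2 powr p * (a powr p + b powr p)" using assms by (intro mult_left_mono) (auto simp: max_def)
  finally show ?thesis .
qed

lemma powr_tendsto_zero:
  assumes "(X \<longlongrightarrow> (0::real)) F" "p > 0" "\<And>n. X n \<ge> 0" shows "((\<lambda>n. X n powr p) \<longlongrightarrow> 0) F"
  using tendsto_powr'[OF assms(1) tendsto_const[of p]] assms by simp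

text \<open>A measurable function is almost everywhere a limit of continuous functions. Projecting
  their values onto the ball of radius \<open>B\<close> and cutting them off outside the support
  makes this convergence dominated.\<close>

lemma Lp_density_bounded:
  fixes f :: "real^'N::finite \<Rightarrow> complex"
  assumes f [measurable]: "f \<in> borel_measurable lebesgue" and B: "B \<ge> 0" "\<And>x. norm (f x) \<le> B"
    and supp: "\<And>x. norm x > r \<Longrightarrow> f x = 0" and q: "q > 0" and e: "e > 0"
  obtains g where "continuous_on UNIV g" "\<And>x. norm x \<ge> r + 1 \<Longrightarrow> g x = 0"
    "(\<integral>\<^sup>+x. ennreal (norm (f x - g x) powr q) \<partial>lebesgue) < ennreal e"
proof -
  have "f measurable_on UNIV" by (rule lebesgue_measurable_imp_measurable_on) auto
  then obtain Z G where Z: "negligible Z" and G: "\<And>n. continuous_on UNIV (G n)"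
    and lim: "\<And>x. x \<notin> Z \<Longrightarrow> (\<lambda>n. G n x) \<longlonglongrightarrow> f x"
    unfolding measurable_on_def by auto
  define cut where "cut x = max 0 (min 1 (r + 1 - norm x))" for x :: "real^'N"
  define cp where "cp = closest_point (cball (0::complex) B)"
  have cpc: "continuous_on UNIV cp" unfolding cp_def
    using B by (intro continuous_on_closest_point) auto
  have cp_le: "norm (cp z) \<le> B" for z
    using closest_point_in_set[of "cball (0::complex) B" z] B by (auto simp: cp_def)
  have cp_id: "cp z = z" if "norm z \<le> B" for z
    unfolding cp_def using that by (intro closest_point_self) auto
  define g where "g n x = cut x *\<^sub>R cp (G n x)" for n x
  have gc: "continuous_on UNIV (g n)" for n
    unfolding g_def[abs_def] cut_def by (intro continuous_intros continuous_on_compose2[OF cpc G]) auto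
  have gs: "g n x = 0" if "norm x \<ge> r + 1" for n x using that by (simp add: g_def cut_def)
  have [measurable]: "g n \<in> borel_measurable lebesgue" for n
    by (rule measurable_completion) (simp add: borel_measurable_continuous_onI gc)
  have gB: "norm (g n x) \<le> B" for n x
  proof -
    have "norm (g n x) \<le> 1 * norm (cp (G n x))" unfolding g_def norm_scaleR by (intro mult_right_mono) (auto simp: cut_def)
    then show ?thesis using cp_le[of "G n x"] by simp
  qed
  have cutf: "cut x *\<^sub>R f x = f x" for x using supp[of x] by (cases "norm x \<le> r") (auto simp: cut_def)
  have conv: "(\<lambda>n. g n x) \<longlonglongrightarrow> f x" if "x \<notin> Z" for x
  proof -
    have "(\<lambda>n. cp (G n x)) \<longlonglongrightarrow> cp (f x)"
      using continuous_on_tendsto_compose[OF cpc lim[OF that]] by simp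
    then have "(\<lambda>n. cut x *\<^sub>R cp (G n x)) \<longlonglongrightarrow> cut x *\<^sub>R cp (f x)" by (intro tendsto_intros)
    then show ?thesis by (simp add: g_def cp_id[OF B(2)] cutf)
  qed
  have "(\<lambda>n. \<integral>\<^sup>+x. ennreal (norm (f x - g n x) powr q) \<partial>lebesgue) \<longlonglongrightarrow> (\<integral>\<^sup>+x. 0 \<partial>(lebesgue :: (real^'N) measure))"
  proof (rule nn_integral_dominated_convergence[where w="\<lambda>x. ennreal ((2 * B) powr q) * indicator (cball (0::real^'N) (r + 1)) x"])
    show "AE x in lebesgue. ennreal (norm (f x - g n x) powr q) \<le> ennreal ((2 * B) powr q) * indicator (cball 0 (r + 1)) x" for n
    proof (rule AE_I2)
      fix x
      show "ennreal (norm (f x - g n x) powr q) \<le> ennreal ((2 * B) powr q) * indicator (cball 0 (r + 1)) x"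
      proof (cases "norm x \<le> r + 1")
        case True
        have "norm (f x - g n x) \<le> 2 * B" using norm_triangle_ineq4[of "f x" "g n x"] B(2)[of x] gB[of n x] by simp
        then have "norm (f x - g n x) powr q \<le> (2 * B) powr q" using q by (intro powr_mono2) auto
        then show ?thesis using True by (simp add: ennreal_leI)
      next
        case False
        then show ?thesis using gs[of x n] supp[of x] q by simp
      qed
    qed
    have "emeasure lebesgue (cball (0::real^'N) (r + 1)) < \<infinity>"
      using lmeasurable_cball[of "0::real^'N" "r + 1"] by (simp add: fmeasurable_def)
    then show "(\<integral>\<^sup>+x. ennreal ((2 * B) powr q) * indicator (cball (0::real^'N) (r + 1)) x \<partial>lebesgue) < \<infinity>"
      by (subst nn_integral_cmult_indicator) (auto simp: ennreal_mult_less_top)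
    have "AE x in lebesgue. x \<notin> Z" using Z by (simp add: negligible_iff_null_sets AE_not_in)
    then show "AE x in lebesgue. (\<lambda>n. ennreal (norm (f x - g n x) powr q)) \<longlonglongrightarrow> 0"
    proof eventually_elim
      fix x assume "x \<notin> Z"
      then have "(\<lambda>n. norm (f x - g n x)) \<longlonglongrightarrow> norm (f x - f x)" by (intro tendsto_intros conv)
      then have "(\<lambda>n. norm (f x - g n x) powr q) \<longlonglongrightarrow> 0" using q by (intro powr_tendsto_zero) auto
      then have "(\<lambda>n. ennreal (norm (f x - g n x) powr q)) \<longlonglongrightarrow> ennreal 0" by (rule tendsto_ennrealI)
      then show "(\<lambda>n. ennreal (norm (f x - g n x) powr q)) \<longlonglongrightarrow> 0" by simp
    qed
    show "(\<lambda>x. ennreal (norm (f x - g n x) powr q)) \<in> borel_measurable lebesgue" for n by measurable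
    have [measurable]: "cball (0::real^'N) (r + 1) \<in> sets lebesgue"
      using lmeasurable_cball[of "0::real^'N" "r + 1"] by (simp add: fmeasurable_def)
    show "(\<lambda>x. ennreal ((2 * B) powr q) * indicator (cball (0::real^'N) (r + 1)) x) \<in> borel_measurable lebesgue"
      by measurable
  qed simp
  then have "eventually (\<lambda>n. (\<integral>\<^sup>+x. ennreal (norm (f x - g n x) powr q) \<partial>lebesgue) < ennreal e) sequentially"
    using e by (intro order_tendstoD) auto
  then obtain n where "(\<integral>\<^sup>+x. ennreal (norm (f x - g n x) powr q) \<partial>lebesgue) < ennreal e"
    by (auto simp: eventually_sequentially)
  then show ?thesis using that gc gs by blast
qed

lemma Lp_density:
  fixes f :: "real^'N::finite \<Rightarrow> complex"
  assumes f: "in_Lp q f" and q: "q > 0" and e: "e > 0"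
  obtains g r where "continuous_on UNIV g" "r > 0" "\<And>x. norm x \<ge> r \<Longrightarrow> g x = 0"
    "(\<integral>\<^sup>+x. ennreal (norm (f x - g x) powr q) \<partial>lebesgue) < ennreal e"
proof -
  note fm [measurable] = in_Lp_measurable[OF f]
  define fn where "fn n x = (if norm (f x) \<le> real n \<and> norm x \<le> real n then f x else 0)" for n x
  have nm [measurable]: "(\<lambda>x::real^'N. norm x) \<in> borel_measurable lebesgue"
    by (rule measurable_completion) simp
  have [measurable]: "fn n \<in> borel_measurable lebesgue" for n unfolding fn_def[abs_def] by simp
  \<comment> \<open>\<open>2 powr q\<close> is the constant of the quasi-triangle inequality for
    \<open>q\<close>-th powers; truncation and continuous approximation share the rest
    equally.\<close>
  define d where "d = e / (2 * 2 powr q)"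
  have d: "d > 0" using e by (simp add: d_def)
  have "(\<lambda>n. \<integral>\<^sup>+x. ennreal (norm (f x - fn n x) powr q) \<partial>lebesgue) \<longlonglongrightarrow> (\<integral>\<^sup>+x. 0 \<partial>(lebesgue :: (real^'N) measure))"
  proof (rule nn_integral_dominated_convergence[where w="\<lambda>x. ennreal (norm (f x) powr q)"])
    show "AE x in lebesgue. ennreal (norm (f x - fn n x) powr q) \<le> ennreal (norm (f x) powr q)" for n
      by (auto simp: fn_def)
    show "(\<integral>\<^sup>+x. ennreal (norm (f x) powr q) \<partial>lebesgue) < \<infinity>" using in_Lp_nn_integral[OF f q] by simp
    show "AE x in lebesgue. (\<lambda>n. ennreal (norm (f x - fn n x) powr q)) \<longlonglongrightarrow> 0"
    proof (rule AE_I2)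
      fix x
      obtain k :: nat where k: "max (norm (f x)) (norm x) \<le> real k" using real_arch_simple by blast
      have "eventually (\<lambda>n. ennreal (norm (f x - fn n x) powr q) = 0) sequentially"
        unfolding eventually_sequentially using k by (intro exI[of _ k]) (auto simp: fn_def)
      then show "(\<lambda>n. ennreal (norm (f x - fn n x) powr q)) \<longlonglongrightarrow> 0" by (rule tendsto_eventually)
    qed
  qed auto
  then have "eventually (\<lambda>n. (\<integral>\<^sup>+x. ennreal (norm (f x - fn n x) powr q) \<partial>lebesgue) < ennreal d) sequentially"
    using d by (intro order_tendstoD) auto
  then obtain n where n: "(\<integral>\<^sup>+x. ennreal (norm (f x - fn n x) powr q) \<partial>lebesgue) < ennreal d"
    by (auto simp: eventually_sequentially)
  obtain g where g: "continuous_on UNIV g" "\<And>x. norm x \<ge> real n + 1 \<Longrightarrow> g x = 0"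
    "(\<integral>\<^sup>+x. ennreal (norm (fn n x - g x) powr q) \<partial>lebesgue) < ennreal d"
    by (rule Lp_density_bounded[of "fn n" "real n" "real n" q d]) (use q d in \<open>auto simp: fn_def split: if_splits\<close>)
  have [measurable]: "g \<in> borel_measurable lebesgue"
    by (rule measurable_completion) (simp add: borel_measurable_continuous_onI g)
  have "(\<integral>\<^sup>+x. ennreal (norm (f x - g x) powr q) \<partial>lebesgue)
     \<le> (\<integral>\<^sup>+x. ennreal (2 powr q) * (ennreal (norm (f x - fn n x) powr q) + ennreal (norm (fn n x - g x) powr q)) \<partial>lebesgue)"
  proof (rule nn_integral_mono)
    fix x
    have "norm (f x - g x) powr q \<le> (norm (f x - fn n x) + norm (fn n x - g x)) powr q"
      using q norm_triangle_ineq[of "f x - fn n x" "fn n x - g x"] by (intro powr_mono2) auto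
    also have "\<dots> \<le> 2 powr q * (norm (f x - fn n x) powr q + norm (fn n x - g x) powr q)"
      using q by (intro add_powr_le) auto
    finally show "ennreal (norm (f x - g x) powr q) \<le> ennreal (2 powr q) * (ennreal (norm (f x - fn n x) powr q) + ennreal (norm (fn n x - g x) powr q))"
      by (simp add: ennreal_leI flip: ennreal_mult ennreal_plus)
  qed
  also have "\<dots> = ennreal (2 powr q) * ((\<integral>\<^sup>+x. ennreal (norm (f x - fn n x) powr q) \<partial>lebesgue) + (\<integral>\<^sup>+x. ennreal (norm (fn n x - g x) powr q) \<partial>lebesgue))"
    by (subst nn_integral_cmult) (auto simp: nn_integral_add)
  also have "\<dots> < ennreal (2 powr q) * (ennreal d + ennreal d)"
    using n g(3) by (intro ennreal_mult_strict_left_mono add_strict_mono) auto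
  also have "\<dots> = ennreal e" using d by (simp add: d_def flip: ennreal_mult ennreal_plus)
  finally have "(\<integral>\<^sup>+x. ennreal (norm (f x - g x) powr q) \<partial>lebesgue) < ennreal e" .
  then show ?thesis using g(1,2) by (intro that[of g "real n + 1"]) auto
qed

section \<open>Convergence of mollifications\<close>

lemma integral_dilate:
  fixes f :: "real^'N::finite \<Rightarrow> complex"
  assumes f: "test_function f" and s: "s > 0"
  shows "(\<integral>z. dilate f s (y - z) \<partial>lebesgue) = (\<integral>z. f z \<partial>lebesgue)"
proof -
  have fb [measurable]: "f \<in> borel_measurable borel" by (rule test_function_borel[OF f])
  have db: "(\<lambda>z. dilate f s (y - z)) \<in> borel_measurable borel"
    by (intro measurable_compose[OF _ test_function_borel[OF test_function_dilate[OF f s]]]) measurable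
  have "(\<integral>z. f z \<partial>lebesgue) = (\<integral>z. f z \<partial>lborel)" by (rule integral_completion) simp
  also have "\<dots> = (\<integral>z. f z \<partial>density (distr lborel borel (\<lambda>x. (1/s) *\<^sub>R y + (-1/s) *\<^sub>R x)) (\<lambda>_. ennreal (\<bar>-1/s\<bar> ^ DIM(real^'N))))"
    using lborel_affine[of "-1/s" "(1/s) *\<^sub>R y"] s by simp
  also have "\<dots> = (\<integral>z. (\<bar>-1/s\<bar> ^ DIM(real^'N)) *\<^sub>R f ((1/s) *\<^sub>R y + (-1/s) *\<^sub>R z) \<partial>lborel)"
    by (subst integral_density) (auto simp: integral_distr)
  also have "\<dots> = (\<integral>z. dilate f s (y - z) \<partial>lborel)"
    using s by (intro Bochner_Integration.integral_cong refl)
      (simp add: dilate_def scaleR_diff_right power_divide)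
  also have "\<dots> = (\<integral>z. dilate f s (y - z) \<partial>lebesgue)" by (rule integral_completion[symmetric]) (use db in simp)
  finally show ?thesis ..
qed

lemma continuous_locally_integrable:
  fixes f :: "real^'N::finite \<Rightarrow> complex"
  assumes f: "continuous_on UNIV f" shows "locally_integrable f"
  unfolding locally_integrable_def set_integrable_def
proof (intro allI impI)
  fix K :: "(real^'N) set" assume K: "compact K"
  have i: "integrable lborel (\<lambda>x. indicator K x *\<^sub>R f x)"
    by (rule borel_integrable_compact[OF K continuous_on_subset[OF f]]) simp
  then have "(\<lambda>x. indicator K x *\<^sub>R f x) \<in> borel_measurable lborel" by (rule borel_measurable_integrable)
  with i show "integrable lebesgue (\<lambda>x. indicator K x *\<^sub>R f x)" by (subst integrable_completion)
qed

text \<open>\<rho> is not normalised, so its integral appears in the limit. On the support of the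
  kernel \<open>f - f y\<close> is uniformly small, and \<open>C\<close> bounds the integral of the
  modulus of the dilates at every scale.\<close>

lemma mollifier_pointwise:
  fixes f :: "real^'N::finite \<Rightarrow> complex"
  assumes fc: "continuous_on UNIV f" and \<rho>: "test_function \<rho>" and s: "\<And>k. s k > 0" "s \<longlonglongrightarrow> 0"
  shows "(\<lambda>k. conv f (dilate \<rho> (s k)) y) \<longlonglongrightarrow> (\<integral>z. \<rho> z \<partial>lebesgue) * f y"
proof -
  have li: "locally_integrable f" by (rule continuous_locally_integrable[OF fc])
  obtain \<Lambda> where L: "\<Lambda> > 0" "\<And>x. norm x \<ge> \<Lambda> \<Longrightarrow> \<rho> x = 0" by (rule test_function_support[OF \<rho>]) blast
  obtain M where M: "M > 0" "\<And>x. norm (\<rho> x) \<le> M" by (rule test_function_bounded[OF \<rho>]) blast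
  define C where "C = M * (unit_ball_vol (real CARD('N)) * \<Lambda> ^ CARD('N))"
  have C: "C > 0" unfolding C_def using M L by simp
  show ?thesis
  proof (rule LIMSEQ_I)
    fix e :: real assume e: "e > 0"
    have "isCont f y" using fc by (simp add: continuous_on_eq_continuous_at)
    then obtain d where d: "d > 0" "\<And>z. dist z y < d \<Longrightarrow> dist (f z) (f y) < e / (2 * C)"
      using e C unfolding continuous_at_eps_delta by (metis divide_pos_pos mult_pos_pos zero_less_numeral)
    have "eventually (\<lambda>k. s k < d / \<Lambda>) sequentially" using s(2) d(1) L(1) by (intro order_tendstoD) auto
    then obtain k0 where k0: "\<And>k. k \<ge> k0 \<Longrightarrow> s k < d / \<Lambda>" by (auto simp: eventually_sequentially)
    show "\<exists>k0. \<forall>k\<ge>k0. norm (conv f (dilate \<rho> (s k)) y - (\<integral>z. \<rho> z \<partial>lebesgue) * f y) < e"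
    proof (intro exI[of _ k0] allI impI)
      fix k assume "k \<ge> k0"
      then have sk: "\<Lambda> * s k < d" using k0[of k] L by (simp add: field_simps)
      have sk0: "s k > 0" by (rule s)
      let ?\<rho> = "dilate \<rho> (s k)"
      have T: "test_function ?\<rho>" by (rule test_function_dilate[OF \<rho> sk0])
      have li1: "locally_integrable (\<lambda>_. 1 :: complex)"
        by (rule continuous_locally_integrable) simp
      have i0: "integrable lebesgue (\<lambda>z. ?\<rho> (y - z))" using conv_integrable[OF li1 T, of y] by simp
      define h where "h z = (if z \<in> ball y (\<Lambda> * s k) then f z - f y else 0)" for z
      have [measurable]: "h \<in> borel_measurable lebesgue"
      proof -
        have [measurable]: "f \<in> borel_measurable lebesgue"
          by (rule measurable_completion) (simp add: borel_measurable_continuous_onI fc)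
        show ?thesis unfolding h_def[abs_def] by (rule measurable_If_set) auto
      qed
      have "conv f ?\<rho> y - (\<integral>z. \<rho> z \<partial>lebesgue) * f y = (\<integral>z. f z * ?\<rho> (y - z) \<partial>lebesgue) - (\<integral>z. f y * ?\<rho> (y - z) \<partial>lebesgue)"
        unfolding conv_def by (simp add: integral_dilate[OF \<rho> sk0] mult.commute)
      also have "\<dots> = (\<integral>z. f z * ?\<rho> (y - z) - f y * ?\<rho> (y - z) \<partial>lebesgue)"
        by (rule Bochner_Integration.integral_diff[symmetric]) (use conv_integrable[OF li T] i0 in auto)
      also have "\<dots> = conv h ?\<rho> y"
        unfolding conv_def
      proof (rule Bochner_Integration.integral_cong[OF refl])
        fix z
        have "?\<rho> (y - z) = 0" if "z \<notin> ball y (\<Lambda> * s k)"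
          using that by (intro dilate_supp[OF L(2) sk0]) (auto simp: dist_norm)
        then show "f z * ?\<rho> (y - z) - f y * ?\<rho> (y - z) = h z * ?\<rho> (y - z)"
          by (auto simp: h_def left_diff_distrib)
      qed
      finally have eq: "conv f ?\<rho> y - (\<integral>z. \<rho> z \<partial>lebesgue) * f y = conv h ?\<rho> y" .
      have hle: "norm (h z) \<le> e / (2 * C)" for z
        using d(2)[of z] sk e C by (auto simp: h_def dist_norm norm_minus_commute less_imp_le)
      have 1: "ennreal (norm (conv h ?\<rho> y)) \<le> ennreal (M / s k ^ CARD('N)) * (\<integral>\<^sup>+z. ennreal (e / (2 * C)) * indicator (ball y (\<Lambda> * s k)) z \<partial>lebesgue)"
        by (rule norm_conv_le) (use hle M dilate_bound[OF M(2) sk0] dilate_supp[OF L(2) sk0] sk0 in auto)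
      have 2: "(\<integral>\<^sup>+z. ennreal (e / (2 * C)) * indicator (ball y (\<Lambda> * s k)) z \<partial>lebesgue) \<le> ennreal (e / (2 * C) * (unit_ball_vol (real CARD('N)) * (\<Lambda> * s k) ^ CARD('N)))"
        using e C L sk0 by (subst nn_integral_cmult_indicator, simp, subst emeasure_lebesgue_ball) (auto simp flip: ennreal_mult)
      have "norm (conv h ?\<rho> y) \<le> M / s k ^ CARD('N) * (e / (2 * C) * (unit_ball_vol (real CARD('N)) * (\<Lambda> * s k) ^ CARD('N)))"
        by (rule norm_le_of_ennreal[OF 1 2]) (use M e C L sk0 in auto)
      also have "\<dots> = e / (2 * C) * C" using sk0 by (simp add: C_def power_mult_distrib)
      also have "\<dots> < e" using C e by simp
      finally show "norm (conv f ?\<rho> y - (\<integral>z. \<rho> z \<partial>lebesgue) * f y) < e" unfolding eq .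
    qed
  qed
qed

lemma in_Lp_diff:
  fixes f g :: "real^'N::finite \<Rightarrow> complex"
  assumes f: "in_Lp q f" and g: "in_Lp q g" and q: "q > 0" shows "in_Lp q (\<lambda>x. f x - g x)"
proof (rule in_LpI)
  note [measurable] = in_Lp_measurable[OF f] in_Lp_measurable[OF g]
  show "(\<lambda>x. f x - g x) \<in> borel_measurable lebesgue" by measurable
  have "(\<integral>\<^sup>+x. ennreal (norm (f x - g x) powr q) \<partial>lebesgue)
     \<le> (\<integral>\<^sup>+x. ennreal (2 powr q) * (ennreal (norm (f x) powr q) + ennreal (norm (g x) powr q)) \<partial>lebesgue)"
  proof (rule nn_integral_mono)
    fix x
    have "norm (f x - g x) powr q \<le> (norm (f x) + norm (g x)) powr q"
      using q norm_triangle_ineq4[of "f x" "g x"] by (intro powr_mono2) auto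
    also have "\<dots> \<le> 2 powr q * (norm (f x) powr q + norm (g x) powr q)" using q by (intro add_powr_le) auto
    finally show "ennreal (norm (f x - g x) powr q) \<le> ennreal (2 powr q) * (ennreal (norm (f x) powr q) + ennreal (norm (g x) powr q))"
      by (simp add: ennreal_leI flip: ennreal_mult ennreal_plus)
  qed
  also have "\<dots> = ennreal (2 powr q) * ((\<integral>\<^sup>+x. ennreal (norm (f x) powr q) \<partial>lebesgue) + (\<integral>\<^sup>+x. ennreal (norm (g x) powr q) \<partial>lebesgue))"
    by (subst nn_integral_cmult) (auto simp: nn_integral_add)
  also have "\<dots> < \<infinity>" using in_Lp_nn_integral[OF f q] in_Lp_nn_integral[OF g q]
    by (simp add: ennreal_mult_less_top flip: ennreal_plus)
  finally show "(\<integral>\<^sup>+x. ennreal (norm (f x - g x) powr q) \<partial>lebesgue) < \<infinity>" .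
qed

text \<open>At every scale the mollification is dominated by a multiple of the maximal function of
  \<open>f\<close>. The uniformity in \<open>s\<close> is what carries the convergence from
  continuous functions over to all of \<open>L^q\<close>.\<close>

lemma conv_pairing_bound:
  fixes w f :: "real^'N::finite \<Rightarrow> complex"
  assumes w: "in_Lp p w" and f: "in_Lp q f" and pq: "p > 1" "q > 1" "1 / p + 1 / q = 1"
    and \<rho>: "test_function \<rho>" and M: "M > 0" "\<And>x. norm (\<rho> x) \<le> M"
    and L: "\<Lambda> > 0" "\<And>x. norm x \<ge> \<Lambda> \<Longrightarrow> \<rho> x = 0" and s: "s > 0"
  shows "(\<integral>\<^sup>+y. ennreal (norm (w y * cnj (conv f (dilate \<rho> s) y))) \<partial>lebesgue)
    \<le> ennreal (M * \<Lambda> ^ CARD('N) * maximal_const CARD('N) q powr (1 / q) * Lp_norm p w * Lp_norm q f)"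
proof -
  note [measurable] = in_Lp_measurable[OF w] in_Lp_measurable[OF f]
  define Mf where "Mf = maximal (\<lambda>x. ennreal (norm (f x)))"
  have [measurable]: "Mf \<in> borel_measurable lebesgue" unfolding Mf_def by (rule measurable_maximal_lebesgue)
  define m where "m y = enn2real (Mf y)" for y
  have [measurable]: "m \<in> borel_measurable lebesgue" unfolding m_def[abs_def] by simp
  have q0: "q > 0" using pq by simp
  have fin: "AE y in lebesgue. Mf y < \<infinity>"
    unfolding Mf_def by (rule maximal_AE_finite[OF _ _ pq(2)]) (use in_Lp_nn_integral[OF f q0] in auto)
  have "(\<integral>\<^sup>+y. ennreal (norm (w y * cnj (conv f (dilate \<rho> s) y))) \<partial>lebesgue)
     \<le> (\<integral>\<^sup>+y. ennreal (M * \<Lambda> ^ CARD('N)) * ennreal (norm (w y) * m y) \<partial>lebesgue)"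
  proof (rule nn_integral_mono_AE, use fin in eventually_elim)
    fix y assume fy: "Mf y < \<infinity>"
    have "ennreal (norm (conv f (dilate \<rho> s) y)) \<le> ennreal (M / s ^ CARD('N)) * (\<integral>\<^sup>+z. ennreal (norm (f z)) * indicator (ball y (\<Lambda> * s)) z \<partial>lebesgue)"
      by (rule norm_conv_le) (use s M dilate_bound[OF M(2) s] dilate_supp[OF L(2) s] in auto)
    moreover have "(\<integral>\<^sup>+z. ennreal (norm (f z)) * indicator (ball y (\<Lambda> * s)) z \<partial>lebesgue) \<le> ennreal ((\<Lambda> * s) ^ CARD('N) * m y)"
    proof -
      have "(\<integral>\<^sup>+z. ennreal (norm (f z)) * indicator (ball y (\<Lambda> * s)) z \<partial>lebesgue) \<le> ennreal ((\<Lambda> * s) ^ CARD('N)) * Mf y"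
        unfolding Mf_def by (rule maximal_upper) (use L s in simp)
      also have "Mf y = ennreal (m y)" using fy by (simp add: m_def)
      finally show ?thesis using L s by (simp add: ennreal_mult m_def)
    qed
    ultimately have "norm (conv f (dilate \<rho> s) y) \<le> M / s ^ CARD('N) * ((\<Lambda> * s) ^ CARD('N) * m y)"
      by (rule norm_le_of_ennreal) (use M s L in \<open>auto simp: m_def\<close>)
    also have "\<dots> = M * \<Lambda> ^ CARD('N) * m y" using s by (simp add: power_mult_distrib)
    finally have "norm (conv f (dilate \<rho> s) y) \<le> M * \<Lambda> ^ CARD('N) * m y" .
    from mult_left_mono[OF this, of "norm (w y)"]
    have "norm (w y * cnj (conv f (dilate \<rho> s) y)) \<le> M * \<Lambda> ^ CARD('N) * (norm (w y) * m y)"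
      by (simp add: norm_mult mult_ac)
    then have "ennreal (norm (w y * cnj (conv f (dilate \<rho> s) y))) \<le> ennreal (M * \<Lambda> ^ CARD('N) * (norm (w y) * m y))"
      by (rule ennreal_leI)
    also have "\<dots> = ennreal (M * \<Lambda> ^ CARD('N)) * ennreal (norm (w y) * m y)"
      by (rule ennreal_mult) (use M(1) L(1) in \<open>auto simp: m_def\<close>)
    finally show "ennreal (norm (w y * cnj (conv f (dilate \<rho> s) y))) \<le> ennreal (M * \<Lambda> ^ CARD('N)) * ennreal (norm (w y) * m y)" .
  qed
  also have "\<dots> = ennreal (M * \<Lambda> ^ CARD('N)) * (\<integral>\<^sup>+y. ennreal (norm (w y) * m y) \<partial>lebesgue)"
    by (rule nn_integral_cmult) measurable
  also have "\<dots> \<le> ennreal (M * \<Lambda> ^ CARD('N)) * ennreal ((Lp_norm p w powr p) powr (1 / p) * (maximal_const CARD('N) q * Lp_norm q f powr q) powr (1 / q))"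
  proof (intro mult_left_mono nn_integral_Holder[OF _ _ _ _ pq])
    show "(\<integral>\<^sup>+x. ennreal (norm (w x) powr p) \<partial>lebesgue) \<le> ennreal (Lp_norm p w powr p)"
      using in_Lp_nn_integral[OF w] pq by simp
    have "(\<integral>\<^sup>+x. ennreal (m x powr q) \<partial>lebesgue) \<le> ennreal (maximal_const CARD('N) q) * (\<integral>\<^sup>+x. ennreal (norm (f x) powr q) \<partial>lebesgue)"
      by (rule maximal_strong_type[OF _ _ pq(2) \<open>m \<in> borel_measurable lebesgue\<close>])
        (auto simp: m_def Mf_def ennreal_enn2real_if)
    also have "\<dots> = ennreal (maximal_const CARD('N) q * Lp_norm q f powr q)"
      using in_Lp_nn_integral[OF f q0] maximal_const_pos[OF pq(2), of "CARD('N)"] by (simp add: ennreal_mult)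
    finally show "(\<integral>\<^sup>+x. ennreal (m x powr q) \<partial>lebesgue) \<le> ennreal (maximal_const CARD('N) q * Lp_norm q f powr q)" .
  qed (use maximal_const_pos[OF pq(2), of "CARD('N)"] in \<open>auto simp: m_def\<close>)
  also have "\<dots> = ennreal (M * \<Lambda> ^ CARD('N) * maximal_const CARD('N) q powr (1 / q) * Lp_norm p w * Lp_norm q f)"
    using pq M L maximal_const_pos[OF pq(2), of "CARD('N)"] Lp_norm_nonneg[of p w] Lp_norm_nonneg[of q f]
    by (simp add: powr_mult powr_powr mult_ac flip: ennreal_mult)
  finally show ?thesis .
qed

lemma measurable_conv:
  assumes "locally_integrable f" "test_function K" shows "conv f K \<in> borel_measurable lebesgue"
  by (rule smooth_measurable[OF smooth_conv[OF assms]])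

lemma conv_diff_left:
  assumes "locally_integrable f" "locally_integrable g" "test_function K"
  shows "conv (\<lambda>x. f x - g x) K y = conv f K y - conv g K y"
  unfolding conv_def using conv_integrable[OF assms(1,3)] conv_integrable[OF assms(2,3)]
  by (simp add: left_diff_distrib)

lemma measurable_cnj_comp: "f \<in> borel_measurable M \<Longrightarrow> (\<lambda>x. cnj (f x)) \<in> borel_measurable M"
  by (rule measurable_compose[OF _ borel_measurable_continuous_onI]) (auto intro: continuous_intros)

text \<open>The bound \<open>S\<close> on the scales keeps the supports of all mollifications in one
  ball, on which \<open>w\<close> is integrable and dominates.\<close>

lemma mollifier_continuous:
  fixes w f :: "real^'N::finite \<Rightarrow> complex"
  assumes w: "in_Lp p w" and p: "p \<ge> 1" and fc: "continuous_on UNIV f" and fs: "r > 0" "\<And>x. norm x \<ge> r \<Longrightarrow> f x = 0"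
    and \<rho>: "test_function \<rho>" and s: "\<And>k. s k > 0" "\<And>k. s k \<le> S" "s \<longlonglongrightarrow> 0"
  shows "(\<lambda>k. \<integral>y. w y * cnj (conv f (dilate \<rho> (s k)) y) \<partial>lebesgue) \<longlonglongrightarrow> cnj (\<integral>z. \<rho> z \<partial>lebesgue) * (\<integral>y. w y * cnj (f y) \<partial>lebesgue)"
proof -
  note [measurable] = in_Lp_measurable[OF w]
  obtain \<Lambda> where L: "\<Lambda> > 0" "\<And>x. norm x \<ge> \<Lambda> \<Longrightarrow> \<rho> x = 0" by (rule test_function_support[OF \<rho>]) blast
  obtain M where M: "M > 0" "\<And>x. norm (\<rho> x) \<le> M" by (rule test_function_bounded[OF \<rho>]) blast
  have S: "S > 0" using s(1,2) by (meson less_le_trans)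
  have "compact (f ` cball 0 r)" by (intro compact_continuous_image continuous_on_subset[OF fc]) auto
  then obtain B where B: "B > 0" "\<And>y. y \<in> f ` cball 0 r \<Longrightarrow> norm y \<le> B"
    using compact_imp_bounded bounded_pos by metis
  have fB: "norm (f x) \<le> B" for x using B fs(2)[of x] by (cases "norm x \<le> r") auto
  have li: "locally_integrable f" by (rule continuous_locally_integrable[OF fc])
  have fm: "f \<in> borel_measurable lebesgue" by (rule measurable_completion) (simp add: borel_measurable_continuous_onI fc)
  have T: "test_function (dilate \<rho> (s k))" for k by (rule test_function_dilate[OF \<rho> s(1)])
  have cm: "conv f (dilate \<rho> (s k)) \<in> borel_measurable lebesgue" for k by (rule measurable_conv[OF li T])
  define C where "C = M * \<Lambda> ^ CARD('N) * unit_ball_vol (real CARD('N)) * B"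
  have C: "C \<ge> 0" using M L B by (simp add: C_def)
  have bound: "norm (conv f (dilate \<rho> (s k)) y) \<le> C * indicator (cball 0 (r + \<Lambda> * S)) y" for k y
  proof (cases "norm y \<le> r + \<Lambda> * S")
    case True
    have 1: "ennreal (norm (conv f (dilate \<rho> (s k)) y)) \<le> ennreal (M / s k ^ CARD('N)) * (\<integral>\<^sup>+z. ennreal B * indicator (ball y (\<Lambda> * s k)) z \<partial>lebesgue)"
      by (rule norm_conv_le) (use fB M dilate_bound[OF M(2) s(1)] dilate_supp[OF L(2) s(1)] less_imp_le[OF s(1)] in auto)
    have 2: "(\<integral>\<^sup>+z. ennreal B * indicator (ball y (\<Lambda> * s k)) z \<partial>lebesgue) \<le> ennreal (B * (unit_ball_vol (real CARD('N)) * (\<Lambda> * s k) ^ CARD('N)))"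
      using B L s(1)[of k] by (subst nn_integral_cmult_indicator, simp, subst emeasure_lebesgue_ball) (auto simp flip: ennreal_mult)
    have "norm (conv f (dilate \<rho> (s k)) y) \<le> M / s k ^ CARD('N) * (B * (unit_ball_vol (real CARD('N)) * (\<Lambda> * s k) ^ CARD('N)))"
      by (rule norm_le_of_ennreal[OF 1 2]) (use M L B s(1)[of k] in auto)
    also have "\<dots> = C" using s(1)[of k] by (simp add: C_def power_mult_distrib)
    finally show ?thesis using True by simp
  next
    case False
    have "f z * dilate \<rho> (s k) (y - z) = 0" for z
    proof (cases "norm z \<ge> r")
      case z: False
      have "norm y \<le> norm (y - z) + norm z" using norm_triangle_ineq[of "y - z" z] by simp
      then have "norm (y - z) \<ge> \<Lambda> * S" using False z by simp
      moreover have "\<Lambda> * s k \<le> \<Lambda> * S" using L s(2)[of k] by (intro mult_left_mono) auto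
      ultimately have "dilate \<rho> (s k) (y - z) = 0" by (intro dilate_supp[OF L(2) s(1)]) auto
      then show ?thesis by simp
    qed (simp add: fs)
    then have "(\<lambda>z. f z * dilate \<rho> (s k) (y - z)) = (\<lambda>_. 0)" by (rule ext)
    then have "conv f (dilate \<rho> (s k)) y = 0" unfolding conv_def by (simp only: Bochner_Integration.integral_zero)
    then show ?thesis using False by simp
  qed
  have lim: "(\<lambda>k. \<integral>y. w y * cnj (conv f (dilate \<rho> (s k)) y) \<partial>lebesgue) \<longlonglongrightarrow> (\<integral>y. w y * cnj ((\<integral>z. \<rho> z \<partial>lebesgue) * f y) \<partial>lebesgue)"
  proof (rule integral_dominated_convergence[where w="\<lambda>y. C * norm (indicator (cball 0 (r + \<Lambda> * S)) y *\<^sub>R w y)"])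
    show "(\<lambda>y. w y * cnj ((\<integral>z. \<rho> z \<partial>lebesgue) * f y)) \<in> borel_measurable lebesgue"
      using measurable_cnj_comp[OF borel_measurable_times[OF borel_measurable_const fm]] by measurable
    show "(\<lambda>y. w y * cnj (conv f (dilate \<rho> (s k)) y)) \<in> borel_measurable lebesgue" for k
      using measurable_cnj_comp[OF cm] by measurable
    show "integrable lebesgue (\<lambda>y. C * norm (indicator (cball 0 (r + \<Lambda> * S)) y *\<^sub>R w y))"
      by (intro integrable_mult_right integrable_norm locally_integrable_cball in_Lp_locally_integrable[OF w p])
    show "AE y in lebesgue. (\<lambda>k. w y * cnj (conv f (dilate \<rho> (s k)) y)) \<longlonglongrightarrow> w y * cnj ((\<integral>z. \<rho> z \<partial>lebesgue) * f y)"
      by (intro AE_I2 tendsto_intros mollifier_pointwise fc \<rho> s)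
    show "AE y in lebesgue. norm (w y * cnj (conv f (dilate \<rho> (s k)) y)) \<le> C * norm (indicator (cball 0 (r + \<Lambda> * S)) y *\<^sub>R w y)" for k
    proof (rule AE_I2)
      fix y
      have "norm (w y) * norm (conv f (dilate \<rho> (s k)) y) \<le> norm (w y) * (C * indicator (cball 0 (r + \<Lambda> * S)) y)"
        by (intro mult_left_mono bound) simp
      then show "norm (w y * cnj (conv f (dilate \<rho> (s k)) y)) \<le> C * norm (indicator (cball 0 (r + \<Lambda> * S)) y *\<^sub>R w y)"
        by (simp add: norm_mult mult_ac)
    qed
  qed
  have "(\<integral>y. w y * cnj ((\<integral>z. \<rho> z \<partial>lebesgue) * f y) \<partial>lebesgue) = (\<integral>y. cnj (\<integral>z. \<rho> z \<partial>lebesgue) * (w y * cnj (f y)) \<partial>lebesgue)"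
    by (simp add: mult_ac)
  also have "\<dots> = cnj (\<integral>z. \<rho> z \<partial>lebesgue) * (\<integral>y. w y * cnj (f y) \<partial>lebesgue)" by simp
  finally show ?thesis using lim by simp
qed

lemma in_Lp_cnj: "in_Lp p f \<Longrightarrow> in_Lp p (\<lambda>x. cnj (f x))"
  by (auto simp: in_Lp_def intro: measurable_cnj_comp)

text \<open>Convergence of pairings with a fixed \<open>w\<close> is what the estimate for averages
  consumes. \<open>f\<close> is split into a continuous function and a remainder whose pairings are
  small uniformly in \<open>k\<close>.\<close>

lemma mollifier_Lp:
  fixes w f :: "real^'N::finite \<Rightarrow> complex"
  assumes w: "in_Lp p w" and f: "in_Lp q f" and pq: "p > 1" "q > 1" "1 / p + 1 / q = 1"
    and \<rho>: "test_function \<rho>" and s: "\<And>k. s k > 0" "\<And>k. s k \<le> S" "s \<longlonglongrightarrow> 0"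
  shows "(\<lambda>k. \<integral>y. w y * cnj (conv f (dilate \<rho> (s k)) y) \<partial>lebesgue) \<longlonglongrightarrow> cnj (\<integral>z. \<rho> z \<partial>lebesgue) * (\<integral>y. w y * cnj (f y) \<partial>lebesgue)"
proof (rule LIMSEQ_I)
  fix e :: real assume e: "e > 0"
  note [measurable] = in_Lp_measurable[OF w]
  obtain \<Lambda> where L: "\<Lambda> > 0" "\<And>x. norm x \<ge> \<Lambda> \<Longrightarrow> \<rho> x = 0" by (rule test_function_support[OF \<rho>]) blast
  obtain M where M: "M > 0" "\<And>x. norm (\<rho> x) \<le> M" by (rule test_function_bounded[OF \<rho>]) blast
  have p1: "p \<ge> 1" and q1: "q \<ge> 1" and q0: "q > 0" using pq by auto
  define K where "K = M * \<Lambda> ^ CARD('N) * maximal_const CARD('N) q powr (1 / q)"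
  have K: "K \<ge> 0" using M L by (simp add: K_def)
  define c where "c = (\<integral>z. \<rho> z \<partial>lebesgue)"
  \<comment> \<open>\<open>H\<close> adds the bounds for the pairings with the mollified remainder
    and with its limit. The choice of \<open>d\<close> below makes \<open>H\<close> times the norm
    of the remainder less than \<open>e / 2\<close>; \<open>H + 1\<close> avoids a division by
    zero.\<close>
  define H where "H = (K + norm c) * Lp_norm p w"
  have H: "H \<ge> 0" using K by (simp add: H_def Lp_norm_nonneg)
  define d where "d = (e / (2 * (H + 1))) powr q"
  have d: "d > 0" using e H by (simp add: d_def)
  obtain g r where g: "continuous_on UNIV g" "r > 0" "\<And>x. norm x \<ge> r \<Longrightarrow> g x = 0"
    "(\<integral>\<^sup>+x. ennreal (norm (f x - g x) powr q) \<partial>lebesgue) < ennreal d"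
    by (rule Lp_density[OF f q0 d]) blast
  have gm: "g \<in> borel_measurable lebesgue" by (rule measurable_completion) (simp add: borel_measurable_continuous_onI g)
  define h where "h x = f x - g x" for x
  have h: "in_Lp q h"
    unfolding h_def[abs_def]
    by (rule in_LpI) (use in_Lp_measurable[OF f] gm g(4) in \<open>auto intro: less_trans\<close>)
  have gL: "in_Lp q g" using in_Lp_diff[OF f h q0] by (simp add: h_def)
  have hn: "Lp_norm q h \<le> e / (2 * (H + 1))"
  proof -
    have "ennreal (Lp_norm q h powr q) < ennreal d" using g(4) in_Lp_nn_integral[OF h q0] by (simp add: h_def)
    then have "Lp_norm q h powr q < d" by (simp add: ennreal_less_iff)
    then have "(Lp_norm q h powr q) powr (1 / q) \<le> d powr (1 / q)" using q0 by (intro powr_mono2) auto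
    then show ?thesis using q0 e H Lp_norm_nonneg[of q h] by (simp add: d_def powr_powr)
  qed
  have Hh: "H * Lp_norm q h < e / 2"
  proof -
    have "H * Lp_norm q h \<le> H * (e / (2 * (H + 1)))" by (rule mult_left_mono[OF hn H])
    also have "\<dots> = e / 2 * (H / (H + 1))" using H by (simp add: field_simps)
    also have "\<dots> < e / 2 * 1" using H e by (intro mult_strict_left_mono) (auto simp: field_simps)
    finally show ?thesis by simp
  qed
  have T: "test_function (dilate \<rho> (s k))" for k by (rule test_function_dilate[OF \<rho> s(1)])
  let ?I = "\<lambda>f k. \<integral>y. w y * cnj (conv f (dilate \<rho> (s k)) y) \<partial>lebesgue"
  have int: "integrable lebesgue (\<lambda>y. w y * cnj (conv f (dilate \<rho> (s k)) y))" if f: "in_Lp q f" for f k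
  proof (rule integrableI_bounded)
    show "(\<lambda>y. w y * cnj (conv f (dilate \<rho> (s k)) y)) \<in> borel_measurable lebesgue"
      using measurable_cnj_comp[OF measurable_conv[OF in_Lp_locally_integrable[OF f q1] T]] by measurable
    show "(\<integral>\<^sup>+y. ennreal (norm (w y * cnj (conv f (dilate \<rho> (s k)) y))) \<partial>lebesgue) < \<infinity>"
      using order_le_less_trans[OF conv_pairing_bound[OF w f pq \<rho> M L s(1)] ennreal_less_top] by simp
  qed
  have intf: "integrable lebesgue (\<lambda>y. w y * cnj (f y))" if f: "in_Lp q f" for f
    by (rule integrable_mult_Lp[OF w in_Lp_cnj[OF f] pq])
  have eq1: "?I f k = ?I g k + ?I h k" for k
  proof -
    have "conv h (dilate \<rho> (s k)) y = conv f (dilate \<rho> (s k)) y - conv g (dilate \<rho> (s k)) y" for y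
      unfolding h_def by (rule conv_diff_left[OF in_Lp_locally_integrable[OF f q1] in_Lp_locally_integrable[OF gL q1] T])
    then have eq: "conv f (dilate \<rho> (s k)) y = conv g (dilate \<rho> (s k)) y + conv h (dilate \<rho> (s k)) y" for y
      by simp
    have "?I f k = (\<integral>y. w y * cnj (conv g (dilate \<rho> (s k)) y) + w y * cnj (conv h (dilate \<rho> (s k)) y) \<partial>lebesgue)"
      by (simp only: eq complex_cnj_add distrib_left)
    then show ?thesis using int[OF gL] int[OF h] by simp
  qed
  have eq2: "(\<integral>y. w y * cnj (f y) \<partial>lebesgue) = (\<integral>y. w y * cnj (g y) \<partial>lebesgue) + (\<integral>y. w y * cnj (h y) \<partial>lebesgue)"
  proof -
    have "(\<integral>y. w y * cnj (f y) \<partial>lebesgue) = (\<integral>y. w y * cnj (g y) + w y * cnj (h y) \<partial>lebesgue)"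
      by (simp add: h_def algebra_simps)
    then show ?thesis using intf[OF gL] intf[OF h] by simp
  qed
  have b1: "norm (?I h k) \<le> K * Lp_norm p w * Lp_norm q h" for k
  proof -
    have "ennreal (norm (?I h k)) \<le> (\<integral>\<^sup>+y. ennreal (norm (w y * cnj (conv h (dilate \<rho> (s k)) y))) \<partial>lebesgue)"
      by (rule integral_norm_bound_ennreal[OF int[OF h]])
    also have "\<dots> \<le> ennreal (K * Lp_norm p w * Lp_norm q h)"
      unfolding K_def by (rule conv_pairing_bound[OF w h pq \<rho> M L s(1)])
    finally show ?thesis using K Lp_norm_nonneg[of p w] Lp_norm_nonneg[of q h] by (simp add: ennreal_le_iff)
  qed
  have b2: "norm (\<integral>y. w y * cnj (h y) \<partial>lebesgue) \<le> Lp_norm p w * Lp_norm q h"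
  proof -
    have "ennreal (norm (\<integral>y. w y * cnj (h y) \<partial>lebesgue)) \<le> (\<integral>\<^sup>+y. ennreal (norm (w y) * norm (h y)) \<partial>lebesgue)"
      using integral_norm_bound_ennreal[OF intf[OF h]] by (simp add: norm_mult)
    also have "\<dots> \<le> ennreal (Lp_norm p w * Lp_norm q h)" by (rule Holder_Lp[OF w h pq])
    finally show ?thesis using Lp_norm_nonneg[of p w] Lp_norm_nonneg[of q h] by (simp add: ennreal_le_iff)
  qed
  have "(\<lambda>k. ?I g k) \<longlonglongrightarrow> cnj c * (\<integral>y. w y * cnj (g y) \<partial>lebesgue)"
    unfolding c_def by (rule mollifier_continuous[OF w p1 g(1) g(2,3) \<rho> s])
  from LIMSEQ_D[OF this, of "e / 2"] e
  obtain k0 where k0: "\<And>k. k \<ge> k0 \<Longrightarrow> norm (?I g k - cnj c * (\<integral>y. w y * cnj (g y) \<partial>lebesgue)) < e / 2"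
    by auto
  show "\<exists>k0. \<forall>k\<ge>k0. norm (?I f k - cnj (\<integral>z. \<rho> z \<partial>lebesgue) * (\<integral>y. w y * cnj (f y) \<partial>lebesgue)) < e"
  proof (intro exI[of _ k0] allI impI)
    fix k assume k: "k \<ge> k0"
    let ?J = "\<lambda>f. \<integral>y. w y * cnj (f y) \<partial>lebesgue"
    have "?I f k - cnj c * ?J f = (?I g k - cnj c * ?J g) + (?I h k - cnj c * ?J h)"
      unfolding eq1 eq2 by (simp add: algebra_simps)
    then have "norm (?I f k - cnj c * ?J f) \<le> norm (?I g k - cnj c * ?J g) + norm (?I h k - cnj c * ?J h)"
      by (simp only: norm_triangle_ineq)
    also have "norm (?I h k - cnj c * ?J h) \<le> norm (?I h k) + norm c * norm (?J h)"
      using norm_triangle_ineq4[of "?I h k" "cnj c * ?J h"] by (simp add: norm_mult)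
    also have "\<dots> \<le> K * Lp_norm p w * Lp_norm q h + norm c * (Lp_norm p w * Lp_norm q h)"
      by (intro add_mono b1 mult_left_mono b2) auto
    also have "\<dots> = H * Lp_norm q h" by (simp add: H_def algebra_simps)
    finally show "norm (?I f k - cnj (\<integral>z. \<rho> z \<partial>lebesgue) * ?J f) < e" using k0[OF k] Hh by (simp add: c_def)
  qed
qed

text \<open>Hoelder's inequality on a ball of radius comparable to \<open>s\<close> bounds the
  mollification by a multiple of \<open>s\<close> to the power \<open>-N/q\<close>, uniformly in the
  point. This disposes of the coarsest scale left by telescoping.\<close>

lemma conv_dilate_at_infinity:
  fixes w f :: "real^'N::finite \<Rightarrow> complex"
  assumes w: "integrable lebesgue w" and f: "in_Lp q f" and q: "q > 1"
    and \<rho>: "test_function \<rho>" and R: "R > 0"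
  shows "(\<lambda>k. \<integral>y. w y * cnj (conv f (dilate \<rho> (2 ^ k * R)) y) \<partial>lebesgue) \<longlonglongrightarrow> 0"
proof -
  obtain \<Lambda> where L: "\<Lambda> > 0" "\<And>x. norm x \<ge> \<Lambda> \<Longrightarrow> \<rho> x = 0" by (rule test_function_support[OF \<rho>]) blast
  obtain M where M: "M > 0" "\<And>x. norm (\<rho> x) \<le> M" by (rule test_function_bounded[OF \<rho>]) blast
  let ?N = "CARD('N)" and ?w = "unit_ball_vol (real CARD('N))"
  have q0: "q > 0" using q by simp
  define F where "F = Lp_norm q f"
  define C where "C = M * F * (?w * \<Lambda> ^ ?N) powr (1 - 1 / q)"
  have C: "C \<ge> 0" using M by (simp add: C_def F_def Lp_norm_nonneg)
  have bound: "norm (conv f (dilate \<rho> s) y) \<le> C * s powr (- real ?N / q)" if s: "s > 0" for s y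
  proof -
    have 1: "ennreal (norm (conv f (dilate \<rho> s) y)) \<le> ennreal (M / s ^ ?N) * (\<integral>\<^sup>+z. ennreal (norm (f z)) * indicator (ball y (\<Lambda> * s)) z \<partial>lebesgue)"
      by (rule norm_conv_le) (use in_Lp_measurable[OF f] s M dilate_bound[OF M(2) s] dilate_supp[OF L(2) s] in auto)
    have 2: "(\<integral>\<^sup>+z. ennreal (norm (f z)) * indicator (ball y (\<Lambda> * s)) z \<partial>lebesgue) \<le> ennreal ((F powr q) powr (1 / q) * (?w * (\<Lambda> * s) ^ ?N) powr (1 - 1 / q))"
    proof (rule nn_integral_Holder_ball[OF _ _ q])
      have "(\<integral>\<^sup>+z. ennreal (norm (f z) powr q) * indicator (ball y (\<Lambda> * s)) z \<partial>lebesgue) \<le> (\<integral>\<^sup>+z. ennreal (norm (f z) powr q) \<partial>lebesgue)"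
        by (intro nn_integral_mono) (auto split: split_indicator)
      also have "\<dots> = ennreal (F powr q)" unfolding F_def by (rule in_Lp_nn_integral[OF f q0])
      finally show "(\<integral>\<^sup>+z. ennreal (norm (f z) powr q) * indicator (ball y (\<Lambda> * s)) z \<partial>lebesgue) \<le> ennreal (F powr q)" .
    qed (use in_Lp_measurable[OF f] L s in auto)
    have "norm (conv f (dilate \<rho> s) y) \<le> M / s ^ ?N * ((F powr q) powr (1 / q) * (?w * (\<Lambda> * s) ^ ?N) powr (1 - 1 / q))"
      by (rule norm_le_of_ennreal[OF 1 2]) (use M s in auto)
    also have "(F powr q) powr (1 / q) = F" using q0 by (simp add: powr_powr F_def Lp_norm_nonneg)
    also have "(?w * (\<Lambda> * s) ^ ?N) powr (1 - 1 / q) = (?w * \<Lambda> ^ ?N) powr (1 - 1 / q) * s powr (real ?N * (1 - 1 / q))"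
    proof -
      have "?w * (\<Lambda> * s) ^ ?N = (?w * \<Lambda> ^ ?N) * s powr real ?N" using s by (simp add: power_mult_distrib powr_realpow)
      then show ?thesis using L by (simp only: powr_mult powr_powr)
    qed
    also have "M / s ^ ?N * (F * ((?w * \<Lambda> ^ ?N) powr (1 - 1 / q) * s powr (real ?N * (1 - 1 / q))))
       = C * (s powr (real ?N * (1 - 1 / q)) / s powr real ?N)"
      using s by (simp add: C_def powr_realpow)
    also have "s powr (real ?N * (1 - 1 / q)) / s powr real ?N = s powr (- real ?N / q)"
      unfolding powr_diff[symmetric] by (rule arg_cong[of _ _ "\<lambda>e. s powr e"]) (simp add: algebra_simps)
    finally show ?thesis .
  qed
  have fm: "conv f (dilate \<rho> (2 ^ k * R)) \<in> borel_measurable lebesgue" for k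
    by (rule measurable_conv) (use in_Lp_locally_integrable[OF f] q test_function_dilate[OF \<rho>] R in auto)
  define D where "D = (\<integral>y. norm (w y) \<partial>lebesgue) * (C * R powr (- real ?N / q))"
  have le: "norm (\<integral>y. w y * cnj (conv f (dilate \<rho> (2 ^ k * R)) y) \<partial>lebesgue) \<le> D * (2 powr (- real ?N / q)) ^ k" for k
  proof -
    let ?B = "C * (2 ^ k * R) powr (- real ?N / q)"
    have b: "norm (cnj (conv f (dilate \<rho> (2 ^ k * R)) y)) \<le> ?B" for y using bound[of "2 ^ k * R" y] R by simp
    have "norm (\<integral>y. w y * cnj (conv f (dilate \<rho> (2 ^ k * R)) y) \<partial>lebesgue) \<le> (\<integral>y. norm (w y * cnj (conv f (dilate \<rho> (2 ^ k * R)) y)) \<partial>lebesgue)"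
      by (rule integral_norm_bound)
    also have "\<dots> \<le> (\<integral>y. norm (w y) * ?B \<partial>lebesgue)"
    proof (rule integral_mono)
      show "integrable lebesgue (\<lambda>y. norm (w y * cnj (conv f (dilate \<rho> (2 ^ k * R)) y)))"
        by (intro integrable_norm integrable_bounded_mult[OF w _ b] measurable_cnj_comp fm)
      show "integrable lebesgue (\<lambda>y. norm (w y) * ?B)" using w by simp
      show "norm (w y * cnj (conv f (dilate \<rho> (2 ^ k * R)) y)) \<le> norm (w y) * ?B" for y
        unfolding norm_mult by (intro mult_left_mono b) simp
    qed
    also have "\<dots> = (\<integral>y. norm (w y) \<partial>lebesgue) * ?B" by simp
    also have "(2 ^ k * R) powr (- real ?N / q) = (2 powr (- real ?N / q)) ^ k * R powr (- real ?N / q)"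
    proof -
      have "(2 ^ k * R) powr (- real ?N / q) = (2 powr real k) powr (- real ?N / q) * R powr (- real ?N / q)"
        using R by (simp add: powr_mult powr_realpow)
      also have "(2 powr real k) powr (- real ?N / q) = (2 powr (- real ?N / q)) powr real k"
        by (simp only: powr_powr mult.commute)
      finally show ?thesis by (simp add: powr_realpow)
    qed
    finally show ?thesis by (simp add: D_def mult_ac)
  qed
  have lt: "2 powr (- real ?N / q) < (2::real) powr 0" using q by (intro powr_less_mono) (auto simp: card_gt_0_iff)
  have "(\<lambda>k. (2 powr (- real ?N / q) :: real) ^ k) \<longlonglongrightarrow> 0" by (rule LIMSEQ_power_zero) (use lt in simp)
  then have "(\<lambda>k. D * (2 powr (- real ?N / q)) ^ k) \<longlonglongrightarrow> D * 0" by (rule tendsto_mult_left)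
  then have lim: "(\<lambda>k. D * (2 powr (- real ?N / q)) ^ k) \<longlonglongrightarrow> 0" by (simp only: mult_zero_right)
  show ?thesis by (rule Lim_null_comparison[OF always_eventually[OF allI[OF le]] lim])
qed

section \<open>Estimates for averages\<close>

lemma integrable_mult_test_function:
  assumes f: "locally_integrable f" and K: "test_function K"
  shows "integrable lebesgue (\<lambda>z. f z * K z)"
proof -
  have "test_function (\<lambda>x. K ((-1) *\<^sub>R x + 0))" by (rule test_function_affine[OF K]) simp
  from conv_integrable[OF f this, of 0] show ?thesis by simp
qed

text \<open>The test function is \<psi> times the conjugate of \<open>E\<close>. As distributions
  are paired bilinearly, the adjoint coefficients act on the second factor as minus the conjugate of
  \<open>L_j E\<close> and on \<psi> as minus the conjugate field.\<close>

lemma divergence_product_rule: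
  fixes c :: "complex^'N::finite^'n::finite"
  assumes V: "\<And>j. locally_integrable (\<lambda>x. V x $ j)"
    and div: "has_distr_adjoint_div c V g" and \<psi>: "test_function \<psi>" and E: "smooth E"
  shows "(\<Sum>j\<in>UNIV. \<integral>y. V y $ j * (\<psi> y * cnj (vfield (c $ j) E y)) \<partial>lebesgue) =
    (\<integral>y. g y * (\<psi> y * cnj (E y)) \<partial>lebesgue)
      - (\<Sum>j\<in>UNIV. \<integral>y. V y $ j * (vfield (cnj_row (c $ j)) \<psi> y * cnj (E y)) \<partial>lebesgue)"
proof -
  define T where "T y = \<psi> y * cnj (E y)" for y
  have T: "test_function T"
    unfolding T_def[abs_def] by (intro test_function_mult_smooth \<psi> smooth_cnj E)
  have dE: "E differentiable at y" for y by (rule smooth_differentiable[OF E])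
  have dcE: "(\<lambda>y. cnj (E y)) differentiable at y" for y by (rule smooth_differentiable[OF smooth_cnj[OF E]])
  have vT: "vfield (adjoint_vfield (c $ j)) T y = - (vfield (cnj_row (c $ j)) \<psi> y * cnj (E y) + \<psi> y * cnj (vfield (c $ j) E y))" for j y
  proof -
    have "partial k T y = partial k \<psi> y * cnj (E y) + \<psi> y * cnj (partial k E y)" for k
      unfolding T_def[abs_def] using dE dcE test_function_differentiable[OF \<psi>] by (simp add: partial_mult partial_cnj)
    then show ?thesis
      by (simp add: vfield_def adjoint_vfield_def cnj_row_def sum_negf sum_subtractf sum.distrib sum_distrib_left sum_distrib_right algebra_simps)
  qed
  have i1: "integrable lebesgue (\<lambda>y. V y $ j * (vfield (cnj_row (c $ j)) \<psi> y * cnj (E y)))" for j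
    by (intro integrable_mult_test_function V test_function_mult_smooth test_function_vfield \<psi> smooth_cnj E)
  have i2: "integrable lebesgue (\<lambda>y. V y $ j * (\<psi> y * cnj (vfield (c $ j) E y)))" for j
    by (intro integrable_mult_test_function V test_function_mult_smooth \<psi> smooth_cnj smooth_vfield E)
  have dv: "distr_vfield (adjoint_vfield (c $ j)) (\<lambda>x. V x $ j) T
    = (\<integral>y. V y $ j * (vfield (cnj_row (c $ j)) \<psi> y * cnj (E y)) \<partial>lebesgue) + (\<integral>y. V y $ j * (\<psi> y * cnj (vfield (c $ j) E y)) \<partial>lebesgue)" for j
    unfolding distr_vfield_def vT mult_minus_right distrib_left using i1[of j] i2[of j] by simp
  have "(\<Sum>j\<in>UNIV. distr_vfield (adjoint_vfield (c $ j)) (\<lambda>x. V x $ j) T) = (\<integral>y. g y * T y \<partial>lebesgue)"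
    using div T unfolding has_distr_adjoint_div_def by blast
  then have "(\<integral>y. g y * T y \<partial>lebesgue) = (\<Sum>j\<in>UNIV. (\<integral>y. V y $ j * (vfield (cnj_row (c $ j)) \<psi> y * cnj (E y)) \<partial>lebesgue) + (\<integral>y. V y $ j * (\<psi> y * cnj (vfield (c $ j) E y)) \<partial>lebesgue))"
    by (simp only: dv)
  then show ?thesis by (simp add: T_def sum.distrib)
qed

lemma in_Lp_mult_bounded:
  fixes f h :: "real^'N::finite \<Rightarrow> complex"
  assumes f: "in_Lp p f" and h: "h \<in> borel_measurable lebesgue" "\<And>x. norm (h x) \<le> B" and p: "p > 0"
  shows "in_Lp p (\<lambda>x. f x * h x)"
proof (rule in_LpI)
  note [measurable] = in_Lp_measurable[OF f] h(1)
  show "(\<lambda>x. f x * h x) \<in> borel_measurable lebesgue" by measurable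
  have "(\<integral>\<^sup>+x. ennreal (norm (f x * h x) powr p) \<partial>lebesgue) \<le> (\<integral>\<^sup>+x. ennreal (B powr p) * ennreal (norm (f x) powr p) \<partial>lebesgue)"
  proof (rule nn_integral_mono)
    fix x
    have "norm (f x * h x) powr p = norm (f x) powr p * norm (h x) powr p" by (simp add: norm_mult powr_mult)
    also have "\<dots> \<le> norm (f x) powr p * B powr p" using h p by (intro mult_left_mono powr_mono2) auto
    finally show "ennreal (norm (f x * h x) powr p) \<le> ennreal (B powr p) * ennreal (norm (f x) powr p)"
      by (simp add: ennreal_leI mult.commute flip: ennreal_mult)
  qed
  also have "\<dots> = ennreal (B powr p) * ennreal (Lp_norm p f powr p)"
    by (subst nn_integral_cmult) (auto simp: in_Lp_nn_integral[OF f p])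
  also have "\<dots> < \<infinity>" by (simp add: ennreal_mult_less_top)
  finally show "(\<integral>\<^sup>+x. ennreal (norm (f x * h x) powr p) \<partial>lebesgue) < \<infinity>" .
qed

lemma vfield_eq_zero:
  assumes "\<And>y. dist x y \<ge> r \<Longrightarrow> \<psi> y = 0" "r < R" "y \<notin> ball x R"
  shows "vfield a \<psi> y = 0"
proof -
  have "((\<lambda>_. 0) has_derivative (\<lambda>_. 0)) (at y)" by simp
  then have "(\<psi> has_derivative (\<lambda>_. 0)) (at y)"
    by (rule has_derivative_transform_within_open[where s="- cball x r"]) (use assms in auto)
  then have "partial k \<psi> y = 0" for k by (rule partial_eqI)
  then show ?thesis by (simp add: vfield_def)
qed

context elliptic_kernel
begin

lemma osc_const_nonneg: "osc_const \<ge> 0"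
  unfolding osc_const_def P_norm_def using small_const_nonneg powr_theta_less M0 L1
  by (intro add_nonneg_nonneg mult_nonneg_nonneg divide_nonneg_nonneg sum_nonneg) auto

text \<open>\<open>X k - Y k\<close> pairs \<psi> times \<open>V\<close> with the gradient of the
  function \<open>E\<close> for the scales from \<open>R / 2^k\<close> to \<open>2^k * R\<close>,
  where the divergence identity and the oscillation bound hold uniformly in \<open>k\<close>. As
  \<open>k\<close> grows, \<open>X\<close> tends to the average in question times the conjugate of
  the integral of \<rho>, and \<open>Y\<close> tends to 0.\<close>

lemma local_estimate:
  assumes pq: "p > 1" "q > 1" "1 / p + 1 / q = 1"
    and V: "in_Lp p V" and div: "has_distr_adjoint_div c V g" and g: "in_Lp p g"
    and dG: "has_distr_gradient c \<phi> G" and G: "in_Lp q G"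
    and \<psi>: "test_function \<psi>" and R: "R > 0" and A: "A \<ge> 0"
    and supp: "\<And>y. dist x y \<ge> R / 2 \<Longrightarrow> \<psi> y = 0"
    and \<psi>_le: "\<And>y. norm (\<psi> y) \<le> A / R ^ CARD('N)"
    and d\<psi>_le: "\<And>j y. norm (vfield (cnj_row (c $ j)) \<psi> y) \<le> A / R ^ (CARD('N) + 1)"
    and a: "a \<ge> 0" and b: "b \<ge> 0"
    and Ha: "\<And>r. r > 0 \<Longrightarrow> (\<integral>\<^sup>+z. ennreal ((norm (V z) + norm (g z)) powr \<alpha>) * indicator (ball x r) z \<partial>lebesgue) \<le> ennreal (a * r ^ CARD('N))"
    and Hb: "\<And>r. r > 0 \<Longrightarrow> (\<integral>\<^sup>+z. ennreal (norm (G z) powr \<beta>) * indicator (ball x r) z \<partial>lebesgue) \<le> ennreal (b * r ^ CARD('N))"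
  shows "norm (\<integral>z. \<rho> z \<partial>lebesgue) * norm (\<integral>y. hermitian_prod (V y) (G y) * \<psi> y \<partial>lebesgue)
    \<le> real CARD('n) * osc_const * (A * max 1 R) * (a powr (1 / \<alpha>) * b powr (1 / \<beta>))"
proof -
  have p1: "p \<ge> 1" and q1: "q \<ge> 1" and p0: "p > 0" and q0: "q > 0" using pq by auto
  have Vj: "in_Lp p (\<lambda>x. V x $ j)" for j by (rule in_Lp_component[OF V p0])
  have Gj: "in_Lp q (\<lambda>x. G x $ j)" for j by (rule in_Lp_component[OF G q0])
  have Vl: "locally_integrable (\<lambda>x. V x $ j)" for j by (rule in_Lp_locally_integrable[OF Vj p1])
  have Gl: "locally_integrable (\<lambda>x. G x $ j)" for j by (rule in_Lp_locally_integrable[OF Gj q1])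
  have gl: "locally_integrable g" by (rule in_Lp_locally_integrable[OF g p1])
  note [measurable] = in_Lp_measurable[OF V] in_Lp_measurable[OF g] in_Lp_measurable[OF G]
  define u where "u z = norm (V z) + norm (g z)" for z
  have um: "u \<in> borel_measurable lebesgue" unfolding u_def[abs_def] by measurable
  have u0: "u z \<ge> 0" for z by (simp add: u_def)
  have n1: "real CARD('n) \<ge> 1" by (simp add: Suc_leI)
  define B where "B = real CARD('n) * osc_const * (A * max 1 R) * (a powr (1 / \<alpha>) * b powr (1 / \<beta>))"
  define w where "w j y = V y $ j * \<psi> y" for j y
  define X where "X k = (\<Sum>j\<in>UNIV. \<integral>y. w j y * cnj (conv (\<lambda>x. G x $ j) (dilate \<rho> (R / 2 ^ k)) y) \<partial>lebesgue)" for k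
  define Y where "Y k = (\<Sum>j\<in>UNIV. \<integral>y. w j y * cnj (conv (\<lambda>x. G x $ j) (dilate \<rho> (2 ^ k * R)) y) \<partial>lebesgue)" for k
  have bound: "norm (X k - Y k) \<le> B" for k
  proof -
    obtain E where E: "smooth E"
      "\<And>i y. vfield (c $ i) E y = conv (\<lambda>x. G x $ i) (dilate \<rho> (R / 2 ^ k)) y - conv (\<lambda>x. G x $ i) (dilate \<rho> (2 ^ k * R)) y"
      "(\<integral>\<^sup>+y. ennreal (u y * norm (E y)) * indicator (ball x R) y \<partial>lebesgue)
      \<le> ennreal (osc_const * R ^ (CARD('N) + 1) * a powr (1 / \<alpha>) * b powr (1 / \<beta>))"
      by (rule oscillation[where m=k and n=k, OF dG Gl in_Lp_measurable[OF G] um u0 R a b Ha[folded u_def] Hb]) (assumption, assumption, rule that)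
    have Em: "E \<in> borel_measurable lebesgue" by (rule smooth_measurable[OF E(1)])
    note [measurable] = um Em
    have sc: "smooth (conv (\<lambda>x. G x $ j) (dilate \<rho> s))" if "s > 0" for j s
      by (intro smooth_conv Gl test_function_dilate rho that)
    have iw: "integrable lebesgue (\<lambda>y. w j y * cnj (conv (\<lambda>x. G x $ j) (dilate \<rho> s) y))" if "s > 0" for j s
    proof -
      have "integrable lebesgue (\<lambda>y. V y $ j * (\<psi> y * cnj (conv (\<lambda>x. G x $ j) (dilate \<rho> s) y)))"
        by (intro integrable_mult_test_function Vl test_function_mult_smooth \<psi> smooth_cnj sc that)
      then show ?thesis by (simp add: w_def mult.assoc)
    qed
    have "X k - Y k = (\<Sum>j\<in>UNIV. \<integral>y. V y $ j * (\<psi> y * cnj (vfield (c $ j) E y)) \<partial>lebesgue)"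
    proof -
      have "(\<integral>y. V y $ j * (\<psi> y * cnj (vfield (c $ j) E y)) \<partial>lebesgue)
         = (\<integral>y. w j y * cnj (conv (\<lambda>x. G x $ j) (dilate \<rho> (R / 2 ^ k)) y) - w j y * cnj (conv (\<lambda>x. G x $ j) (dilate \<rho> (2 ^ k * R)) y) \<partial>lebesgue)" for j
        by (intro Bochner_Integration.integral_cong refl) (simp add: E(2) w_def algebra_simps)
      then show ?thesis using iw R by (simp add: X_def Y_def sum_subtractf)
    qed
    also have "\<dots> = (\<integral>y. g y * (\<psi> y * cnj (E y)) \<partial>lebesgue)
      - (\<Sum>j\<in>UNIV. \<integral>y. V y $ j * (vfield (cnj_row (c $ j)) \<psi> y * cnj (E y)) \<partial>lebesgue)"
      by (rule divergence_product_rule[OF Vl div \<psi> E(1)])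
    also have "\<dots> = (\<integral>y. g y * (\<psi> y * cnj (E y)) - (\<Sum>j\<in>UNIV. V y $ j * (vfield (cnj_row (c $ j)) \<psi> y * cnj (E y))) \<partial>lebesgue)"
    proof -
      have j1: "integrable lebesgue (\<lambda>y. V y $ j * (vfield (cnj_row (c $ j)) \<psi> y * cnj (E y)))" for j
        by (intro integrable_mult_test_function Vl test_function_mult_smooth test_function_vfield \<psi> smooth_cnj E)
      have j2: "integrable lebesgue (\<lambda>y. g y * (\<psi> y * cnj (E y)))"
        by (intro integrable_mult_test_function gl test_function_mult_smooth \<psi> smooth_cnj E)
      show ?thesis using j1 j2 by simp
    qed
    finally have eq: "X k - Y k = (\<integral>y. g y * (\<psi> y * cnj (E y)) - (\<Sum>j\<in>UNIV. V y $ j * (vfield (cnj_row (c $ j)) \<psi> y * cnj (E y))) \<partial>lebesgue)"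
      (is "_ = (\<integral>y. ?F y \<partial>lebesgue)") .
    have iF: "integrable lebesgue ?F"
      by (intro Bochner_Integration.integrable_diff Bochner_Integration.integrable_sum integrable_mult_test_function gl Vl
          test_function_mult_smooth test_function_vfield \<psi> smooth_cnj E)
    \<comment> \<open>The bound for \<psi> exceeds the one for its derivatives by the factor
      \<open>R\<close>; with \<open>max 1 R\<close> a single constant covers both.\<close>
    define C where "C = real CARD('n) * (A * max 1 R / R ^ (CARD('N) + 1))"
    have C0: "C \<ge> 0" using A R by (simp add: C_def)
    have F_le: "norm (?F y) \<le> C * (u y * norm (E y))" for y
    proof -
      have g1: "norm (\<psi> y) \<le> C"
      proof -
        have "norm (\<psi> y) \<le> A * R / R ^ (CARD('N) + 1)" using \<psi>_le[of y] R by simp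
        also have "\<dots> \<le> A * max 1 R / R ^ (CARD('N) + 1)" using A R by (intro divide_right_mono mult_left_mono) auto
        also have "\<dots> \<le> C" unfolding C_def using n1 A R mult_right_mono[OF n1, of "A * max 1 R / R ^ (CARD('N) + 1)"] by simp
        finally show ?thesis .
      qed
      have g2: "norm (vfield (cnj_row (c $ j)) \<psi> y) \<le> A * max 1 R / R ^ (CARD('N) + 1)" for j
      proof -
        have "A / R ^ (CARD('N) + 1) \<le> A * max 1 R / R ^ (CARD('N) + 1)"
          using A R mult_left_mono[of 1 "max 1 R" A] by (intro divide_right_mono) auto
        then show ?thesis using d\<psi>_le[of j y] by linarith
      qed
      have "norm (?F y) \<le> norm (g y * (\<psi> y * cnj (E y))) + (\<Sum>j\<in>UNIV. norm (V y $ j * (vfield (cnj_row (c $ j)) \<psi> y * cnj (E y))))"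
        by (rule order_trans[OF norm_triangle_ineq4 add_left_mono[OF norm_sum]])
      also have "\<dots> \<le> norm (g y) * (C * norm (E y)) + (\<Sum>j\<in>(UNIV::'n set). norm (V y) * ((A * max 1 R / R ^ (CARD('N) + 1)) * norm (E y)))"
        unfolding norm_mult complex_mod_cnj
        by (intro add_mono sum_mono mult_mono mult_left_mono mult_right_mono g1 g2 Finite_Cartesian_Product.norm_nth_le order_refl norm_ge_zero mult_nonneg_nonneg)
          (use A R in auto)
      also have "\<dots> = C * (u y * norm (E y))" by (simp add: C_def u_def algebra_simps add_divide_distrib)
      finally show ?thesis .
    qed
    have F_zero: "?F y = 0" if "y \<notin> ball x R" for y
    proof -
      \<comment> \<open>Support within radius \<open>R / 2\<close> leaves a margin: every
        \<open>y\<close> outside the ball of radius \<open>R\<close> has a neighbourhood where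
        \<psi> vanishes.\<close>
      have "vfield d \<psi> y = 0" for d
        by (rule vfield_eq_zero[where r="R / 2" and x=x and R=R]) (use supp R that in auto)
      moreover have "\<psi> y = 0" by (rule supp) (use R that in auto)
      ultimately show ?thesis by simp
    qed
    have "ennreal (norm (X k - Y k)) \<le> (\<integral>\<^sup>+y. ennreal (norm (?F y)) \<partial>lebesgue)"
      unfolding eq by (rule integral_norm_bound_ennreal[OF iF])
    also have "\<dots> \<le> (\<integral>\<^sup>+y. ennreal C * (ennreal (u y * norm (E y)) * indicator (ball x R) y) \<partial>lebesgue)"
    proof (rule nn_integral_mono)
      fix y
      show "ennreal (norm (?F y)) \<le> ennreal C * (ennreal (u y * norm (E y)) * indicator (ball x R) y)"
      proof (cases "y \<in> ball x R")
        case True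
        have "ennreal (norm (?F y)) \<le> ennreal (C * (u y * norm (E y)))" by (rule ennreal_leI[OF F_le])
        also have "\<dots> = ennreal C * ennreal (u y * norm (E y))" by (rule ennreal_mult) (use C0 u0 in auto)
        finally show ?thesis using True by simp
      next
        case False
        then show ?thesis using F_zero[OF False] by simp
      qed
    qed
    also have "\<dots> = ennreal C * (\<integral>\<^sup>+y. ennreal (u y * norm (E y)) * indicator (ball x R) y \<partial>lebesgue)"
      by (rule nn_integral_cmult) measurable
    also have "\<dots> \<le> ennreal C * ennreal (osc_const * R ^ (CARD('N) + 1) * a powr (1 / \<alpha>) * b powr (1 / \<beta>))"
      by (intro mult_left_mono E(3)) simp
    also have "\<dots> = ennreal (C * (osc_const * R ^ (CARD('N) + 1) * a powr (1 / \<alpha>) * b powr (1 / \<beta>)))"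
      by (rule ennreal_mult'[symmetric, OF C0])
    also have "C * (osc_const * R ^ (CARD('N) + 1) * a powr (1 / \<alpha>) * b powr (1 / \<beta>)) = B"
      using R by (simp add: C_def B_def)
    finally have "ennreal (norm (X k - Y k)) \<le> ennreal B" .
    moreover have "B \<ge> 0"
      unfolding B_def using A osc_const_nonneg by (intro mult_nonneg_nonneg) auto
    ultimately show ?thesis by (simp add: ennreal_le_iff)
  qed
  obtain M' where M': "\<And>y. norm (\<psi> y) \<le> M'" using test_function_bounded[OF \<psi>] by blast
  have wL: "in_Lp p (w j)" for j
    unfolding w_def[abs_def] by (rule in_Lp_mult_bounded[OF Vj smooth_measurable[OF test_function_smooth[OF \<psi>]] M' p0])
  have wi: "integrable lebesgue (w j)" for j
    unfolding w_def[abs_def] by (rule integrable_mult_test_function[OF Vl \<psi>])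
  have "X \<longlonglongrightarrow> (\<Sum>j\<in>UNIV. cnj (\<integral>z. \<rho> z \<partial>lebesgue) * (\<integral>y. w j y * cnj (G y $ j) \<partial>lebesgue))"
    unfolding X_def[abs_def]
  proof (intro tendsto_sum mollifier_Lp[OF wL Gj pq rho])
    show "R / 2 ^ k > 0" "R / 2 ^ k \<le> R" for k using R by (auto simp: field_simps)
    have "(\<lambda>k. R * (1/2) ^ k) \<longlonglongrightarrow> R * 0" by (intro tendsto_mult_left LIMSEQ_power_zero) simp
    then show "(\<lambda>k. R / 2 ^ k) \<longlonglongrightarrow> 0" by (simp add: power_divide)
  qed
  moreover have "Y \<longlonglongrightarrow> (\<Sum>j\<in>(UNIV::'n set). 0)"
    unfolding Y_def[abs_def] by (intro tendsto_sum conv_dilate_at_infinity[OF wi Gj pq(2) rho R])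
  ultimately have "(\<lambda>k. X k - Y k) \<longlonglongrightarrow> (\<Sum>j\<in>UNIV. cnj (\<integral>z. \<rho> z \<partial>lebesgue) * (\<integral>y. w j y * cnj (G y $ j) \<partial>lebesgue)) - (\<Sum>j\<in>(UNIV::'n set). 0)"
    by (rule tendsto_diff)
  then have "norm ((\<Sum>j\<in>UNIV. cnj (\<integral>z. \<rho> z \<partial>lebesgue) * (\<integral>y. w j y * cnj (G y $ j) \<partial>lebesgue)) - (\<Sum>j\<in>(UNIV::'n set). 0)) \<le> B"
    by (intro LIMSEQ_le_const2[OF tendsto_norm]) (use bound in auto)
  moreover have "(\<Sum>j\<in>UNIV. cnj (\<integral>z. \<rho> z \<partial>lebesgue) * (\<integral>y. w j y * cnj (G y $ j) \<partial>lebesgue))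
      = cnj (\<integral>z. \<rho> z \<partial>lebesgue) * (\<integral>y. hermitian_prod (V y) (G y) * \<psi> y \<partial>lebesgue)"
  proof -
    have "integrable lebesgue (\<lambda>y. w j y * cnj (G y $ j))" for j
      by (rule integrable_mult_Lp[OF wL in_Lp_cnj[OF Gj] pq])
    then have "(\<Sum>j\<in>UNIV. \<integral>y. w j y * cnj (G y $ j) \<partial>lebesgue) = (\<integral>y. (\<Sum>j\<in>UNIV. w j y * cnj (G y $ j)) \<partial>lebesgue)"
      by simp
    also have "\<dots> = (\<integral>y. hermitian_prod (V y) (G y) * \<psi> y \<partial>lebesgue)"
      by (intro Bochner_Integration.integral_cong refl) (simp add: hermitian_prod_def w_def sum_distrib_left sum_distrib_right mult_ac)
    finally show ?thesis by (simp flip: sum_distrib_left)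
  qed
  ultimately show ?thesis by (simp add: B_def norm_mult)
qed

end

text \<open>\<rho> is convolved with a continuous cutoff that is 1 up to radius
  \<open>\<Lambda> + 1\<close> and 0 from \<open>\<Lambda> + 2\<close> on, and divided by its
  integral. At points of the unit ball the kernel meets only the part where the cutoff is 1.\<close>

lemma cutoff_exists:
  fixes \<rho> :: "real^'N::finite \<Rightarrow> complex"
  assumes \<rho>: "test_function \<rho>" and c: "(\<integral>z. \<rho> z \<partial>lebesgue) \<noteq> 0"
  obtains \<sigma> :: "real^'N \<Rightarrow> complex" and L where "test_function \<sigma>" "L \<ge> 1"
    "\<And>z. norm z \<le> 1 \<Longrightarrow> \<sigma> z = 1" "\<And>z. norm z \<ge> L \<Longrightarrow> \<sigma> z = 0"
proof -
  obtain \<Lambda> where L: "\<Lambda> > 0" "\<And>x. norm x \<ge> \<Lambda> \<Longrightarrow> \<rho> x = 0" by (rule test_function_support[OF \<rho>]) blast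
  define f where "f w = complex_of_real (max 0 (min 1 (\<Lambda> + 2 - norm w)))" for w :: "real^'N"
  have f: "locally_integrable f"
    by (rule continuous_locally_integrable) (auto simp: f_def intro!: continuous_intros)
  define \<sigma> where "\<sigma> z = (1 / (\<integral>z. \<rho> z \<partial>lebesgue)) * conv f \<rho> z" for z
  have zero: "\<sigma> z = 0" if "norm z \<ge> 2 * \<Lambda> + 2" for z
  proof -
    have "(\<lambda>w. f w * \<rho> (z - w)) = (\<lambda>_. 0)"
    proof
      fix w
      show "f w * \<rho> (z - w) = 0"
      proof (cases "norm w \<ge> \<Lambda> + 2")
        case False
        then have "norm (z - w) \<ge> \<Lambda>" using that norm_triangle_ineq[of "z - w" w] by simp
        then show ?thesis using L by simp
      qed (simp add: f_def)
    qed
    then have "conv f \<rho> z = 0" unfolding conv_def by (simp only: Bochner_Integration.integral_zero)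
    then show ?thesis by (simp add: \<sigma>_def)
  qed
  have one: "\<sigma> z = 1" if "norm z \<le> 1" for z
  proof -
    have "f w * \<rho> (z - w) = dilate \<rho> 1 (z - w)" for w
    proof (cases "norm w \<le> \<Lambda> + 1")
      case True then show ?thesis by (simp add: f_def dilate_def)
    next
      case False
      then have "norm (z - w) \<ge> \<Lambda>" using that norm_triangle_ineq[of "w - z" z] by (simp add: norm_minus_commute)
      then show ?thesis using L by (simp add: dilate_def)
    qed
    then have "conv f \<rho> z = (\<integral>z. \<rho> z \<partial>lebesgue)"
      unfolding conv_def using integral_dilate[OF \<rho>, of 1 z] by simp
    then show ?thesis using c by (simp add: \<sigma>_def)
  qed
  have "smooth \<sigma>" unfolding \<sigma>_def[abs_def] by (rule smooth_cmult[OF smooth_conv[OF f \<rho>]])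
  then have "test_function \<sigma>"
    by (rule test_functionI[of _ "2 * \<Lambda> + 2"]) (use zero in auto)
  then show ?thesis using that[of \<sigma> "2 * \<Lambda> + 2"] L zero one by auto
qed

section \<open>Dyadic decomposition of a Schwartz function\<close>

lemma schwartz_decay:
  assumes "schwartz (\<eta> :: real^'N::finite \<Rightarrow> complex)"
  obtains D where "D > 0" "\<And>z. norm z ^ m * norm (\<eta> z) \<le> D" "\<And>l z. norm z ^ m * norm (partial l \<eta> z) \<le> D"
proof -
  have b: "bounded (range (\<lambda>x. norm x ^ m *\<^sub>R partials ks \<eta> x))" for ks
    using assms unfolding schwartz_def by blast
  obtain D0 where D0: "D0 > 0" "\<And>z. norm z ^ m * norm (\<eta> z) \<le> D0"
    using b[of "[]"] unfolding bounded_pos by auto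
  have "\<exists>D>0. \<forall>z. norm z ^ m * norm (partial l \<eta> z) \<le> D" for l
    using b[of "[l]"] unfolding bounded_pos by auto
  then obtain D where D: "\<And>l. D l > 0" "\<And>l z. norm z ^ m * norm (partial l \<eta> z) \<le> D l" by metis
  have D_le: "D l \<le> (\<Sum>l\<in>UNIV. D l)" for l
    using D(1) by (intro member_le_sum) (auto intro: less_imp_le)
  have Ds: "(\<Sum>l\<in>UNIV. D l) \<ge> 0" using D(1) by (intro sum_nonneg) (auto intro: less_imp_le)
  show ?thesis
  proof (rule that[of "D0 + (\<Sum>l\<in>UNIV. D l)"])
    show "D0 + (\<Sum>l\<in>UNIV. D l) > 0" using D0 Ds by simp
    show "norm z ^ m * norm (\<eta> z) \<le> D0 + (\<Sum>l\<in>UNIV. D l)" for z using D0(2)[of z] Ds by simp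
    show "norm z ^ m * norm (partial l \<eta> z) \<le> D0 + (\<Sum>l\<in>UNIV. D l)" for l z
      using D(2)[of z l] D_le[of l] D0(1) by simp
  qed
qed

text \<open>The \<open>k\<close>-th piece lives at distance about \<open>2\<^sup>k\<close> from the origin, where \<open>\<eta>\<close> is smaller than any power of \<open>2\<^sup>-\<^sup>k\<close>.\<close>

lemma schwartz_decomposition:
  fixes \<eta> \<sigma> :: "real^'N::finite \<Rightarrow> complex"
  assumes \<eta>: "schwartz \<eta>" and \<sigma>: "test_function \<sigma>"
    and one: "\<And>z. norm z \<le> 1 \<Longrightarrow> \<sigma> z = 1" and zero: "\<And>z. norm z \<ge> L \<Longrightarrow> \<sigma> z = 0" and L: "L \<ge> 1"
  obtains \<zeta> :: "nat \<Rightarrow> real^'N \<Rightarrow> complex" and C where "C > 0" "\<And>k. test_function (\<zeta> k)"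
    "\<And>k z. norm z \<ge> L * 2 ^ k \<Longrightarrow> \<zeta> k z = 0"
    "\<And>k z. norm (\<zeta> k z) \<le> C * ((1/2) ^ k) ^ m"
    "\<And>k l z. norm (partial l (\<zeta> k) z) \<le> C * ((1/2) ^ k) ^ m"
    "\<And>z. (\<lambda>K. \<Sum>k<K. \<zeta> k z) \<longlonglongrightarrow> \<eta> z" "\<And>K z. norm (\<Sum>k<K. \<zeta> k z) \<le> C"
proof -
  have s\<eta>: "smooth \<eta>" using \<eta> by (simp add: schwartz_def)
  obtain B0 where B0: "B0 > 0" "\<And>z. norm (\<sigma> z) \<le> B0" by (rule test_function_bounded[OF \<sigma>]) blast
  have "\<exists>B>0. \<forall>z. norm (partial l \<sigma> z) \<le> B" for l
    by (rule test_function_bounded[OF test_function_partial[OF \<sigma>]]) blast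
  then obtain B' where B': "\<And>l. B' l > 0" "\<And>l z. norm (partial l \<sigma> z) \<le> B' l" by metis
  define B1 where "B1 = (\<Sum>l\<in>UNIV. B' l)"
  have B1: "B1 \<ge> 0" "\<And>l z. norm (partial l \<sigma> z) \<le> B1"
  proof -
    show "B1 \<ge> 0" unfolding B1_def using B'(1) by (intro sum_nonneg) (auto intro: less_imp_le)
    fix l z
    have "B' l \<le> B1" unfolding B1_def using B'(1) by (intro member_le_sum) (auto intro: less_imp_le)
    then show "norm (partial l \<sigma> z) \<le> B1" using B'(2)[of l z] by simp
  qed
  define X where "X k z = \<sigma> ((1 / 2 ^ k) *\<^sub>R z)" for k :: nat and z
  have Xt: "test_function (X k)" for k
    unfolding X_def[abs_def] using test_function_affine[OF \<sigma>, of "1 / 2 ^ k" 0] by simp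
  have X_le: "norm (X k z) \<le> B0" for k z unfolding X_def by (rule B0)
  have dX_le: "norm (partial l (X k) z) \<le> B1" for k l z
  proof -
    have "partial l (X k) z = (1 / 2 ^ k) *\<^sub>R partial l \<sigma> ((1 / 2 ^ k) *\<^sub>R z)"
      unfolding X_def[abs_def] by (rule partial_dilate) (rule test_function_differentiable[OF \<sigma>])
    then have "norm (partial l (X k) z) = (1 / 2 ^ k) * norm (partial l \<sigma> ((1 / 2 ^ k) *\<^sub>R z))" by simp
    also have "\<dots> \<le> 1 * B1" by (intro mult_mono B1) auto
    finally show ?thesis by simp
  qed
  have X_one: "X k z = 1" if "norm z \<le> 2 ^ k" for k z
    unfolding X_def using that by (intro one) simp
  have X_zero: "X k z = 0" if "norm z \<ge> L * 2 ^ k" for k z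
    unfolding X_def using that by (intro zero) (simp add: field_simps)
  \<comment> \<open>Consecutive differences of dilated cutoffs: for \<open>k > 0\<close> the factor
    lives in a shell of radius about \<open>2^k\<close>, and the partial sums telescope to one
    cutoff.\<close>
  define Y where "Y k = (case k of 0 \<Rightarrow> X 0 | Suc j \<Rightarrow> (\<lambda>z. X (Suc j) z - X j z))" for k
  have Y0: "Y 0 = X 0" and YS: "Y (Suc j) = (\<lambda>z. X (Suc j) z - X j z)" for j by (auto simp: Y_def)
  have Yt: "test_function (Y k)" for k by (cases k) (auto simp: Y0 YS intro: test_function_diff Xt)
  have Y_le: "norm (Y k z) \<le> 2 * B0" for k z
  proof (cases k)
    case 0 then show ?thesis using X_le[of 0 z] B0 by (simp add: Y0)
  next
    case (Suc j) then show ?thesis using norm_triangle_ineq4[of "X k z" "X j z"] X_le[of k z] X_le[of j z] by (simp add: YS)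
  qed
  have dY: "partial l (Y (Suc j)) z = partial l (X (Suc j)) z - partial l (X j) z" for l j z
  proof -
    have "Y (Suc j) = (\<lambda>z. X (Suc j) z + (-1) * X j z)" by (simp add: YS)
    then have "partial l (Y (Suc j)) z = partial l (X (Suc j)) z + (-1) * partial l (X j) z"
      using test_function_differentiable[OF Xt] test_function_differentiable[OF test_function_cmult[OF Xt, of "-1"]]
      by (simp only: partial_add partial_cmult)
    then show ?thesis by simp
  qed
  have dY_le: "norm (partial l (Y k) z) \<le> 2 * B1" for k l z
  proof (cases k)
    case 0 then show ?thesis using dX_le[of l 0 z] B1(1) by (simp add: Y0)
  next
    case (Suc j)
    then show ?thesis using norm_triangle_ineq4[of "partial l (X k) z" "partial l (X j) z"] dX_le[of l k z] dX_le[of l j z] by (simp add: dY)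
  qed
  have Y_zero: "Y k z = 0" if "norm z \<ge> L * 2 ^ k" for k z
  proof (cases k)
    case 0 then show ?thesis using X_zero that by (simp add: Y0)
  next
    case (Suc j)
    have "L * 2 ^ j \<le> L * 2 ^ k" using L Suc by simp
    then show ?thesis using Suc X_zero[of k z] X_zero[of j z] that by (simp add: YS)
  qed
  obtain D0 where D0: "D0 > 0" "\<And>z. norm z ^ 0 * norm (\<eta> z) \<le> D0" "\<And>l z. norm z ^ 0 * norm (partial l \<eta> z) \<le> D0"
    by (rule schwartz_decay[OF \<eta>, of 0]) blast
  obtain Dm where Dm: "Dm > 0" "\<And>z. norm z ^ m * norm (\<eta> z) \<le> Dm" "\<And>l z. norm z ^ m * norm (partial l \<eta> z) \<le> Dm"
    by (rule schwartz_decay[OF \<eta>, of m]) blast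
  \<comment> \<open>\<open>D0\<close> serves \<open>k = 0\<close>, and \<open>2^m\<close> converts
    decay measured at radius \<open>2^(k-1)\<close> into powers of \<open>2^(-k)\<close>.\<close>
  define D where "D = D0 + Dm * 2 ^ m"
  have D: "D > 0" "D0 \<le> D" using D0 Dm by (auto simp: D_def add_pos_pos)
  \<comment> \<open>For \<open>k = Suc j\<close>, both cutoffs are 1 on the open ball of radius
    \<open>2^j\<close>, so there \<open>Y k\<close> vanishes together with its derivatives. Outside
    that ball the Schwartz bounds of order \<open>m\<close> apply.\<close>
  have dich: "(Y k z = 0 \<and> (\<forall>l. partial l (Y k) z = 0)) \<or>
      (norm (\<eta> z) \<le> D * ((1/2) ^ k) ^ m \<and> (\<forall>l. norm (partial l \<eta> z) \<le> D * ((1/2) ^ k) ^ m))" for k z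
  proof (cases k)
    case 0
    then show ?thesis using D0(2)[of z] D0(3)[of z] D(2) by (auto intro: order_trans)
  next
    case (Suc j)
    show ?thesis
    proof (cases "norm z < 2 ^ j")
      case True
      have le: "Y k y = 0" if y: "norm y \<le> 2 ^ j" for y
      proof -
        have "norm y \<le> 2 ^ k" using y norm_ge_zero[of y] unfolding Suc power_Suc by linarith
        then show ?thesis using X_one[OF y] X_one[of y k] Suc by (simp add: YS)
      qed
      have "((\<lambda>_. 0) has_derivative (\<lambda>_. 0)) (at z)" by simp
      then have "(Y k has_derivative (\<lambda>_. 0)) (at z)"
        by (rule has_derivative_transform_within_open[where s="ball 0 (2 ^ j)"]) (use True le in auto)
      then have "partial l (Y k) z = 0" for l by (rule partial_eqI)
      then show ?thesis using le[of z] True by simp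
    next
      case False
      have gen: "v \<le> D * ((1/2) ^ k) ^ m" if v: "norm z ^ m * v \<le> Dm" "v \<ge> 0" for v
      proof -
        have "(2 ^ j) ^ m * v \<le> norm z ^ m * v" using False v by (intro mult_right_mono power_mono) auto
        then have "(2 ^ j) ^ m * v \<le> Dm" using v by simp
        then have "v \<le> Dm * ((1 / 2) ^ j) ^ m" by (simp add: field_simps)
        also have "\<dots> = (Dm * 2 ^ m) * ((1/2) ^ k) ^ m" 
        proof -
          have "(1/2) ^ j = 2 * (1/2 :: real) ^ k" by (simp add: Suc)
          then show ?thesis by (simp only: power_mult_distrib mult.assoc)
        qed
        also have "\<dots> \<le> D * ((1/2) ^ k) ^ m" using D0 by (intro mult_right_mono) (auto simp: D_def)
        finally show ?thesis .
      qed
      show ?thesis using gen[OF Dm(2)] gen[OF Dm(3)] by simp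
    qed
  qed
  define \<zeta> where "\<zeta> k z = Y k z * \<eta> z" for k z
  define C where "C = (2 * B1 + 2 * B0) * D"
  have C: "C > 0" using B0 B1 D by (simp add: C_def add_nonneg_pos)
  have e0: "((1/2) ^ k) ^ m \<ge> (0::real)" for k by simp
  have \<zeta>_le: "norm (\<zeta> k z) \<le> C * ((1/2) ^ k) ^ m" for k z
  proof (cases "Y k z = 0")
    case True then show ?thesis using C by (simp add: \<zeta>_def)
  next
    case False
    then have "norm (\<eta> z) \<le> D * ((1/2) ^ k) ^ m" using dich[of k z] by blast
    then have "norm (\<zeta> k z) \<le> 2 * B0 * (D * ((1/2) ^ k) ^ m)"
      unfolding \<zeta>_def norm_mult using B0 by (intro mult_mono Y_le) auto
    also have "\<dots> \<le> (2 * B1 + 2 * B0) * (D * ((1/2) ^ k) ^ m)" using B1 D by (intro mult_right_mono) auto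
    finally show ?thesis by (simp add: C_def)
  qed
  have d\<zeta>_le: "norm (partial l (\<zeta> k) z) \<le> C * ((1/2) ^ k) ^ m" for k l z
  proof -
    have eq: "partial l (\<zeta> k) z = partial l (Y k) z * \<eta> z + Y k z * partial l \<eta> z"
      unfolding \<zeta>_def[abs_def] by (rule partial_mult) (intro test_function_differentiable Yt smooth_differentiable s\<eta>)+
    consider "Y k z = 0 \<and> (\<forall>l. partial l (Y k) z = 0)" |
      "norm (\<eta> z) \<le> D * ((1/2) ^ k) ^ m" "norm (partial l \<eta> z) \<le> D * ((1/2) ^ k) ^ m" using dich[of k z] by blast
    then show ?thesis
    proof cases
      case 1 then show ?thesis using C by (simp add: eq)
    next
      case 2
      have "norm (partial l (\<zeta> k) z) \<le> norm (partial l (Y k) z) * norm (\<eta> z) + norm (Y k z) * norm (partial l \<eta> z)"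
        unfolding eq using norm_triangle_ineq by (metis norm_mult)
      also have "\<dots> \<le> 2 * B1 * (D * ((1/2) ^ k) ^ m) + 2 * B0 * (D * ((1/2) ^ k) ^ m)"
        using 2 B0 B1 by (intro add_mono mult_mono Y_le dY_le) auto
      also have "\<dots> = C * ((1/2) ^ k) ^ m" by (simp add: C_def algebra_simps)
      finally show ?thesis .
    qed
  qed
  have tele: "(\<Sum>k<Suc K. Y k z) = X K z" for K z
    by (induction K) (simp_all add: Y0 YS)
  have sum\<zeta>: "(\<Sum>k<Suc K. \<zeta> k z) = X K z * \<eta> z" for K z
    unfolding \<zeta>_def sum_distrib_right[symmetric] tele ..
  have lim: "(\<lambda>K. \<Sum>k<K. \<zeta> k z) \<longlonglongrightarrow> \<eta> z" for z
  proof -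
    obtain K0 :: nat where K0: "norm z < 2 ^ K0" using real_arch_pow[of 2 "norm z"] by auto
    have "(\<Sum>k<K. \<zeta> k z) = \<eta> z" if "K \<ge> Suc K0" for K
    proof -
      define K' where "K' = K - 1"
      have K': "K = Suc K'" "K' \<ge> K0" using that by (auto simp: K'_def)
      have "(2::real) ^ K0 \<le> 2 ^ K'" by (rule power_increasing[OF K'(2)]) simp
      then have "norm z \<le> 2 ^ K'" using K0 by linarith
      then show ?thesis unfolding K'(1) sum\<zeta> using X_one by simp
    qed
    then have "eventually (\<lambda>K. (\<Sum>k<K. \<zeta> k z) = \<eta> z) sequentially"
      unfolding eventually_sequentially by blast
    then show ?thesis by (rule tendsto_eventually)
  qed
  have bd: "norm (\<Sum>k<K. \<zeta> k z) \<le> C" for K z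
  proof (cases K)
    case 0 then show ?thesis using C by simp
  next
    case (Suc K')
    have "norm (X K' z * \<eta> z) \<le> B0 * D0"
      unfolding norm_mult using X_le[of K' z] D0(2)[of z] B0 by (intro mult_mono) auto
    also have "\<dots> \<le> (2 * B1 + 2 * B0) * D" using B0 B1 D D0 by (intro mult_mono) auto
    finally show ?thesis unfolding Suc sum\<zeta> C_def .
  qed
  have \<zeta>t: "test_function (\<zeta> k)" for k
    unfolding \<zeta>_def[abs_def] by (rule test_function_mult_smooth[OF Yt s\<eta>])
  have \<zeta>z: "\<zeta> k z = 0" if "norm z \<ge> L * 2 ^ k" for k z using Y_zero[OF that] by (simp add: \<zeta>_def)
  show ?thesis by (rule that[OF C \<zeta>t \<zeta>z \<zeta>_le d\<zeta>_le lim bd])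
qed

section \<open>Averages of the product against dilates of a Schwartz function\<close>

context elliptic_kernel
begin

text \<open>The added 1 makes the constant at least 1, so that it can multiply the bound for \<psi>
  as well as the bound for its derivatives along the fields.\<close>

definition coeff_norm :: real where
  "coeff_norm = 1 + (\<Sum>j\<in>UNIV. \<Sum>l\<in>UNIV. norm (c $ j $ l))"

lemma norm_vfield_le:
  assumes "\<And>l. norm (partial l f y) \<le> B" "B \<ge> 0"
  shows "norm (vfield (cnj_row (c $ j)) f y) \<le> coeff_norm * B"
proof -
  have "norm (vfield (cnj_row (c $ j)) f y) \<le> (\<Sum>l\<in>UNIV. norm (c $ j $ l) * B)"
    unfolding vfield_def by (intro sum_norm_le) (simp add: cnj_row_def norm_mult mult_left_mono assms)
  also have "\<dots> = (\<Sum>l\<in>UNIV. norm (c $ j $ l)) * B" by (simp add: sum_distrib_right)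
  also have "(\<Sum>l\<in>UNIV. norm (c $ j $ l)) \<le> (\<Sum>j\<in>UNIV. \<Sum>l\<in>UNIV. norm (c $ j $ l))"
    by (rule member_le_sum) (auto intro: sum_nonneg)
  then have "(\<Sum>l\<in>UNIV. norm (c $ j $ l)) * B \<le> coeff_norm * B"
    unfolding coeff_norm_def using assms(2) by (intro mult_right_mono) auto
  finally show ?thesis .
qed

lemma coeff_norm_ge: "coeff_norm \<ge> 1"
  unfolding coeff_norm_def by (simp add: sum_nonneg)

text \<open>The decay of order \<open>N + 3\<close> is spent as follows: \<open>N + 1\<close> powers
  of \<open>2^(-k)\<close> on the normalisation of a bump and its derivatives at a radius
  proportional to \<open>2^k\<close>, one power on \<open>max 1 R\<close>, which is at most a
  multiple of \<open>2^k\<close> because \<open>t < 1\<close>, and one power on the summation over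
  \<open>k\<close>.\<close>

lemma schwartz_average_estimate:
  assumes pq: "p > 1" "q > 1" "1 / p + 1 / q = 1"
    and V: "in_Lp p V" and div: "has_distr_adjoint_div c V g" and g: "in_Lp p g"
    and dG: "has_distr_gradient c \<phi> G" and G: "in_Lp q G"
    and C: "C > 0" and L: "L \<ge> 1" and \<zeta>: "\<And>k. test_function (\<zeta> k)"
    and \<zeta>_supp: "\<And>k z. norm z \<ge> L * 2 ^ k \<Longrightarrow> \<zeta> k z = 0"
    and \<zeta>_le: "\<And>k z. norm (\<zeta> k z) \<le> C * ((1/2) ^ k) ^ (CARD('N) + 3)"
    and d\<zeta>_le: "\<And>k l z. norm (partial l (\<zeta> k) z) \<le> C * ((1/2) ^ k) ^ (CARD('N) + 3)"
    and \<zeta>_lim: "\<And>z. (\<lambda>K. \<Sum>k<K. \<zeta> k z) \<longlonglongrightarrow> \<eta> z" and \<zeta>_sum: "\<And>K z. norm (\<Sum>k<K. \<zeta> k z) \<le> C"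
    and \<eta>: "\<eta> \<in> borel_measurable borel"
    and a: "a \<ge> 0" and b: "b \<ge> 0"
    and Ha: "\<And>r. r > 0 \<Longrightarrow> (\<integral>\<^sup>+z. ennreal ((norm (V z) + norm (g z)) powr \<alpha>) * indicator (ball x r) z \<partial>lebesgue) \<le> ennreal (a * r ^ CARD('N))"
    and Hb: "\<And>r. r > 0 \<Longrightarrow> (\<integral>\<^sup>+z. ennreal (norm (G z) powr \<beta>) * indicator (ball x r) z \<partial>lebesgue) \<le> ennreal (b * r ^ CARD('N))"
    and t: "0 < t" "t < 1"
  shows "norm (\<integral>z. \<rho> z \<partial>lebesgue) * norm (\<integral>y. hermitian_prod (V y) (G y) * dilate \<eta> t (x - y) \<partial>lebesgue)
    \<le> 2 * real CARD('n) * osc_const * (C * coeff_norm * (2 * L) ^ (CARD('N) + 2)) * (a powr (1 / \<alpha>) * b powr (1 / \<beta>))"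
proof -
  have p0: "p > 0" and q0: "q > 0" using pq by auto
  have Vj: "in_Lp p (\<lambda>x. V x $ j)" for j by (rule in_Lp_component[OF V p0])
  have Gj: "in_Lp q (\<lambda>x. G x $ j)" for j by (rule in_Lp_component[OF G q0])
  define H where "H y = hermitian_prod (V y) (G y)" for y
  have iH: "integrable lebesgue H"
    unfolding H_def[abs_def] hermitian_prod_def
    by (intro Bochner_Integration.integrable_sum integrable_mult_Lp[OF Vj in_Lp_cnj[OF Gj] pq])
  define \<psi> where "\<psi> k y = dilate (\<zeta> k) t (x - y)" for k y
  define cr where "cr = norm (\<integral>z. \<rho> z \<partial>lebesgue)"
  define Q where "Q = real CARD('n) * osc_const * (C * coeff_norm * (2 * L) ^ (CARD('N) + 2)) * (a powr (1 / \<alpha>) * b powr (1 / \<beta>))"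
  have Q0: "Q \<ge> 0" unfolding Q_def using osc_const_nonneg C coeff_norm_ge L by (intro mult_nonneg_nonneg) auto
  have \<psi>_eq: "\<psi> k = (\<lambda>y. complex_of_real (1 / t ^ CARD('N)) * \<zeta> k ((-1/t) *\<^sub>R y + (1/t) *\<^sub>R x))" for k
    by (simp add: \<psi>_def dilate_def fun_eq_iff scaleR_diff_right scaleR_conv_of_real[where 'a=complex])
  have \<zeta>a: "test_function (\<lambda>y. \<zeta> k ((-1/t) *\<^sub>R y + (1/t) *\<^sub>R x))" for k
    by (rule test_function_affine[OF \<zeta>]) (use t in simp)
  have \<psi>t: "test_function (\<psi> k)" for k unfolding \<psi>_eq by (rule test_function_cmult[OF \<zeta>a])
  have piece_le: "cr * norm (\<integral>y. H y * \<psi> k y \<partial>lebesgue) \<le> Q * (1/2) ^ k" for k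
  proof -
    define e where "e = (1/2 :: real) ^ k"
    have e: "e > 0" "e \<le> 1" "2 ^ k = 1 / e" by (auto simp: e_def power_le_one power_divide)
    \<comment> \<open>Twice the radius \<open>L * 2^k * t\<close> of the support of the rescaled
      piece, since the local estimate asks for support in the half ball. \<open>A\<close> is then
      fixed by equating \<open>A / R^(N+1)\<close> with the bound for the derivatives.\<close>
    define R where "R = 2 * L * t / e"
    have R: "R > 0" using L t e by (simp add: R_def)
    define A where "A = C * coeff_norm * (2 * L) ^ (CARD('N) + 1) * e ^ 2"
    have A0: "A \<ge> 0" unfolding A_def using C coeff_norm_ge L by (intro mult_nonneg_nonneg) auto
    have "cr * norm (\<integral>y. H y * \<psi> k y \<partial>lebesgue) \<le> real CARD('n) * osc_const * (A * max 1 R) * (a powr (1 / \<alpha>) * b powr (1 / \<beta>))"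
      unfolding cr_def H_def
    proof (rule local_estimate[OF pq V div g dG G \<psi>t R A0 _ _ _ a b Ha Hb])
      fix y
      show "\<psi> k y = 0" if "dist x y \<ge> R / 2"
      proof -
        have "norm (x - y) \<ge> (L * 2 ^ k) * t" using that e by (simp add: R_def dist_norm)
        then show ?thesis unfolding \<psi>_def by (intro dilate_supp[OF \<zeta>_supp t(1)]) auto
      qed
      have RN: "A / R ^ (CARD('N) + 1) = coeff_norm * (C * e ^ (CARD('N) + 3) / t ^ (CARD('N) + 1))"
        using L t e by (simp add: A_def R_def power_mult_distrib power_divide power_add power2_eq_square power3_eq_cube)
      show "norm (\<psi> k y) \<le> A / R ^ CARD('N)"
      proof -
        have "norm (\<psi> k y) \<le> C * e ^ (CARD('N) + 3) / t ^ CARD('N)"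
          unfolding \<psi>_def using \<zeta>_le[of k, folded e_def] by (rule dilate_bound[OF _ t(1)])
        also have "\<dots> = (C * e ^ (CARD('N) + 3) / t ^ (CARD('N) + 1)) * t" using t by simp
        also have "\<dots> \<le> (coeff_norm * (C * e ^ (CARD('N) + 3) / t ^ (CARD('N) + 1))) * R"
        proof (intro mult_mono)
          have "1 * (C * e ^ (CARD('N) + 3) / t ^ (CARD('N) + 1)) \<le> coeff_norm * (C * e ^ (CARD('N) + 3) / t ^ (CARD('N) + 1))"
            using C e t by (intro mult_right_mono coeff_norm_ge) auto
          then show "C * e ^ (CARD('N) + 3) / t ^ (CARD('N) + 1) \<le> coeff_norm * (C * e ^ (CARD('N) + 3) / t ^ (CARD('N) + 1))" by simp
          have "e * t \<le> 2 * L * t" using e L t by (intro mult_right_mono) auto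
          then show "t \<le> R" using e by (simp add: R_def field_simps)
        qed (use C e t coeff_norm_ge in auto)
        also have "\<dots> = A / R ^ CARD('N)" unfolding RN[symmetric] using R by simp
        finally show ?thesis .
      qed
      fix j
      have "norm (partial l (\<psi> k) y) \<le> C * e ^ (CARD('N) + 3) / t ^ (CARD('N) + 1)" for l
      proof -
        have "partial l (\<psi> k) y = complex_of_real (1 / t ^ CARD('N)) * ((-1/t) *\<^sub>R partial l (\<zeta> k) ((-1/t) *\<^sub>R y + (1/t) *\<^sub>R x))"
          unfolding \<psi>_eq by (simp only: partial_cmult[OF test_function_differentiable[OF \<zeta>a]] partial_affine[OF test_function_differentiable[OF \<zeta>]])
        then have "norm (partial l (\<psi> k) y) = norm (partial l (\<zeta> k) ((-1/t) *\<^sub>R y + (1/t) *\<^sub>R x)) / t ^ (CARD('N) + 1)"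
          using t by (simp add: norm_mult norm_divide norm_power)
        also have "\<dots> \<le> C * e ^ (CARD('N) + 3) / t ^ (CARD('N) + 1)"
          using t d\<zeta>_le[of l k, folded e_def] by (intro divide_right_mono) auto
        finally show ?thesis .
      qed
      then show "norm (vfield (cnj_row (c $ j)) (\<psi> k) y) \<le> A / R ^ (CARD('N) + 1)"
        unfolding RN by (rule norm_vfield_le) (use C e t in auto)
    qed
    also have "\<dots> \<le> real CARD('n) * osc_const * (C * coeff_norm * (2 * L) ^ (CARD('N) + 2) * e) * (a powr (1 / \<alpha>) * b powr (1 / \<beta>))"
    proof (intro mult_right_mono mult_left_mono)
      have "max 1 R \<le> 2 * L / e"
      proof -
        have "1 * e \<le> 2 * L" using e L by linarith
        moreover have "2 * L * t \<le> 2 * L * 1" using L t by (intro mult_left_mono) auto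
        ultimately show ?thesis using e by (simp add: R_def field_simps)
      qed
      then have "A * max 1 R \<le> A * (2 * L / e)" using A0 by (rule mult_left_mono)
      also have "\<dots> = C * coeff_norm * (2 * L) ^ (CARD('N) + 2) * e"
        using e by (simp add: A_def power2_eq_square)
      finally show "A * max 1 R \<le> C * coeff_norm * (2 * L) ^ (CARD('N) + 2) * e" .
    qed (use osc_const_nonneg in auto)
    also have "\<dots> = Q * (1/2) ^ k" by (simp add: Q_def e_def)
    finally show ?thesis .
  qed
  have sum_le: "cr * norm (\<integral>y. H y * (\<Sum>k<K. \<psi> k y) \<partial>lebesgue) \<le> 2 * Q" for K
  proof -
    have i: "integrable lebesgue (\<lambda>y. H y * \<psi> k y)" for k
    proof -
      obtain B where "\<And>y. norm (\<psi> k y) \<le> B" using test_function_bounded[OF \<psi>t] by blast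
      then show ?thesis
        by (intro integrable_bounded_mult[OF iH smooth_measurable[OF test_function_smooth[OF \<psi>t]]])
    qed
    have "(\<integral>y. H y * (\<Sum>k<K. \<psi> k y) \<partial>lebesgue) = (\<Sum>k<K. \<integral>y. H y * \<psi> k y \<partial>lebesgue)"
      unfolding sum_distrib_left using i by simp
    then have "cr * norm (\<integral>y. H y * (\<Sum>k<K. \<psi> k y) \<partial>lebesgue) \<le> cr * (\<Sum>k<K. norm (\<integral>y. H y * \<psi> k y \<partial>lebesgue))"
      by (simp only:) (intro mult_left_mono norm_sum, simp add: cr_def)
    also have "\<dots> = (\<Sum>k<K. cr * norm (\<integral>y. H y * \<psi> k y \<partial>lebesgue))" by (rule sum_distrib_left)
    also have "\<dots> \<le> (\<Sum>k<K. Q * (1/2) ^ k)" by (intro sum_mono piece_le)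
    also have "\<dots> = Q * (\<Sum>k<K. (1/2) ^ k)" by (rule sum_distrib_left[symmetric])
    also have "\<dots> \<le> Q * 2" by (intro mult_left_mono sum_half_powers_le Q0)
    finally show ?thesis by simp
  qed
  have \<psi>_sum: "(\<Sum>k<K. \<psi> k y) = complex_of_real (1 / t ^ CARD('N)) * (\<Sum>k<K. \<zeta> k ((1/t) *\<^sub>R (x - y)))" for K y
    unfolding sum_distrib_left by (intro sum.cong refl) (simp add: \<psi>_def dilate_def scaleR_conv_of_real[where 'a=complex])
  have dil: "dilate \<eta> t (x - y) = complex_of_real (1 / t ^ CARD('N)) * \<eta> ((1/t) *\<^sub>R (x - y))" for y
    by (simp add: dilate_def scaleR_conv_of_real[where 'a=complex])
  note Hm = borel_measurable_integrable[OF iH]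
  have am: "(\<lambda>y. (1/t) *\<^sub>R (x - y)) \<in> borel_measurable lebesgue"
    by (rule measurable_completion) simp
  have "(\<lambda>K. \<integral>y. H y * (\<Sum>k<K. \<psi> k y) \<partial>lebesgue) \<longlonglongrightarrow> (\<integral>y. H y * dilate \<eta> t (x - y) \<partial>lebesgue)"
  proof (rule integral_dominated_convergence[where w="\<lambda>y. norm (H y) * (C / t ^ CARD('N))"])
    show "(\<lambda>y. H y * dilate \<eta> t (x - y)) \<in> borel_measurable lebesgue"
      unfolding dil by (intro borel_measurable_times Hm borel_measurable_const measurable_compose[OF am \<eta>])
    show "(\<lambda>y. H y * (\<Sum>k<K. \<psi> k y)) \<in> borel_measurable lebesgue" for K
      by (intro borel_measurable_times Hm borel_measurable_sum smooth_measurable test_function_smooth \<psi>t)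
    show "integrable lebesgue (\<lambda>y. norm (H y) * (C / t ^ CARD('N)))" using iH by simp
    show "AE y in lebesgue. (\<lambda>K. H y * (\<Sum>k<K. \<psi> k y)) \<longlonglongrightarrow> H y * dilate \<eta> t (x - y)"
      unfolding \<psi>_sum dil by (intro AE_I2 tendsto_mult tendsto_const \<zeta>_lim)
    show "AE y in lebesgue. norm (H y * (\<Sum>k<K. \<psi> k y)) \<le> norm (H y) * (C / t ^ CARD('N))" for K
    proof (rule AE_I2)
      fix y
      have "norm (\<Sum>k<K. \<psi> k y) = norm (\<Sum>k<K. \<zeta> k ((1/t) *\<^sub>R (x - y))) / t ^ CARD('N)"
        unfolding \<psi>_sum using t by (simp add: norm_mult norm_divide norm_power)
      also have "\<dots> \<le> C / t ^ CARD('N)" using t by (intro divide_right_mono \<zeta>_sum) auto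
      finally show "norm (H y * (\<Sum>k<K. \<psi> k y)) \<le> norm (H y) * (C / t ^ CARD('N))"
        unfolding norm_mult by (rule mult_left_mono) simp
    qed
  qed
  then have "(\<lambda>K. cr * norm (\<integral>y. H y * (\<Sum>k<K. \<psi> k y) \<partial>lebesgue)) \<longlonglongrightarrow> cr * norm (\<integral>y. H y * dilate \<eta> t (x - y) \<partial>lebesgue)"
    by (intro tendsto_mult_left tendsto_norm)
  then have "cr * norm (\<integral>y. H y * dilate \<eta> t (x - y) \<partial>lebesgue) \<le> 2 * Q"
    by (rule LIMSEQ_le_const2) (use sum_le in blast)
  then show ?thesis by (simp add: cr_def Q_def H_def mult.assoc)
qed

end

section \<open>Proof of the theorem\<close>

text \<open>Linear independence of the family of rows is full row rank. Injectivity allows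
  coefficients indexed by \<open>j\<close> to be transported to the set of rows.\<close>

lemma independent_right_inverse:
  fixes c :: "complex^'N::finite^'n::finite"
  assumes "independent_system c"
  obtains P :: "complex^'n^'N" where "c ** P = mat 1"
proof -
  have inj: "inj (\<lambda>j. c $ j)" and ind: "vec.independent (range (\<lambda>j. c $ j))"
    using assms by (auto simp: independent_system_def)
  have "d j = 0" if s: "(\<Sum>i\<in>UNIV. d i *s row i c) = 0" for d :: "'n \<Rightarrow> complex" and j
  proof -
    define u where "u v = d (inv (\<lambda>j. c $ j) v)" for v
    have u: "u (c $ i) = d i" for i unfolding u_def using inv_f_f[OF inj, of i] by simp
    have "(\<Sum>v\<in>range (\<lambda>j. c $ j). u v *s v) = (\<Sum>i\<in>UNIV. u (c $ i) *s (c $ i))"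
      using inj by (subst sum.reindex) auto
    also have "\<dots> = (\<Sum>i\<in>UNIV. d i *s row i c)"
      by (intro sum.cong refl) (simp add: u row_def vec_lambda_eta)
    finally have "(\<Sum>v\<in>range (\<lambda>j. c $ j). u v *s v) = 0" using s by simp
    then have "u (c $ j) = 0"
      using ind unfolding vec.dependent_finite[OF finite_imageI[OF finite_class.finite_UNIV]] by blast
    then show ?thesis by (simp add: u)
  qed
  then have "\<exists>P::complex^'n^'N. c ** P = mat 1"
    unfolding matrix_right_invertible_independent_rows by blast
  then show ?thesis using that by blast
qed

lemma elliptic_kernel_exists:
  fixes c :: "complex^'N::finite^'n::finite"
  assumes ell: "elliptic_system c" and ind: "independent_system c"
    and ab: "\<alpha> > 1" "\<beta> > 1" "1 / \<alpha> + 1 / \<beta> \<ge> 1" "real CARD('N) * (1 / \<alpha> + 1 / \<beta> - 1) < 1"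
  obtains \<rho> \<Psi> P \<Lambda> M where "elliptic_kernel c \<rho> \<Psi> P \<Lambda> M \<alpha> \<beta>" "(\<integral>x. \<rho> x \<partial>lebesgue) \<noteq> 0"
proof -
  obtain \<rho> \<Psi> :: "real^'N \<Rightarrow> complex" where \<rho>: "test_function \<rho>" and \<Psi>: "test_function \<Psi>"
    and int: "(\<integral>x. \<rho> x \<partial>lebesgue) \<noteq> 0"
    and lap: "\<And>x. (\<Sum>j\<in>UNIV. vfield (c $ j) (vfield (cnj_row (c $ j)) \<Psi>) x) = \<rho> x - dilate \<rho> 2 x"
    by (rule kernel_exists[OF ell]) blast
  obtain P :: "complex^'n^'N" where P: "c ** P = mat 1" by (rule independent_right_inverse[OF ind])
  define \<kappa> where "\<kappa> j = vfield (cnj_row (c $ j)) \<Psi>" for j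
  have \<kappa>: "test_function (\<kappa> j)" for j unfolding \<kappa>_def by (rule test_function_vfield[OF \<Psi>])
  obtain r0 where r0: "r0 > 0" "\<And>x. norm x \<ge> r0 \<Longrightarrow> \<rho> x = 0" by (rule test_function_support[OF \<rho>]) blast
  obtain m0 where m0: "m0 > 0" "\<And>x. norm (\<rho> x) \<le> m0" by (rule test_function_bounded[OF \<rho>]) blast
  have "\<exists>r>0. \<forall>x. norm x \<ge> r \<longrightarrow> \<kappa> j x = 0" for j by (rule test_function_support[OF \<kappa>]) blast
  then obtain r1 where r1: "\<And>j. r1 j > 0" "\<And>j x. norm x \<ge> r1 j \<Longrightarrow> \<kappa> j x = 0" by metis
  have "\<exists>r>0. \<forall>x. norm x \<ge> r \<longrightarrow> partial (snd i) (\<kappa> (fst i)) x = 0" for i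
    by (rule test_function_support[OF test_function_partial[OF \<kappa>]]) blast
  then obtain r2 where r2: "\<And>i. r2 i > 0" "\<And>i x. norm x \<ge> r2 i \<Longrightarrow> partial (snd i) (\<kappa> (fst i)) x = 0" by metis
  have "\<exists>m>0. \<forall>x. norm (\<kappa> j x) \<le> m" for j by (rule test_function_bounded[OF \<kappa>]) blast
  then obtain m1 where m1: "\<And>j. m1 j > 0" "\<And>j x. norm (\<kappa> j x) \<le> m1 j" by metis
  have "\<exists>m>0. \<forall>x h. norm (\<kappa> j (x + h) - \<kappa> j x - (\<Sum>k\<in>UNIV. h $ k *\<^sub>R partial k (\<kappa> j) x)) \<le> m * norm h ^ 2" for j
    by (rule test_function_taylor[OF \<kappa>]) blast
  then obtain m2 where m2: "\<And>j. m2 j > 0"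
    "\<And>j x h. norm (\<kappa> j (x + h) - \<kappa> j x - (\<Sum>k\<in>UNIV. h $ k *\<^sub>R partial k (\<kappa> j) x)) \<le> m2 j * norm h ^ 2" by metis
  have sum_ge: "f i \<le> sum f UNIV" "sum f UNIV \<ge> 0" if "\<And>i. f i > 0" for f :: "'c::finite \<Rightarrow> real" and i
  proof -
    show "f i \<le> sum f UNIV" by (rule member_le_sum) (use that in \<open>auto intro: less_imp_le\<close>)
    show "sum f UNIV \<ge> 0" by (rule sum_nonneg) (use that in \<open>auto intro: less_imp_le\<close>)
  qed
  \<comment> \<open>Sums over the finitely many indices stand in for maxima, here and in
    \<open>M\<close>; the leading 1 ensures that \<Lambda> is at least 1.\<close>
  define \<Lambda> where "\<Lambda> = 1 + r0 + sum r1 UNIV + sum r2 UNIV"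
  define M where "M = m0 + sum m1 UNIV + sum m2 UNIV"
  have L: "1 \<le> \<Lambda>" "r0 \<le> \<Lambda>" "r1 j \<le> \<Lambda>" "r2 i \<le> \<Lambda>" for i j
    using r0(1) sum_ge(1)[of r1 j, OF r1(1)] sum_ge(1)[of r2 i, OF r2(1)]
      sum_ge(2)[of r1, OF r1(1)] sum_ge(2)[of r2, OF r2(1)] by (auto simp: \<Lambda>_def)
  have M: "m0 \<le> M" "m1 j \<le> M" "m2 j \<le> M" for j
    using m0(1) sum_ge(1)[of m1 j, OF m1(1)] sum_ge(1)[of m2 j, OF m2(1)]
      sum_ge(2)[of m1, OF m1(1)] sum_ge(2)[of m2, OF m2(1)] by (auto simp: M_def)
  have "elliptic_kernel c \<rho> \<Psi> P \<Lambda> M \<alpha> \<beta>"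
  proof (unfold_locales; (fold \<kappa>_def)?)
    show "test_function \<rho>" "test_function \<Psi>" "c ** P = mat 1" "1 \<le> \<Lambda>" by (fact \<rho> \<Psi> P L(1))+
    show "0 < M" using m0(1) M(1) by linarith
    show "(\<Sum>j\<in>UNIV. vfield (c $ j) (\<kappa> j) x) = \<rho> x - dilate \<rho> 2 x" for x unfolding \<kappa>_def by (rule lap)
    show "norm (\<rho> x) \<le> M" for x using m0(2)[of x] M(1) by linarith
    show "\<rho> x = 0" if "\<Lambda> \<le> norm x" for x using r0(2)[of x] L(2) that by linarith
    show "norm (\<kappa> j x) \<le> M" for j x using m1(2)[of j x] M(2)[of j] by linarith
    show "\<kappa> j x = 0" if "\<Lambda> \<le> norm x" for j x using r1(2)[of j x] L(3)[of j] that by linarith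
    show "partial k (\<kappa> j) x = 0" if "\<Lambda> \<le> norm x" for j k x using r2(2)[of "(j, k)" x] L(4)[of "(j, k)"] that by simp
    show "norm (\<kappa> j (x + h) - \<kappa> j x - (\<Sum>k\<in>UNIV. h $ k *\<^sub>R partial k (\<kappa> j) x)) \<le> M * norm h ^ 2" for j x h
      using m2(2)[of j x h] mult_right_mono[OF M(3)[of j], of "norm h ^ 2"] by simp
  qed (use ab in auto)
  then show ?thesis using that int by blast
qed

text \<open>The reciprocals of \<open>\<theta> * p\<close> and \<open>\<theta> * q\<close> add up to
  \<open>1 / \<theta>\<close>, so the gain in the small scales is positive exactly when \<theta>
  exceeds \<open>N / (N + 1)\<close>. Exceeding \<open>1 / p\<close> and \<open>1 / q\<close> as
  well keeps both exponents above 1; \<theta> is the midpoint between the largest of these bounds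
  and 1.\<close>

lemma exponent_choice:
  fixes p q :: real
  assumes pq: "p > 1" "q > 1" "1 / p + 1 / q = 1" and N: "N > 0"
  obtains \<theta> where "0 < \<theta>" "\<theta> < 1" "\<theta> * p > 1" "\<theta> * q > 1" "1 / (\<theta> * p) + 1 / (\<theta> * q) \<ge> 1"
    "N * (1 / (\<theta> * p) + 1 / (\<theta> * q) - 1) < 1"
proof -
  define s where "s = max (N / (N + 1)) (max (1 / p) (1 / q))"
  have s: "s < 1" "s > 0" "N / (N + 1) \<le> s" "1 / p \<le> s" "1 / q \<le> s"
    using pq N by (auto simp: s_def less_max_iff_disj)
  define \<theta> where "\<theta> = (1 + s) / 2"
  have t: "\<theta> < 1" "s < \<theta>" "\<theta> > 0" using s by (auto simp: \<theta>_def)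
  have 1: "\<theta> * p > 1"
  proof -
    have "1 / p < \<theta>" using s t by linarith
    then show ?thesis using pq by (simp add: field_simps)
  qed
  have 2: "\<theta> * q > 1"
  proof -
    have "1 / q < \<theta>" using s t by linarith
    then show ?thesis using pq by (simp add: field_simps)
  qed
  have sum: "1 / (\<theta> * p) + 1 / (\<theta> * q) = 1 / \<theta>"
  proof -
    have "1 / (\<theta> * p) + 1 / (\<theta> * q) = (1 / \<theta>) * (1 / p + 1 / q)" by (simp add: distrib_left)
    then show ?thesis using pq by simp
  qed
  have 3: "1 / \<theta> \<ge> 1" using t by simp
  have "N / (N + 1) < \<theta>" using s t by linarith
  then have "N < \<theta> * (N + 1)" using N by (simp add: field_simps)
  then have 4: "N * (1 / \<theta> - 1) < 1" using t by (simp add: field_simps)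
  show ?thesis using that[of \<theta>] t 1 2 3 4 sum by simp
qed

text \<open>\<open>a\<close> is the maximal function of \<open>f powr (\<theta> * p)\<close>, to
  which the strong bound with exponent \<open>1 / \<theta>\<close> applies. This exponent exceeds 1
  because \<theta> < 1, which is the reason for lowering \<open>p\<close>; outside a null set a
  single value \<open>a x\<close> serves all radii.\<close>

lemma maximal_power_bound:
  fixes f :: "real^'N::finite \<Rightarrow> real"
  assumes f [measurable]: "f \<in> borel_measurable lebesgue" and f0: "\<And>x. f x \<ge> 0"
    and \<theta>: "0 < \<theta>" "\<theta> < 1" and p: "p > 0" and F: "F \<ge> 0"
    and le: "(\<integral>\<^sup>+x. ennreal (f x powr p) \<partial>lebesgue) \<le> ennreal F"
  obtains a where "a \<in> borel_measurable lebesgue" "\<And>x. a x \<ge> 0"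
    "AE x in lebesgue. \<forall>r>0. (\<integral>\<^sup>+z. ennreal (f z powr (\<theta> * p)) * indicator (ball x r) z \<partial>lebesgue) \<le> ennreal (a x * r ^ CARD('N))"
    "(\<integral>\<^sup>+x. ennreal (a x powr (1 / \<theta>)) \<partial>lebesgue) \<le> ennreal (maximal_const CARD('N) (1 / \<theta>) * F)"
proof -
  let ?f = "\<lambda>x. f x powr (\<theta> * p)"
  let ?M = "maximal (\<lambda>x. ennreal (?f x))"
  have q: "1 / \<theta> > 1" using \<theta> by simp
  have pw: "?f x powr (1 / \<theta>) = f x powr p" for x using \<theta> by (simp add: powr_powr)
  define a where "a x = enn2real (?M x)" for x
  have am: "a \<in> borel_measurable lebesgue"
    unfolding a_def[abs_def] using measurable_maximal_lebesgue[of "\<lambda>x. ennreal (?f x)"] by measurable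
  have fm: "?f \<in> borel_measurable lebesgue" by measurable
  have AE: "AE x in lebesgue. ?M x < \<infinity>"
    by (rule maximal_AE_finite[OF fm _ q]) (use le in \<open>auto simp: pw order_le_less_trans\<close>)
  have 1: "AE x in lebesgue. \<forall>r>0. (\<integral>\<^sup>+z. ennreal (?f z) * indicator (ball x r) z \<partial>lebesgue) \<le> ennreal (a x * r ^ CARD('N))"
    using AE
  proof eventually_elim
    fix x assume fin: "?M x < \<infinity>"
    show "\<forall>r>0. (\<integral>\<^sup>+z. ennreal (?f z) * indicator (ball x r) z \<partial>lebesgue) \<le> ennreal (a x * r ^ CARD('N))"
    proof (intro allI impI)
      fix r :: real assume r: "r > 0"
      have "(\<integral>\<^sup>+z. ennreal (?f z) * indicator (ball x r) z \<partial>lebesgue) \<le> ennreal (r ^ CARD('N)) * ?M x"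
        by (rule maximal_upper[OF r])
      also have "?M x = ennreal (a x)" using fin by (simp add: a_def)
      also have "ennreal (r ^ CARD('N)) * ennreal (a x) = ennreal (a x * r ^ CARD('N))"
        using r by (subst ennreal_mult[symmetric]) (auto simp: a_def mult.commute)
      finally show "(\<integral>\<^sup>+z. ennreal (?f z) * indicator (ball x r) z \<partial>lebesgue) \<le> ennreal (a x * r ^ CARD('N))" .
    qed
  qed
  have "(\<integral>\<^sup>+x. ennreal (a x powr (1 / \<theta>)) \<partial>lebesgue) \<le> ennreal (maximal_const CARD('N) (1 / \<theta>)) * (\<integral>\<^sup>+x. ennreal (?f x powr (1 / \<theta>)) \<partial>lebesgue)"
    by (rule maximal_strong_type[OF fm _ q am]) (auto simp: a_def ennreal_enn2real_if)
  also have "\<dots> \<le> ennreal (maximal_const CARD('N) (1 / \<theta>)) * ennreal F"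
    unfolding pw by (intro mult_left_mono le) simp
  also have "\<dots> = ennreal (maximal_const CARD('N) (1 / \<theta>) * F)"
    using maximal_const_pos[OF q, of "CARD('N)"] F by (simp add: ennreal_mult)
  finally show ?thesis using that[OF am _ 1] by (simp add: a_def)
qed

text \<open>The bound has the shape of a constant times a \<open>p\<close>-th power, so that its
  \<open>p\<close>-th root is linear in the sum of the norms.\<close>

lemma nn_integral_sum_powr_le:
  assumes V: "in_Lp p V" and g: "in_Lp p g" and p: "p > 0"
  shows "(\<integral>\<^sup>+x. ennreal ((norm (V x) + norm (g x)) powr p) \<partial>lebesgue) \<le> ennreal (2 * (2 * (Lp_norm p V + Lp_norm p g)) powr p)"
proof -
  note [measurable] = in_Lp_measurable[OF V] in_Lp_measurable[OF g]
  have "(\<integral>\<^sup>+x. ennreal ((norm (V x) + norm (g x)) powr p) \<partial>lebesgue)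
     \<le> (\<integral>\<^sup>+x. ennreal (2 powr p) * (ennreal (norm (V x) powr p) + ennreal (norm (g x) powr p)) \<partial>lebesgue)"
  proof (rule nn_integral_mono)
    fix x
    have "(norm (V x) + norm (g x)) powr p \<le> 2 powr p * (norm (V x) powr p + norm (g x) powr p)"
      using p by (intro add_powr_le) auto
    then show "ennreal ((norm (V x) + norm (g x)) powr p) \<le> ennreal (2 powr p) * (ennreal (norm (V x) powr p) + ennreal (norm (g x) powr p))"
      by (simp add: ennreal_leI flip: ennreal_mult ennreal_plus)
  qed
  also have "\<dots> = ennreal (2 powr p) * (ennreal (Lp_norm p V powr p) + ennreal (Lp_norm p g powr p))"
    by (subst nn_integral_cmult) (auto simp: nn_integral_add in_Lp_nn_integral[OF V p] in_Lp_nn_integral[OF g p])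
  also have "\<dots> = ennreal (2 powr p * (Lp_norm p V powr p + Lp_norm p g powr p))"
    by (simp flip: ennreal_mult ennreal_plus)
  also have "\<dots> \<le> ennreal (2 * (2 * (Lp_norm p V + Lp_norm p g)) powr p)"
  proof (rule ennreal_leI)
    let ?S = "Lp_norm p V + Lp_norm p g"
    have "Lp_norm p V powr p \<le> ?S powr p" "Lp_norm p g powr p \<le> ?S powr p"
      using p Lp_norm_nonneg[of p V] Lp_norm_nonneg[of p g] by (auto intro!: powr_mono2)
    then have "2 powr p * (Lp_norm p V powr p + Lp_norm p g powr p) \<le> 2 powr p * (?S powr p + ?S powr p)"
      by (intro mult_left_mono) auto
    also have "\<dots> = 2 * (2 * ?S) powr p"
    proof -
      have "(2 * ?S) powr p = 2 powr p * ?S powr p"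
        by (rule powr_mult)
      then show ?thesis by (simp only: distrib_left mult_2)
    qed
    finally show "2 powr p * (Lp_norm p V powr p + Lp_norm p g powr p) \<le> 2 * (2 * ?S) powr p" .
  qed
  finally show ?thesis .
qed

theorem theorem1p2:
  fixes c :: "complex^'N^'n"
    and p p' :: real
    and \<eta> :: "real^'N \<Rightarrow> complex"
  assumes "CARD('N) \<ge> 2" and "CARD('n) \<ge> 2"
    and "elliptic_system c" and "independent_system c"
    and "1 < p" and "1 / p + 1 / p' = 1"
    and "schwartz \<eta>" and "(\<integral>x. \<eta> x \<partial>lebesgue) \<noteq> 0"
  shows "\<exists>C>0. \<forall>(V :: real^'N \<Rightarrow> complex^'n) (g :: real^'N \<Rightarrow> complex).
           in_Lp p V \<and> has_distr_adjoint_div c V g \<and> in_Lp p g \<longrightarrow>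
           (\<forall>(\<phi> :: real^'N \<Rightarrow> complex) (G :: real^'N \<Rightarrow> complex^'n).
              locally_integrable \<phi> \<and> has_distr_gradient c \<phi> G \<and> in_Lp p' G \<longrightarrow>
              local_hardy_norm \<eta> (\<lambda>x. hermitian_prod (V x) (G x))
                \<le> ennreal (C * (Lp_norm p V + Lp_norm p g) * Lp_norm p' G))"
proof -
  have p'1: "p' > 1"
  proof -
    have e: "1 / p' = 1 - 1 / p" using assms(6) by simp
    have "0 < 1 / p'" "1 / p' < 1" unfolding e using assms(5) by auto
    then show ?thesis by (simp add: field_simps split: if_splits)
  qed
  note pq = assms(5) p'1 assms(6)
  have p0: "p > 0" and p'0: "p' > 0" using pq by auto
  obtain \<theta> where \<theta>: "0 < \<theta>" "\<theta> < 1" "\<theta> * p > 1" "\<theta> * p' > 1" "1 / (\<theta> * p) + 1 / (\<theta> * p') \<ge> 1"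
    "real CARD('N) * (1 / (\<theta> * p) + 1 / (\<theta> * p') - 1) < 1"
    by (rule exponent_choice[OF pq, of "real CARD('N)"]) auto
  obtain \<rho> \<Psi> P \<Lambda> M where ek: "elliptic_kernel c \<rho> \<Psi> P \<Lambda> M (\<theta> * p) (\<theta> * p')"
    and int: "(\<integral>x. \<rho> x \<partial>lebesgue) \<noteq> 0"
    by (rule elliptic_kernel_exists[OF assms(3,4) \<theta>(3-6)]) blast
  interpret elliptic_kernel c \<rho> \<Psi> P \<Lambda> M "\<theta> * p" "\<theta> * p'" by (rule ek)
  obtain \<sigma> :: "real^'N \<Rightarrow> complex" and L where \<sigma>: "test_function \<sigma>" "L \<ge> 1"
    "\<And>z. norm z \<le> 1 \<Longrightarrow> \<sigma> z = 1" "\<And>z. norm z \<ge> L \<Longrightarrow> \<sigma> z = 0"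
    by (rule cutoff_exists[OF rho int]) blast
  obtain \<zeta> :: "nat \<Rightarrow> real^'N \<Rightarrow> complex" and C where \<zeta>: "C > 0" "\<And>k. test_function (\<zeta> k)"
    "\<And>k z. norm z \<ge> L * 2 ^ k \<Longrightarrow> \<zeta> k z = 0"
    "\<And>k z. norm (\<zeta> k z) \<le> C * ((1/2) ^ k) ^ (CARD('N) + 3)"
    "\<And>k l z. norm (partial l (\<zeta> k) z) \<le> C * ((1/2) ^ k) ^ (CARD('N) + 3)"
    "\<And>z. (\<lambda>K. \<Sum>k<K. \<zeta> k z) \<longlonglongrightarrow> \<eta> z" "\<And>K z. norm (\<Sum>k<K. \<zeta> k z) \<le> C"
    by (rule schwartz_decomposition[OF assms(7) \<sigma>(1) \<sigma>(3) \<sigma>(4) \<sigma>(2), of "CARD('N) + 3"]) (assumption, assumption, rule that)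
  have \<eta>m: "\<eta> \<in> borel_measurable borel"
    using assms(7) by (simp add: schwartz_def borel_measurable_continuous_onI smooth_continuous_on)
  define mc where "mc = maximal_const CARD('N) (1 / \<theta>)"
  have mc: "mc > 0" unfolding mc_def by (rule maximal_const_pos) (use \<theta> in simp)
  define K where "K = 2 * real CARD('n) * osc_const * (C * coeff_norm * (2 * L) ^ (CARD('N) + 2)) / norm (\<integral>z. \<rho> z \<partial>lebesgue)"
  have K0: "K \<ge> 0" unfolding K_def using osc_const_nonneg \<zeta>(1) coeff_norm_ge \<sigma>(2)
    by (intro divide_nonneg_nonneg mult_nonneg_nonneg) auto
  \<comment> \<open>The roots of order \<open>p\<close> and \<open>p'\<close> of the factors that
    the maximal theorem produces; the added 1 makes the constant positive.\<close>
  define D where "D = K * ((2 * mc) powr (1 / p) * 2 * mc powr (1 / p')) + 1"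
  have D0: "D > 0" unfolding D_def using K0 mc by (intro add_nonneg_pos mult_nonneg_nonneg) auto
  have main: "local_hardy_norm \<eta> (\<lambda>x. hermitian_prod (V x) (G x)) \<le> ennreal (D * (Lp_norm p V + Lp_norm p g) * Lp_norm p' G)"
    if V: "in_Lp p V" and div: "has_distr_adjoint_div c V g" and g: "in_Lp p g"
      and dG: "has_distr_gradient c \<phi> G" and G: "in_Lp p' G"
    for V :: "real^'N \<Rightarrow> complex^'n" and g \<phi> G
  proof -
    note [measurable] = in_Lp_measurable[OF V] in_Lp_measurable[OF g] in_Lp_measurable[OF G]
    define S where "S = Lp_norm p V + Lp_norm p g"
    define T where "T = Lp_norm p' G"
    have S0: "S \<ge> 0" and T0: "T \<ge> 0" by (auto simp: S_def T_def Lp_norm_nonneg)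
    obtain a where a: "a \<in> borel_measurable lebesgue" "\<And>x. a x \<ge> 0"
      "AE x in lebesgue. \<forall>r>0. (\<integral>\<^sup>+z. ennreal ((norm (V z) + norm (g z)) powr (\<theta> * p)) * indicator (ball x r) z \<partial>lebesgue) \<le> ennreal (a x * r ^ CARD('N))"
      "(\<integral>\<^sup>+x. ennreal (a x powr (1 / \<theta>)) \<partial>lebesgue) \<le> ennreal (mc * (2 * (2 * S) powr p))"
      unfolding mc_def S_def
      by (rule maximal_power_bound[OF _ _ \<theta>(1,2) p0 _ nn_integral_sum_powr_le[OF V g p0]]) auto
    obtain b where b: "b \<in> borel_measurable lebesgue" "\<And>x. b x \<ge> 0"
      "AE x in lebesgue. \<forall>r>0. (\<integral>\<^sup>+z. ennreal (norm (G z) powr (\<theta> * p')) * indicator (ball x r) z \<partial>lebesgue) \<le> ennreal (b x * r ^ CARD('N))"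
      "(\<integral>\<^sup>+x. ennreal (b x powr (1 / \<theta>)) \<partial>lebesgue) \<le> ennreal (mc * T powr p')"
      unfolding mc_def T_def
      by (rule maximal_power_bound[of "\<lambda>z. norm (G z)", OF _ _ \<theta>(1,2) p'0 _ order_eq_refl[OF in_Lp_nn_integral[OF G p'0]]]) auto
    note [measurable] = a(1) b(1)
    \<comment> \<open>At almost every \<open>x\<close> the values \<open>a x\<close> and
      \<open>b x\<close> bound the averages for all \<open>t\<close> at once, which handles the
      supremum. Raised to the powers \<open>p\<close> and \<open>p'\<close>, the two factors become
      \<open>a\<close> and \<open>b\<close> to the power \<open>1 / \<theta>\<close>, so the bounds
      for these powers fit Hoelder's inequality.\<close>
    have "local_hardy_norm \<eta> (\<lambda>x. hermitian_prod (V x) (G x)) \<le> (\<integral>\<^sup>+x. ennreal K * ennreal (a x powr (1 / (\<theta> * p)) * b x powr (1 / (\<theta> * p'))) \<partial>lebesgue)"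
      unfolding local_hardy_norm_def
    proof (rule nn_integral_mono_AE, use a(3) b(3) in eventually_elim)
      fix x
      assume Ha: "\<forall>r>0. (\<integral>\<^sup>+z. ennreal ((norm (V z) + norm (g z)) powr (\<theta> * p)) * indicator (ball x r) z \<partial>lebesgue) \<le> ennreal (a x * r ^ CARD('N))"
        and Hb: "\<forall>r>0. (\<integral>\<^sup>+z. ennreal (norm (G z) powr (\<theta> * p')) * indicator (ball x r) z \<partial>lebesgue) \<le> ennreal (b x * r ^ CARD('N))"
      show "local_maximal \<eta> (\<lambda>x. hermitian_prod (V x) (G x)) x \<le> ennreal K * ennreal (a x powr (1 / (\<theta> * p)) * b x powr (1 / (\<theta> * p')))"
        unfolding local_maximal_def
      proof (rule SUP_least)
        fix t :: real assume "t \<in> {0<..<1}"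
        then have t: "0 < t" "t < 1" by auto
        have "norm (\<integral>z. \<rho> z \<partial>lebesgue) * norm (\<integral>y. hermitian_prod (V y) (G y) * dilate \<eta> t (x - y) \<partial>lebesgue)
          \<le> 2 * real CARD('n) * osc_const * (C * coeff_norm * (2 * L) ^ (CARD('N) + 2)) * (a x powr (1 / (\<theta> * p)) * b x powr (1 / (\<theta> * p')))"
          by (rule schwartz_average_estimate[OF pq V div g dG G \<zeta>(1) \<sigma>(2) \<zeta>(2) \<zeta>(3) \<zeta>(4) \<zeta>(5) \<zeta>(6) \<zeta>(7) \<eta>m a(2) b(2) _ _ t])
            (use Ha Hb in blast)+
        then have "norm (\<integral>y. hermitian_prod (V y) (G y) * dilate \<eta> t (x - y) \<partial>lebesgue) \<le> K * (a x powr (1 / (\<theta> * p)) * b x powr (1 / (\<theta> * p')))"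
          using int by (simp add: K_def field_simps)
        then have "ennreal (norm (\<integral>y. hermitian_prod (V y) (G y) * dilate \<eta> t (x - y) \<partial>lebesgue)) \<le> ennreal (K * (a x powr (1 / (\<theta> * p)) * b x powr (1 / (\<theta> * p'))))"
          by (rule ennreal_leI)
        also have "\<dots> = ennreal K * ennreal (a x powr (1 / (\<theta> * p)) * b x powr (1 / (\<theta> * p')))"
          by (rule ennreal_mult'[OF K0])
        finally show "ennreal (norm (\<integral>y. hermitian_prod (V y) (G y) * dilate \<eta> t (x - y) \<partial>lebesgue)) \<le> \<dots>" .
      qed
    qed
    also have "\<dots> = ennreal K * (\<integral>\<^sup>+x. ennreal (a x powr (1 / (\<theta> * p)) * b x powr (1 / (\<theta> * p'))) \<partial>lebesgue)"
      by (rule nn_integral_cmult) measurable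
    also have "\<dots> \<le> ennreal K * ennreal ((mc * (2 * (2 * S) powr p)) powr (1 / p) * (mc * T powr p') powr (1 / p'))"
    proof (intro mult_left_mono nn_integral_Holder[OF _ _ _ _ pq])
      show "(\<integral>\<^sup>+x. ennreal ((a x powr (1 / (\<theta> * p))) powr p) \<partial>lebesgue) \<le> ennreal (mc * (2 * (2 * S) powr p))"
        using a(4) p0 by (simp add: powr_powr)
      show "(\<integral>\<^sup>+x. ennreal ((b x powr (1 / (\<theta> * p'))) powr p') \<partial>lebesgue) \<le> ennreal (mc * T powr p')"
        using b(4) p'0 by (simp add: powr_powr)
    qed (use mc in auto)
    also have "\<dots> = ennreal (K * ((2 * mc) powr (1 / p) * 2 * mc powr (1 / p')) * S * T)"
    proof -
      have "(mc * (2 * (2 * S) powr p)) powr (1 / p) = (2 * mc) powr (1 / p) * (2 * S)"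
      proof -
        have "mc * (2 * (2 * S) powr p) = (2 * mc) * (2 * S) powr p" by simp
        then have "(mc * (2 * (2 * S) powr p)) powr (1 / p) = (2 * mc) powr (1 / p) * ((2 * S) powr p) powr (1 / p)"
          using mc by (simp only: powr_mult)
        also have "((2 * S) powr p) powr (1 / p) = 2 * S" using p0 S0 by (simp add: powr_powr)
        finally show ?thesis .
      qed
      moreover have "(mc * T powr p') powr (1 / p') = mc powr (1 / p') * T"
      proof -
        have "(mc * T powr p') powr (1 / p') = mc powr (1 / p') * (T powr p') powr (1 / p')"
          using mc by (simp only: powr_mult)
        also have "(T powr p') powr (1 / p') = T" using p'0 T0 by (simp add: powr_powr)
        finally show ?thesis .
      qed
      ultimately show ?thesis using K0 by (subst ennreal_mult'[symmetric]) (auto simp: mult_ac)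
    qed
    also have "\<dots> \<le> ennreal (D * S * T)"
      using S0 T0 by (intro ennreal_leI mult_right_mono) (auto simp: D_def)
    finally show ?thesis by (simp add: S_def T_def)
  qed
  show ?thesis using D0 main by blast
qed

end
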